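(* Let $\mathcal{G}=(G,\lambda)$ be a temporal graph with $n$ vertices, lifetime $T$ and underlying treewidth at most $\mathsf{w}$, let $\omega\ge0$ and let $c$ be a positive integer. Then the non-normalised temporal $c$-modularity $\widetilde{q}^{\,*}_{c,\omega}(\mathcal{G})$ can be calculated in time $n^{\mathcal{O}(cT)}c^{\mathcal{O}(\mathsf{w} T)}T^{\mathcal{O}(c)}$.
   Context: A temporal graph $\mathcal{G}=(G,\lambda)$ with lifetime $T$ consists of a simple undirected graph $G=(V,E)$ (the underlying graph; "underlying treewidth" means the treewidth of $G$) with $n=|V|$, and $\lambda:E\to 2^{[T]}$. For $t\in[T]$ the snapshot is $G_t=(V,E_t)$ with $E_t=\{e\in E:t\in\lambda(e)\}$, $m_t=|E_t|$, and $d_{v,t}$ is the degree of $v$ in $G_t$. For $A\subseteq V$, $e_{G_t}(A)$ is the number of edges of $G_t$ inside $A$ and $\mathrm{vol}_{G_t}(A)=\sum_{v\in A}d_{v,t}$. A partition $\mathcal{A}$ of $\mathcal{G}$ into $k$ parts is a function $\pi_{\mathcal{A}}:V\times[T]\to[k]$, inducing for each $t$ a partition $\mathcal{A}_t$ of $V$ into the sets $\{v:\pi_{\mathcal{A}}(v,t)=i\}$, $i\in[k]$. The loyalty contribution is $\mathcal{L}(\mathcal{A})=\sum_{v\in V}\sum_{t=1}^{T-1}\mathbf{1}[\pi_{\mathcal{A}}(v,t)=\pi_{\mathcal{A}}(v,t+1)]$. For $\omega\ge0$ the non-normalised temporal modularity is $$\widetilde{q}_\omega(\mathcal{G},\mathcal{A})=\sum_{t=1}^T\sum_{A\in\mathcal{A}_t}\left(2e_{G_t}(A)-\frac{\mathrm{vol}_{G_t}(A)^2}{2m_t}\right)+\omega\mathcal{L}(\mathcal{A}),$$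 and $\widetilde{q}^{\,*}_{c,\omega}(\mathcal{G})$ is its maximum over all partitions with at most $c$ parts. Computation is in the Word-RAM model.
   Formalization: The parameter ω is taken to be a nonnegative rational p/q given by numerator and denominator, since an arbitrary real ω (and the resulting value) has no representation as Word-RAM input or output; the graph has at least one vertex and lifetime at least 1. *)

theory Defs
  imports Complex_Main "HOL-Library.FuncSet"
begin

section \<open>Simple graphs and treewidth\<close>

definition simple_graph :: "'v set \<Rightarrow> 'v set set \<Rightarrow> bool" where
  "simple_graph V E \<longleftrightarrow> finite V \<and> (\<forall>e\<in>E. e \<subseteq> V \<and> card e = 2)"

text \<open>Connectedness of the subgraph of \<open>E\<close> induced by the vertex set \<open>S\<close>.\<close>

definition connected_induced :: "'v set \<Rightarrow> 'v set set \<Rightarrow> bool" where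
  "connected_induced S E \<longleftrightarrow>
     (\<forall>x\<in>S. \<forall>y\<in>S. (x, y) \<in> {(a, b). a \<in> S \<and> b \<in> S \<and> {a, b} \<in> E}\<^sup>*)"

definition is_cycle :: "'v set set \<Rightarrow> 'v list \<Rightarrow> bool" where
  "is_cycle E cs \<longleftrightarrow> length cs \<ge> 3 \<and> distinct cs \<and>
     (\<forall>i<length cs. {cs ! i, cs ! (Suc i mod length cs)} \<in> E)"

definition is_tree :: "'v set \<Rightarrow> 'v set set \<Rightarrow> bool" where
  "is_tree I F \<longleftrightarrow> simple_graph I F \<and> I \<noteq> {} \<and> connected_induced I F \<and> (\<nexists>cs. is_cycle F cs)"

definition tree_decomposition ::
    "'v set \<Rightarrow> 'v set set \<Rightarrow> 'i set \<Rightarrow> 'i set set \<Rightarrow> ('i \<Rightarrow> 'v set) \<Rightarrow> bool" where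
  "tree_decomposition V E I F B \<longleftrightarrow>
     is_tree I F \<and>
     (\<forall>i\<in>I. B i \<subseteq> V) \<and>
     (\<forall>v\<in>V. \<exists>i\<in>I. v \<in> B i) \<and>
     (\<forall>e\<in>E. \<exists>i\<in>I. e \<subseteq> B i) \<and>
     (\<forall>v\<in>V. connected_induced {i\<in>I. v \<in> B i} F)"

definition decomposition_width :: "'i set \<Rightarrow> ('i \<Rightarrow> 'v set) \<Rightarrow> nat" where
  "decomposition_width I B = Max ((\<lambda>i. card (B i)) ` I) - 1"

text \<open>The nodes of the decomposition tree may be taken to be natural numbers, as the tree is finite.\<close>

definition treewidth :: "'v set \<Rightarrow> 'v set set \<Rightarrow> nat" where
  "treewidth V E = (LEAST k. \<exists>(I :: nat set) F B.
     tree_decomposition V E I F B \<and> decomposition_width I B = k)"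

section \<open>Temporal graphs and temporal modularity\<close>

record 'v temporal_graph =
  verts :: "'v set"
  edges :: "'v set set"
  lifetime :: nat
  times :: "'v set \<Rightarrow> nat set"

definition wf_temporal_graph :: "'v temporal_graph \<Rightarrow> bool" where
  "wf_temporal_graph G \<longleftrightarrow>
     simple_graph (verts G) (edges G) \<and> verts G \<noteq> {} \<and> lifetime G \<ge> 1 \<and>
     (\<forall>e\<in>edges G. times G e \<subseteq> {1..lifetime G})"

definition snapshot :: "'v temporal_graph \<Rightarrow> nat \<Rightarrow> 'v set set" where
  "snapshot G t = {e \<in> edges G. t \<in> times G e}"

definition degree_at :: "'v temporal_graph \<Rightarrow> nat \<Rightarrow> 'v \<Rightarrow> nat" where
  "degree_at G t v = card {e \<in> snapshot G t. v \<in> e}"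

definition edges_inside :: "'v temporal_graph \<Rightarrow> nat \<Rightarrow> 'v set \<Rightarrow> nat" where
  "edges_inside G t A = card {e \<in> snapshot G t. e \<subseteq> A}"

definition volume :: "'v temporal_graph \<Rightarrow> nat \<Rightarrow> 'v set \<Rightarrow> nat" where
  "volume G t A = (\<Sum>v\<in>A. degree_at G t v)"

definition temporal_partitions :: "'v temporal_graph \<Rightarrow> nat \<Rightarrow> ('v \<times> nat \<Rightarrow> nat) set" where
  "temporal_partitions G k = verts G \<times> {1..lifetime G} \<rightarrow>\<^sub>E {1..k}"

definition part :: "'v temporal_graph \<Rightarrow> ('v \<times> nat \<Rightarrow> nat) \<Rightarrow> nat \<Rightarrow> nat \<Rightarrow> 'v set" where
  "part G \<pi> t i = {v \<in> verts G. \<pi> (v, t) = i}"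

definition loyalty :: "'v temporal_graph \<Rightarrow> ('v \<times> nat \<Rightarrow> nat) \<Rightarrow> nat" where
  "loyalty G \<pi> = (\<Sum>v\<in>verts G. \<Sum>t=1..lifetime G - 1. of_bool (\<pi> (v, t) = \<pi> (v, t + 1)))"

text \<open>
  A snapshot without edges contributes 0: all volumes vanish and \<open>x / 0 = 0\<close>.
  Empty parts likewise contribute 0.
\<close>

definition temporal_modularity ::
    "'v temporal_graph \<Rightarrow> real \<Rightarrow> nat \<Rightarrow> ('v \<times> nat \<Rightarrow> nat) \<Rightarrow> real" where
  "temporal_modularity G \<omega> k \<pi> =
     (\<Sum>t=1..lifetime G. \<Sum>i=1..k.
        2 * real (edges_inside G t (part G \<pi> t i))
        - (real (volume G t (part G \<pi> t i)))\<^sup>2 / (2 * real (card (snapshot G t))))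
     + \<omega> * real (loyalty G \<pi>)"

definition max_temporal_modularity :: "'v temporal_graph \<Rightarrow> nat \<Rightarrow> real \<Rightarrow> real" where
  "max_temporal_modularity G c \<omega> =
     Max {temporal_modularity G \<omega> k \<pi> | k \<pi>. k \<le> c \<and> \<pi> \<in> temporal_partitions G k}"

section \<open>Word-RAM\<close>

text \<open>
  Registers and memory cells hold words of \<open>W\<close> bits, i.e. naturals below \<open>2 ^ W\<close>; addresses are
  words. A program is a finite list of instructions, each of which takes one time unit.
\<close>

datatype binop = Add | Sub | Mul | Div | Mod | And | Or | Xor | Shl | Shr

datatype instr =
    Const nat nat            \<comment> \<open>\<open>R i := k\<close>\<close>
  | Op binop nat nat nat     \<comment> \<open>\<open>R i := R j \<circ> R k\<close>\<close>
  | Load nat nat             \<comment> \<open>\<open>R i := M (R j)\<close>\<close>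
  | Store nat nat            \<comment> \<open>\<open>M (R i) := R j\<close>\<close>
  | Jump_if_less nat nat nat \<comment> \<open>\<open>if R i < R j then goto l\<close>\<close>
  | Jump nat
  | Halt

type_synonym program = "instr list"

record config =
  pc :: nat
  regs :: "nat \<Rightarrow> nat"
  mem :: "nat \<Rightarrow> nat"

context
  includes bit_operations_syntax
begin

fun eval_binop :: "nat \<Rightarrow> binop \<Rightarrow> nat \<Rightarrow> nat \<Rightarrow> nat" where
  "eval_binop W Add a b = (a + b) mod 2 ^ W"
| "eval_binop W Sub a b = (a + 2 ^ W - b) mod 2 ^ W"
| "eval_binop W Mul a b = (a * b) mod 2 ^ W"
| "eval_binop W Div a b = a div b"
| "eval_binop W Mod a b = a mod b"
| "eval_binop W And a b = a AND b"
| "eval_binop W Or a b = a OR b"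
| "eval_binop W Xor a b = a XOR b"
| "eval_binop W Shl a b = push_bit b a mod 2 ^ W"
| "eval_binop W Shr a b = drop_bit b a"

end

fun exec :: "nat \<Rightarrow> instr \<Rightarrow> config \<Rightarrow> config" where
  "exec W (Const i k) s = s\<lparr>pc := pc s + 1, regs := (regs s)(i := k mod 2 ^ W)\<rparr>"
| "exec W (Op f i j k) s =
     s\<lparr>pc := pc s + 1, regs := (regs s)(i := eval_binop W f (regs s j) (regs s k))\<rparr>"
| "exec W (Load i j) s = s\<lparr>pc := pc s + 1, regs := (regs s)(i := mem s (regs s j))\<rparr>"
| "exec W (Store i j) s = s\<lparr>pc := pc s + 1, mem := (mem s)(regs s i := regs s j)\<rparr>"
| "exec W (Jump_if_less i j l) s = s\<lparr>pc := (if regs s i < regs s j then l else pc s + 1)\<rparr>"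
| "exec W (Jump l) s = s\<lparr>pc := l\<rparr>"
| "exec W Halt s = s"

definition halted :: "program \<Rightarrow> config \<Rightarrow> bool" where
  "halted P s \<longleftrightarrow> pc s \<ge> length P \<or> P ! pc s = Halt"

definition step :: "nat \<Rightarrow> program \<Rightarrow> config \<Rightarrow> config" where
  "step W P s = (if halted P s then s else exec W (P ! pc s) s)"

definition initial_config :: "nat list \<Rightarrow> config" where
  "initial_config xs =
     \<lparr>pc = 0, regs = (\<lambda>_. 0), mem = (\<lambda>a. if a < length xs then xs ! a else 0)\<rparr>"

text \<open>
  The result is a non-negative rational number, left as numerator and denominator in the first two
  memory cells. (The maximum modularity is never negative: a single part already achieves
  \<open>\<omega> * n * (T - 1)\<close>.)
\<close>

definition ram_computes_within :: "nat \<Rightarrow> program \<Rightarrow> nat list \<Rightarrow> real \<Rightarrow> nat \<Rightarrow> bool" where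
  "ram_computes_within W P xs y \<tau> \<longleftrightarrow>
     (\<exists>k\<le>\<tau>. let s = (step W P ^^ k) (initial_config xs) in
        halted P s \<and> mem s 1 \<noteq> 0 \<and> y = real (mem s 0) / real (mem s 1))"

text \<open>
  Words must be able to hold every input number and to address the input and all memory reachable
  within the time bound \<open>\<tau>\<close>; as usual the word length is only assumed to exceed a constant multiple
  \<open>C\<close> of the logarithms of these quantities.
\<close>

definition adequate_word_length :: "nat \<Rightarrow> nat \<Rightarrow> nat list \<Rightarrow> nat \<Rightarrow> bool" where
  "adequate_word_length W C xs \<tau> \<longleftrightarrow> (\<forall>x \<in> insert \<tau> (insert (length xs) (set xs)). x ^ C < 2 ^ W)"

section \<open>Encoding of instances\<close>

definition adjacency_matrix :: "nat \<Rightarrow> nat set set \<Rightarrow> nat list" where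
  "adjacency_matrix n E = [of_bool ({u, v} \<in> E). u \<leftarrow> [0..<n], v \<leftarrow> [0..<n]]"

text \<open>
  Encoding of a temporal graph with vertex set \<open>{..<n}\<close>, a number of parts \<open>c\<close> and \<open>\<omega> = p / q\<close>:
  a header, the adjacency matrix of the underlying graph, and those of the snapshots.
\<close>

definition encode_instance :: "nat temporal_graph \<Rightarrow> nat \<Rightarrow> nat \<Rightarrow> nat \<Rightarrow> nat list" where
  "encode_instance G c p q =
     (let n = card (verts G); T = lifetime G in
      [n, T, c, p, q] @ adjacency_matrix n (edges G)
        @ concat (map (\<lambda>t. adjacency_matrix n (snapshot G t)) [1..<T + 1]))"

end

theory Submission
  imports Defs "HOL-Library.Nat_Bijection"
begin

text \<open>
  The algorithm is written in a small loop language over arrays that compiles to the Word-RAM; its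
  time and the size of its numbers are polynomial in the bounds on the values it writes, so that the
  exponents hidden in \<open>\<O>\<close> need not be tracked.

  It first computes an elimination order of \<open>G\<close> in which every vertex has \<open>\<O>(w)\<close> later neighbours.
  The vertices are added one at a time; when a vertex is added, the order is rebuilt from balanced
  separators of size at most \<open>w + 1\<close>. These exist since some bag of a tree decomposition is a
  centroid, and they are found by eliminating along the old, slightly worse order.

  Label a vertex by its parts at times \<open>1, \<dots>, T\<close>; there are \<open>c\<^sup>T\<close> labels. The modularity of a
  partition depends only on the \<open>c T\<close> volumes, the number of edges inside parts and the loyalty, each
  of which is a sum of terms that belong to a single vertex or edge. Packed into one number below
  \<open>n\<^bsup>\<O>(c T)\<^esup> T\<^bsup>\<O>(1)\<^esup>\<close>, the set of achievable sums is computed by dynamic programming along the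
  elimination order, with tables indexed by the \<open>c\<^bsup>\<O>(w T)\<^esup>\<close> labellings of the later neighbours of a
  vertex, and the best achievable sum is the answer.
\<close>

section \<open>A loop language over arrays\<close>

text \<open>The treewidth bound w is not part of the input, so the program keeps a guess k of its
  own. It starts at 1 and grows only when an attachment set of 8k vertices has no suitable
  separator; by the centroid bag this cannot happen once k > w. A balanced separator leaves at most
  6k < 7k of the 8k vertices on a side, and 7k - 1 of them together with k + 1 separator vertices
  make 8k again. So unplaced components keep 8k attachments, and placed vertices get at most 9k
  later neighbours. The separator search is the same dynamic programme as the final one, run with
  three labels; its 3^O(w) tables are affordable because n^(cT) c^(wT) absorbs them for n, c \<ge>
  2. For c = 1 or n = 1 this fails, and a closed formula takes over. Numbers such as p and q are
  bounded by the word length only, not by the running time. Hence the time analysis treats the input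
  and array 0, which holds the result, as unbounded and looks at loop ranges alone, while the
  analysis of the word length bounds everything.\<close>

datatype arith_op = Plus | Times | Quot | Rem

primrec arith :: "arith_op \<Rightarrow> nat \<Rightarrow> nat \<Rightarrow> nat" where
  "arith Plus a b = a + b"
| "arith Times a b = a * b"
| "arith Quot a b = a div b"
| "arith Rem a b = a mod b"

primrec opcode :: "arith_op \<Rightarrow> binop" where
  "opcode Plus = Add"
| "opcode Times = Mul"
| "opcode Quot = Div"
| "opcode Rem = Mod"

datatype expr =
    Num nat
  | Var nat
  | Input expr
  | Arr nat expr
  | Arith arith_op expr expr
  | Monus expr expr
  | Less expr expr
  | Sum nat expr expr        \<comment> \<open>\<open>Sum x m e\<close> is \<open>\<Sum>x<m. e\<close>\<close>

datatype cmd =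
    Write nat expr expr      \<comment> \<open>\<open>Write a i e\<close> is \<open>a[i] := e\<close>\<close>
  | Seq cmd cmd (infixr ";;" 60)
  | If expr cmd cmd
  | For nat expr cmd         \<comment> \<open>the range is evaluated once, before the loop\<close>
  | Skip

type_synonym env = "nat \<Rightarrow> nat"
type_synonym store = "nat \<Rightarrow> nat \<Rightarrow> nat"

primrec val :: "(nat \<Rightarrow> nat) \<Rightarrow> expr \<Rightarrow> env \<Rightarrow> store \<Rightarrow> nat" where
  "val I (Num k) \<rho> st = k"
| "val I (Var x) \<rho> st = \<rho> x"
| "val I (Input e) \<rho> st = I (val I e \<rho> st)"
| "val I (Arr a e) \<rho> st = st a (val I e \<rho> st)"
| "val I (Arith f e1 e2) \<rho> st = arith f (val I e1 \<rho> st) (val I e2 \<rho> st)"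
| "val I (Monus e1 e2) \<rho> st = val I e1 \<rho> st - val I e2 \<rho> st"
| "val I (Less e1 e2) \<rho> st = of_bool (val I e1 \<rho> st < val I e2 \<rho> st)"
| "val I (Sum x m e) \<rho> st = (\<Sum>i<val I m \<rho> st. val I e (\<rho>(x := i)) st)"

primrec iter :: "nat \<Rightarrow> (nat \<Rightarrow> 'a \<Rightarrow> 'a) \<Rightarrow> 'a \<Rightarrow> 'a" where
  "iter 0 f s = s"
| "iter (Suc m) f s = f m (iter m f s)"

text \<open>Commands change only the store. Variables are bound by loops alone and ranges are fixed
  on entry, so a run is a total function and needs no termination argument.\<close>

primrec run :: "(nat \<Rightarrow> nat) \<Rightarrow> cmd \<Rightarrow> env \<Rightarrow> store \<Rightarrow> store" where
  "run I (Write a i e) \<rho> st = st(a := (st a)(val I i \<rho> st := val I e \<rho> st))"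
| "run I (c1 ;; c2) \<rho> st = run I c2 \<rho> (run I c1 \<rho> st)"
| "run I (If e c1 c2) \<rho> st = (if val I e \<rho> st \<noteq> 0 then run I c1 \<rho> st else run I c2 \<rho> st)"
| "run I (For x m c) \<rho> st = iter (val I m \<rho> st) (\<lambda>i. run I c (\<rho>(x := i))) st"
| "run I Skip \<rho> st = st"

text \<open>Upper bounds on the number of executed instructions of the compiled code. An array
  access, for example, costs ten instructions for the address and one load. Some constants are
  rounded up, which polynomial bounds absorb.\<close>

primrec expr_cost :: "(nat \<Rightarrow> nat) \<Rightarrow> expr \<Rightarrow> env \<Rightarrow> store \<Rightarrow> nat" where
  "expr_cost I (Num k) \<rho> st = 1"
| "expr_cost I (Var x) \<rho> st = 1"
| "expr_cost I (Input e) \<rho> st = expr_cost I e \<rho> st + 3"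
| "expr_cost I (Arr a e) \<rho> st = expr_cost I e \<rho> st + 11"
| "expr_cost I (Arith f e1 e2) \<rho> st = expr_cost I e1 \<rho> st + expr_cost I e2 \<rho> st + 1"
| "expr_cost I (Monus e1 e2) \<rho> st = expr_cost I e1 \<rho> st + expr_cost I e2 \<rho> st + 3"
| "expr_cost I (Less e1 e2) \<rho> st = expr_cost I e1 \<rho> st + expr_cost I e2 \<rho> st + 3"
| "expr_cost I (Sum x m e) \<rho> st =
     expr_cost I m \<rho> st + 7 + (\<Sum>i<val I m \<rho> st. expr_cost I e (\<rho>(x := i)) st + 5)"

primrec cost :: "(nat \<Rightarrow> nat) \<Rightarrow> cmd \<Rightarrow> env \<Rightarrow> store \<Rightarrow> nat" where
  "cost I (Write a i e) \<rho> st = expr_cost I i \<rho> st + expr_cost I e \<rho> st + 12"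
| "cost I (c1 ;; c2) \<rho> st = cost I c1 \<rho> st + cost I c2 \<rho> (run I c1 \<rho> st)"
| "cost I (If e c1 c2) \<rho> st =
     expr_cost I e \<rho> st + 4 + (if val I e \<rho> st \<noteq> 0 then cost I c1 \<rho> st else cost I c2 \<rho> st)"
| "cost I (For x m c) \<rho> st = expr_cost I m \<rho> st + 6 +
     (\<Sum>i<val I m \<rho> st. cost I c (\<rho>(x := i)) (iter i (\<lambda>i. run I c (\<rho>(x := i))) st) + 5)"
| "cost I Skip \<rho> st = 0"

text \<open>
  \<open>fits\<close> and \<open>cmd_fits\<close> say that no intermediate value reaches the word bound \<open>M\<close>; in
  particular the address of cell \<open>i\<close> of array \<open>a\<close>, which is \<open>base + prod_encode (a, i)\<close>, is a word.
\<close>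

primrec fits :: "(nat \<Rightarrow> nat) \<Rightarrow> nat \<Rightarrow> nat \<Rightarrow> expr \<Rightarrow> env \<Rightarrow> store \<Rightarrow> bool" where
  "fits I M base (Num k) \<rho> st \<longleftrightarrow> k < M"
| "fits I M base (Var x) \<rho> st \<longleftrightarrow> True"
| "fits I M base (Input e) \<rho> st \<longleftrightarrow> fits I M base e \<rho> st"
| "fits I M base (Arr a e) \<rho> st \<longleftrightarrow>
     fits I M base e \<rho> st \<and> base + (a + val I e \<rho> st + 2)\<^sup>2 < M"
| "fits I M base (Arith f e1 e2) \<rho> st \<longleftrightarrow>
     fits I M base e1 \<rho> st \<and> fits I M base e2 \<rho> st \<and> arith f (val I e1 \<rho> st) (val I e2 \<rho> st) < M"
| "fits I M base (Monus e1 e2) \<rho> st \<longleftrightarrow>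
     fits I M base e1 \<rho> st \<and> fits I M base e2 \<rho> st \<and> val I e1 \<rho> st < M"
| "fits I M base (Less e1 e2) \<rho> st \<longleftrightarrow> fits I M base e1 \<rho> st \<and> fits I M base e2 \<rho> st"
| "fits I M base (Sum x m e) \<rho> st \<longleftrightarrow>
     fits I M base m \<rho> st \<and> (\<forall>i<val I m \<rho> st. fits I M base e (\<rho>(x := i)) st) \<and>
     val I m \<rho> st < M \<and> val I (Sum x m e) \<rho> st < M"

primrec cmd_fits :: "(nat \<Rightarrow> nat) \<Rightarrow> nat \<Rightarrow> nat \<Rightarrow> cmd \<Rightarrow> env \<Rightarrow> store \<Rightarrow> bool" where
  "cmd_fits I M base (Write a i e) \<rho> st \<longleftrightarrow>
     fits I M base i \<rho> st \<and> fits I M base e \<rho> st \<and> base + (a + val I i \<rho> st + 2)\<^sup>2 < M"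
| "cmd_fits I M base (c1 ;; c2) \<rho> st \<longleftrightarrow>
     cmd_fits I M base c1 \<rho> st \<and> cmd_fits I M base c2 \<rho> (run I c1 \<rho> st)"
| "cmd_fits I M base (If e c1 c2) \<rho> st \<longleftrightarrow> fits I M base e \<rho> st \<and>
     (if val I e \<rho> st \<noteq> 0 then cmd_fits I M base c1 \<rho> st else cmd_fits I M base c2 \<rho> st)"
| "cmd_fits I M base (For x m c) \<rho> st \<longleftrightarrow>
     fits I M base m \<rho> st \<and> val I m \<rho> st < M \<and>
     (\<forall>i<val I m \<rho> st. cmd_fits I M base c (\<rho>(x := i)) (iter i (\<lambda>i. run I c (\<rho>(x := i))) st))"
| "cmd_fits I M base Skip \<rho> st \<longleftrightarrow> True"

primrec expr_vars :: "expr \<Rightarrow> nat set" where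
  "expr_vars (Num k) = {}"
| "expr_vars (Var x) = {x}"
| "expr_vars (Input e) = expr_vars e"
| "expr_vars (Arr a e) = expr_vars e"
| "expr_vars (Arith f e1 e2) = expr_vars e1 \<union> expr_vars e2"
| "expr_vars (Monus e1 e2) = expr_vars e1 \<union> expr_vars e2"
| "expr_vars (Less e1 e2) = expr_vars e1 \<union> expr_vars e2"
| "expr_vars (Sum x m e) = insert x (expr_vars m \<union> expr_vars e)"

primrec cmd_vars :: "cmd \<Rightarrow> nat set" where
  "cmd_vars (Write a i e) = expr_vars i \<union> expr_vars e"
| "cmd_vars (c1 ;; c2) = cmd_vars c1 \<union> cmd_vars c2"
| "cmd_vars (If e c1 c2) = expr_vars e \<union> cmd_vars c1 \<union> cmd_vars c2"
| "cmd_vars (For x m c) = insert x (expr_vars m \<union> cmd_vars c)"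
| "cmd_vars Skip = {}"

section \<open>Compilation to the Word-RAM\<close>

text \<open>
  Register 0 holds the start of the work memory, register \<open>Suc x\<close> the variable \<open>x\<close>. The code of
  an expression, placed at address \<open>p\<close>, leaves its value in register \<open>r\<close> and changes only
  registers from \<open>r\<close> on; bound variables are saved and restored.
\<close>

definition address_code :: "nat \<Rightarrow> nat \<Rightarrow> nat \<Rightarrow> instr list" where
  "address_code a i r =
     [Const r a, Op Add r r i, Const (r + 1) 1, Op Add (r + 1) (r + 1) r,
      Op Mul r r (r + 1), Const (r + 1) 2, Op Div r r (r + 1), Const (r + 1) a,
      Op Add r r (r + 1), Op Add r r 0]"

primrec expr_code :: "expr \<Rightarrow> nat \<Rightarrow> nat \<Rightarrow> instr list" where
  "expr_code (Num k) p r = [Const r k]"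
| "expr_code (Var x) p r = [Op Or r (Suc x) (Suc x)]"
| "expr_code (Input e) p r =
     (let c = expr_code e p r; q = p + length c
      in c @ [Jump_if_less r 0 (q + 3), Const r 0, Jump (q + 4), Load r r])"
| "expr_code (Arr a e) p r = expr_code e p r @ address_code a r (r + 1) @ [Load r (r + 1)]"
| "expr_code (Arith f e1 e2) p r =
     (let c = expr_code e1 p r
      in c @ expr_code e2 (p + length c) (r + 1) @ [Op (opcode f) r r (r + 1)])"
| "expr_code (Monus e1 e2) p r =
     (let c1 = expr_code e1 p r; c2 = expr_code e2 (p + length c1) (r + 1);
          q = p + length c1 + length c2
      in c1 @ c2 @ [Jump_if_less r (r + 1) (q + 3), Op Sub r r (r + 1), Jump (q + 4), Const r 0])"
| "expr_code (Less e1 e2) p r =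
     (let c1 = expr_code e1 p r; c2 = expr_code e2 (p + length c1) (r + 1);
          q = p + length c1 + length c2
      in c1 @ c2 @ [Jump_if_less r (r + 1) (q + 3), Const r 0, Jump (q + 4), Const r 1])"
| "expr_code (Sum x m e) p r =
     (let c = expr_code m p r; h = p + length c + 3; b = expr_code e (h + 2) (r + 3)
      in c @ [Op Or (r + 1) (Suc x) (Suc x), Const (Suc x) 0, Const (r + 2) 0] @
         [Jump_if_less (Suc x) r (h + 2), Jump (h + length b + 6)] @ b @
         [Op Add (r + 2) (r + 2) (r + 3), Const (r + 3) 1, Op Add (Suc x) (Suc x) (r + 3), Jump h] @
         [Op Or (Suc x) (r + 1) (r + 1), Op Or r (r + 2) (r + 2)])"

primrec cmd_code :: "cmd \<Rightarrow> nat \<Rightarrow> nat \<Rightarrow> instr list" where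
  "cmd_code (Write a i e) p r =
     (let c = expr_code i p r
      in c @ expr_code e (p + length c) (r + 1) @ address_code a r (r + 2) @ [Store (r + 2) (r + 1)])"
| "cmd_code (c1 ;; c2) p r = (let c = cmd_code c1 p r in c @ cmd_code c2 (p + length c) r)"
| "cmd_code (If e c1 c2) p r =
     (let c = expr_code e p r; q = p + length c; d1 = cmd_code c1 (q + 3) r;
          d2 = cmd_code c2 (q + length d1 + 4) r
      in c @ [Const (r + 1) 0, Jump_if_less (r + 1) r (q + 3), Jump (q + length d1 + 4)] @ d1 @
         [Jump (q + length d1 + length d2 + 4)] @ d2)"
| "cmd_code (For x m c) p r =
     (let d = expr_code m p r; h = p + length d + 2; b = cmd_code c (h + 2) (r + 2)
      in d @ [Op Or (r + 1) (Suc x) (Suc x), Const (Suc x) 0] @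
         [Jump_if_less (Suc x) r (h + 2), Jump (h + length b + 5)] @ b @
         [Const (r + 2) 1, Op Add (Suc x) (Suc x) (r + 2), Jump h] @
         [Op Or (Suc x) (r + 1) (r + 1)])"
| "cmd_code Skip p r = []"

text \<open>All arrays are interleaved behind the input by the Cantor pairing, so no array needs a
  size fixed in advance; addresses grow only quadratically in the indices.\<close>

definition memory_of :: "(nat \<Rightarrow> nat) \<Rightarrow> nat \<Rightarrow> store \<Rightarrow> nat \<Rightarrow> nat" where
  "memory_of I base st j = (if j < base then I j else case_prod st (prod_decode (j - base)))"

lemma memory_of_encode [simp]: "memory_of I base st (base + prod_encode (a, i)) = st a i"
  by (simp add: memory_of_def)

lemma memory_of_encode' [simp]: "memory_of I base st (prod_encode (a, i) + base) = st a i"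
  by (simp add: memory_of_def)

lemma memory_of_update:
  "(memory_of I base st)(base + prod_encode (a, i) := y) = memory_of I base (st(a := (st a)(i := y)))"
proof
  fix j
  show "((memory_of I base st)(base + prod_encode (a, i) := y)) j =
      memory_of I base (st(a := (st a)(i := y))) j"
  proof (cases "j < base")
    case True
    then show ?thesis by (simp add: memory_of_def)
  next
    case False
    obtain b l where "prod_decode (j - base) = (b, l)" by force
    moreover from this have "j = base + prod_encode (b, l)"
      using False by (metis le_add_diff_inverse not_less prod_decode_inverse)
    ultimately show ?thesis by (auto simp: memory_of_def)
  qed
qed

section \<open>Placement of code and reachability of configurations\<close>

definition code_at :: "program \<Rightarrow> nat \<Rightarrow> instr list \<Rightarrow> bool" where
  "code_at P p is \<longleftrightarrow> (\<forall>j<length is. p + j < length P \<and> P ! (p + j) = is ! j)"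

lemma code_at_Nil [simp]: "code_at P p []"
  by (simp add: code_at_def)

lemma code_at_Cons [simp]:
  "code_at P p (i # is) \<longleftrightarrow> p < length P \<and> P ! p = i \<and> code_at P (Suc p) is"
proof -
  have "(\<forall>j<Suc n. Q j) \<longleftrightarrow> Q 0 \<and> (\<forall>j<n. Q (Suc j))" for n and Q :: "nat \<Rightarrow> bool"
    using less_Suc_eq_0_disj by auto
  then show ?thesis by (simp add: code_at_def)
qed

lemma code_at_append [simp]:
  "code_at P p (xs @ ys) \<longleftrightarrow> code_at P p xs \<and> code_at P (p + length xs) ys"
  by (induction xs arbitrary: p) auto

definition reaches :: "nat \<Rightarrow> program \<Rightarrow> nat \<Rightarrow> config \<Rightarrow> config \<Rightarrow> bool" where
  "reaches W P k s s' \<longleftrightarrow> (\<exists>j\<le>k. (step W P ^^ j) s = s')"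

lemma reaches_refl: "reaches W P k s s"
  unfolding reaches_def by (rule exI[of _ 0]) simp

lemma reaches_trans:
  assumes "reaches W P k s s'" "reaches W P l s' s''"
  shows "reaches W P (k + l) s s''"
proof -
  obtain i j where "i \<le> k" "(step W P ^^ i) s = s'" "j \<le> l" "(step W P ^^ j) s' = s''"
    using assms by (auto simp: reaches_def)
  then show ?thesis
    unfolding reaches_def by (intro exI[of _ "j + i"]) (auto simp: funpow_add)
qed

lemma reaches_mono:
  assumes "reaches W P k s s'" "k \<le> l"
  shows "reaches W P l s s'"
  using assms le_trans unfolding reaches_def by blast

lemma reaches_step:
  assumes "pc s < length P" "P ! pc s = i" "i \<noteq> Halt" "reaches W P k (exec W i s) s'"
  shows "reaches W P (Suc k) s s'"
proof -
  obtain j where "j \<le> k" "(step W P ^^ j) (exec W i s) = s'" using assms(4) by (auto simp: reaches_def)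
  then have "(step W P ^^ Suc j) s = s'"
    using assms(1-3) by (simp add: funpow_Suc_right step_def halted_def del: funpow.simps)
  with \<open>j \<le> k\<close> show ?thesis unfolding reaches_def by (intro exI[of _ "Suc j"]) simp
qed

lemma reaches_one:
  assumes "pc s < length P" "P ! pc s = i" "i \<noteq> Halt"
  shows "reaches W P 1 s (exec W i s)"
  using reaches_step[OF assms reaches_refl, of W 0] by simp

fun straight :: "instr \<Rightarrow> bool" where
  "straight (Jump_if_less i j l) \<longleftrightarrow> False"
| "straight (Jump l) \<longleftrightarrow> False"
| "straight Halt \<longleftrightarrow> False"
| "straight i \<longleftrightarrow> True"

lemma reaches_straight:
  assumes "code_at P (pc s) is" "list_all straight is"
  shows "reaches W P (length is) s (fold (exec W) is s)"
  using assms
proof (induction "is" arbitrary: s)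
  case Nil
  then show ?case by (simp add: reaches_refl)
next
  case (Cons i "is")
  have "i \<noteq> Halt" "pc (exec W i s) = Suc (pc s)" using Cons.prems by (cases i; simp)+
  moreover have "reaches W P (length is) (exec W i s) (fold (exec W) is (exec W i s))"
    using Cons calculation by simp
  ultimately show ?case using Cons.prems by (auto intro: reaches_step)
qed

text \<open>\<open>Input\<close>, \<open>Monus\<close> and \<open>Less\<close> compile to this block
  of four instructions. Both branches meet right behind the block, and the longer one runs three
  instructions.\<close>

lemma reaches_branch:
  assumes code: "code_at P (pc s) [Jump_if_less i j (pc s + 3), i1, Jump (pc s + 4), i2]"
    and "straight i1" "straight i2"
  shows "reaches W P 3 s ((exec W (if regs s i < regs s j then i2 else i1) s)\<lparr>pc := pc s + 4\<rparr>)"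
proof -
  define s1 where "s1 = exec W (Jump_if_less i j (pc s + 3)) s"
  have 1: "reaches W P 1 s s1" unfolding s1_def by (rule reaches_one) (use code in auto)
  show ?thesis
  proof (cases "regs s i < regs s j")
    case True
    then have "s1 = s\<lparr>pc := pc s + 3\<rparr>" by (simp add: s1_def)
    moreover have "reaches W P 1 s1 (exec W i2 s1)"
      by (rule reaches_one) (use code assms(3) calculation in \<open>auto simp: eval_nat_numeral\<close>)
    moreover have "exec W i2 (s\<lparr>pc := pc s + 3\<rparr>) = (exec W i2 s)\<lparr>pc := pc s + 4\<rparr>" using assms(3) by (cases i2) auto
    ultimately show ?thesis using True reaches_mono[OF reaches_trans[OF 1], of 1 _ 3] by simp
  next
    case False
    define s2 where "s2 = exec W i1 s1"
    have s1: "s1 = s\<lparr>pc := pc s + 1\<rparr>" using False by (simp add: s1_def)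
    have "reaches W P 1 s1 s2" unfolding s2_def by (rule reaches_one) (use code assms(2) s1 in auto)
    moreover have s2: "s2 = (exec W i1 s)\<lparr>pc := pc s + 2\<rparr>" using assms(2) unfolding s2_def s1 by (cases i1) auto
    moreover have "reaches W P 1 s2 (exec W (Jump (pc s + 4)) s2)" by (rule reaches_one) (use code s2 in auto)
    ultimately have "reaches W P (1 + (1 + 1)) s (exec W (Jump (pc s + 4)) s2)" using 1 reaches_trans by blast
    then have "reaches W P 3 s (exec W (Jump (pc s + 4)) s2)" by (rule reaches_mono) simp
    then show ?thesis using False s2 by simp
  qed
qed

lemma prod_encode_bound: "prod_encode (a, i) < (a + i + 2)\<^sup>2"
proof -
  have "triangle (a + i) \<le> (a + i) * (a + i + 1)" by (simp add: triangle_def)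
  then show ?thesis by (simp add: prod_encode_def power2_eq_square algebra_simps)
qed

text \<open>The square bounds every intermediate word, including the product of two consecutive
  numbers before it is halved to a triangular number.\<close>

lemma address_code_correct:
  assumes code: "code_at P (pc s) (address_code a i r)"
    and reg: "0 < r" "i < r"
    and fit: "regs s 0 + (a + regs s i + 2)\<^sup>2 < 2 ^ W"
  shows "\<exists>s'. reaches W P 10 s s' \<and> pc s' = pc s + 10 \<and> mem s' = mem s \<and>
    (\<forall>j<r. regs s' j = regs s j) \<and> regs s' r = regs s 0 + prod_encode (a, regs s i)"
proof -
  define M :: nat where "M = 2 ^ W"
  define v where "v = regs s i"
  have fit': "regs s 0 + (a + v + 2)\<^sup>2 < M" using fit by (simp add: M_def v_def)
  have sq: "(a + v + 2)\<^sup>2 = (a + v) * (a + v + 1) + 3 * (a + v) + 4"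
    by (simp add: power2_eq_square algebra_simps)
  have m: "a < M" "a + v < M" "1 < M" "2 < M" "a + v + 1 < M" "(a + v) * (a + v + 1) < M"
    using fit' sq by (auto intro: le_less_trans[rotated])
  have t: "triangle (a + v) = (a + v) * (a + v + 1) div 2" by (simp add: triangle_def)
  have pe: "triangle (a + v) + a = prod_encode (a, v)" by (simp add: prod_encode_def)
  have m2: "regs s 0 + prod_encode (a, v) < M" using prod_encode_bound[of a v] fit' by linarith
  then have m3: "prod_encode (a, v) < M" by linarith
  have "reaches W P (length (address_code a i r)) s (fold (exec W) (address_code a i r) s)"
    by (rule reaches_straight) (use code in \<open>simp_all add: address_code_def\<close>)
  moreover have "length (address_code a i r) = 10" by (simp add: address_code_def)
  moreover have "regs (fold (exec W) (address_code a i r) s) r = regs s 0 + prod_encode (a, regs s i)"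
    using m m2 m3 reg t pe
    by (simp add: address_code_def M_def[symmetric] v_def[symmetric] add_ac)
  moreover have "pc (fold (exec W) (address_code a i r) s) = pc s + 10"
    "mem (fold (exec W) (address_code a i r) s) = mem s"
    "\<forall>j<r. regs (fold (exec W) (address_code a i r) s) j = regs s j"
    by (simp_all add: address_code_def del: eval_binop.simps)
  ultimately show ?thesis by metis
qed

lemma arith_eval_binop:
  "arith f a b < 2 ^ W \<Longrightarrow> eval_binop W (opcode f) a b = arith f a b"
  by (cases f) auto

section \<open>Simulation of expressions\<close>

definition simulates :: "(nat \<Rightarrow> nat) \<Rightarrow> nat \<Rightarrow> nat \<Rightarrow> env \<Rightarrow> store \<Rightarrow> config \<Rightarrow> bool" where
  "simulates I base V \<rho> st s \<longleftrightarrow>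
     regs s 0 = base \<and> mem s = memory_of I base st \<and> (\<forall>x<V. regs s (Suc x) = \<rho> x)"

lemma simulates_cong:
  assumes "simulates I base V \<rho> st s" "mem s' = mem s" "\<forall>i<r. regs s' i = regs s i" "V < r"
  shows "simulates I base V \<rho> st s'"
  using assms by (auto simp: simulates_def)

locale ram_simulation =
  fixes W :: nat and P :: program and I :: "nat \<Rightarrow> nat" and base V :: nat
  assumes input_bound: "\<And>j. base \<le> j \<Longrightarrow> I j = 0" and word_gt1: "1 < (2 :: nat) ^ W"
begin

lemma word_length_pos: "0 < W"
  using word_gt1 by (cases W) auto

abbreviation "sim \<equiv> simulates I base V"

definition evaluates :: "expr \<Rightarrow> bool" where
  "evaluates e \<longleftrightarrow> (\<forall>p r s \<rho> st. code_at P p (expr_code e p r) \<longrightarrow> pc s = p \<longrightarrow> V < r \<longrightarrow>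
     expr_vars e \<subseteq> {..<V} \<longrightarrow> sim \<rho> st s \<longrightarrow> fits I (2 ^ W) base e \<rho> st \<longrightarrow>
     (\<exists>s'. reaches W P (expr_cost I e \<rho> st) s s' \<and> pc s' = p + length (expr_code e p r) \<and>
        mem s' = mem s \<and> (\<forall>i<r. regs s' i = regs s i) \<and> regs s' r = val I e \<rho> st))"

lemma evaluatesE:
  assumes "evaluates e" "code_at P (pc s) (expr_code e (pc s) r)" "V < r" "expr_vars e \<subseteq> {..<V}"
    "sim \<rho> st s" "fits I (2 ^ W) base e \<rho> st"
  obtains s' where "reaches W P (expr_cost I e \<rho> st) s s'"
    "pc s' = pc s + length (expr_code e (pc s) r)" "mem s' = mem s"
    "\<forall>i<r. regs s' i = regs s i" "regs s' r = val I e \<rho> st"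
  using assms unfolding evaluates_def by blast

lemma evaluates_binary:
  assumes "evaluates e1" "evaluates e2"
    and code: "code_at P (pc s) (expr_code e1 (pc s) r)"
      "code_at P (pc s + length (expr_code e1 (pc s) r))
         (expr_code e2 (pc s + length (expr_code e1 (pc s) r)) (r + 1))"
    and "V < r" "expr_vars e1 \<subseteq> {..<V}" "expr_vars e2 \<subseteq> {..<V}" "sim \<rho> st s"
      "fits I (2 ^ W) base e1 \<rho> st" "fits I (2 ^ W) base e2 \<rho> st"
  obtains s' where "reaches W P (expr_cost I e1 \<rho> st + expr_cost I e2 \<rho> st) s s'"
    "pc s' = pc s + length (expr_code e1 (pc s) r) +
       length (expr_code e2 (pc s + length (expr_code e1 (pc s) r)) (r + 1))"
    "mem s' = mem s" "\<forall>i<r. regs s' i = regs s i"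
    "regs s' r = val I e1 \<rho> st" "regs s' (r + 1) = val I e2 \<rho> st"
proof -
  obtain s1 where s1: "reaches W P (expr_cost I e1 \<rho> st) s s1"
    "pc s1 = pc s + length (expr_code e1 (pc s) r)" "mem s1 = mem s"
    "\<forall>i<r. regs s1 i = regs s i" "regs s1 r = val I e1 \<rho> st"
    using evaluatesE[OF assms(1) code(1)] assms by metis
  have "sim \<rho> st s1" using simulates_cong s1 assms by metis
  then obtain s2 where s2: "reaches W P (expr_cost I e2 \<rho> st) s1 s2"
    "pc s2 = pc s1 + length (expr_code e2 (pc s1) (r + 1))" "mem s2 = mem s1"
    "\<forall>i<r + 1. regs s2 i = regs s1 i" "regs s2 (r + 1) = val I e2 \<rho> st"
    using evaluatesE[OF assms(2), of s1 "r + 1" \<rho> st] assms s1(2) by (metis trans_less_add1)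
  show thesis
    by (rule that[of s2]) (use s1 s2 reaches_trans[OF s1(1) s2(1)] in auto)
qed

text \<open>The invariant at the loop head \<open>h\<close>: register \<open>Suc x\<close> counts,
  \<open>r\<close> holds the range, \<open>r + 1\<close> the saved outer value of \<open>x\<close>
  and \<open>r + 2\<close> the partial sum, while the body works from \<open>r + 3\<close> on.
  \<open>Op Or\<close> with equal operands serves as a register copy.\<close>

lemma evaluates_Sum:
  assumes "evaluates m" "evaluates e"
  shows "evaluates (Sum x m e)"
  unfolding evaluates_def
proof (intro allI impI)
  fix p r and s :: config and \<rho> st
  let ?c = "expr_code m p r" and ?M = "2 ^ W :: nat"
  define h where "h = p + length ?c + 3"
  define b where "b = expr_code e (h + 2) (r + 3)"
  define n where "n = val I m \<rho> st"
  define S where "S i = (\<Sum>j<i. val I e (\<rho>(x := j)) st)" for i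
  assume code: "code_at P p (expr_code (Sum x m e) p r)" and pc: "pc s = p" and r: "V < r"
    and vars: "expr_vars (Sum x m e) \<subseteq> {..<V}" and sim: "sim \<rho> st s"
    and fit: "fits I ?M base (Sum x m e) \<rho> st"
  have len: "length (expr_code (Sum x m e) p r) = length ?c + length b + 11"
    by (simp add: Let_def h_def b_def)
  have code_c: "code_at P p ?c"
    and code1: "code_at P (p + length ?c)
      [Op Or (r + 1) (Suc x) (Suc x), Const (Suc x) 0, Const (r + 2) 0]"
    and code2: "code_at P h [Jump_if_less (Suc x) r (h + 2), Jump (h + length b + 6)]"
    and code_b: "code_at P (h + 2) b"
    and code3: "code_at P (h + 2 + length b)
      [Op Add (r + 2) (r + 2) (r + 3), Const (r + 3) 1, Op Add (Suc x) (Suc x) (r + 3)]"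
    and code4: "code_at P (h + length b + 5) [Jump h]"
    and code5: "code_at P (h + length b + 6) [Op Or (Suc x) (r + 1) (r + 1), Op Or r (r + 2) (r + 2)]"
    using code by (simp_all add: Let_def h_def b_def eval_nat_numeral add_ac)
  have xV: "x < V" and vm: "expr_vars m \<subseteq> {..<V}" and ve: "expr_vars e \<subseteq> {..<V}" using vars by auto
  have fm: "fits I ?M base m \<rho> st" and fe: "\<And>i. i < n \<Longrightarrow> fits I ?M base e (\<rho>(x := i)) st"
    and nM: "n < ?M" and SM: "S n < ?M" using fit by (auto simp: n_def S_def)
  obtain s1 where s1: "reaches W P (expr_cost I m \<rho> st) s s1" "pc s1 = p + length ?c"
    "mem s1 = mem s" "\<forall>i<r. regs s1 i = regs s i" "regs s1 r = n"
    using evaluatesE[OF assms(1), of s r \<rho> st] code_c pc r vm sim fm unfolding n_def by metis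
  define s2 where "s2 = fold (exec W)
    [Op Or (r + 1) (Suc x) (Suc x), Const (Suc x) 0, Const (r + 2) 0] s1"
  have s2: "reaches W P 3 s1 s2"
    using reaches_straight[of P s1 "[Op Or (r + 1) (Suc x) (Suc x), Const (Suc x) 0, Const (r + 2) 0]" W]
      code1 s1(2) by (simp add: s2_def numeral_3_eq_3 del: exec.simps)
  have inv: "\<exists>s'. reaches W P (\<Sum>j<i. expr_cost I e (\<rho>(x := j)) st + 5) s2 s' \<and> pc s' = h \<and>
      mem s' = mem s \<and> (\<forall>j<r. j \<noteq> Suc x \<longrightarrow> regs s' j = regs s j) \<and> regs s' (Suc x) = i \<and>
      regs s' r = n \<and> regs s' (r + 1) = regs s (Suc x) \<and> regs s' (r + 2) = S i"
    if "i \<le> n" for i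
    using that
  proof (induction i)
    case 0
    show ?case
      by (rule exI[of _ s2]) (use s1 r xV in \<open>auto simp: s2_def reaches_refl h_def S_def\<close>)
  next
    case (Suc i)
    then obtain t where t: "reaches W P (\<Sum>j<i. expr_cost I e (\<rho>(x := j)) st + 5) s2 t" "pc t = h"
      "mem t = mem s" "\<forall>j<r. j \<noteq> Suc x \<longrightarrow> regs t j = regs s j" "regs t (Suc x) = i"
      "regs t r = n" "regs t (r + 1) = regs s (Suc x)" "regs t (r + 2) = S i"
      by (meson Suc_leD)
    have i: "i < n" using Suc.prems by simp
    define t1 where "t1 = exec W (Jump_if_less (Suc x) r (h + 2)) t"
    have t1: "reaches W P 1 t t1" using code2 t(2) unfolding t1_def by (intro reaches_one) auto
    have t1': "pc t1 = h + 2" "mem t1 = mem t" "regs t1 = regs t" using t i by (auto simp: t1_def)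
    have sim1: "sim (\<rho>(x := i)) st t1" using sim t r t1' by (auto simp: simulates_def)
    obtain t2 where t2: "reaches W P (expr_cost I e (\<rho>(x := i)) st) t1 t2" "pc t2 = h + 2 + length b"
      "mem t2 = mem t1" "\<forall>j<r + 3. regs t2 j = regs t1 j" "regs t2 (r + 3) = val I e (\<rho>(x := i)) st"
      using evaluatesE[OF assms(2), of t1 "r + 3" "\<rho>(x := i)" st] code_b t1'(1) r ve sim1 fe[OF i]
      unfolding b_def by (metis trans_less_add1)
    let ?is = "[Op Add (r + 2) (r + 2) (r + 3), Const (r + 3) 1, Op Add (Suc x) (Suc x) (r + 3)]"
    define t3 where "t3 = fold (exec W) ?is t2"
    have t3: "reaches W P 3 t2 t3"
      using reaches_straight[of P t2 ?is W] code3 t2(2) by (simp add: t3_def numeral_3_eq_3 del: exec.simps)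
    define t4 where "t4 = exec W (Jump h) t3"
    have pc3: "pc t3 = h + length b + 5" using t2 by (simp add: t3_def)
    have t4: "reaches W P 1 t3 t4" using code4 pc3 unfolding t4_def by (intro reaches_one) auto
    have "reaches W P ((\<Sum>j<i. expr_cost I e (\<rho>(x := j)) st + 5) + (1 + (expr_cost I e (\<rho>(x := i)) st + (3 + 1)))) s2 t4"
      using reaches_trans[OF t(1) reaches_trans[OF t1 reaches_trans[OF t2(1) reaches_trans[OF t3 t4]]]] .
    then have R: "reaches W P (\<Sum>j<Suc i. expr_cost I e (\<rho>(x := j)) st + 5) s2 t4"
      by (rule reaches_mono) simp
    \<comment> \<open>Partial sums increase, so the bound on the complete sum excludes a wrap-around
      in each addition.\<close>
    have "S (Suc i) \<le> S n" unfolding S_def using i by (intro sum_mono2) auto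
    then have Si: "S i + val I e (\<rho>(x := i)) st < ?M" using SM by (simp add: S_def)
    have reg2: "regs t2 (Suc x) = i" "regs t2 (r + 2) = S i" "regs t2 r = n"
      "regs t2 (r + 1) = regs s (Suc x)" "\<forall>j<r. j \<noteq> Suc x \<longrightarrow> regs t2 j = regs s j"
      using t2(4) t1'(3) t xV r by auto
    have "S (Suc i) = S i + val I e (\<rho>(x := i)) st" by (simp add: S_def)
    moreover have "Suc i < ?M" using i nM by simp
    ultimately have "regs t4 (Suc x) = Suc i" "regs t4 (r + 2) = S (Suc i)" "regs t4 r = n"
      "regs t4 (r + 1) = regs s (Suc x)" "\<forall>j<r. j \<noteq> Suc x \<longrightarrow> regs t4 j = regs s j"
      "pc t4 = h" "mem t4 = mem s"
      using reg2 Si t2(3,5) t1'(2) t(3) xV r by (auto simp: t4_def t3_def word_length_pos)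
    with R show ?case by blast
  qed
  obtain t where t: "reaches W P (\<Sum>j<n. expr_cost I e (\<rho>(x := j)) st + 5) s2 t" "pc t = h"
      "mem t = mem s" "\<forall>j<r. j \<noteq> Suc x \<longrightarrow> regs t j = regs s j" "regs t (Suc x) = n"
      "regs t r = n" "regs t (r + 1) = regs s (Suc x)" "regs t (r + 2) = S n"
    using inv[OF order_refl] by blast
  define t1 where "t1 = exec W (Jump_if_less (Suc x) r (h + 2)) t"
  have t1: "reaches W P 1 t t1" using code2 t(2) unfolding t1_def by (intro reaches_one) auto
  define t2 where "t2 = exec W (Jump (h + length b + 6)) t1"
  have t2: "reaches W P 1 t1 t2"
    using code2 t unfolding t2_def t1_def by (intro reaches_one) auto
  define t3 where "t3 = fold (exec W) [Op Or (Suc x) (r + 1) (r + 1), Op Or r (r + 2) (r + 2)] t2"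
  have t3: "reaches W P 2 t2 t3"
    using reaches_straight[of P t2 "[Op Or (Suc x) (r + 1) (r + 1), Op Or r (r + 2) (r + 2)]" W] code5
    by (simp add: t3_def t2_def numeral_2_eq_2 del: exec.simps(2))
  have "reaches W P (expr_cost I m \<rho> st + (3 + ((\<Sum>j<n. expr_cost I e (\<rho>(x := j)) st + 5) + (1 + (1 + 2))))) s t3"
    using reaches_trans[OF s1(1) reaches_trans[OF s2 reaches_trans[OF t(1) reaches_trans[OF t1 reaches_trans[OF t2 t3]]]]] .
  then have "reaches W P (expr_cost I (Sum x m e) \<rho> st) s t3"
    by (rule reaches_mono) (simp add: n_def)
  moreover have "pc t3 = p + length (expr_code (Sum x m e) p r)" "mem t3 = mem s"
    "regs t3 r = val I (Sum x m e) \<rho> st"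
    using t len xV r by (auto simp: t3_def t2_def t1_def h_def S_def n_def)
  moreover have "\<forall>i<r. regs t3 i = regs s i" using t xV r by (auto simp: t3_def t2_def t1_def)
  ultimately show "\<exists>s'. reaches W P (expr_cost I (Sum x m e) \<rho> st) s s' \<and>
      pc s' = p + length (expr_code (Sum x m e) p r) \<and> mem s' = mem s \<and>
      (\<forall>i<r. regs s' i = regs s i) \<and> regs s' r = val I (Sum x m e) \<rho> st" by blast
qed

lemma expr_code_correct: "evaluates e"
proof (induction e)
  case (Num k)
  show ?case unfolding evaluates_def
  proof (intro allI impI)
    fix p r and s :: config and \<rho> st
    assume "code_at P p (expr_code (Num k) p r)" "pc s = p" "fits I (2 ^ W) base (Num k) \<rho> st"
    then show "\<exists>s'. reaches W P (expr_cost I (Num k) \<rho> st) s s' \<and>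
      pc s' = p + length (expr_code (Num k) p r) \<and> mem s' = mem s \<and>
      (\<forall>i<r. regs s' i = regs s i) \<and> regs s' r = val I (Num k) \<rho> st"
      using reaches_one[of s P "Const r k" W] by (intro exI[of _ "exec W (Const r k) s"]) auto
  qed
next
  case (Var x)
  show ?case unfolding evaluates_def
  proof (intro allI impI)
    fix p r and s :: config and \<rho> st
    assume "code_at P p (expr_code (Var x) p r)" "pc s = p" "sim \<rho> st s" "expr_vars (Var x) \<subseteq> {..<V}"
    then show "\<exists>s'. reaches W P (expr_cost I (Var x) \<rho> st) s s' \<and>
      pc s' = p + length (expr_code (Var x) p r) \<and> mem s' = mem s \<and>
      (\<forall>i<r. regs s' i = regs s i) \<and> regs s' r = val I (Var x) \<rho> st"
      using reaches_one[of s P "Op Or r (Suc x) (Suc x)" W]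
      by (intro exI[of _ "exec W (Op Or r (Suc x) (Suc x)) s"]) (auto simp: simulates_def)
  qed
next
  case (Input e)
  show ?case unfolding evaluates_def
  proof (intro allI impI)
    fix p r and s :: config and \<rho> st
    assume code: "code_at P p (expr_code (Input e) p r)" and pc: "pc s = p" and r: "V < r"
      and vars: "expr_vars (Input e) \<subseteq> {..<V}" and sim: "sim \<rho> st s"
      and fit: "fits I (2 ^ W) base (Input e) \<rho> st"
    define q where "q = p + length (expr_code e p r)"
    define v where "v = val I e \<rho> st"
    obtain s1 where s1: "reaches W P (expr_cost I e \<rho> st) s s1" "pc s1 = q" "mem s1 = mem s"
      "\<forall>i<r. regs s1 i = regs s i" "regs s1 r = v"
      using evaluatesE[OF Input.IH, of s r \<rho> st] code pc r vars sim fit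
      unfolding q_def v_def by (auto simp: Let_def)
    have code': "code_at P q [Jump_if_less r 0 (q + 3), Const r 0, Jump (q + 4), Load r r]"
      using code by (simp add: q_def Let_def)
    have base: "regs s1 0 = base" "mem s1 = memory_of I base st" using sim s1 r by (auto simp: simulates_def)
    define s' where "s' = (exec W (if regs s1 r < regs s1 0 then Load r r else Const r 0) s1)\<lparr>pc := pc s1 + 4\<rparr>"
    have "reaches W P 3 s1 s'" unfolding s'_def by (rule reaches_branch) (use code' s1 in auto)
    \<comment> \<open>The comparison with register 0 hides the work memory: beyond the input a
      machine cell may hold array data, but there the branch yields the 0 that \<open>I\<close>
      has.\<close>
    moreover have "v < base \<Longrightarrow> mem s1 v = I v" by (simp add: base memory_of_def)
    then have "regs s' r = I v" using s1 base(1) input_bound[of v] by (auto simp: s'_def)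
    moreover have "pc s' = q + 4" "mem s' = mem s" "\<forall>i<r. regs s' i = regs s1 i" using s1 by (auto simp: s'_def)
    ultimately show "\<exists>s'. reaches W P (expr_cost I (Input e) \<rho> st) s s' \<and>
      pc s' = p + length (expr_code (Input e) p r) \<and> mem s' = mem s \<and>
      (\<forall>i<r. regs s' i = regs s i) \<and> regs s' r = val I (Input e) \<rho> st"
      using s1 reaches_trans[OF s1(1)] by (intro exI[of _ s']) (auto simp: Let_def q_def v_def)
  qed
next
  case (Arr a e)
  show ?case unfolding evaluates_def
  proof (intro allI impI)
    fix p r and s :: config and \<rho> st
    assume code: "code_at P p (expr_code (Arr a e) p r)" and pc: "pc s = p" and r: "V < r"
      and vars: "expr_vars (Arr a e) \<subseteq> {..<V}" and sim: "sim \<rho> st s"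
      and fit: "fits I (2 ^ W) base (Arr a e) \<rho> st"
    define q where "q = p + length (expr_code e p r)"
    define v where "v = val I e \<rho> st"
    obtain s1 where s1: "reaches W P (expr_cost I e \<rho> st) s s1" "pc s1 = q" "mem s1 = mem s"
      "\<forall>i<r. regs s1 i = regs s i" "regs s1 r = v"
      using evaluatesE[OF Arr.IH, of s r \<rho> st] code pc r vars sim fit
      unfolding q_def v_def by auto
    have base: "regs s1 0 = base" "mem s1 = memory_of I base st" using sim s1 r by (auto simp: simulates_def)
    have len: "length (address_code a r (r + 1)) = 10" by (simp add: address_code_def)
    have code': "code_at P q (address_code a r (r + 1))" "code_at P (q + 10) [Load r (r + 1)]"
      using code len by (auto simp: q_def add_ac)
    obtain s2 where s2: "reaches W P 10 s1 s2" "pc s2 = q + 10" "mem s2 = mem s1"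
      "\<forall>j<r + 1. regs s2 j = regs s1 j" "regs s2 (r + 1) = base + prod_encode (a, v)"
      using address_code_correct[of P s1 a r "r + 1" W] code' s1 base fit r by (auto simp: v_def)
    have "reaches W P 1 s2 (exec W (Load r (r + 1)) s2)"
      using code' s2 by (intro reaches_one) auto
    then have "reaches W P (expr_cost I e \<rho> st + (10 + 1)) s (exec W (Load r (r + 1)) s2)"
      using s1(1) s2(1) reaches_trans by blast
    moreover have "mem s2 (base + prod_encode (a, v)) = st a v" using s2 base by simp
    ultimately show "\<exists>s'. reaches W P (expr_cost I (Arr a e) \<rho> st) s s' \<and>
      pc s' = p + length (expr_code (Arr a e) p r) \<and> mem s' = mem s \<and>
      (\<forall>i<r. regs s' i = regs s i) \<and> regs s' r = val I (Arr a e) \<rho> st"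
      using s1 s2 base len
      by (intro exI[of _ "exec W (Load r (r + 1)) s2"]) (auto simp: q_def v_def)
  qed
next
  case (Arith f e1 e2)
  show ?case unfolding evaluates_def
  proof (intro allI impI)
    fix p r and s :: config and \<rho> st
    assume code: "code_at P p (expr_code (Arith f e1 e2) p r)" and pc: "pc s = p" and r: "V < r"
      and vars: "expr_vars (Arith f e1 e2) \<subseteq> {..<V}" and sim: "sim \<rho> st s"
      and fit: "fits I (2 ^ W) base (Arith f e1 e2) \<rho> st"
    obtain s1 where s1: "reaches W P (expr_cost I e1 \<rho> st + expr_cost I e2 \<rho> st) s s1"
      "pc s1 = p + length (expr_code e1 p r) + length (expr_code e2 (p + length (expr_code e1 p r)) (r + 1))"
      "mem s1 = mem s" "\<forall>i<r. regs s1 i = regs s i" "regs s1 r = val I e1 \<rho> st" "regs s1 (r + 1) = val I e2 \<rho> st"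
      using evaluates_binary[OF Arith.IH, of s r \<rho> st] code pc r vars sim fit by (auto simp: Let_def)
    have "reaches W P 1 s1 (exec W (Op (opcode f) r r (r + 1)) s1)"
      using code s1 by (intro reaches_one) (auto simp: Let_def add_ac)
    from reaches_trans[OF s1(1) this]
    show "\<exists>s'. reaches W P (expr_cost I (Arith f e1 e2) \<rho> st) s s' \<and>
      pc s' = p + length (expr_code (Arith f e1 e2) p r) \<and> mem s' = mem s \<and>
      (\<forall>i<r. regs s' i = regs s i) \<and> regs s' r = val I (Arith f e1 e2) \<rho> st"
      using s1 fit arith_eval_binop[of f "val I e1 \<rho> st" "val I e2 \<rho> st" W]
      by (intro exI[of _ "exec W (Op (opcode f) r r (r + 1)) s1"]) (auto simp: Let_def)
  qed
next
  case (Monus e1 e2)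
  show ?case unfolding evaluates_def
  proof (intro allI impI)
    fix p r and s :: config and \<rho> st
    assume code: "code_at P p (expr_code (Monus e1 e2) p r)" and pc: "pc s = p" and r: "V < r"
      and vars: "expr_vars (Monus e1 e2) \<subseteq> {..<V}" and sim: "sim \<rho> st s"
      and fit: "fits I (2 ^ W) base (Monus e1 e2) \<rho> st"
    define q where "q = p + length (expr_code e1 p r) + length (expr_code e2 (p + length (expr_code e1 p r)) (r + 1))"
    obtain s1 where s1: "reaches W P (expr_cost I e1 \<rho> st + expr_cost I e2 \<rho> st) s s1"
      "pc s1 = q" "mem s1 = mem s" "\<forall>i<r. regs s1 i = regs s i" "regs s1 r = val I e1 \<rho> st"
      "regs s1 (r + 1) = val I e2 \<rho> st"
      using evaluates_binary[OF Monus.IH, of s r \<rho> st] code pc r vars sim fit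
      unfolding q_def by (auto simp: Let_def)
    have code': "code_at P q [Jump_if_less r (r + 1) (q + 3), Op Sub r r (r + 1), Jump (q + 4), Const r 0]"
      using code by (simp add: q_def Let_def add_ac)
    \<comment> \<open>\<open>Sub\<close> works modulo the word size. The preceding test makes the
      difference non-negative, and it is again a word.\<close>
    have sub: "(val I e1 \<rho> st + 2 ^ W - val I e2 \<rho> st) mod 2 ^ W = val I e1 \<rho> st - val I e2 \<rho> st" if "\<not> val I e1 \<rho> st < val I e2 \<rho> st"
    proof -
      have "val I e1 \<rho> st + 2 ^ W - val I e2 \<rho> st = (val I e1 \<rho> st - val I e2 \<rho> st) + 2 ^ W" using that by simp
      moreover have "val I e1 \<rho> st - val I e2 \<rho> st < 2 ^ W" using fit by (simp add: less_imp_diff_less)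
      ultimately show ?thesis by (metis mod_add_self2 mod_less)
    qed
    define s' where "s' = (exec W (if regs s1 r < regs s1 (r + 1) then Const r 0 else Op Sub r r (r + 1)) s1)\<lparr>pc := pc s1 + 4\<rparr>"
    have "reaches W P 3 s1 s'" unfolding s'_def by (rule reaches_branch) (use code' s1 in auto)
    moreover have "regs s' r = val I (Monus e1 e2) \<rho> st" using s1 sub by (cases "val I e1 \<rho> st < val I e2 \<rho> st") (auto simp: s'_def)
    moreover have "pc s' = q + 4" "mem s' = mem s" "\<forall>i<r. regs s' i = regs s1 i" using s1 by (auto simp: s'_def)
    ultimately show "\<exists>s'. reaches W P (expr_cost I (Monus e1 e2) \<rho> st) s s' \<and>
      pc s' = p + length (expr_code (Monus e1 e2) p r) \<and> mem s' = mem s \<and>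
      (\<forall>i<r. regs s' i = regs s i) \<and> regs s' r = val I (Monus e1 e2) \<rho> st"
      using s1 reaches_trans[OF s1(1), of 3 s'] by (intro exI[of _ s']) (auto simp: Let_def q_def)
  qed
next
  case (Less e1 e2)
  show ?case unfolding evaluates_def
  proof (intro allI impI)
    fix p r and s :: config and \<rho> st
    assume code: "code_at P p (expr_code (Less e1 e2) p r)" and pc: "pc s = p" and r: "V < r"
      and vars: "expr_vars (Less e1 e2) \<subseteq> {..<V}" and sim: "sim \<rho> st s"
      and fit: "fits I (2 ^ W) base (Less e1 e2) \<rho> st"
    define q where "q = p + length (expr_code e1 p r) + length (expr_code e2 (p + length (expr_code e1 p r)) (r + 1))"
    obtain s1 where s1: "reaches W P (expr_cost I e1 \<rho> st + expr_cost I e2 \<rho> st) s s1"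
      "pc s1 = q" "mem s1 = mem s" "\<forall>i<r. regs s1 i = regs s i" "regs s1 r = val I e1 \<rho> st"
      "regs s1 (r + 1) = val I e2 \<rho> st"
      using evaluates_binary[OF Less.IH, of s r \<rho> st] code pc r vars sim fit
      unfolding q_def by (auto simp: Let_def)
    have code': "code_at P q [Jump_if_less r (r + 1) (q + 3), Const r 0, Jump (q + 4), Const r 1]"
      using code by (simp add: q_def Let_def add_ac)
    define s' where "s' = (exec W (if regs s1 r < regs s1 (r + 1) then Const r 1 else Const r 0) s1)\<lparr>pc := pc s1 + 4\<rparr>"
    have "reaches W P 3 s1 s'" unfolding s'_def by (rule reaches_branch) (use code' s1 in auto)
    moreover have "regs s' r = val I (Less e1 e2) \<rho> st" using s1 by (auto simp: s'_def word_length_pos)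
    moreover have "pc s' = q + 4" "mem s' = mem s" "\<forall>i<r. regs s' i = regs s1 i" using s1 by (auto simp: s'_def)
    ultimately show "\<exists>s'. reaches W P (expr_cost I (Less e1 e2) \<rho> st) s s' \<and>
      pc s' = p + length (expr_code (Less e1 e2) p r) \<and> mem s' = mem s \<and>
      (\<forall>i<r. regs s' i = regs s i) \<and> regs s' r = val I (Less e1 e2) \<rho> st"
      using s1 reaches_trans[OF s1(1), of 3 s'] by (intro exI[of _ s']) (auto simp: Let_def q_def)
  qed
next
  case (Sum x m e)
  then show ?case by (rule evaluates_Sum)
qed

end

section \<open>Simulation of commands\<close>

context ram_simulation
begin

definition executes :: "cmd \<Rightarrow> bool" where
  "executes c \<longleftrightarrow> (\<forall>p r s \<rho> st. code_at P p (cmd_code c p r) \<longrightarrow> pc s = p \<longrightarrow> V < r \<longrightarrow>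
     cmd_vars c \<subseteq> {..<V} \<longrightarrow> sim \<rho> st s \<longrightarrow> cmd_fits I (2 ^ W) base c \<rho> st \<longrightarrow>
     (\<exists>s'. reaches W P (cost I c \<rho> st) s s' \<and> pc s' = p + length (cmd_code c p r) \<and>
        sim \<rho> (run I c \<rho> st) s' \<and> (\<forall>i<r. regs s' i = regs s i)))"

lemma executesE:
  assumes "executes c" "code_at P (pc s) (cmd_code c (pc s) r)" "V < r" "cmd_vars c \<subseteq> {..<V}"
    "sim \<rho> st s" "cmd_fits I (2 ^ W) base c \<rho> st"
  obtains s' where "reaches W P (cost I c \<rho> st) s s'"
    "pc s' = pc s + length (cmd_code c (pc s) r)" "sim \<rho> (run I c \<rho> st) s'"
    "\<forall>i<r. regs s' i = regs s i"
  using assms unfolding executes_def by blast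

text \<open>The counter lives in the register of \<open>x\<close> itself, so the configuration at
  the loop head simulates the environment \<open>\<rho>(x := i)\<close>. The outer value waits in
  \<open>r + 1\<close>, safe because the body leaves all registers below \<open>r + 2\<close> as
  they were.\<close>

lemma executes_For:
  assumes "executes c"
  shows "executes (For x m c)"
  unfolding executes_def
proof (intro allI impI)
  fix p r and s :: config and \<rho> st
  let ?d = "expr_code m p r" and ?M = "2 ^ W :: nat"
  define h where "h = p + length ?d + 2"
  define b where "b = cmd_code c (h + 2) (r + 2)"
  define n where "n = val I m \<rho> st"
  define S where "S i = iter i (\<lambda>i. run I c (\<rho>(x := i))) st" for i
  define C where "C i = (\<Sum>j<i. cost I c (\<rho>(x := j)) (S j) + 5)" for i
  assume code: "code_at P p (cmd_code (For x m c) p r)" and pc: "pc s = p" and r: "V < r"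
    and vars: "cmd_vars (For x m c) \<subseteq> {..<V}" and sim: "sim \<rho> st s"
    and fit: "cmd_fits I ?M base (For x m c) \<rho> st"
  have len: "length (cmd_code (For x m c) p r) = length ?d + length b + 8"
    by (simp add: Let_def h_def b_def)
  have code_d: "code_at P p ?d"
    and code1: "code_at P (p + length ?d) [Op Or (r + 1) (Suc x) (Suc x), Const (Suc x) 0]"
    and code2: "code_at P h [Jump_if_less (Suc x) r (h + 2), Jump (h + length b + 5)]"
    and code_b: "code_at P (h + 2) b"
    and code3: "code_at P (h + 2 + length b) [Const (r + 2) 1, Op Add (Suc x) (Suc x) (r + 2)]"
    and code4: "code_at P (h + length b + 4) [Jump h]"
    and code5: "code_at P (h + length b + 5) [Op Or (Suc x) (r + 1) (r + 1)]"
    using code by (simp_all add: Let_def h_def b_def eval_nat_numeral add_ac)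
  have xV: "x < V" and vm: "expr_vars m \<subseteq> {..<V}" and vc: "cmd_vars c \<subseteq> {..<V}" using vars by auto
  have fm: "fits I ?M base m \<rho> st" and fc: "\<And>i. i < n \<Longrightarrow> cmd_fits I ?M base c (\<rho>(x := i)) (S i)"
    and nM: "n < ?M" using fit by (auto simp: n_def S_def)
  obtain s1 where s1: "reaches W P (expr_cost I m \<rho> st) s s1" "pc s1 = p + length ?d"
    "mem s1 = mem s" "\<forall>i<r. regs s1 i = regs s i" "regs s1 r = n"
    using evaluatesE[OF expr_code_correct[of m], of s r \<rho> st] code_d pc r vm sim fm
    unfolding n_def by metis
  let ?is1 = "[Op Or (r + 1) (Suc x) (Suc x), Const (Suc x) 0]"
  define s2 where "s2 = fold (exec W) ?is1 s1"
  have s2: "reaches W P 2 s1 s2"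
    using reaches_straight[of P s1 ?is1 W] code1 s1(2)
    by (simp add: s2_def numeral_2_eq_2 del: exec.simps)
  have inv: "\<exists>s'. reaches W P (C i) s2 s' \<and> pc s' = h \<and> sim (\<rho>(x := i)) (S i) s' \<and>
      (\<forall>j<r. j \<noteq> Suc x \<longrightarrow> regs s' j = regs s j) \<and> regs s' r = n \<and> regs s' (r + 1) = regs s (Suc x)"
    if "i \<le> n" for i
    using that
  proof (induction i)
    case 0
    show ?case
      by (rule exI[of _ s2])
        (use s1 r xV sim in \<open>auto simp: s2_def reaches_refl h_def S_def simulates_def\<close>)
  next
    case (Suc i)
    then obtain t where t: "reaches W P (C i) s2 t" "pc t = h" "sim (\<rho>(x := i)) (S i) t"
      "\<forall>j<r. j \<noteq> Suc x \<longrightarrow> regs t j = regs s j" "regs t r = n" "regs t (r + 1) = regs s (Suc x)"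
      by (meson Suc_leD)
    have i: "i < n" using Suc.prems by simp
    have tx: "regs t (Suc x) = i" using t(3) xV by (simp add: simulates_def)
    define t1 where "t1 = exec W (Jump_if_less (Suc x) r (h + 2)) t"
    have t1: "reaches W P 1 t t1" using code2 t(2) unfolding t1_def by (intro reaches_one) auto
    have t1': "pc t1 = h + 2" "mem t1 = mem t" "regs t1 = regs t" using t i tx by (auto simp: t1_def)
    have sim1: "sim (\<rho>(x := i)) (S i) t1" using t t1' by (auto simp: simulates_def)
    obtain t2 where t2: "reaches W P (cost I c (\<rho>(x := i)) (S i)) t1 t2" "pc t2 = h + 2 + length b"
      "sim (\<rho>(x := i)) (run I c (\<rho>(x := i)) (S i)) t2" "\<forall>j<r + 2. regs t2 j = regs t1 j"
      using executesE[OF assms, of t1 "r + 2" "\<rho>(x := i)" "S i"] code_b t1'(1) r vc sim1 fc[OF i]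
      unfolding b_def by (metis trans_less_add1)
    let ?is = "[Const (r + 2) 1, Op Add (Suc x) (Suc x) (r + 2)]"
    define t3 where "t3 = fold (exec W) ?is t2"
    have t3: "reaches W P 2 t2 t3"
      using reaches_straight[of P t2 ?is W] code3 t2(2)
      by (simp add: t3_def numeral_2_eq_2 del: exec.simps)
    define t4 where "t4 = exec W (Jump h) t3"
    have pc3: "pc t3 = h + length b + 4" using t2 by (simp add: t3_def)
    have t4: "reaches W P 1 t3 t4" using code4 pc3 unfolding t4_def by (intro reaches_one) auto
    have "reaches W P (C i + (1 + (cost I c (\<rho>(x := i)) (S i) + (2 + 1)))) s2 t4"
      using reaches_trans[OF t(1) reaches_trans[OF t1 reaches_trans[OF t2(1) reaches_trans[OF t3 t4]]]] .
    then have R: "reaches W P (C (Suc i)) s2 t4"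
      by (rule reaches_mono) (simp add: C_def)
    have reg2: "regs t2 (Suc x) = i" "regs t2 r = n" "regs t2 (r + 1) = regs s (Suc x)"
      "\<forall>j<r. j \<noteq> Suc x \<longrightarrow> regs t2 j = regs s j"
      using t2(4) t1'(3) t tx xV r by auto
    have "Suc i < ?M" using i nM by simp
    then have reg4: "regs t4 (Suc x) = Suc i" "regs t4 r = n" "regs t4 (r + 1) = regs s (Suc x)"
      "\<forall>j<r. j \<noteq> Suc x \<longrightarrow> regs t4 j = regs s j" "pc t4 = h" "mem t4 = mem t2"
      "\<forall>j<r. j \<noteq> Suc x \<longrightarrow> regs t4 j = regs t2 j"
      using reg2 xV r by (auto simp: t4_def t3_def word_length_pos)
    moreover have "sim (\<rho>(x := Suc i)) (S (Suc i)) t4"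
      using t2(3) reg4 r by (auto simp: simulates_def S_def)
    ultimately show ?case using R by blast
  qed
  obtain t where t: "reaches W P (C n) s2 t" "pc t = h" "sim (\<rho>(x := n)) (S n) t"
      "\<forall>j<r. j \<noteq> Suc x \<longrightarrow> regs t j = regs s j" "regs t r = n" "regs t (r + 1) = regs s (Suc x)"
    using inv[OF order_refl] by blast
  have tx: "regs t (Suc x) = n" using t(3) xV by (simp add: simulates_def)
  define t1 where "t1 = exec W (Jump_if_less (Suc x) r (h + 2)) t"
  have t1: "reaches W P 1 t t1" using code2 t(2) unfolding t1_def by (intro reaches_one) auto
  define t2 where "t2 = exec W (Jump (h + length b + 5)) t1"
  have t2: "reaches W P 1 t1 t2"
    using code2 t tx unfolding t2_def t1_def by (intro reaches_one) auto
  define t3 where "t3 = exec W (Op Or (Suc x) (r + 1) (r + 1)) t2"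
  have t3: "reaches W P 1 t2 t3"
    using code5 unfolding t3_def by (intro reaches_one) (auto simp: t2_def)
  have "reaches W P (expr_cost I m \<rho> st + (2 + (C n + (1 + (1 + 1))))) s t3"
    using reaches_trans[OF s1(1) reaches_trans[OF s2 reaches_trans[OF t(1) reaches_trans[OF t1 reaches_trans[OF t2 t3]]]]] .
  then have "reaches W P (cost I (For x m c) \<rho> st) s t3"
    by (rule reaches_mono) (simp add: n_def C_def S_def)
  moreover have "pc t3 = p + length (cmd_code (For x m c) p r)"
    using t len xV r by (auto simp: t3_def t2_def t1_def h_def)
  moreover have reg: "\<forall>i<r. regs t3 i = regs s i"
    using t xV r by (auto simp: t3_def t2_def t1_def)
  moreover have "mem t3 = mem t" using tx t by (simp add: t3_def t2_def t1_def)
  then have "sim \<rho> (run I (For x m c) \<rho> st) t3"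
    using t(3) sim reg r by (auto simp: simulates_def S_def n_def)
  ultimately show "\<exists>s'. reaches W P (cost I (For x m c) \<rho> st) s s' \<and>
      pc s' = p + length (cmd_code (For x m c) p r) \<and> sim \<rho> (run I (For x m c) \<rho> st) s' \<and>
      (\<forall>i<r. regs s' i = regs s i)" by blast
qed

lemma cmd_code_correct: "executes c"
proof (induction c)
  case (Write a i e)
  show ?case unfolding executes_def
  proof (intro allI impI)
    fix p r and s :: config and \<rho> st
    assume code: "code_at P p (cmd_code (Write a i e) p r)" and pc: "pc s = p" and r: "V < r"
      and vars: "cmd_vars (Write a i e) \<subseteq> {..<V}" and sim: "sim \<rho> st s"
      and fit: "cmd_fits I (2 ^ W) base (Write a i e) \<rho> st"
    define q where "q = p + length (expr_code i p r) + length (expr_code e (p + length (expr_code i p r)) (r + 1))"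
    have len: "length (address_code a r (r + 2)) = 10" by (simp add: address_code_def)
    obtain s1 where s1: "reaches W P (expr_cost I i \<rho> st + expr_cost I e \<rho> st) s s1"
      "pc s1 = q" "mem s1 = mem s" "\<forall>i<r. regs s1 i = regs s i" "regs s1 r = val I i \<rho> st"
      "regs s1 (r + 1) = val I e \<rho> st"
      using evaluates_binary[OF expr_code_correct[of i] expr_code_correct[of e], of s r \<rho> st]
        code pc r vars sim fit unfolding q_def by (auto simp: Let_def)
    have code': "code_at P q (address_code a r (r + 2))" "code_at P (q + 10) [Store (r + 2) (r + 1)]"
      using code len by (auto simp: q_def Let_def add_ac)
    have base: "regs s1 0 = base" "mem s1 = memory_of I base st" using sim s1 r by (auto simp: simulates_def)
    obtain s2 where s2: "reaches W P 10 s1 s2" "pc s2 = q + 10" "mem s2 = mem s1"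
      "\<forall>j<r + 2. regs s2 j = regs s1 j" "regs s2 (r + 2) = base + prod_encode (a, val I i \<rho> st)"
      using address_code_correct[of P s1 a r "r + 2" W] code' s1 base fit r by auto
    define s3 where "s3 = exec W (Store (r + 2) (r + 1)) s2"
    have "reaches W P 1 s2 s3" using code' s2 unfolding s3_def by (intro reaches_one) auto
    from reaches_trans[OF s1(1) reaches_trans[OF s2(1) this]]
    have "reaches W P (cost I (Write a i e) \<rho> st) s s3" by (rule reaches_mono) simp
    moreover have "pc s3 = p + length (cmd_code (Write a i e) p r)"
      using s2 len by (simp add: s3_def q_def Let_def)
    moreover have reg: "\<forall>i<r. regs s3 i = regs s i" using s2 s1 by (simp add: s3_def)
    moreover have "mem s3 = memory_of I base (run I (Write a i e) \<rho> st)"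
      using s1(6) s2 base memory_of_update[of I base st a "val I i \<rho> st" "val I e \<rho> st"]
      by (simp add: s3_def)
    then have "sim \<rho> (run I (Write a i e) \<rho> st) s3"
      using sim reg r by (simp add: simulates_def)
    ultimately show "\<exists>s'. reaches W P (cost I (Write a i e) \<rho> st) s s' \<and>
      pc s' = p + length (cmd_code (Write a i e) p r) \<and> sim \<rho> (run I (Write a i e) \<rho> st) s' \<and>
      (\<forall>i<r. regs s' i = regs s i)" by blast
  qed
next
  case (Seq c1 c2)
  show ?case unfolding executes_def
  proof (intro allI impI)
    fix p r and s :: config and \<rho> st
    assume code: "code_at P p (cmd_code (c1 ;; c2) p r)" and pc: "pc s = p" and r: "V < r"
      and vars: "cmd_vars (c1 ;; c2) \<subseteq> {..<V}" and sim: "sim \<rho> st s"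
      and fit: "cmd_fits I (2 ^ W) base (c1 ;; c2) \<rho> st"
    obtain s1 where s1: "reaches W P (cost I c1 \<rho> st) s s1" "pc s1 = p + length (cmd_code c1 p r)"
      "sim \<rho> (run I c1 \<rho> st) s1" "\<forall>i<r. regs s1 i = regs s i"
      using executesE[OF Seq.IH(1), of s r \<rho> st] code pc r vars sim fit by (auto simp: Let_def)
    obtain s2 where s2: "reaches W P (cost I c2 \<rho> (run I c1 \<rho> st)) s1 s2"
      "pc s2 = pc s1 + length (cmd_code c2 (pc s1) r)"
      "sim \<rho> (run I c2 \<rho> (run I c1 \<rho> st)) s2" "\<forall>i<r. regs s2 i = regs s1 i"
      using executesE[OF Seq.IH(2), of s1 r \<rho> "run I c1 \<rho> st"] code s1 r vars fit by (auto simp: Let_def)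
    show "\<exists>s'. reaches W P (cost I (c1 ;; c2) \<rho> st) s s' \<and>
      pc s' = p + length (cmd_code (c1 ;; c2) p r) \<and> sim \<rho> (run I (c1 ;; c2) \<rho> st) s' \<and>
      (\<forall>i<r. regs s' i = regs s i)"
      using s1 s2 reaches_trans[OF s1(1) s2(1)] by (intro exI[of _ s2]) (simp add: Let_def)
  qed
next
  case (If e c1 c2)
  show ?case unfolding executes_def
  proof (intro allI impI)
    fix p r and s :: config and \<rho> st
    assume code: "code_at P p (cmd_code (If e c1 c2) p r)" and pc: "pc s = p" and r: "V < r"
      and vars: "cmd_vars (If e c1 c2) \<subseteq> {..<V}" and sim: "sim \<rho> st s"
      and fit: "cmd_fits I (2 ^ W) base (If e c1 c2) \<rho> st"
    define q where "q = p + length (expr_code e p r)"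
    define d1 where "d1 = cmd_code c1 (q + 3) r"
    define d2 where "d2 = cmd_code c2 (q + length d1 + 4) r"
    define v where "v = val I e \<rho> st"
    have code1: "code_at P q [Const (r + 1) 0, Jump_if_less (r + 1) r (q + 3), Jump (q + length d1 + 4)]"
      and cd1: "code_at P (q + 3) d1" and cj: "code_at P (q + 3 + length d1) [Jump (q + length d1 + length d2 + 4)]"
      and cd2: "code_at P (q + length d1 + 4) d2"
      using code by (simp_all add: Let_def q_def d1_def d2_def eval_nat_numeral add_ac)
    have len: "p + length (cmd_code (If e c1 c2) p r) = q + length d1 + length d2 + 4"
      by (simp add: Let_def q_def d1_def d2_def)
    obtain s1 where s1: "reaches W P (expr_cost I e \<rho> st) s s1" "pc s1 = q" "mem s1 = mem s"
      "\<forall>i<r. regs s1 i = regs s i" "regs s1 r = v"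
      using evaluatesE[OF expr_code_correct[of e], of s r \<rho> st] code pc r vars sim fit
      unfolding q_def v_def by (auto simp: Let_def)
    define s2 where "s2 = exec W (Const (r + 1) 0) s1"
    define s3 where "s3 = exec W (Jump_if_less (r + 1) r (q + 3)) s2"
    have s2: "reaches W P 1 s1 s2" using code1 s1(2) unfolding s2_def by (intro reaches_one) auto
    have s3: "reaches W P 1 s2 s3"
      using code1 s1(2) unfolding s3_def by (intro reaches_one) (auto simp: s2_def)
    have reg3: "\<forall>i<r. regs s3 i = regs s i" "mem s3 = mem s" using s1 by (auto simp: s3_def s2_def)
    have pre: "reaches W P (expr_cost I e \<rho> st + (1 + 1)) s s3"
      using reaches_trans[OF s1(1) reaches_trans[OF s2 s3]] .
    show "\<exists>s'. reaches W P (cost I (If e c1 c2) \<rho> st) s s' \<and>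
      pc s' = p + length (cmd_code (If e c1 c2) p r) \<and> sim \<rho> (run I (If e c1 c2) \<rho> st) s' \<and>
      (\<forall>i<r. regs s' i = regs s i)"
    proof (cases "v \<noteq> 0")
      case True
      have pc3: "pc s3 = q + 3" using True s1 by (simp add: s3_def s2_def)
      have "sim \<rho> st s3" using simulates_cong[OF sim reg3(2,1) r] .
      then obtain s4 where s4: "reaches W P (cost I c1 \<rho> st) s3 s4" "pc s4 = q + 3 + length d1"
        "sim \<rho> (run I c1 \<rho> st) s4" "\<forall>i<r. regs s4 i = regs s3 i"
        using executesE[OF If.IH(1), of s3 r \<rho> st] cd1 pc3 r vars fit True
        unfolding d1_def v_def by auto
      define s5 where "s5 = exec W (Jump (q + length d1 + length d2 + 4)) s4"
      have "reaches W P 1 s4 s5" using cj s4(2) unfolding s5_def by (intro reaches_one) auto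
      from reaches_trans[OF pre reaches_trans[OF s4(1) this]]
      have "reaches W P (cost I (If e c1 c2) \<rho> st) s s5"
        using True by (auto simp: v_def intro: reaches_mono)
      moreover have "sim \<rho> (run I (If e c1 c2) \<rho> st) s5"
        using s4(3) True by (simp add: v_def s5_def simulates_def)
      ultimately show ?thesis using s4 reg3 len by (intro exI[of _ s5]) (auto simp: s5_def)
    next
      case False
      define s4 where "s4 = exec W (Jump (q + length d1 + 4)) s3"
      have pc3: "pc s3 = q + 2" using False s1 by (simp add: s3_def s2_def)
      have s4: "reaches W P 1 s3 s4"
        using code1 pc3 unfolding s4_def by (intro reaches_one) auto
      have reg4: "\<forall>i<r. regs s4 i = regs s i" "mem s4 = mem s" "pc s4 = q + length d1 + 4"
        using reg3 by (simp_all add: s4_def)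
      have "sim \<rho> st s4" using simulates_cong[OF sim reg4(2,1) r] .
      then obtain s5 where s5: "reaches W P (cost I c2 \<rho> st) s4 s5" "pc s5 = q + length d1 + 4 + length d2"
        "sim \<rho> (run I c2 \<rho> st) s5" "\<forall>i<r. regs s5 i = regs s4 i"
        using executesE[OF If.IH(2), of s4 r \<rho> st] cd2 reg4(3) r vars fit False
        unfolding d2_def v_def by auto
      from reaches_trans[OF pre reaches_trans[OF s4 s5(1)]]
      have "reaches W P (cost I (If e c1 c2) \<rho> st) s s5"
        using False by (auto simp: v_def intro: reaches_mono)
      then show ?thesis using s5 reg4 len False by (intro exI[of _ s5]) (auto simp: v_def)
    qed
  qed
next
  case (For x m c)
  then show ?case by (rule executes_For)
next
  case Skip
  show ?case unfolding executes_def using reaches_refl by fastforce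
qed

end

text \<open>
  The prologue sets register 0 to the length \<open>5 + n\<^sup>2 (T + 1)\<close> of the input, the epilogue copies the
  first two cells of array 0 to the output cells.
\<close>

definition prologue :: "instr list" where
  "prologue = [Const 1 1, Load 2 1, Op Add 2 2 1, Const 3 0, Load 4 3, Op Mul 4 4 4, Op Mul 4 4 2,
     Const 5 5, Op Add 0 4 5, Const 1 0, Const 2 0, Const 3 0, Const 4 0, Const 5 0]"

definition compile :: "nat \<Rightarrow> cmd \<Rightarrow> program" where
  "compile V c =
     (let d = cmd_code c 14 (V + 1); p = 14 + length d; e0 = expr_code (Arr 0 (Num 0)) p (V + 1);
          e1 = expr_code (Arr 0 (Num 1)) (p + length e0) (V + 2)
      in prologue @ d @ e0 @ e1 @
         [Const (V + 3) 0, Store (V + 3) (V + 1), Const (V + 3) 1, Store (V + 3) (V + 2)])"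

lemma compile_correct:
  fixes xs :: "nat list"
  defines "I \<equiv> \<lambda>j. if j < length xs then xs ! j else 0"
  assumes len: "length xs = 5 + xs ! 0 * xs ! 0 * (xs ! 1 + 1)"
    and W: "length xs + 9 < 2 ^ W"
    and vars: "cmd_vars c \<subseteq> {..<V}"
    and fit: "cmd_fits I (2 ^ W) (length xs) c (\<lambda>_. 0) (\<lambda>_ _. 0)"
    and out: "run I c (\<lambda>_. 0) (\<lambda>_ _. 0) 0 1 \<noteq> 0"
    and y: "y = real (run I c (\<lambda>_. 0) (\<lambda>_ _. 0) 0 0) / real (run I c (\<lambda>_. 0) (\<lambda>_ _. 0) 0 1)"
    and time: "cost I c (\<lambda>_. 0) (\<lambda>_ _. 0) + 42 \<le> \<tau>"
  shows "ram_computes_within W (compile V c) xs y \<tau>"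
proof -
  define P where "P = compile V c"
  define base where "base = length xs"
  define d where "d = cmd_code c 14 (V + 1)"
  define p where "p = 14 + length d"
  define e0 where "e0 = expr_code (Arr 0 (Num 0)) p (V + 1)"
  define e1 where "e1 = expr_code (Arr 0 (Num 1)) (p + length e0) (V + 2)"
  define fin where "fin = [Const (V + 3) 0, Store (V + 3) (V + 1), Const (V + 3) 1, Store (V + 3) (V + 2)]"
  let ?\<rho> = "\<lambda>_. 0 :: nat"
  define st where "st = run I c ?\<rho> (\<lambda>_ _. 0)"
  define M :: nat where "M = 2 ^ W"
  have lp: "length prologue = 14" by (simp add: prologue_def)
  have P: "P = prologue @ d @ e0 @ e1 @ fin"
    by (simp add: P_def compile_def Let_def d_def p_def e0_def e1_def fin_def)
  have "code_at P 0 (prologue @ d @ e0 @ e1 @ fin)" by (simp add: P code_at_def)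
  then have code: "code_at P 0 prologue" "code_at P 14 d" "code_at P p e0" "code_at P (p + length e0) e1"
    "code_at P (p + length e0 + length e1) fin"
    unfolding code_at_append by (simp_all add: lp p_def)
  interpret ram_simulation W P I base V
    by unfold_locales (use W in \<open>auto simp: I_def base_def\<close>)
  let ?s0 = "initial_config xs"
  define s1 where "s1 = fold (exec W) prologue ?s0"
  have "list_all straight prologue" by (simp add: prologue_def)
  moreover have "pc ?s0 = 0" by (simp add: initial_config_def)
  ultimately have s1: "reaches W P 14 ?s0 s1"
    using reaches_straight[of P ?s0 prologue W] code(1) lp unfolding s1_def by simp
  define n where "n = xs ! 0"
  define T where "T = xs ! 1"
  have b: "base = 5 + n * n * (T + 1)" using len by (simp add: base_def n_def T_def)
  have small: "base + 9 < M" using W by (simp add: base_def M_def)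
  have "1 < M" "5 < M" using small by auto
  have "xs \<noteq> []" "1 < length xs" using len by auto
  have mem0: "mem ?s0 0 = n" "mem ?s0 1 = T" "mem ?s0 (Suc 0) = T"
    using \<open>xs \<noteq> []\<close> \<open>1 < length xs\<close> by (auto simp: initial_config_def n_def T_def)
  have reg0: "regs ?s0 = ?\<rho>" "pc ?s0 = 0" by (auto simp: initial_config_def)
  have memI: "mem ?s0 = I" by (simp add: initial_config_def I_def)
  \<comment> \<open>Only the final product is known to be a word: for \<open>n = 0\<close> nothing
    bounds \<open>T + 1\<close>. Reducing the factors first does no harm.\<close>
  have "n * n * (T + 1) mod M = n * n * (T + 1)" using b small by simp
  then have pm: "(n * n mod M) * ((T + 1) mod M) mod M = n * n * (T + 1)"
    by (simp add: mod_mult_eq)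
  have b': "(n * n * (T + 1) + 5) mod M = base" using b small by (simp add: add.commute)
  have r1: "regs s1 0 = base"
    using mem0 reg0 pm b' \<open>1 < M\<close> \<open>5 < M\<close>
    by (simp add: s1_def prologue_def M_def[symmetric])
  have r1': "regs s1 (Suc x) = 0" for x
    by (simp add: s1_def prologue_def reg0 del: eval_binop.simps)
  have m1: "mem s1 = I" "pc s1 = 14"
    using memI reg0 by (simp_all add: s1_def prologue_def del: eval_binop.simps)
  have mI: "memory_of I base (\<lambda>_ _. 0) = I"
    by (auto simp: memory_of_def I_def base_def split: prod.split)
  have sim1: "sim ?\<rho> (\<lambda>_ _. 0) s1" by (simp add: simulates_def r1 r1' m1 mI)
  obtain s2 where s2: "reaches W P (cost I c ?\<rho> (\<lambda>_ _. 0)) s1 s2" "pc s2 = p" "sim ?\<rho> st s2"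
    by (rule executesE[OF cmd_code_correct[of c], of s1 "V + 1" ?\<rho> "\<lambda>_ _. 0"])
      (use code(2) vars sim1 fit in \<open>simp_all add: m1 d_def p_def st_def base_def\<close>)
  \<comment> \<open>The 9 is \<open>(0 + 1 + 2)\<^sup>2\<close>, the address bound for cell 1 of
    array 0.\<close>
  have "base + 9 < 2 ^ W" using small by (simp add: M_def)
  then have f: "fits I (2 ^ W) base (Arr 0 (Num 0)) ?\<rho> st" "fits I (2 ^ W) base (Arr 0 (Num 1)) ?\<rho> st"
    using word_gt1 by (auto simp: power2_eq_square)
  obtain s3 where s3: "reaches W P 12 s2 s3" "pc s3 = p + length e0" "mem s3 = mem s2"
    "\<forall>i<V + 1. regs s3 i = regs s2 i" "regs s3 (V + 1) = st 0 0"
    by (rule evaluatesE[OF expr_code_correct[of "Arr 0 (Num 0)"], of s2 "V + 1" ?\<rho> st])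
      (use code(3) s2 f(1) in \<open>simp_all add: e0_def del: expr_code.simps fits.simps\<close>)
  have sim3: "sim ?\<rho> st s3" by (rule simulates_cong[OF s2(3) s3(3,4)]) simp
  obtain s4 where s4: "reaches W P 12 s3 s4" "pc s4 = p + length e0 + length e1" "mem s4 = mem s3"
    "\<forall>i<V + 2. regs s4 i = regs s3 i" "regs s4 (V + 2) = st 0 1"
    by (rule evaluatesE[OF expr_code_correct[of "Arr 0 (Num 1)"], of s3 "V + 2" ?\<rho> st])
      (use code(4) s3 sim3 f(2) in \<open>simp_all add: e1_def del: expr_code.simps fits.simps\<close>)
  define s5 where "s5 = fold (exec W) fin s4"
  have s5: "reaches W P 4 s4 s5"
    using reaches_straight[of P s4 fin W] code(5) s4(2)
    by (simp add: s5_def fin_def eval_nat_numeral del: exec.simps)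
  have "regs s4 (V + 1) = st 0 0" using s4(4) s3(5) by simp
  then have out5: "mem s5 0 = st 0 0" "mem s5 1 = st 0 1"
    using s4(5) by (simp_all add: s5_def fin_def word_length_pos)
  have "pc s5 = length P" using s4(2) by (simp add: s5_def fin_def P lp p_def)
  then have halt: "halted P s5" by (simp add: halted_def)
  \<comment> \<open>Prologue, the two reads of the result and the final stores take 14 + 12 + 12 + 4
    = 42 steps.\<close>
  have "reaches W P (14 + (cost I c ?\<rho> (\<lambda>_ _. 0) + (12 + (12 + 4)))) ?s0 s5"
    using reaches_trans[OF s1 reaches_trans[OF s2(1) reaches_trans[OF s3(1) reaches_trans[OF s4(1) s5]]]] .
  then have "reaches W P \<tau> ?s0 s5" by (rule reaches_mono) (use time in simp)
  then obtain k where "k \<le> \<tau>" "(step W P ^^ k) ?s0 = s5"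
    unfolding reaches_def by blast
  then show ?thesis
    using halt out5 out y unfolding ram_computes_within_def P_def[symmetric] st_def[symmetric]
    by (intro exI[of _ k]) (auto simp: Let_def)
qed

section \<open>Polynomial bounds on values and running time\<close>

text \<open>
  If the contents of all arrays stay below a bound, so do polynomially all values, and loops whose
  ranges depend only on small arrays take time polynomial in the bound on those. Hence the only
  obligation left for a program is to bound the values it writes.
\<close>

primrec writes_ok :: "(nat \<Rightarrow> nat) \<Rightarrow> (nat \<Rightarrow> nat) \<Rightarrow> cmd \<Rightarrow> env \<Rightarrow> store \<Rightarrow> bool" where
  "writes_ok I bd (Write a i e) \<rho> st \<longleftrightarrow> val I e \<rho> st \<le> bd a"
| "writes_ok I bd (c1 ;; c2) \<rho> st \<longleftrightarrow> writes_ok I bd c1 \<rho> st \<and> writes_ok I bd c2 \<rho> (run I c1 \<rho> st)"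
| "writes_ok I bd (If e c1 c2) \<rho> st \<longleftrightarrow>
     (if val I e \<rho> st \<noteq> 0 then writes_ok I bd c1 \<rho> st else writes_ok I bd c2 \<rho> st)"
| "writes_ok I bd (For x m c) \<rho> st \<longleftrightarrow>
     (\<forall>i<val I m \<rho> st. writes_ok I bd c (\<rho>(x := i)) (iter i (\<lambda>i. run I c (\<rho>(x := i))) st))"
| "writes_ok I bd Skip \<rho> st \<longleftrightarrow> True"

text \<open>The inputs count as small only if all arrays are small, \<open>A = UNIV\<close>.\<close>

primrec expr_over :: "nat set \<Rightarrow> expr \<Rightarrow> bool" where
  "expr_over A (Num k) \<longleftrightarrow> True"
| "expr_over A (Var x) \<longleftrightarrow> True"
| "expr_over A (Input e) \<longleftrightarrow> A = UNIV"
| "expr_over A (Arr a e) \<longleftrightarrow> a \<in> A \<and> expr_over A e"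
| "expr_over A (Arith f e1 e2) \<longleftrightarrow> expr_over A e1 \<and> expr_over A e2"
| "expr_over A (Monus e1 e2) \<longleftrightarrow> expr_over A e1 \<and> expr_over A e2"
| "expr_over A (Less e1 e2) \<longleftrightarrow> expr_over A e1 \<and> expr_over A e2"
| "expr_over A (Sum x m e) \<longleftrightarrow> expr_over A m \<and> expr_over A e"

text \<open>While \<open>expr_over\<close> restricts every array that enters a value, only the
  ranges of sums are restricted here: the cost depends on the numbers of iterations alone, so
  summands and indices may be arbitrarily large.\<close>

primrec ranges_over :: "nat set \<Rightarrow> expr \<Rightarrow> bool" where
  "ranges_over A (Num k) \<longleftrightarrow> True"
| "ranges_over A (Var x) \<longleftrightarrow> True"
| "ranges_over A (Input e) \<longleftrightarrow> ranges_over A e"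
| "ranges_over A (Arr a e) \<longleftrightarrow> ranges_over A e"
| "ranges_over A (Arith f e1 e2) \<longleftrightarrow> ranges_over A e1 \<and> ranges_over A e2"
| "ranges_over A (Monus e1 e2) \<longleftrightarrow> ranges_over A e1 \<and> ranges_over A e2"
| "ranges_over A (Less e1 e2) \<longleftrightarrow> ranges_over A e1 \<and> ranges_over A e2"
| "ranges_over A (Sum x m e) \<longleftrightarrow> expr_over A m \<and> ranges_over A m \<and> ranges_over A e"

primrec cmd_ranges_over :: "nat set \<Rightarrow> cmd \<Rightarrow> bool" where
  "cmd_ranges_over A (Write a i e) \<longleftrightarrow> ranges_over A i \<and> ranges_over A e"
| "cmd_ranges_over A (c1 ;; c2) \<longleftrightarrow> cmd_ranges_over A c1 \<and> cmd_ranges_over A c2"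
| "cmd_ranges_over A (If e c1 c2) \<longleftrightarrow> ranges_over A e \<and> cmd_ranges_over A c1 \<and> cmd_ranges_over A c2"
| "cmd_ranges_over A (For x m c) \<longleftrightarrow> expr_over A m \<and> ranges_over A m \<and> cmd_ranges_over A c"
| "cmd_ranges_over A Skip \<longleftrightarrow> True"

section \<open>Polynomial bounds for expressions\<close>

lemma le_power_self: "2 \<le> B \<Longrightarrow> k \<le> (B :: nat) ^ k"
  by (metis less_exp less_imp_le_nat order_trans power_mono zero_le)

lemma power_add_le:
  fixes B :: nat
  assumes "2 \<le> B" "x \<le> B ^ a" "y \<le> B ^ b"
  shows "x + y \<le> B ^ (a + b + 1)"
proof -
  have "x \<le> B ^ (a + b)" "y \<le> B ^ (a + b)"
    using assms by (meson le_add1 le_add2 le_trans numeral_le_one_iff one_le_numeral power_increasing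
        semiring_norm(69))+
  then have "x + y \<le> 2 * B ^ (a + b)" by simp
  also have "\<dots> \<le> B * B ^ (a + b)" using assms(1) by simp
  finally show ?thesis by simp
qed

lemma power_mult_le:
  fixes B :: nat
  assumes "x \<le> B ^ a" "y \<le> B ^ b"
  shows "x * y \<le> B ^ (a + b)"
  using mult_le_mono[OF assms] by (simp add: power_add)

lemma arith_poly:
  fixes B :: nat
  assumes "2 \<le> B" "u \<le> B ^ a" "v \<le> B ^ b"
  shows "arith f u v \<le> B ^ (a + b + 1)"
proof -
  have s: "u + v \<le> B ^ (a + b + 1)" using power_add_le[OF assms] .
  have "B ^ (a + b) \<le> B ^ (a + b + 1)" using assms(1) by (intro power_increasing) auto
  then have "u * v \<le> B ^ (a + b + 1)" using power_mult_le[OF assms(2,3)] by linarith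
  moreover have "u div v \<le> u" "u mod v \<le> u" by simp_all
  then have "u div v \<le> B ^ (a + b + 1)" "u mod v \<le> B ^ (a + b + 1)" using s by linarith+
  ultimately show ?thesis using s by (cases f) simp_all
qed

lemma const_add_le:
  fixes B :: nat
  assumes "2 \<le> B" "x \<le> B ^ a"
  shows "x + k \<le> B ^ (a + k + 1)"
  using power_add_le[OF assms le_power_self[OF assms(1), of k]] .

lemma power_le_power_left: "2 \<le> (B :: nat) \<Longrightarrow> B \<le> B ^ Suc d"
  by simp

lemma sum_le_power:
  fixes B :: nat
  assumes "n \<le> B ^ a" "\<And>i. i < n \<Longrightarrow> f i \<le> B ^ b"
  shows "(\<Sum>i<n. f i) \<le> B ^ (a + b)"
proof -
  have "(\<Sum>i<n. f i) \<le> of_nat (card {..<n}) * B ^ b" using assms(2) by (intro sum_bounded_above) auto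
  then show ?thesis using power_mult_le[OF assms(1) order_refl, of b] by simp
qed

definition below :: "nat \<Rightarrow> (nat \<Rightarrow> nat) \<Rightarrow> nat set \<Rightarrow> env \<Rightarrow> store \<Rightarrow> bool" where
  "below B I A \<rho> st \<longleftrightarrow> (\<forall>x. \<rho> x \<le> B) \<and> (\<forall>a\<in>A. \<forall>i. st a i \<le> B) \<and> (A = UNIV \<longrightarrow> (\<forall>j. I j \<le> B))"

text \<open>A loop index may exceed \<open>B\<close>, so the body is analysed under the larger bound
  \<open>B ^ Suc d\<close>. Degrees then multiply along nested loops, which stays polynomial because
  the program is fixed.\<close>

lemma below_update:
  assumes "below B I A \<rho> st" "2 \<le> B" "i < B ^ d"
  shows "below (B ^ Suc d) I A (\<rho>(x := i)) st"
proof -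
  have "B \<le> B ^ Suc d" "B ^ d \<le> B ^ Suc d" using assms(2) by auto
  then have "y \<le> B \<Longrightarrow> y \<le> B ^ Suc d" "i \<le> B ^ Suc d" for y using assms(3) by linarith+
  then show ?thesis using assms(1) unfolding below_def by (simp del: power_Suc)
qed

text \<open>The exponent is chosen before \<open>B\<close>: only so can the induction hypothesis for
  the body of a sum be applied with a power of \<open>B\<close> in place of
  \<open>B\<close>.\<close>

lemma val_poly_over:
  assumes "expr_over A e"
  shows "\<exists>d. \<forall>B I \<rho> st. 2 \<le> B \<longrightarrow> below B I A \<rho> st \<longrightarrow> val I e \<rho> st \<le> B ^ d"
  using assms
proof (induction e)
  case (Num k)
  show ?case by (rule exI[of _ k]) (simp add: le_power_self)
next
  case (Var x)
  show ?case by (rule exI[of _ 1]) (simp add: below_def)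
next
  case (Input e)
  then show ?case by (intro exI[of _ 1]) (simp add: below_def)
next
  case (Arr a e)
  then show ?case by (intro exI[of _ 1]) (simp add: below_def)
next
  case (Arith f e1 e2)
  then obtain d1 d2 where d: "\<And>B I \<rho> st. 2 \<le> B \<Longrightarrow> below B I A \<rho> st \<Longrightarrow> val I e1 \<rho> st \<le> B ^ d1"
    "\<And>B I \<rho> st. 2 \<le> B \<Longrightarrow> below B I A \<rho> st \<Longrightarrow> val I e2 \<rho> st \<le> B ^ d2" by auto metis
  show ?case
    by (intro exI[of _ "d1 + d2 + 1"] allI impI; unfold val.simps; intro arith_poly d; assumption)
next
  case (Monus e1 e2)
  then show ?case by simp (meson diff_le_self order_trans)
next
  case (Less e1 e2)
  show ?case by (rule exI[of _ 1]) simp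
next
  case (Sum x m e)
  then obtain d1 d2 where d: "\<And>B I \<rho> st. 2 \<le> B \<Longrightarrow> below B I A \<rho> st \<Longrightarrow> val I m \<rho> st \<le> B ^ d1"
    "\<And>B I \<rho> st. 2 \<le> B \<Longrightarrow> below B I A \<rho> st \<Longrightarrow> val I e \<rho> st \<le> B ^ d2" by auto metis
  have "val I (Sum x m e) \<rho> st \<le> B ^ (d1 + Suc d1 * d2)" if B: "2 \<le> B" "below B I A \<rho> st" for B I \<rho> st
  proof -
    have m: "val I m \<rho> st \<le> B ^ d1" using d(1)[OF B] .
    have "val I e (\<rho>(x := i)) st \<le> B ^ (Suc d1 * d2)" if "i < val I m \<rho> st" for i
    proof -
      have "2 \<le> B ^ Suc d1" using B(1) power_le_power_left order_trans by blast
      then show ?thesis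
        using d(2)[of "B ^ Suc d1" I "\<rho>(x := i)" st] below_update[OF B(2,1), of i d1 x] that m
        by (simp only: power_mult)
    qed
    then show ?thesis using sum_le_power[OF m] by simp
  qed
  then show ?case by blast
qed

abbreviation all_below :: "nat \<Rightarrow> (nat \<Rightarrow> nat) \<Rightarrow> env \<Rightarrow> store \<Rightarrow> bool" where
  "all_below B I \<equiv> below B I UNIV"

lemma val_poly: "\<exists>d. \<forall>B I \<rho> st. 2 \<le> B \<longrightarrow> all_below B I \<rho> st \<longrightarrow> val I e \<rho> st \<le> B ^ d"
proof (rule val_poly_over)
  show "expr_over UNIV e" by (induction e) auto
qed

lemma less_power_mono:
  fixes B M :: nat
  assumes "B ^ d < M" "c \<le> d" "2 \<le> B"
  shows "B ^ c < M"
  using assms power_increasing[of c d B] by linarith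

lemma address_poly:
  "2 \<le> B \<Longrightarrow> v \<le> B ^ d \<Longrightarrow> base \<le> B \<Longrightarrow> base + (a + v + 2)\<^sup>2 \<le> (B :: nat) ^ (2 * (d + a + 3) + 2)"
proof -
  assume B: "2 \<le> B" "v \<le> B ^ d" "base \<le> B"
  have "v + (a + 2) \<le> B ^ (d + (a + 2) + 1)" by (rule const_add_le[OF B(1,2)])
  moreover have "d + (a + 2) + 1 = d + a + 3" by simp
  ultimately have "a + v + 2 \<le> B ^ (d + a + 3)" by (simp only: add_ac)
  then have "(a + v + 2)\<^sup>2 \<le> (B ^ (d + a + 3))\<^sup>2" by (intro power_mono) simp_all
  then have "(a + v + 2)\<^sup>2 \<le> B ^ (2 * (d + a + 3))" by (simp only: power_mult mult.commute[of 2])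
  moreover have "base \<le> B ^ 1" using B by simp
  ultimately have "(a + v + 2)\<^sup>2 + base \<le> B ^ (2 * (d + a + 3) + 1 + 1)" by (rule power_add_le[OF B(1)])
  moreover have "2 * (d + a + 3) + 1 + 1 = 2 * (d + a + 3) + 2" by simp
  ultimately show ?thesis by (simp only: add_ac)
qed

text \<open>All arrays and all inputs are bounded here, since a word must accommodate every value
  and not only those that drive loops.\<close>

lemma fits_poly:
  "\<exists>d. \<forall>B I M base \<rho> st. 2 \<le> B \<longrightarrow> all_below B I \<rho> st \<longrightarrow> base \<le> B \<longrightarrow> B ^ d < M \<longrightarrow> fits I M base e \<rho> st"
proof (induction e)
  case (Num k)
  have "k < M" if "2 \<le> B" "B ^ k < M" for B M using le_power_self[OF that(1), of k] that by linarith
  then show ?case by auto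
next
  case (Arr a e)
  then obtain d1 where d1: "\<And>B I M base \<rho> st. 2 \<le> B \<Longrightarrow> all_below B I \<rho> st \<Longrightarrow> base \<le> B \<Longrightarrow>
    B ^ d1 < M \<Longrightarrow> fits I M base e \<rho> st" by metis
  obtain d where d: "\<And>B I \<rho> st. 2 \<le> B \<Longrightarrow> all_below B I \<rho> st \<Longrightarrow> val I e \<rho> st \<le> B ^ d"
    using val_poly[of e] by metis
  have "fits I M base (Arr a e) \<rho> st"
    if B: "2 \<le> B" "all_below B I \<rho> st" "base \<le> B" "B ^ (d1 + (2 * (d + a + 3) + 2)) < M" for B I M base \<rho> st
    using d1[OF B(1-3), of M] address_poly[OF B(1) d[OF B(1,2)] B(3), of a]
      less_power_mono[OF B(4) _ B(1)] by (auto intro: le_less_trans)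
  then show ?case by blast
next
  case (Arith f e1 e2)
  then obtain d1 d2 where d: "\<And>B I M base \<rho> st. 2 \<le> B \<Longrightarrow> all_below B I \<rho> st \<Longrightarrow> base \<le> B \<Longrightarrow>
    B ^ d1 < M \<Longrightarrow> fits I M base e1 \<rho> st" "\<And>B I M base \<rho> st. 2 \<le> B \<Longrightarrow> all_below B I \<rho> st \<Longrightarrow> base \<le> B \<Longrightarrow>
    B ^ d2 < M \<Longrightarrow> fits I M base e2 \<rho> st" by metis
  obtain d3 where d3: "\<And>B I \<rho> st. 2 \<le> B \<Longrightarrow> all_below B I \<rho> st \<Longrightarrow> val I (Arith f e1 e2) \<rho> st \<le> B ^ d3"
    using val_poly[of "Arith f e1 e2"] by metis
  have "fits I M base (Arith f e1 e2) \<rho> st"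
    if B: "2 \<le> B" "all_below B I \<rho> st" "base \<le> B" "B ^ (d1 + d2 + d3) < M" for B I M base \<rho> st
    using d(1)[OF B(1-3), of M] d(2)[OF B(1-3), of M] d3[OF B(1,2)]
      less_power_mono[OF B(4) _ B(1)] by (auto intro: le_less_trans)
  then show ?case by blast
next
  case (Monus e1 e2)
  then obtain d1 d2 where d: "\<And>B I M base \<rho> st. 2 \<le> B \<Longrightarrow> all_below B I \<rho> st \<Longrightarrow> base \<le> B \<Longrightarrow>
    B ^ d1 < M \<Longrightarrow> fits I M base e1 \<rho> st" "\<And>B I M base \<rho> st. 2 \<le> B \<Longrightarrow> all_below B I \<rho> st \<Longrightarrow> base \<le> B \<Longrightarrow>
    B ^ d2 < M \<Longrightarrow> fits I M base e2 \<rho> st" by metis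
  obtain d3 where d3: "\<And>B I \<rho> st. 2 \<le> B \<Longrightarrow> all_below B I \<rho> st \<Longrightarrow> val I e1 \<rho> st \<le> B ^ d3"
    using val_poly[of "e1"] by metis
  have "fits I M base (Monus e1 e2) \<rho> st"
    if B: "2 \<le> B" "all_below B I \<rho> st" "base \<le> B" "B ^ (d1 + d2 + d3) < M" for B I M base \<rho> st
    using d(1)[OF B(1-3), of M] d(2)[OF B(1-3), of M] d3[OF B(1,2)]
      less_power_mono[OF B(4) _ B(1)] by (auto intro: le_less_trans)
  then show ?case by blast
next
  case (Less e1 e2)
  then obtain d1 d2 where d: "\<And>B I M base \<rho> st. 2 \<le> B \<Longrightarrow> all_below B I \<rho> st \<Longrightarrow> base \<le> B \<Longrightarrow>
    B ^ d1 < M \<Longrightarrow> fits I M base e1 \<rho> st" "\<And>B I M base \<rho> st. 2 \<le> B \<Longrightarrow> all_below B I \<rho> st \<Longrightarrow> base \<le> B \<Longrightarrow>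
    B ^ d2 < M \<Longrightarrow> fits I M base e2 \<rho> st" by metis
  have "fits I M base (Less e1 e2) \<rho> st"
    if B: "2 \<le> B" "all_below B I \<rho> st" "base \<le> B" "B ^ (d1 + d2) < M" for B I M base \<rho> st
    using d(1)[OF B(1-3), of M] d(2)[OF B(1-3), of M]
      less_power_mono[OF B(4) _ B(1)] by auto
  then show ?case by blast
next
  case (Sum x m e)
  then obtain d1 d2 where d: "\<And>B I M base \<rho> st. 2 \<le> B \<Longrightarrow> all_below B I \<rho> st \<Longrightarrow> base \<le> B \<Longrightarrow>
    B ^ d1 < M \<Longrightarrow> fits I M base m \<rho> st" "\<And>B I M base \<rho> st. 2 \<le> B \<Longrightarrow> all_below B I \<rho> st \<Longrightarrow> base \<le> B \<Longrightarrow>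
    B ^ d2 < M \<Longrightarrow> fits I M base e \<rho> st" by metis
  obtain d3 where d3: "\<And>B I \<rho> st. 2 \<le> B \<Longrightarrow> all_below B I \<rho> st \<Longrightarrow> val I (Sum x m e) \<rho> st \<le> B ^ d3"
    using val_poly[of "Sum x m e"] by metis
  obtain d4 where d4: "\<And>B I \<rho> st. 2 \<le> B \<Longrightarrow> all_below B I \<rho> st \<Longrightarrow> val I m \<rho> st \<le> B ^ d4"
    using val_poly[of m] by metis
  have "fits I M base (Sum x m e) \<rho> st"
    if B: "2 \<le> B" "all_below B I \<rho> st" "base \<le> B" "B ^ (d1 + Suc d4 * d2 + d3 + d4) < M" for B I M base \<rho> st
  proof -
    have le: "B ^ d1 < M" "B ^ (Suc d4 * d2) < M" "B ^ d3 < M" "B ^ d4 < M"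
      using less_power_mono[OF B(4) _ B(1)] by auto
    have m: "val I m \<rho> st \<le> B ^ d4" using d4[OF B(1,2)] .
    have B': "2 \<le> B ^ Suc d4" "base \<le> B ^ Suc d4" "(B ^ Suc d4) ^ d2 < M"
      using power_le_power_left[OF B(1), of d4] B le(2) unfolding power_mult by linarith+
    have "fits I M base e (\<rho>(x := i)) st" if "i < val I m \<rho> st" for i
      using d(2)[of "B ^ Suc d4" I "\<rho>(x := i)" st base M] B' below_update[OF B(2,1), of i d4 x] m that
      by simp
    then show ?thesis
      using d(1)[OF B(1-3) le(1)] d3[OF B(1,2)] m le by (auto intro: le_less_trans)
  qed
  then show ?case by blast
qed auto

lemma expr_cost_poly:
  assumes "ranges_over A e"
  shows "\<exists>d. \<forall>B I \<rho> st. 2 \<le> B \<longrightarrow> below B I A \<rho> st \<longrightarrow> expr_cost I e \<rho> st \<le> B ^ d"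
  using assms
proof (induction e)
  case (Num k)
  show ?case by (rule exI[of _ 1]) simp
next
  case (Var x)
  show ?case by (rule exI[of _ 1]) simp
next
  case (Input e)
  then obtain d where d: "\<And>B I \<rho> st. 2 \<le> B \<Longrightarrow> below B I A \<rho> st \<Longrightarrow> expr_cost I e \<rho> st \<le> B ^ d"
    by auto metis
  show ?case
    by (intro exI[of _ "d + 3 + 1"] allI impI; unfold expr_cost.simps; intro const_add_le d; assumption)
next
  case (Arr a e)
  then obtain d where d: "\<And>B I \<rho> st. 2 \<le> B \<Longrightarrow> below B I A \<rho> st \<Longrightarrow> expr_cost I e \<rho> st \<le> B ^ d"
    by auto metis
  show ?case
    by (intro exI[of _ "d + 11 + 1"] allI impI; unfold expr_cost.simps; intro const_add_le d; assumption)
next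
  case (Arith f e1 e2)
  then obtain d1 d2 where d: "\<And>B I \<rho> st. 2 \<le> B \<Longrightarrow> below B I A \<rho> st \<Longrightarrow> expr_cost I e1 \<rho> st \<le> B ^ d1"
    "\<And>B I \<rho> st. 2 \<le> B \<Longrightarrow> below B I A \<rho> st \<Longrightarrow> expr_cost I e2 \<rho> st \<le> B ^ d2" by auto metis
  show ?case
    by (intro exI[of _ "(d1 + d2 + 1) + 1 + 1"] allI impI; unfold expr_cost.simps;
        intro const_add_le power_add_le d; assumption)
next
  case (Monus e1 e2)
  then obtain d1 d2 where d: "\<And>B I \<rho> st. 2 \<le> B \<Longrightarrow> below B I A \<rho> st \<Longrightarrow> expr_cost I e1 \<rho> st \<le> B ^ d1"
    "\<And>B I \<rho> st. 2 \<le> B \<Longrightarrow> below B I A \<rho> st \<Longrightarrow> expr_cost I e2 \<rho> st \<le> B ^ d2" by auto metis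
  show ?case
    by (intro exI[of _ "(d1 + d2 + 1) + 3 + 1"] allI impI; unfold expr_cost.simps;
        intro const_add_le power_add_le d; assumption)
next
  case (Less e1 e2)
  then obtain d1 d2 where d: "\<And>B I \<rho> st. 2 \<le> B \<Longrightarrow> below B I A \<rho> st \<Longrightarrow> expr_cost I e1 \<rho> st \<le> B ^ d1"
    "\<And>B I \<rho> st. 2 \<le> B \<Longrightarrow> below B I A \<rho> st \<Longrightarrow> expr_cost I e2 \<rho> st \<le> B ^ d2" by auto metis
  show ?case
    by (intro exI[of _ "(d1 + d2 + 1) + 3 + 1"] allI impI; unfold expr_cost.simps;
        intro const_add_le power_add_le d; assumption)
next
  case (Sum x m e)
  then obtain d1 d2 where d: "\<And>B I \<rho> st. 2 \<le> B \<Longrightarrow> below B I A \<rho> st \<Longrightarrow> expr_cost I m \<rho> st \<le> B ^ d1"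
    "\<And>B I \<rho> st. 2 \<le> B \<Longrightarrow> below B I A \<rho> st \<Longrightarrow> expr_cost I e \<rho> st \<le> B ^ d2" by auto metis
  obtain d3 where d3: "\<And>B I \<rho> st. 2 \<le> B \<Longrightarrow> below B I A \<rho> st \<Longrightarrow> val I m \<rho> st \<le> B ^ d3"
    using val_poly_over[of A m] Sum.prems by auto metis
  have "expr_cost I (Sum x m e) \<rho> st \<le> B ^ ((d1 + 7 + 1) + (d3 + Suc d3 * (d2 + 5 + 1)) + 1)"
    if B: "2 \<le> B" "below B I A \<rho> st" for B I \<rho> st
  proof -
    have m: "val I m \<rho> st \<le> B ^ d3" using d3[OF B] .
    have B': "2 \<le> B ^ Suc d3" using power_le_power_left[OF B(1), of d3] B(1) by linarith
    have "expr_cost I e (\<rho>(x := i)) st + 5 \<le> B ^ (Suc d3 * (d2 + 5 + 1))" if "i < val I m \<rho> st" for i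
      unfolding power_mult
      by (intro const_add_le[OF B'] d(2)[OF B'] below_update[OF B(2,1)] less_le_trans[OF that m])
    then have "(\<Sum>i<val I m \<rho> st. expr_cost I e (\<rho>(x := i)) st + 5) \<le> B ^ (d3 + Suc d3 * (d2 + 5 + 1))"
      by (intro sum_le_power[OF m]) auto
    then show ?thesis
      unfolding expr_cost.simps by (intro power_add_le[OF B(1)] const_add_le[OF B(1)] d(1)[OF B])
  qed
  then show ?case by blast
qed

section \<open>Polynomial bounds for commands\<close>

lemma run_below:
  assumes "writes_ok I bd c \<rho> st" "\<And>a i. st a i \<le> bd a"
  shows "run I c \<rho> st a i \<le> bd a"
  using assms
proof (induction c arbitrary: \<rho> st a i)
  case (For x m c)
  have "iter k (\<lambda>i. run I c (\<rho>(x := i))) st a i \<le> bd a" if "k \<le> val I m \<rho> st" for k a i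
    using that
  proof (induction k arbitrary: a i)
    case 0
    then show ?case using For.prems(2) by simp
  next
    case (Suc k)
    have "writes_ok I bd c (\<rho>(x := k)) (iter k (\<lambda>i. run I c (\<rho>(x := i))) st)"
      using For.prems(1) Suc.prems by simp
    then have "run I c (\<rho>(x := k)) (iter k (\<lambda>i. run I c (\<rho>(x := i))) st) a i \<le> bd a"
      by (rule For.IH) (use Suc.IH Suc.prems Suc_leD in blast)
    then show ?case by (simp only: iter.simps)
  qed
  from this[OF order_refl] show ?case by (simp only: run.simps)
next
  case (Seq c1 c2)
  then show ?case by simp
qed (auto split: if_splits)

lemma iter_below:
  assumes "writes_ok I bd (For x m c) \<rho> st" "\<And>a i. st a i \<le> bd a" "k \<le> val I m \<rho> st"
  shows "iter k (\<lambda>i. run I c (\<rho>(x := i))) st a i \<le> bd a"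
proof -
  have "writes_ok I bd (For x (Num k) c) \<rho> st" using assms by simp
  from run_below[OF this assms(2)] show ?thesis by simp
qed

lemma cmd_fits_poly:
  "\<exists>d. \<forall>(B :: nat) I M base bd \<rho> st. 2 \<le> B \<longrightarrow> (\<forall>x. \<rho> x \<le> B) \<longrightarrow> (\<forall>j. I j \<le> B) \<longrightarrow> (\<forall>a. bd a \<le> B) \<longrightarrow>
     (\<forall>a i. st a i \<le> bd a) \<longrightarrow> writes_ok I bd c \<rho> st \<longrightarrow> base \<le> B \<longrightarrow> B ^ d < M \<longrightarrow> cmd_fits I M base c \<rho> st"
  (is "\<exists>d. ?Q d c")
proof (induction c)
  case (Write a i e)
  obtain d1 where d1: "\<And>B I M base \<rho> st. 2 \<le> B \<Longrightarrow> all_below B I \<rho> st \<Longrightarrow> base \<le> B \<Longrightarrow> B ^ d1 < M \<Longrightarrow> fits I M base i \<rho> st"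
    using fits_poly[of i] by metis
  obtain d2 where d2: "\<And>B I M base \<rho> st. 2 \<le> B \<Longrightarrow> all_below B I \<rho> st \<Longrightarrow> base \<le> B \<Longrightarrow> B ^ d2 < M \<Longrightarrow> fits I M base e \<rho> st"
    using fits_poly[of e] by metis
  obtain d where d: "\<And>B I \<rho> st. 2 \<le> B \<Longrightarrow> all_below B I \<rho> st \<Longrightarrow> val I i \<rho> st \<le> B ^ d"
    using val_poly[of i] by metis
  show ?case
  proof (rule exI[of _ "d1 + d2 + (2 * (d + a + 3) + 2)"], intro allI impI)
    fix B M base :: nat and I bd :: "nat \<Rightarrow> nat" and \<rho> :: env and st :: store
    assume B: "2 \<le> B" "base \<le> B" "B ^ (d1 + d2 + (2 * (d + a + 3) + 2)) < M"
      and "\<forall>x. \<rho> x \<le> B" "\<forall>j. I j \<le> B" "\<forall>a. bd a \<le> B" "\<forall>a i. st a i \<le> bd a"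
    then have ab: "all_below B I \<rho> st" unfolding below_def by (meson order_trans)
    have "base + (a + val I i \<rho> st + 2)\<^sup>2 < M"
      using address_poly[OF B(1) d[OF B(1) ab] B(2), of a] less_power_mono[OF B(3) _ B(1), of "2 * (d + a + 3) + 2"]
      by linarith
    then show "cmd_fits I M base (Write a i e) \<rho> st"
      using d1[OF B(1) ab B(2)] d2[OF B(1) ab B(2)] less_power_mono[OF B(3) _ B(1)] by simp
  qed
next
  case (Seq c1 c2)
  then obtain d1 d2 where d: "?Q d1 c1" "?Q d2 c2" by blast
  show ?case
  proof (rule exI[of _ "d1 + d2"], intro allI impI)
    fix B M base :: nat and I bd :: "nat \<Rightarrow> nat" and \<rho> :: env and st :: store
    assume B: "2 \<le> B" "base \<le> B" "B ^ (d1 + d2) < M" "\<forall>x. \<rho> x \<le> B" "\<forall>j. I j \<le> B" "\<forall>a. bd a \<le> B"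
      and s: "\<forall>a i. st a i \<le> bd a" "writes_ok I bd (c1 ;; c2) \<rho> st"
    have lt: "B ^ d1 < M" "B ^ d2 < M" using less_power_mono[OF B(3) _ B(1)] by auto
    have "\<forall>a i. run I c1 \<rho> st a i \<le> bd a" using run_below s by simp
    then show "cmd_fits I M base (c1 ;; c2) \<rho> st"
      using d[rule_format, of B \<rho> I bd] B s lt by simp
  qed
next
  case (If e c1 c2)
  then obtain d1 d2 where d: "?Q d1 c1" "?Q d2 c2" by blast
  obtain d3 where d3: "\<And>B I M base \<rho> st. 2 \<le> B \<Longrightarrow> all_below B I \<rho> st \<Longrightarrow> base \<le> B \<Longrightarrow> B ^ d3 < M \<Longrightarrow> fits I M base e \<rho> st"
    using fits_poly[of e] by metis
  show ?case
  proof (rule exI[of _ "d1 + d2 + d3"], intro allI impI)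
    fix B M base :: nat and I bd :: "nat \<Rightarrow> nat" and \<rho> :: env and st :: store
    assume B: "2 \<le> B" "base \<le> B" "B ^ (d1 + d2 + d3) < M" "\<forall>x. \<rho> x \<le> B" "\<forall>j. I j \<le> B" "\<forall>a. bd a \<le> B"
      and s: "\<forall>a i. st a i \<le> bd a" "writes_ok I bd (If e c1 c2) \<rho> st"
    have lt: "B ^ d1 < M" "B ^ d2 < M" "B ^ d3 < M" using less_power_mono[OF B(3) _ B(1)] by auto
    have ab: "all_below B I \<rho> st" using B s unfolding below_def by (meson order_trans)
    show "cmd_fits I M base (If e c1 c2) \<rho> st"
      using d[rule_format, of B \<rho> I bd st base M] B s lt d3[OF B(1) ab B(2) lt(3)] by auto
  qed
next
  case (For x m c)
  then obtain d1 where d: "?Q d1 c" by blast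
  obtain d2 where d2: "\<And>B I M base \<rho> st. 2 \<le> B \<Longrightarrow> all_below B I \<rho> st \<Longrightarrow> base \<le> B \<Longrightarrow> B ^ d2 < M \<Longrightarrow> fits I M base m \<rho> st"
    using fits_poly[of m] by metis
  obtain d3 where d3: "\<And>B I \<rho> st. 2 \<le> B \<Longrightarrow> all_below B I \<rho> st \<Longrightarrow> val I m \<rho> st \<le> B ^ d3"
    using val_poly[of m] by metis
  show ?case
  proof (rule exI[of _ "Suc d3 * d1 + d2 + d3"], intro allI impI)
    fix B M base :: nat and I bd :: "nat \<Rightarrow> nat" and \<rho> :: env and st :: store
    assume B: "2 \<le> B" "base \<le> B" "B ^ (Suc d3 * d1 + d2 + d3) < M" "\<forall>x. \<rho> x \<le> B" "\<forall>j. I j \<le> B" "\<forall>a. bd a \<le> B"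
      and s: "\<forall>a i. st a i \<le> bd a" "writes_ok I bd (For x m c) \<rho> st"
    have lt: "B ^ (Suc d3 * d1) < M" "B ^ d2 < M" "B ^ d3 < M" using less_power_mono[OF B(3) _ B(1)] by auto
    have ab: "all_below B I \<rho> st" using B s unfolding below_def by (meson order_trans)
    have m: "val I m \<rho> st \<le> B ^ d3" using d3[OF B(1) ab] .
    have pl: "B \<le> B ^ Suc d3" by (rule power_le_power_left[OF B(1)])
    have "cmd_fits I M base c (\<rho>(x := i)) (iter i (\<lambda>i. run I c (\<rho>(x := i))) st)" if i: "i < val I m \<rho> st" for i
    proof (rule d[rule_format, of "B ^ Suc d3" "\<rho>(x := i)" I bd])
      show "2 \<le> B ^ Suc d3" "base \<le> B ^ Suc d3" using pl B by linarith+
      show "(\<rho>(x := i)) y \<le> B ^ Suc d3" for y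
        using below_update[OF ab B(1), of i d3 x] i m unfolding below_def by simp
      show "I j \<le> B ^ Suc d3" for j using B(5) pl by (meson order_trans)
      show "bd a \<le> B ^ Suc d3" for a using B(6) pl by (meson order_trans)
      show "(B ^ Suc d3) ^ d1 < M" using lt(1) by (simp only: power_mult)
      show "iter i (\<lambda>i. run I c (\<rho>(x := i))) st a j \<le> bd a" for a j
        by (rule iter_below[OF s(2)]) (use s i in auto)
      show "writes_ok I bd c (\<rho>(x := i)) (iter i (\<lambda>i. run I c (\<rho>(x := i))) st)" using s(2) i by simp
    qed
    then show "cmd_fits I M base (For x m c) \<rho> st"
      using d2[OF B(1) ab B(2) lt(2)] m lt(3) by simp
  qed
qed simp

text \<open>With \<open>A \<noteq> UNIV\<close> the inputs and the arrays outside \<open>A\<close>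
  may be arbitrarily large. The running time stays bounded even though p, q and the result can
  exceed it by far.\<close>

lemma cost_poly:
  assumes "cmd_ranges_over A c" and A: "A \<noteq> UNIV"
  shows "\<exists>d. \<forall>(B :: nat) I bd \<rho> st. 2 \<le> B \<longrightarrow> (\<forall>x. \<rho> x \<le> B) \<longrightarrow> (\<forall>a\<in>A. bd a \<le> B) \<longrightarrow>
     (\<forall>a i. st a i \<le> bd a) \<longrightarrow> writes_ok I bd c \<rho> st \<longrightarrow> cost I c \<rho> st \<le> B ^ d"
  (is "\<exists>d. ?Q d c")
  using assms(1)
proof (induction c)
  case (Write a i e)
  obtain d1 where d1: "\<And>B I \<rho> st. 2 \<le> B \<Longrightarrow> below B I A \<rho> st \<Longrightarrow> expr_cost I i \<rho> st \<le> B ^ d1"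
    using expr_cost_poly[of A i] Write by auto metis
  obtain d2 where d2: "\<And>B I \<rho> st. 2 \<le> B \<Longrightarrow> below B I A \<rho> st \<Longrightarrow> expr_cost I e \<rho> st \<le> B ^ d2"
    using expr_cost_poly[of A e] Write by auto metis
  show ?case
  proof (rule exI[of _ "(d1 + d2 + 1) + 12 + 1"], intro allI impI)
    fix B :: nat and I bd :: "nat \<Rightarrow> nat" and \<rho> :: env and st :: store
    assume B: "2 \<le> B" and "\<forall>x. \<rho> x \<le> B" "\<forall>a\<in>A. bd a \<le> B" "\<forall>a i. st a i \<le> bd a"
    \<comment> \<open>The clause of \<open>below\<close> on inputs is void for
      \<open>A \<noteq> UNIV\<close>.\<close>
    then have "below B I A \<rho> st" using A unfolding below_def by (meson order_trans)
    then show "cost I (Write a i e) \<rho> st \<le> B ^ ((d1 + d2 + 1) + 12 + 1)"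
      unfolding cost.simps by (intro const_add_le power_add_le B d1 d2)
  qed
next
  case (Seq c1 c2)
  obtain d1 d2 where d: "?Q d1 c1" "?Q d2 c2"
    using Seq.IH Seq.prems unfolding cmd_ranges_over.simps by blast
  show ?case
  proof (rule exI[of _ "d1 + d2 + 1"], intro allI impI)
    fix B :: nat and I bd :: "nat \<Rightarrow> nat" and \<rho> :: env and st :: store
    assume B: "2 \<le> B" "\<forall>x. \<rho> x \<le> B" "\<forall>a\<in>A. bd a \<le> B" and s: "\<forall>a i. st a i \<le> bd a" "writes_ok I bd (c1 ;; c2) \<rho> st"
    have "\<forall>a i. run I c1 \<rho> st a i \<le> bd a" using run_below s by simp
    then show "cost I (c1 ;; c2) \<rho> st \<le> B ^ (d1 + d2 + 1)"
      using d[rule_format, of B \<rho> bd] B s unfolding cost.simps by (intro power_add_le) auto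
  qed
next
  case (If e c1 c2)
  obtain d1 d2 where d: "?Q d1 c1" "?Q d2 c2"
    using If.IH If.prems unfolding cmd_ranges_over.simps by blast
  obtain d3 where d3: "\<And>B I \<rho> st. 2 \<le> B \<Longrightarrow> below B I A \<rho> st \<Longrightarrow> expr_cost I e \<rho> st \<le> B ^ d3"
    using expr_cost_poly[of A e] If by auto metis
  show ?case
  proof (rule exI[of _ "(d3 + 4 + 1) + (d1 + d2) + 1"], intro allI impI)
    fix B :: nat and I bd :: "nat \<Rightarrow> nat" and \<rho> :: env and st :: store
    assume B: "2 \<le> B" "\<forall>x. \<rho> x \<le> B" "\<forall>a\<in>A. bd a \<le> B" and s: "\<forall>a i. st a i \<le> bd a" "writes_ok I bd (If e c1 c2) \<rho> st"
    have ab: "below B I A \<rho> st" using A B s unfolding below_def by (meson order_trans)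
    have "(if val I e \<rho> st \<noteq> 0 then cost I c1 \<rho> st else cost I c2 \<rho> st) \<le> B ^ (d1 + d2)"
    proof (cases "val I e \<rho> st \<noteq> 0")
      case True
      then have "cost I c1 \<rho> st \<le> B ^ d1" using d(1)[rule_format, of B \<rho> bd] B s by simp
      then have "cost I c1 \<rho> st \<le> B ^ (d1 + d2)" using B(1) power_increasing[of d1 "d1 + d2" B] by linarith
      then show ?thesis using True by simp
    next
      case False
      then have "cost I c2 \<rho> st \<le> B ^ d2" using d(2)[rule_format, of B \<rho> bd] B s by simp
      then have "cost I c2 \<rho> st \<le> B ^ (d1 + d2)" using B(1) power_increasing[of d2 "d1 + d2" B] by linarith
      then show ?thesis using False by simp
    qed
    then show "cost I (If e c1 c2) \<rho> st \<le> B ^ ((d3 + 4 + 1) + (d1 + d2) + 1)"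
      unfolding cost.simps by (intro power_add_le const_add_le B(1) d3 ab)
  qed
next
  case (For x m c)
  obtain d1 where d: "?Q d1 c" using For.IH For.prems unfolding cmd_ranges_over.simps by blast
  obtain d2 where d2: "\<And>B I \<rho> st. 2 \<le> B \<Longrightarrow> below B I A \<rho> st \<Longrightarrow> expr_cost I m \<rho> st \<le> B ^ d2"
    using expr_cost_poly[of A m] For.prems by auto metis
  obtain d3 where d3: "\<And>B I \<rho> st. 2 \<le> B \<Longrightarrow> below B I A \<rho> st \<Longrightarrow> val I m \<rho> st \<le> B ^ d3"
    using val_poly_over[of A m] For.prems by auto metis
  show ?case
  proof (rule exI[of _ "(d2 + 6 + 1) + (d3 + Suc d3 * (d1 + 5 + 1)) + 1"], intro allI impI)
    fix B :: nat and I bd :: "nat \<Rightarrow> nat" and \<rho> :: env and st :: store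
    assume B: "2 \<le> B" "\<forall>x. \<rho> x \<le> B" "\<forall>a\<in>A. bd a \<le> B" and s: "\<forall>a i. st a i \<le> bd a" "writes_ok I bd (For x m c) \<rho> st"
    have ab: "below B I A \<rho> st" using A B s unfolding below_def by (meson order_trans)
    have m: "val I m \<rho> st \<le> B ^ d3" using d3[OF B(1) ab] .
    have pl: "B \<le> B ^ Suc d3" by (rule power_le_power_left[OF B(1)])
    then have B': "2 \<le> B ^ Suc d3" using B(1) by linarith
    have "cost I c (\<rho>(x := i)) (iter i (\<lambda>i. run I c (\<rho>(x := i))) st) \<le> (B ^ Suc d3) ^ d1" if i: "i < val I m \<rho> st" for i
    proof (rule d[rule_format])
      show "2 \<le> B ^ Suc d3" by (rule B')
      show "(\<rho>(x := i)) y \<le> B ^ Suc d3" for y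
        using below_update[OF ab B(1), of i d3 x] i m unfolding below_def by simp
      show "bd a \<le> B ^ Suc d3" if "a \<in> A" for a using B(3) pl that by (meson order_trans)
      show "iter i (\<lambda>i. run I c (\<rho>(x := i))) st a j \<le> bd a" for a j
        by (rule iter_below[OF s(2)]) (use s i in auto)
      show "writes_ok I bd c (\<rho>(x := i)) (iter i (\<lambda>i. run I c (\<rho>(x := i))) st)" using s(2) i by simp
    qed
    then have "cost I c (\<rho>(x := i)) (iter i (\<lambda>i. run I c (\<rho>(x := i))) st) + 5 \<le> B ^ (Suc d3 * (d1 + 5 + 1))"
      if "i < val I m \<rho> st" for i
      unfolding power_mult using that by (intro const_add_le[OF B']) auto
    then have "(\<Sum>i<val I m \<rho> st. cost I c (\<rho>(x := i)) (iter i (\<lambda>i. run I c (\<rho>(x := i))) st) + 5)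
        \<le> B ^ (d3 + Suc d3 * (d1 + 5 + 1))"
      by (intro sum_le_power[OF m]) auto
    then show "cost I (For x m c) \<rho> st \<le> B ^ ((d2 + 6 + 1) + (d3 + Suc d3 * (d1 + 5 + 1)) + 1)"
      unfolding cost.simps by (intro power_add_le const_add_le B(1) d2 ab)
  qed
next
  case Skip
  show ?case by simp
qed

section \<open>Balanced separators from tree decompositions\<close>

text \<open>If the new first vertex already lies on the path, everything before that occurrence is
  cut off.\<close>

lemma rtrancl_distinct_path:
  assumes "(x, y) \<in> R\<^sup>*"
  shows "\<exists>xs. xs \<noteq> [] \<and> hd xs = x \<and> last xs = y \<and> distinct xs \<and>
    (\<forall>k. Suc k < length xs \<longrightarrow> (xs ! k, xs ! Suc k) \<in> R)"
  using assms
proof (induction rule: converse_rtrancl_induct)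
  case base
  show ?case by (rule exI[of _ "[y]"]) simp
next
  case (step x x')
  then obtain xs where xs: "xs \<noteq> []" "hd xs = x'" "last xs = y" "distinct xs"
    "\<And>k. Suc k < length xs \<Longrightarrow> (xs ! k, xs ! Suc k) \<in> R" by blast
  show ?case
  proof (cases "x \<in> set xs")
    case True
    then obtain as bs where ab: "xs = as @ x # bs" by (meson split_list)
    have "((x # bs) ! k, (x # bs) ! Suc k) \<in> R" if "Suc k < length (x # bs)" for k
      using xs(5)[of "length as + k"] that by (simp add: ab nth_append)
    then show ?thesis using xs ab by (intro exI[of _ "x # bs"]) auto
  next
    case False
    have "((x # xs) ! k, (x # xs) ! Suc k) \<in> R" if "Suc k < length (x # xs)" for k
      using xs step(1) that by (cases k) (auto simp: hd_conv_nth)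
    then show ?thesis using xs False by (intro exI[of _ "x # xs"]) auto
  qed
qed

text \<open>A simple path from \<open>i\<close> to \<open>j\<close> that avoids the edge between
  them has an inner vertex, so this edge closes it to a cycle of length at least 3.\<close>

lemma cycle_from_detour:
  assumes "{i, j} \<in> F" "i \<noteq> j" "(i, j) \<in> {(a, b). {a, b} \<in> F \<and> {a, b} \<noteq> {i, j}}\<^sup>*"
  shows "\<exists>cs. is_cycle F cs"
proof -
  obtain xs where xs: "xs \<noteq> []" "hd xs = i" "last xs = j" "distinct xs"
    "\<And>k. Suc k < length xs \<Longrightarrow> {xs ! k, xs ! Suc k} \<in> F \<and> {xs ! k, xs ! Suc k} \<noteq> {i, j}"
    using rtrancl_distinct_path[OF assms(3)] by auto
  have ends: "xs ! 0 = i" "xs ! (length xs - 1) = j" using xs by (simp_all add: hd_conv_nth last_conv_nth)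
  have "length xs \<noteq> 1" using ends assms(2) by auto
  moreover have "length xs \<noteq> 2" using ends xs(5)[of 0] by auto
  moreover have "length xs \<noteq> 0" using xs(1) by simp
  ultimately have len: "3 \<le> length xs" by linarith
  have "{xs ! k, xs ! (Suc k mod length xs)} \<in> F" if "k < length xs" for k
  proof (cases "Suc k < length xs")
    case True
    then show ?thesis using xs(5) by simp
  next
    case False
    then have "Suc k = length xs" using that by simp
    then have "k = length xs - 1" "Suc k mod length xs = 0" by simp_all
    then show ?thesis using ends assms(1) by (simp add: insert_commute)
  qed
  then show ?thesis using len xs(4) unfolding is_cycle_def by blast
qed

text \<open>Iterates in a finite set become periodic. The least period of a periodic point is not 1,
  as \<open>f\<close> has no fixed point; 2 gives the first alternative, and otherwise the orbit is
  the cycle.\<close>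

lemma functional_cycle:
  assumes "finite I" "I \<noteq> {}" "\<And>i. i \<in> I \<Longrightarrow> f i \<in> I \<and> f i \<noteq> i"
  obtains i where "i \<in> I" "f (f i) = i"
  | cs where "3 \<le> length cs" "distinct cs" "set cs \<subseteq> I"
      "\<And>k. k < length cs \<Longrightarrow> cs ! (Suc k mod length cs) = f (cs ! k)"
proof -
  obtain i0 where "i0 \<in> I" using assms(2) by blast
  have I: "(f ^^ n) i0 \<in> I" for n by (induction n) (use \<open>i0 \<in> I\<close> assms(3) in auto)
  have "\<not> inj (\<lambda>n. (f ^^ n) i0)"
    using I assms(1) by (meson finite_subset image_subsetI infinite_UNIV_nat finite_imageD)
  then obtain m n where mn: "m < n" "(f ^^ m) i0 = (f ^^ n) i0"
    unfolding inj_def by (metis linorder_neqE_nat)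
  define x where "x = (f ^^ m) i0"
  have xI: "(f ^^ k) x \<in> I" for k using I[of "k + m"] by (simp add: x_def funpow_add)
  have "(f ^^ (n - m)) x = (f ^^ (n - m + m)) i0" by (simp only: x_def funpow_add comp_apply)
  then have "(f ^^ (n - m)) x = x" using mn by (simp add: x_def)
  then have ex: "\<exists>p>0. (f ^^ p) x = x" using mn(1) by (intro exI[of _ "n - m"]) simp
  define p where "p = (LEAST p. 0 < p \<and> (f ^^ p) x = x)"
  have p: "0 < p" "(f ^^ p) x = x" using LeastI_ex[OF ex] unfolding p_def by auto
  have minp: "\<not> (0 < q \<and> (f ^^ q) x = x)" if "q < p" for q using not_less_Least that unfolding p_def by blast
  define cs where "cs = map (\<lambda>k. (f ^^ k) x) [0..<p]"
  have ne: "(f ^^ a) x \<noteq> (f ^^ b) x" if "a < b" "b < p" for a b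
  proof
    assume "(f ^^ a) x = (f ^^ b) x"
    \<comment> \<open>Completing the orbit from \<open>b\<close> on would give the smaller period
      \<open>p - b + a\<close>.\<close>
    then have "(f ^^ (p - b)) ((f ^^ a) x) = (f ^^ (p - b)) ((f ^^ b) x)" by simp
    then have "(f ^^ (p - b + a)) x = (f ^^ (p - b + b)) x" by (simp only: funpow_add comp_apply)
    then have "(f ^^ (p - b + a)) x = x" using that p by simp
    moreover have "0 < p - b + a" "p - b + a < p" using that by auto
    ultimately show False using minp by blast
  qed
  have "p \<noteq> 1" using p(2) assms(3)[of x] xI[of 0] by auto
  then consider "p = 2" | "3 \<le> p" using p(1) by linarith
  then show thesis
  proof cases
    case 1
    then show thesis using that(1)[of x] p(2) xI[of 0] by (simp add: numeral_2_eq_2)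
  next
    case 2
    show thesis
    proof (rule that(2)[of cs])
      show "distinct cs" using ne unfolding cs_def distinct_conv_nth
        by auto (metis linorder_neqE_nat)
      show "cs ! (Suc k mod length cs) = f (cs ! k)" if "k < length cs" for k
      proof (cases "Suc k < p")
        case False
        then have "Suc k = p" using that by (simp add: cs_def)
        then have "f ((f ^^ k) x) = x" using p(2) by (metis comp_apply funpow.simps(2))
        then show ?thesis using \<open>Suc k = p\<close> by (simp add: cs_def)
      qed (use that in \<open>simp add: cs_def\<close>)
    qed (use 2 xI in \<open>auto simp: cs_def\<close>)
  qed
qed

text \<open>Whenever the path comes back to \<open>i\<close>, the walk is restarted and the next
  vertex becomes the new \<open>j\<close>.\<close>

lemma rtrancl_first_step:
  assumes "(i, k) \<in> {(a, b). a \<in> I \<and> b \<in> I \<and> {a, b} \<in> F}\<^sup>*" "k \<noteq> i"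
  shows "\<exists>j\<in>I. {i, j} \<in> F \<and> (j, k) \<in> {(a, b). a \<in> I - {i} \<and> b \<in> I - {i} \<and> {a, b} \<in> F}\<^sup>*"
  using assms
proof (induction rule: rtrancl_induct)
  case (step y z)
  then show ?case
    by (cases "y = i") (auto intro: rtrancl_into_rtrancl)
qed simp

text \<open>The nodes whose bags contain a fixed vertex of \<open>Q\<close> form a subtree that
  misses \<open>i\<close>, and adjacent vertices share a bag. So a path inside \<open>Q\<close> can
  be followed in the tree without passing through \<open>i\<close>.\<close>

lemma tree_decomposition_connected_avoiding:
  assumes td: "tree_decomposition V E I F B"
    and Q: "Q \<subseteq> V - B i" "connected_induced Q E"
    and k: "k \<in> I" "B k \<inter> Q \<noteq> {}" and k': "k' \<in> I" "B k' \<inter> Q \<noteq> {}"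
  shows "(k, k') \<in> {(a, b). a \<in> I - {i} \<and> b \<in> I - {i} \<and> {a, b} \<in> F}\<^sup>*" (is "_ \<in> ?R\<^sup>*")
proof -
  have conn: "(k, k') \<in> ?R\<^sup>*" if "v \<in> Q" "k \<in> I" "k' \<in> I" "v \<in> B k" "v \<in> B k'" for v k k'
  proof -
    have "(k, k') \<in> {(a, b). a \<in> {i \<in> I. v \<in> B i} \<and> b \<in> {i \<in> I. v \<in> B i} \<and> {a, b} \<in> F}\<^sup>*"
      using td that Q(1) unfolding tree_decomposition_def connected_induced_def by auto
    moreover have "v \<notin> B i" using that(1) Q(1) by auto
    ultimately show ?thesis by (elim rtrancl_mono[THEN subsetD, rotated]) auto
  qed
  obtain x y where xy: "x \<in> B k" "x \<in> Q" "y \<in> B k'" "y \<in> Q" using k k' by blast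
  have "(x, y) \<in> {(a, b). a \<in> Q \<and> b \<in> Q \<and> {a, b} \<in> E}\<^sup>*"
    using Q(2) xy unfolding connected_induced_def by blast
  then have "\<forall>l\<in>I. y \<in> B l \<longrightarrow> (k, l) \<in> ?R\<^sup>*"
  proof (induction rule: rtrancl_induct)
    case base
    then show ?case using conn xy k(1) by blast
  next
    case (step y z)
    have "{y, z} \<in> E" using step(2) by blast
    then obtain m where "m \<in> I" "{y, z} \<subseteq> B m"
      using td unfolding tree_decomposition_def by meson
    then have m: "m \<in> I" "y \<in> B m" "z \<in> B m" by auto
    show ?case
    proof (intro ballI impI)
      fix l assume "l \<in> I" "z \<in> B l"
      then have "(m, l) \<in> ?R\<^sup>*" using conn[of z m l] m step(2) by blast
      moreover have "(k, m) \<in> ?R\<^sup>*" using step.IH m by blast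
      ultimately show "(k, l) \<in> ?R\<^sup>*" by simp
    qed
  qed
  then show ?thesis using k'(1) xy by blast
qed

text \<open>
  If every bag leaves a heavy component, sending each node one step towards its heavy component
  gives a map on the tree; as the tree has no cycle, it flips some edge, and the two heavy
  components on the two sides of that edge are disjoint.
\<close>

lemma centroid_bag:
  assumes td: "tree_decomposition V E I F B" and S: "S \<subseteq> V" "finite S"
  shows "\<exists>i\<in>I. \<forall>Q. Q \<subseteq> V - B i \<longrightarrow> connected_induced Q E \<longrightarrow> 2 * card (Q \<inter> S) \<le> card S"
proof (rule ccontr)
  assume "\<not> ?thesis"
  then obtain Q where Q: "\<And>i. i \<in> I \<Longrightarrow> Q i \<subseteq> V - B i" "\<And>i. i \<in> I \<Longrightarrow> connected_induced (Q i) E"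
    "\<And>i. i \<in> I \<Longrightarrow> card S < 2 * card (Q i \<inter> S)"
    by (metis linorder_not_le)
  let ?R = "\<lambda>i. {(a, b). a \<in> I - {i} \<and> b \<in> I - {i} \<and> {a, b} \<in> F}"
  have tree: "finite I" "I \<noteq> {}" "connected_induced I F" "\<nexists>cs. is_cycle F cs"
    and edge: "\<And>i j. {i, j} \<in> F \<Longrightarrow> i \<noteq> j"
    using td unfolding tree_decomposition_def is_tree_def simple_graph_def by (auto simp: card_2_iff doubleton_eq_iff)
  have "\<exists>j\<in>I. {i, j} \<in> F \<and> (\<forall>k\<in>I. B k \<inter> Q i \<noteq> {} \<longrightarrow> (j, k) \<in> (?R i)\<^sup>*)" if "i \<in> I" for i
  proof -
    have "Q i \<noteq> {}" using Q(3)[OF that] by auto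
    then obtain v where "v \<in> Q i" by blast
    then obtain k where k: "k \<in> I" "v \<in> B k"
      using td Q(1)[OF \<open>i \<in> I\<close>] unfolding tree_decomposition_def by blast
    have "k \<noteq> i" using k \<open>v \<in> Q i\<close> Q(1)[OF \<open>i \<in> I\<close>] by auto
    have "(i, k) \<in> {(a, b). a \<in> I \<and> b \<in> I \<and> {a, b} \<in> F}\<^sup>*"
      using tree(3) that k unfolding connected_induced_def by blast
    from rtrancl_first_step[OF this \<open>k \<noteq> i\<close>]
    obtain j where j: "j \<in> I" "{i, j} \<in> F" "(j, k) \<in> (?R i)\<^sup>*" by blast
    have "B k \<inter> Q i \<noteq> {}" using k \<open>v \<in> Q i\<close> by blast
    then have "(j, k') \<in> (?R i)\<^sup>*" if "k' \<in> I" "B k' \<inter> Q i \<noteq> {}" for k'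
      using rtrancl_trans[OF j(3) tree_decomposition_connected_avoiding[OF td Q(1,2)[OF \<open>i \<in> I\<close>] k(1) _ that]]
      by blast
    then show ?thesis using j by blast
  qed
  then have "\<forall>i\<in>I. \<exists>j. j \<in> I \<and> {i, j} \<in> F \<and>
      (\<forall>k\<in>I. B k \<inter> Q i \<noteq> {} \<longrightarrow> (j, k) \<in> (?R i)\<^sup>*)" by blast
  from bchoice[OF this] obtain f where "\<forall>i\<in>I. f i \<in> I \<and> {i, f i} \<in> F \<and>
      (\<forall>k\<in>I. B k \<inter> Q i \<noteq> {} \<longrightarrow> (f i, k) \<in> (?R i)\<^sup>*)"
    by blast
  then have f: "\<And>i. i \<in> I \<Longrightarrow> f i \<in> I" "\<And>i. i \<in> I \<Longrightarrow> {i, f i} \<in> F"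
    "\<And>i k. i \<in> I \<Longrightarrow> k \<in> I \<Longrightarrow> B k \<inter> Q i \<noteq> {} \<Longrightarrow> (f i, k) \<in> (?R i)\<^sup>*"
    by blast+
  have "f i \<in> I \<and> f i \<noteq> i" if "i \<in> I" for i using f that edge by metis
  from tree(1,2) this show False
  proof (rule functional_cycle)
    fix cs assume cs: "3 \<le> length cs" "distinct cs" "set cs \<subseteq> I"
      "\<And>k. k < length cs \<Longrightarrow> cs ! (Suc k mod length cs) = f (cs ! k)"
    then have "is_cycle F cs" using f(2) unfolding is_cycle_def by (metis nth_mem subsetD)
    then show False using tree(4) by blast
  next
    fix i assume i: "i \<in> I" "f (f i) = i"
    define j where "j = f i"
    have j: "j \<in> I" "f j = i" "{i, j} \<in> F" "i \<noteq> j" using i f edge by (auto simp: j_def)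
    \<comment> \<open>Two sets that each contain more than half of \<open>S\<close> meet. A bag
      containing a common vertex then links \<open>i\<close> and \<open>j\<close> by a walk that
      avoids the edge between them.\<close>
    have "card (Q i \<inter> S) + card (Q j \<inter> S) = card (Q i \<inter> S \<union> Q j \<inter> S) + card (Q i \<inter> S \<inter> (Q j \<inter> S))"
      using S(2) by (intro card_Un_Int) auto
    moreover have "card (Q i \<inter> S \<union> Q j \<inter> S) \<le> card S" using S(2) by (intro card_mono) auto
    ultimately have "card (Q i \<inter> S \<inter> (Q j \<inter> S)) \<noteq> 0" using Q(3)[OF i(1)] Q(3)[OF j(1)] by linarith
    then obtain v where v: "v \<in> Q i" "v \<in> Q j" by (metis Int_iff card.empty equals0I)
    then obtain k where k: "k \<in> I" "v \<in> B k"
      using td Q(1)[OF i(1)] unfolding tree_decomposition_def by blast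
    let ?D = "{(a, b). {a, b} \<in> F \<and> {a, b} \<noteq> {i, j}}"
    have sub: "?R i \<subseteq> ?D" "?R j \<subseteq> ?D" by (auto simp: doubleton_eq_iff)
    have "B k \<inter> Q i \<noteq> {}" "B k \<inter> Q j \<noteq> {}" using k v by blast+
    then have "(j, k) \<in> (?R i)\<^sup>*" "(i, k) \<in> (?R j)\<^sup>*"
      using f(3)[OF i(1) k(1)] f(3)[OF j(1) k(1)] j(2) unfolding j_def by simp_all
    then have 1: "(j, k) \<in> ?D\<^sup>*" and 2: "(i, k) \<in> ?D\<^sup>*"
      using rtrancl_mono[OF sub(1)] rtrancl_mono[OF sub(2)] by (meson subsetD)+
    have "sym ?D" by (auto simp: sym_def insert_commute)
    then have "(k, j) \<in> ?D\<^sup>*" using 1 sym_rtrancl[of ?D] by (meson symD)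
    with 2 have "(i, j) \<in> ?D\<^sup>*" by simp
    then show False using cycle_from_detour[OF j(3,4)] tree(4) by blast
  qed
qed

text \<open>Members are added until the collected weight reaches a quarter of \<open>W\<close>. The
  last addition starts below a quarter and weighs at most a half, so three quarters are not
  exceeded, and at most three quarters remain outside.\<close>

lemma balanced_subfamily:
  fixes g :: "'a \<Rightarrow> nat"
  assumes "finite C" "\<And>c. c \<in> C \<Longrightarrow> 2 * g c \<le> W" "sum g C \<le> W"
  shows "\<exists>D\<subseteq>C. 4 * sum g D \<le> 3 * W \<and> 4 * sum g (C - D) \<le> 3 * W"
proof -
  have "\<exists>D\<subseteq>C. 4 * sum g D \<le> 3 * W \<and> (W \<le> 4 * sum g D \<or> D = C)"
    using assms(1,2)
  proof (induction C rule: finite_induct)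
    case (insert c C)
    then obtain D where D: "D \<subseteq> C" "4 * sum g D \<le> 3 * W" "W \<le> 4 * sum g D \<or> D = C" by auto
    show ?case
    proof (cases "W \<le> 4 * sum g D")
      case True
      then show ?thesis using D by (intro exI[of _ D]) auto
    next
      case False
      then have "D = C" using D by blast
      then have "4 * sum g (insert c C) \<le> 3 * W" using False insert.hyps insert.prems[of c] by simp
      then show ?thesis by blast
    qed
  qed simp
  then obtain D where D: "D \<subseteq> C" "4 * sum g D \<le> 3 * W" "W \<le> 4 * sum g D \<or> D = C" by blast
  have "sum g C = sum g D + sum g (C - D)"
    using sum.subset_diff[OF D(1) assms(1), of g] by simp
  then have "4 * sum g (C - D) \<le> 3 * W" using D(3) assms(3) by auto
  then show ?thesis using D by blast
qed

text \<open>The one-node tree with bag \<open>V\<close> shows that the least width is attained. The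
  width is a truncated difference, so width plus 1 bounds the bags even if all of them are
  empty.\<close>

lemma treewidth_decomposition:
  assumes "simple_graph V E"
  obtains I :: "nat set" and F B where "tree_decomposition V E I F B"
    "\<And>i. i \<in> I \<Longrightarrow> card (B i) \<le> treewidth V E + 1"
proof -
  have "is_tree {0 :: nat} {}"
    by (auto simp: is_tree_def simple_graph_def connected_induced_def is_cycle_def
        intro!: exI[of _ "0 :: nat"])
  then have "tree_decomposition V E {0 :: nat} {} (\<lambda>_. V)"
    using assms by (auto simp: tree_decomposition_def connected_induced_def simple_graph_def)
  then have "\<exists>k. \<exists>(I :: nat set) F B. tree_decomposition V E I F B \<and> decomposition_width I B = k" by blast
  from LeastI_ex[OF this] obtain I :: "nat set" and F B where
    td: "tree_decomposition V E I F B" and w: "decomposition_width I B = treewidth V E"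
    unfolding treewidth_def by blast
  have "finite I" using td by (simp add: tree_decomposition_def is_tree_def simple_graph_def)
  then have "card (B i) \<le> Max ((\<lambda>i. card (B i)) ` I)" if "i \<in> I" for i using that by (intro Max_ge) auto
  then have "card (B i) \<le> treewidth V E + 1" if "i \<in> I" for i
    using that w unfolding decomposition_width_def by fastforce
  then show thesis using that td by blast
qed

text \<open>Labels 0 and 1 are the two sides, label 2 is the separator.\<close>

lemma balanced_labelling:
  assumes G: "simple_graph V E" and w: "treewidth V E \<le> w" and S: "S \<subseteq> V"
  shows "\<exists>lab. (\<forall>x. lab x \<le> (2 :: nat)) \<and> (\<forall>x y. {x, y} \<in> E \<longrightarrow> lab x + lab y \<noteq> 1) \<and>
    card {x \<in> V. lab x = 2} \<le> w + 1 \<and>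
    4 * card {x \<in> S. lab x = 0} \<le> 3 * card S \<and> 4 * card {x \<in> S. lab x = 1} \<le> 3 * card S"
proof -
  have fin: "finite V" "finite S" using G S finite_subset by (auto simp: simple_graph_def)
  obtain I :: "nat set" and F B where td: "tree_decomposition V E I F B"
    and bags: "\<And>i. i \<in> I \<Longrightarrow> card (B i) \<le> treewidth V E + 1"
    using treewidth_decomposition[OF G] by metis
  obtain i where i: "i \<in> I" and half: "\<And>Q. Q \<subseteq> V - B i \<Longrightarrow> connected_induced Q E \<Longrightarrow> 2 * card (Q \<inter> S) \<le> card S"
    using centroid_bag[OF td S fin(2)] by metis
  define X where "X = B i"
  have X: "X \<subseteq> V" "card X \<le> w + 1" using td i bags[OF i] w by (auto simp: X_def tree_decomposition_def)
  \<comment> \<open>The components of the graph without the centroid bag are obtained as classes of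
    reachability.\<close>
  define R where "R = {(a, b). a \<in> V - X \<and> b \<in> V - X \<and> {a, b} \<in> E}"
  define r where "r = {(x, y). x \<in> V - X \<and> (x, y) \<in> R\<^sup>*}"
  have rV: "y \<in> V - X" if "(x, y) \<in> R\<^sup>*" "x \<in> V - X" for x y
    using that by (induction rule: rtrancl_induct) (auto simp: R_def)
  have "sym R" by (auto simp: sym_def R_def insert_commute)
  then have "sym (R\<^sup>*)" by (rule sym_rtrancl)
  then have eq: "equiv (V - X) r"
    unfolding r_def equiv_def refl_on_def sym_def trans_def using rV
    by auto
  define C where "C = (V - X) // r"
  have finC: "finite C" using fin(1) eq unfolding C_def by (intro finite_quotient) (auto simp: equiv_def refl_on_def r_def rV)
  have half': "2 * card (Q \<inter> S) \<le> card S" if "Q \<in> C" for Q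
  proof (rule half)
    show sub: "Q \<subseteq> V - B i" using that eq unfolding C_def X_def[symmetric] by (metis Union_quotient Union_upper)
    show "connected_induced Q E"
      unfolding connected_induced_def
    proof (intro ballI)
      fix x y assume xy: "x \<in> Q" "y \<in> Q"
      have Q: "Q = r `` {x}" using that xy eq unfolding C_def
        by (metis equiv_class_eq_iff quotientE Image_singleton_iff)
      have "(x, y) \<in> R\<^sup>*" using xy Q by (auto simp: r_def)
      then have "(x, y) \<in> {(a, b). a \<in> Q \<and> b \<in> Q \<and> {a, b} \<in> E}\<^sup>*"
      proof (induction rule: rtrancl_induct)
        case (step y z)
        have "x \<in> V - X" using xy Q sub by (auto simp: X_def)
        then have "y \<in> Q" "z \<in> Q" using step(1,2) Q by (auto simp: r_def intro: rtrancl_into_rtrancl)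
        then have "(y, z) \<in> {(a, b). a \<in> Q \<and> b \<in> Q \<and> {a, b} \<in> E}" using step(2) by (auto simp: R_def)
        then show ?case using step.IH by (rule rtrancl_into_rtrancl[rotated])
      qed simp
      then show "(x, y) \<in> {(a, b). a \<in> Q \<and> b \<in> Q \<and> {a, b} \<in> E}\<^sup>*" .
    qed
  qed
  have disj: "P \<inter> Q = {}" if "P \<in> C" "Q \<in> C" "P \<noteq> Q" for P Q
    using quotient_disj[OF eq] that unfolding C_def by blast
  have sumcard: "(\<Sum>Q\<in>D. card (Q \<inter> S)) = card (\<Union>D \<inter> S)" if "D \<subseteq> C" for D
  proof -
    have "card (\<Union>Q\<in>D. Q \<inter> S) = (\<Sum>Q\<in>D. card (Q \<inter> S))"
      using that finC fin disj by (intro card_UN_disjoint) (auto intro: finite_subset)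
    moreover have "(\<Union>Q\<in>D. Q \<inter> S) = \<Union>D \<inter> S" by auto
    ultimately show ?thesis by simp
  qed
  have "(\<Sum>Q\<in>C. card (Q \<inter> S)) \<le> card S"
    using sumcard[of C] card_mono[OF fin(2), of "\<Union>C \<inter> S"] by simp
  from balanced_subfamily[of C "\<lambda>Q. card (Q \<inter> S)", OF finC half' this]
  obtain D where "D \<subseteq> C" "4 * (\<Sum>Q\<in>D. card (Q \<inter> S)) \<le> 3 * card S"
    "4 * (\<Sum>Q\<in>C - D. card (Q \<inter> S)) \<le> 3 * card S" by blast
  then have D: "D \<subseteq> C" "4 * card (\<Union>D \<inter> S) \<le> 3 * card S" "4 * card (\<Union>(C - D) \<inter> S) \<le> 3 * card S"
    using sumcard[of D] sumcard[of "C - D"] by auto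
  define lab where "lab x = (if x \<in> X then 2 else if x \<in> \<Union>D then 0 else 1 :: nat)" for x
  have UC: "\<Union>C = V - X" using Union_quotient[OF eq] by (simp add: C_def)
  \<comment> \<open>Among the labels 0, 1 and 2 a sum of 1 means one end on either side, so this
    says that no edge joins the two sides.\<close>
  have "lab x + lab y \<noteq> 1" if e: "{x, y} \<in> E" for x y
  proof -
    have V: "x \<in> V" "y \<in> V" using e G by (auto simp: simple_graph_def)
    have "y' \<in> \<Union>D" if "x' \<in> \<Union>D" "y' \<in> V - X" "{x', y'} \<in> E" for x' y'
    proof -
      obtain Q where Q: "Q \<in> D" "x' \<in> Q" using \<open>x' \<in> \<Union>D\<close> by blast
      then have "x' \<in> V - X" using UC D(1) by blast
      then have "(x', y') \<in> R" using that by (auto simp: R_def)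
      then have "(x', y') \<in> r" using \<open>x' \<in> V - X\<close> by (auto simp: r_def)
      moreover have "Q \<in> (V - X) // r" using Q(1) D(1) by (auto simp: C_def)
      ultimately have "y' \<in> Q" using Q(2) in_quotient_imp_closed[OF eq] by metis
      then show ?thesis using Q(1) by blast
    qed
    from this[of x y] this[of y x] show ?thesis
      using e V unfolding lab_def by (auto simp: insert_commute split: if_splits)
  qed
  moreover have "{x \<in> V. lab x = 2} = X" using X by (auto simp: lab_def split: if_splits)
  moreover have "{x \<in> S. lab x = 0} \<subseteq> \<Union>D \<inter> S" by (auto simp: lab_def split: if_splits)
  then have "card {x \<in> S. lab x = 0} \<le> card (\<Union>D \<inter> S)" using fin by (intro card_mono) auto
  moreover have "{x \<in> S. lab x = 1} \<subseteq> \<Union>(C - D) \<inter> S"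
  proof
    fix x assume "x \<in> {x \<in> S. lab x = 1}"
    then have x: "x \<in> S" "x \<in> V - X" "x \<notin> \<Union>D" using S by (auto simp: lab_def split: if_splits)
    then obtain Q where "Q \<in> C" "x \<in> Q" using UC by blast
    then show "x \<in> \<Union>(C - D) \<inter> S" using x by blast
  qed
  then have "card {x \<in> S. lab x = 1} \<le> card (\<Union>(C - D) \<inter> S)" using fin by (intro card_mono) auto
  moreover have "\<forall>x. lab x \<le> 2" by (simp add: lab_def)
  ultimately show ?thesis using D(2,3) X(2) by (intro exI[of _ lab]) auto
qed

section \<open>Mixed radix numbers\<close>

text \<open>The base may vary from digit to digit: later it is 1 at vertices that are not
  neighbours, and it differs between the volumes and the other statistics.\<close>

lemma mixed_radix_less:
  fixes w b d :: "nat \<Rightarrow> nat"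
  assumes "w 0 = 1" "\<And>x. x < m \<Longrightarrow> w (Suc x) = w x * b x" "\<And>x. x < m \<Longrightarrow> d x < b x"
  shows "(\<Sum>x<m. d x * w x) < w m"
  using assms
proof (induction m)
  case (Suc m)
  have "(\<Sum>x<Suc m. d x * w x) < w m + d m * w m" using Suc by simp
  also have "\<dots> = Suc (d m) * w m" by simp
  also have "\<dots> \<le> b m * w m" using Suc.prems(3)[of m] by (intro mult_le_mono1) simp
  finally show ?case using Suc.prems(2)[of m] by (simp add: mult.commute)
qed simp

lemma mixed_radix_dvd:
  fixes w b :: "nat \<Rightarrow> nat"
  assumes "\<And>x. x < m \<Longrightarrow> w (Suc x) = w x * b x" "j \<le> m"
  shows "w j dvd w m"
  using assms
proof (induction m)
  case (Suc m)
  show ?case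
  proof (cases "j = Suc m")
    case False
    then have "w j dvd w m" using Suc by simp
    then show ?thesis using Suc.prems(1)[of m] by simp
  qed simp
qed simp

text \<open>The lower digits together stay below \<open>w j\<close>, and all higher weights are
  multiples of \<open>w (Suc j)\<close>, so quotient and remainder isolate one digit.\<close>

lemma mixed_radix_digit:
  fixes w b d :: "nat \<Rightarrow> nat"
  assumes "w 0 = 1" "\<And>x. x < m \<Longrightarrow> w (Suc x) = w x * b x" "\<And>x. x < m \<Longrightarrow> d x < b x" "j < m"
  shows "(\<Sum>x<m. d x * w x) div w j mod b j = d j"
  using assms
proof (induction m)
  case (Suc m)
  define s where "s = (\<Sum>x<m. d x * w x)"
  have s: "s < w m" unfolding s_def by (rule mixed_radix_less) (use Suc.prems in auto)
  show ?case
  proof (cases "j = m")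
    case True
    have "(s + d m * w m) div w m = d m" using s by simp
    then show ?thesis using Suc.prems(3)[of m] True by (simp add: s_def)
  next
    case False
    then have "j < m" using Suc.prems by simp
    then have IH: "s div w j mod b j = d j" using Suc by (simp add: s_def)
    have "w (Suc j) dvd w m" by (rule mixed_radix_dvd[of m w b]) (use Suc.prems \<open>j < m\<close> in auto)
    then obtain q where q: "w m = w j * b j * q" using Suc.prems(2)[of j] \<open>j < m\<close> by auto
    have "w j \<noteq> 0"
    proof
      assume "w j = 0"
      then show False using s q by simp
    qed
    have "(s + d m * w m) div w j = (s + w j * (b j * q * d m)) div w j" using q by (simp add: mult_ac)
    also have "\<dots> = b j * q * d m + s div w j" using \<open>w j \<noteq> 0\<close> by simp
    finally have "(s + d m * w m) div w j mod b j = s div w j mod b j"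
      by (simp add: mult.assoc)
    then show ?thesis using IH by (simp add: s_def)
  qed
qed simp

section \<open>Bucket elimination\<close>

text \<open>
  \<open>H u\<close> is the set of later neighbours of \<open>u\<close> after fill-in, \<open>pos\<close> is the elimination time and
  \<open>g y lab\<close> the contribution charged to vertex \<open>y\<close>, which depends only on the labels of \<open>y\<close> and
  \<open>H y\<close>. \<open>par\<close> is the elimination tree, \<open>below_set v\<close> the subtree of \<open>v\<close>.
\<close>

locale bucket_elimination =
  fixes N K :: nat and H :: "nat \<Rightarrow> nat set" and pos :: "nat \<Rightarrow> nat"
    and g :: "nat \<Rightarrow> (nat \<Rightarrow> nat) \<Rightarrow> nat" and root :: nat
  assumes H_less: "\<And>u x. u < N \<Longrightarrow> x \<in> H u \<Longrightarrow> x < N"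
    and H_pos: "\<And>u x. u < N \<Longrightarrow> x \<in> H u \<Longrightarrow> pos u < pos x"
    and H_fill: "\<And>u v x. u < N \<Longrightarrow> v \<in> H u \<Longrightarrow> x \<in> H u \<Longrightarrow> pos v < pos x \<Longrightarrow> x \<in> H v"
    and pos_inj: "inj_on pos {..<N}"
    and root: "root < N" "\<And>u. u < N \<Longrightarrow> u \<noteq> root \<Longrightarrow> root \<in> H u"
    and g_local: "\<And>y lab lab'. y < N \<Longrightarrow> (\<And>x. x \<in> insert y (H y) \<Longrightarrow> lab x = lab' x) \<Longrightarrow> g y lab = g y lab'"
begin

definition par :: "nat \<Rightarrow> nat \<Rightarrow> bool" where
  "par u v \<longleftrightarrow> u < N \<and> v \<in> H u \<and> (\<forall>x\<in>H u. \<not> pos x < pos v)"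

abbreviation "parent_rel \<equiv> {(u, v). par u v}"

definition below_set :: "nat \<Rightarrow> nat set" where
  "below_set v = {y. y < N \<and> (y, v) \<in> parent_rel\<^sup>*}"

lemma par_less: "par u v \<Longrightarrow> u < N \<and> v < N \<and> pos u < pos v"
  using H_less H_pos by (auto simp: par_def)

lemma par_unique: "par u v \<Longrightarrow> par u v' \<Longrightarrow> v = v'"
  using pos_inj H_less unfolding par_def inj_on_def by (metis lessThan_iff linorder_neqE_nat)

lemma single_valued_parent: "single_valued parent_rel"
  using par_unique by (auto simp: single_valued_def)

text \<open>This is \<open>H_fill\<close> for the earliest element \<open>v\<close> of
  \<open>H u\<close>: all other elements come after \<open>v\<close>.\<close>

lemma H_par: "par u v \<Longrightarrow> H u \<subseteq> insert v (H v)"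
proof
  fix x assume uv: "par u v" and x: "x \<in> H u"
  show "x \<in> insert v (H v)"
  proof (cases "x = v")
    case False
    have "u < N" "v \<in> H u" "\<not> pos x < pos v" using uv x by (auto simp: par_def)
    then have "pos v < pos x"
      using False pos_inj H_less x unfolding inj_on_def by (metis lessThan_iff linorder_neqE_nat)
    then show ?thesis using H_fill \<open>u < N\<close> \<open>v \<in> H u\<close> x by blast
  qed simp
qed

lemma rtrancl_parent:
  "(y, v) \<in> parent_rel\<^sup>* \<Longrightarrow> y = v \<or> y < N \<and> v < N \<and> pos y < pos v"
  by (induction rule: rtrancl_induct) (auto dest: par_less intro: less_trans)

lemma finite_below_set: "finite (below_set v)"
  by (rule finite_subset[of _ "{..<N}"]) (auto simp: below_set_def)

lemma below_set_pos: "y \<in> below_set v \<Longrightarrow> pos y \<le> pos v"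
  using rtrancl_parent by (fastforce simp: below_set_def)

text \<open>By \<open>H_par\<close>, one step up the tree loses at most the parent, so a subtree
  sees the rest of the graph only through \<open>H v\<close>.\<close>

lemma H_below_set:
  assumes "y \<in> below_set v"
  shows "H y \<subseteq> below_set v \<union> H v"
proof -
  have "(y, v) \<in> parent_rel\<^sup>*" using assms by (simp add: below_set_def)
  then show ?thesis
  proof (induction rule: converse_rtrancl_induct)
    case (step y p)
    have "p \<in> below_set v" using step(1,2) par_less by (auto simp: below_set_def)
    then show ?case using H_par[of y p] step by auto
  qed simp
qed

lemma below_set_unfold:
  assumes "v < N"
  shows "below_set v = insert v (\<Union>u\<in>{u. par u v}. below_set u)"
proof (intro set_eqI iffI)
  fix y assume y: "y \<in> below_set v"
  then have "(y, v) \<in> parent_rel\<^sup>*" by (simp add: below_set_def)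
  then show "y \<in> insert v (\<Union>u\<in>{u. par u v}. below_set u)"
    by (cases rule: rtranclE) (use y in \<open>auto simp: below_set_def\<close>)
next
  fix y assume "y \<in> insert v (\<Union>u\<in>{u. par u v}. below_set u)"
  then show "y \<in> below_set v"
    using assms by (auto simp: below_set_def intro: rtrancl_into_rtrancl)
qed

text \<open>Ancestors of a common vertex are comparable since parents are unique. But a chain from
  one sibling to the other would pass through \<open>v\<close> and then return to a smaller
  position.\<close>

lemma below_set_disjoint:
  assumes "par u v" "par u' v" "u \<noteq> u'"
  shows "below_set u \<inter> below_set u' = {}"
proof (rule ccontr)
  assume "\<not> ?thesis"
  then obtain y where "(y, u) \<in> parent_rel\<^sup>*" "(y, u') \<in> parent_rel\<^sup>*" by (auto simp: below_set_def)
  then have c: "(u, u') \<in> parent_rel\<^sup>* \<or> (u', u) \<in> parent_rel\<^sup>*"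
    using single_valued_confluent[OF single_valued_parent] by blast
  have no: "\<not> (a, b) \<in> parent_rel\<^sup>*" if ab: "par a v" "par b v" "a \<noteq> b" for a b
  proof
    assume "(a, b) \<in> parent_rel\<^sup>*"
    then obtain c where "par a c" "(c, b) \<in> parent_rel\<^sup>*" using ab(3) by (auto elim: converse_rtranclE)
    then have "(v, b) \<in> parent_rel\<^sup>*" using par_unique ab(1) by blast
    then show False using rtrancl_parent[of v b] par_less[OF ab(2)] by auto
  qed
  show False using c no assms by blast
qed

lemma scope_disjoint:
  assumes "par u v"
  shows "insert v (H v) \<inter> below_set u = {}"
proof -
  have "pos x \<le> pos u" if "x \<in> below_set u" for x using below_set_pos that by blast
  moreover have "pos u < pos v" "v < N" using par_less[OF assms] by auto
  ultimately show ?thesis using H_pos[of v] by fastforce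
qed

lemma H_disjoint: "v < N \<Longrightarrow> H v \<inter> below_set v = {}"
  using below_set_pos H_pos by fastforce

definition valid :: "(nat \<Rightarrow> nat) \<Rightarrow> bool" where
  "valid lab \<longleftrightarrow> (\<forall>x. lab x < K)"

definition achieves :: "nat \<Rightarrow> (nat \<Rightarrow> nat) \<Rightarrow> nat \<Rightarrow> bool" where
  "achieves v lab s \<longleftrightarrow> (\<exists>lab'. valid lab' \<and> (\<forall>x. x \<notin> below_set v \<longrightarrow> lab' x = lab x) \<and>
     s = (\<Sum>y\<in>below_set v. g y lab'))"

lemma g_below_cong:
  assumes "y \<in> below_set v" "\<And>x. x \<in> below_set v \<union> H v \<Longrightarrow> lab x = lab' x"
  shows "g y lab = g y lab'"
  using H_below_set[OF assms(1)] assms by (intro g_local) (auto simp: below_set_def)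

text \<open>Contributions in the subtree depend on labels outside only through \<open>H v\<close>;
  this is why a table over the labellings of \<open>H v\<close> suffices.\<close>

lemma achieves_cong:
  assumes "valid lab2" "\<And>x. x \<in> H v \<Longrightarrow> lab x = lab2 x" "achieves v lab s"
  shows "achieves v lab2 s"
proof -
  obtain lab' where l: "valid lab'" "\<And>x. x \<notin> below_set v \<Longrightarrow> lab' x = lab x" "s = (\<Sum>y\<in>below_set v. g y lab')"
    using assms(3) by (auto simp: achieves_def)
  define l2 where "l2 x = (if x \<in> below_set v then lab' x else lab2 x)" for x
  have "g y lab' = g y l2" if "y \<in> below_set v" for y
    by (rule g_below_cong[OF that]) (use assms(2) l(2) in \<open>auto simp: l2_def\<close>)
  then have "s = (\<Sum>y\<in>below_set v. g y l2)" using l(3) by simp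
  moreover have "valid l2" using assms(1) l(1) by (simp add: valid_def l2_def)
  ultimately show ?thesis unfolding achieves_def by (intro exI[of _ l2]) (auto simp: l2_def)
qed

lemma sum_below_set:
  assumes "v < N"
  shows "(\<Sum>y\<in>below_set v. h y) = h v + (\<Sum>u\<in>{u. par u v}. \<Sum>y\<in>below_set u. h y :: nat)"
proof -
  let ?C = "{u. par u v}"
  have fin: "finite ?C" by (rule finite_subset[of _ "{..<N}"]) (auto dest: par_less)
  have "v \<notin> (\<Union>u\<in>?C. below_set u)" using scope_disjoint by blast
  then have "(\<Sum>y\<in>below_set v. h y) = h v + (\<Sum>y\<in>(\<Union>u\<in>?C. below_set u). h y)"
    unfolding below_set_unfold[OF assms] by (subst sum.insert) (auto simp: fin finite_below_set)
  also have "(\<Sum>y\<in>(\<Union>u\<in>?C. below_set u). h y) = (\<Sum>u\<in>?C. \<Sum>y\<in>below_set u. h y)"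
    using fin finite_below_set below_set_disjoint by (intro sum.UNION_disjoint) auto
  finally show ?thesis .
qed

text \<open>Once \<open>v\<close> and \<open>H v\<close> are labelled, the subtrees of the children
  are independent: they are disjoint, and outside themselves they depend on labels in
  \<open>insert v (H v)\<close> only.\<close>

lemma achieves_rec:
  assumes v: "v < N" and lab: "valid lab"
  shows "achieves v lab s \<longleftrightarrow> (\<exists>l<K. \<exists>f. (\<forall>u. par u v \<longrightarrow> achieves u (lab(v := l)) (f u)) \<and>
    s = g v (lab(v := l)) + (\<Sum>u\<in>{u. par u v}. f u))"
proof
  assume "achieves v lab s"
  then obtain lab' where l: "valid lab'" "\<And>x. x \<notin> below_set v \<Longrightarrow> lab' x = lab x" "s = (\<Sum>y\<in>below_set v. g y lab')"
    by (auto simp: achieves_def)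
  define m where "m = lab(v := lab' v)"
  have m: "m x = lab' x" if "x \<in> insert v (H v)" for x
  proof (cases "x = v")
    case False
    then have "x \<notin> below_set v" using that H_disjoint[OF v] by blast
    then show ?thesis using False l(2) by (simp add: m_def)
  qed (simp add: m_def)
  have "valid m" using lab l(1) by (auto simp: m_def valid_def)
  have "achieves u m (\<Sum>y\<in>below_set u. g y lab')" if u: "par u v" for u
  proof -
    define l2 where "l2 x = (if x \<in> below_set u then lab' x else m x)" for x
    have "g y lab' = g y l2" if "y \<in> below_set u" for y
      by (rule g_below_cong[OF that]) (use m H_par[OF u] in \<open>auto simp: l2_def\<close>)
    moreover have "valid l2" using \<open>valid m\<close> l(1) by (simp add: valid_def l2_def)
    ultimately show ?thesis unfolding achieves_def by (intro exI[of _ l2]) (auto simp: l2_def)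
  qed
  moreover have "g v m = g v lab'" by (rule g_local) (use m v in auto)
  then have "s = g v m + (\<Sum>u\<in>{u. par u v}. \<Sum>y\<in>below_set u. g y lab')"
    using l(3) sum_below_set[OF v] by simp
  moreover have "lab' v < K" using l(1) by (simp add: valid_def)
  ultimately show "\<exists>l<K. \<exists>f. (\<forall>u. par u v \<longrightarrow> achieves u (lab(v := l)) (f u)) \<and>
    s = g v (lab(v := l)) + (\<Sum>u\<in>{u. par u v}. f u)"
    unfolding m_def by (intro exI[of _ "lab' v"] conjI exI[of _ "\<lambda>u. \<Sum>y\<in>below_set u. g y lab'"]) auto
next
  assume "\<exists>l<K. \<exists>f. (\<forall>u. par u v \<longrightarrow> achieves u (lab(v := l)) (f u)) \<and>
    s = g v (lab(v := l)) + (\<Sum>u\<in>{u. par u v}. f u)"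
  then obtain l f where l: "l < K" and f: "\<And>u. par u v \<Longrightarrow> achieves u (lab(v := l)) (f u)"
    and s: "s = g v (lab(v := l)) + (\<Sum>u\<in>{u. par u v}. f u)" by blast
  define m where "m = lab(v := l)"
  have "\<forall>u\<in>{u. par u v}. \<exists>lab'. valid lab' \<and> (\<forall>x. x \<notin> below_set u \<longrightarrow> lab' x = m x) \<and>
      f u = (\<Sum>y\<in>below_set u. g y lab')"
    using f by (auto simp: achieves_def m_def)
  from bchoice[OF this] obtain L where L: "\<And>u. par u v \<Longrightarrow> valid (L u)"
    "\<And>u x. par u v \<Longrightarrow> x \<notin> below_set u \<Longrightarrow> L u x = m x"
    "\<And>u. par u v \<Longrightarrow> f u = (\<Sum>y\<in>below_set u. g y (L u))" by auto
  \<comment> \<open>The labellings of the children are glued together; \<open>THE\<close> is well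
    defined because subtrees of siblings are disjoint.\<close>
  define M where "M x = (if \<exists>u. par u v \<and> x \<in> below_set u then L (THE u. par u v \<and> x \<in> below_set u) x else m x)" for x
  have M1: "M x = L u x" if "par u v" "x \<in> below_set u" for x u
  proof -
    have "(THE u. par u v \<and> x \<in> below_set u) = u"
      using that below_set_disjoint by (intro the_equality) blast+
    then show ?thesis using that by (auto simp: M_def)
  qed
  have M2: "M x = m x" if "x \<in> insert v (H v)" for x
    using scope_disjoint that unfolding M_def by (auto split: if_splits)
  have "g y M = g y (L u)" if uy: "par u v" "y \<in> below_set u" for u y
  proof (rule g_below_cong[OF uy(2)])
    fix x assume "x \<in> below_set u \<union> H u"
    then consider "x \<in> below_set u" | "x \<notin> below_set u" "x \<in> insert v (H v)"
      using H_par[OF uy(1)] by blast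
    then show "M x = L u x" using M1[OF uy(1)] M2 L(2)[OF uy(1)] by cases simp_all
  qed
  then have "(\<Sum>u\<in>{u. par u v}. f u) = (\<Sum>u\<in>{u. par u v}. \<Sum>y\<in>below_set u. g y M)"
    using L(3) by (intro sum.cong) auto
  moreover have "g v m = g v M" using M2 v by (intro g_local) auto
  ultimately have "s = (\<Sum>y\<in>below_set v. g y M)" using s sum_below_set[OF v, of "\<lambda>y. g y M"] by (simp add: m_def)
  moreover have "valid M"
    unfolding valid_def
  proof
    fix x
    show "M x < K"
    proof (cases "\<exists>u. par u v \<and> x \<in> below_set u")
      case True
      then show ?thesis using M1 L(1) by (metis valid_def)
    next
      case False
      then have "M x = m x" unfolding M_def by meson
      then show ?thesis using l lab by (simp add: m_def valid_def)
    qed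
  qed
  moreover have "M x = lab x" if "x \<notin> below_set v" for x
    using that below_set_unfold[OF v] unfolding M_def m_def by auto
  ultimately show "achieves v lab s" unfolding achieves_def by blast
qed

text \<open>All vertex numbers are scanned and those that are not children are skipped, because the
  program keeps no lists of children.\<close>

definition partial :: "nat \<Rightarrow> (nat \<Rightarrow> nat) \<Rightarrow> nat \<Rightarrow> nat \<Rightarrow> bool" where
  "partial v lab U s \<longleftrightarrow> (\<exists>f. (\<forall>u<U. par u v \<longrightarrow> achieves u lab (f u)) \<and>
     s = g v lab + (\<Sum>u\<in>{u. u < U \<and> par u v}. f u))"

lemma partial_0: "partial v lab 0 s \<longleftrightarrow> s = g v lab"
  by (simp add: partial_def)

lemma partial_Suc_other:
  assumes "\<not> par U v"
  shows "partial v lab (Suc U) s \<longleftrightarrow> partial v lab U s"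
proof -
  have "{u. u < Suc U \<and> par u v} = {u. u < U \<and> par u v}" using assms by (auto simp: less_Suc_eq)
  moreover have "(\<forall>u<Suc U. par u v \<longrightarrow> Q u) \<longleftrightarrow> (\<forall>u<U. par u v \<longrightarrow> Q u)" for Q
    using assms by (auto simp: less_Suc_eq)
  ultimately show ?thesis by (simp add: partial_def)
qed

text \<open>A child adds a summand of its own, so the set of achievable sums is convolved with the
  table of the child.\<close>

lemma partial_Suc:
  assumes "par U v"
  shows "partial v lab (Suc U) s \<longleftrightarrow> (\<exists>a\<le>s. partial v lab U a \<and> achieves U lab (s - a))"
proof -
  have eq: "{u. u < Suc U \<and> par u v} = insert U {u. u < U \<and> par u v}" using assms by (auto simp: less_Suc_eq)
  have sum: "(\<Sum>u\<in>{u. u < Suc U \<and> par u v}. f u) = f U + (\<Sum>u\<in>{u. u < U \<and> par u v}. f u)" for f :: "nat \<Rightarrow> nat"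
    unfolding eq by (subst sum.insert) auto
  show ?thesis
  proof
    assume "partial v lab (Suc U) s"
    then obtain f where f: "\<forall>u<Suc U. par u v \<longrightarrow> achieves u lab (f u)"
      "s = g v lab + (f U + (\<Sum>u\<in>{u. u < U \<and> par u v}. f u))" unfolding partial_def sum by blast
    moreover from this have "partial v lab U (g v lab + (\<Sum>u\<in>{u. u < U \<and> par u v}. f u))"
      unfolding partial_def by (intro exI[of _ f]) auto
    ultimately show "\<exists>a\<le>s. partial v lab U a \<and> achieves U lab (s - a)"
      using assms by (intro exI[of _ "g v lab + (\<Sum>u\<in>{u. u < U \<and> par u v}. f u)"]) auto
  next
    assume "\<exists>a\<le>s. partial v lab U a \<and> achieves U lab (s - a)"
    then obtain a f where a: "a \<le> s" "achieves U lab (s - a)" and f: "\<forall>u<U. par u v \<longrightarrow> achieves u lab (f u)"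
      "a = g v lab + (\<Sum>u\<in>{u. u < U \<and> par u v}. f u)" unfolding partial_def by blast
    have "(\<Sum>u\<in>{u. u < U \<and> par u v}. (f(U := s - a)) u) = (\<Sum>u\<in>{u. u < U \<and> par u v}. f u)"
      by (intro sum.cong) auto
    then show "partial v lab (Suc U) s"
      unfolding partial_def sum using a f by (intro exI[of _ "f(U := s - a)"]) (auto simp: less_Suc_eq)
  qed
qed

lemma achieves_iff_partial:
  assumes "v < N" "valid lab"
  shows "achieves v lab s \<longleftrightarrow> (\<exists>l<K. partial v (lab(v := l)) N s)"
proof -
  have "{u. u < N \<and> par u v} = {u. par u v}" by (auto dest: par_less)
  moreover have "(\<forall>u<N. par u v \<longrightarrow> Q u) \<longleftrightarrow> (\<forall>u. par u v \<longrightarrow> Q u)" for Q using par_less by blast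
  ultimately show ?thesis unfolding achieves_rec[OF assms] partial_def by simp
qed

text \<open>Every other vertex has the root among its later neighbours, hence it has a parent at a
  later position. Positions are bounded, so the chain of parents ends, and it can end only at the
  root.\<close>

lemma below_set_root: "below_set root = {..<N}"
proof -
  have step: "\<exists>p. par u p" if "u < N" "u \<noteq> root" for u
  proof -
    have fin: "finite (H u)" using H_less[OF that(1)] by (meson finite_lessThan finite_subset lessThan_iff subsetI)
    have "H u \<noteq> {}" using root(2)[OF that] by blast
    then obtain v where "v \<in> H u" "\<And>x. x \<in> H u \<Longrightarrow> pos v \<le> pos x"
      using fin arg_min_if_finite[of "H u" pos] by (metis linorder_not_less)
    then have "par u v" using that(1) by (fastforce simp: par_def)
    then show ?thesis by blast
  qed
  define m where "m = Max (pos ` {..<N})"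
  have m: "pos u \<le> m" if "u < N" for u using that by (auto simp: m_def intro: Max_ge)
  have "(u, root) \<in> parent_rel\<^sup>*" if "u < N" for u
    using that
  proof (induction "m - pos u" arbitrary: u rule: less_induct)
    case less
    show ?case
    proof (cases "u = root")
      case False
      then obtain p where p: "par u p" using step less.prems by blast
      have "m - pos p < m - pos u" using par_less[OF p] m[of p] by auto
      then have "(p, root) \<in> parent_rel\<^sup>*" using less.hyps par_less[OF p] by blast
      then show ?thesis using p by (auto intro: converse_rtrancl_into_rtrancl)
    qed simp
  qed
  then show ?thesis by (auto simp: below_set_def)
qed

lemma achieves_root:
  assumes "valid lab"
  shows "achieves root lab s \<longleftrightarrow> (\<exists>lab'. (\<forall>x<N. lab' x < K) \<and> s = (\<Sum>y<N. g y lab'))"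
proof
  assume "achieves root lab s"
  then show "\<exists>lab'. (\<forall>x<N. lab' x < K) \<and> s = (\<Sum>y<N. g y lab')"
    by (auto simp: achieves_def below_set_root valid_def)
next
  assume "\<exists>lab'. (\<forall>x<N. lab' x < K) \<and> s = (\<Sum>y<N. g y lab')"
  then obtain l where l: "\<And>x. x < N \<Longrightarrow> l x < K" "s = (\<Sum>y<N. g y l)" by blast
  define l2 where "l2 x = (if x < N then l x else lab x)" for x
  have "g y l = g y l2" if "y < N" for y
    by (rule g_local) (use that H_less in \<open>auto simp: l2_def\<close>)
  then have "s = (\<Sum>y<N. g y l2)" using l(2) by simp
  moreover have "valid l2" using l(1) assms by (auto simp: valid_def l2_def)
  ultimately show "achieves root lab s"
    unfolding achieves_def below_set_root by (intro exI[of _ l2]) (auto simp: l2_def)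
qed

end

section \<open>Elimination orders\<close>

text \<open>Positions may have gaps up to \<open>N * N\<close>: the construction reserves a block of
  \<open>N\<close> positions for each round and leaves many of them empty.\<close>

definition elim_order :: "nat \<Rightarrow> (nat \<Rightarrow> nat \<Rightarrow> bool) \<Rightarrow> (nat \<Rightarrow> nat) \<Rightarrow> (nat \<Rightarrow> nat set) \<Rightarrow> bool" where
  "elim_order N adj pos H \<longleftrightarrow>
     (\<forall>u<N. H u \<subseteq> {..<N} \<and> pos u < N * N) \<and>
     (\<forall>u<N. \<forall>x\<in>H u. pos u < pos x) \<and>
     (\<forall>u<N. \<forall>v<N. adj u v \<longrightarrow> pos u < pos v \<longrightarrow> v \<in> H u) \<and>
     (\<forall>u<N. \<forall>v\<in>H u. \<forall>x\<in>H u. pos v < pos x \<longrightarrow> x \<in> H v) \<and>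
     inj_on pos {..<N}"

text \<open>The new vertex goes last and into every row. This raises the width by only one and makes
  the vertex a common root. The position \<open>N * N\<close> lies beyond all old positions and
  below \<open>Suc N * Suc N\<close>.\<close>

lemma elim_order_extend:
  assumes "elim_order N adj pos H"
  shows "elim_order (Suc N) adj (pos(N := N * N)) (\<lambda>u. if u < N then insert N (H u) else {})"
proof -
  have less: "H u \<subseteq> {..<N}" "pos u < N * N" if "u < N" for u
    using assms that by (auto simp: elim_order_def)
  let ?H = "\<lambda>u. if u < N then insert N (H u) else {}" and ?pos = "pos(N := N * N)"
  have old: "\<And>u x. u < N \<Longrightarrow> x \<in> H u \<Longrightarrow> pos u < pos x"
    "\<And>u v. u < N \<Longrightarrow> v < N \<Longrightarrow> adj u v \<Longrightarrow> pos u < pos v \<Longrightarrow> v \<in> H u"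
    "\<And>u v x. u < N \<Longrightarrow> v \<in> H u \<Longrightarrow> x \<in> H u \<Longrightarrow> pos v < pos x \<Longrightarrow> x \<in> H v"
    "inj_on pos {..<N}"
    using assms unfolding elim_order_def by blast+
  have lt: "N * N < Suc N * Suc N" by simp
  have p: "?pos u < N * N" if "u < N" for u using less(2) that by simp
  have HN: "x < N" if "x \<in> H u" "u < N" for x u using less(1) that by auto
  have "inj_on ?pos {..<Suc N}"
  proof (rule inj_onI)
    fix x y assume "x \<in> {..<Suc N}" "y \<in> {..<Suc N}" "?pos x = ?pos y"
    then show "x = y"
      using less(2)[of x] less(2)[of y] old(4)
      by (cases "x = N"; cases "y = N") (auto simp: less_Suc_eq dest: inj_onD)
  qed
  moreover have "?pos u < Suc N * Suc N" if "u < Suc N" for u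
    using p[of u] that lt by (cases "u < N") (auto simp: less_Suc_eq)
  moreover have "?H u \<subseteq> {..<Suc N}" if "u < Suc N" for u using HN[of _ u] by (auto intro: less_SucI)
  moreover have "?pos u < ?pos x" if "u < Suc N" "x \<in> ?H u" for u x
  proof -
    have u: "u < N" "x = N \<or> x \<in> H u" using that by (auto split: if_splits)
    then show ?thesis using old(1)[of u x] HN[of x u] less(2)[of u] by auto
  qed
  moreover have "v \<in> ?H u" if "u < Suc N" "v < Suc N" "adj u v" "?pos u < ?pos v" for u v
  proof -
    have "u < N"
    proof (rule ccontr)
      assume "\<not> u < N"
      then have "u = N" using that(1) by simp
      then show False using that(2,4) p[of v] by (cases "v = N") auto
    qed
    then show ?thesis using that old(2)[of u v] by (cases "v = N") auto
  qed
  moreover have "x \<in> ?H v" if "u < Suc N" "v \<in> ?H u" "x \<in> ?H u" "?pos v < ?pos x" for u v x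
  proof -
    have u: "u < N" "v = N \<or> v \<in> H u" "x = N \<or> x \<in> H u" using that by (auto split: if_splits)
    have "v \<noteq> N"
    proof
      assume "v = N"
      then show False using that(4) u HN[of x u] p[of x] by (cases "x = N") auto
    qed
    then have v: "v \<in> H u" "v < N" using u HN by auto
    then show ?thesis using that(4) u old(3)[of u v x] HN[of x u] by auto
  qed
  ultimately show ?thesis unfolding elim_order_def by blast
qed

text \<open>
  An elimination order is built from its end: \<open>F\<close> is the set of vertices already placed, and for
  the others \<open>H u\<close> contains all placed neighbours of the component of \<open>u\<close> outside \<open>F\<close>.
\<close>

definition elim_state ::
    "nat \<Rightarrow> (nat \<Rightarrow> nat \<Rightarrow> bool) \<Rightarrow> nat set \<Rightarrow> (nat \<Rightarrow> nat) \<Rightarrow> (nat \<Rightarrow> nat set) \<Rightarrow> bool" where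
  "elim_state N adj F pos H \<longleftrightarrow>
     F \<subseteq> {..<N} \<and> (\<forall>u<N. H u \<subseteq> F) \<and>
     (\<forall>u<N. \<forall>v<N. u \<notin> F \<longrightarrow> v \<notin> F \<longrightarrow> adj u v \<longrightarrow> H u = H v) \<and>
     (\<forall>u<N. \<forall>f\<in>F. u \<notin> F \<longrightarrow> adj u f \<longrightarrow> f \<in> H u) \<and>
     (\<forall>f\<in>F. \<forall>x\<in>H f. pos f < pos x) \<and>
     (\<forall>u\<in>F. \<forall>v\<in>F. adj u v \<longrightarrow> pos u < pos v \<longrightarrow> v \<in> H u) \<and>
     (\<forall>u<N. \<forall>v\<in>H u. \<forall>x\<in>H u. pos v < pos x \<longrightarrow> x \<in> H v) \<and>
     inj_on pos F"

lemma elim_state_final: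
  assumes "elim_state N adj F pos H" "{..<N} \<subseteq> F" "\<And>u. u < N \<Longrightarrow> pos u < N * N"
  shows "elim_order N adj pos H"
proof -
  note st = assms(1)[unfolded elim_state_def]
  have F: "F = {..<N}" using st[THEN conjunct1] assms(2) by blast
  note st = st[unfolded F, THEN conjunct2]
  note st2 = st[THEN conjunct2, THEN conjunct2, THEN conjunct2]
  note st4 = st2[THEN conjunct2, THEN conjunct2]
  have "\<forall>u<N. H u \<subseteq> {..<N} \<and> pos u < N * N" using st[THEN conjunct1] assms(3) by blast
  moreover have "\<forall>u<N. \<forall>x\<in>H u. pos u < pos x" using st2[THEN conjunct1] by blast
  moreover have "\<forall>u<N. \<forall>v<N. adj u v \<longrightarrow> pos u < pos v \<longrightarrow> v \<in> H u"
    using st2[THEN conjunct2, THEN conjunct1] by blast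
  ultimately show ?thesis
    unfolding elim_order_def using st4[THEN conjunct1] st4[THEN conjunct2] by (intro conjI)
qed

text \<open>\<open>U\<close> is a union of components outside \<open>F\<close> with the common
  attachment set \<open>S\<close>. Its separator vertices \<open>J\<close> are placed before
  \<open>F\<close>, in decreasing order of their numbers. Each side then keeps the part of
  \<open>S\<close> on that side, the part of \<open>S\<close> in the separator, and all of
  \<open>J\<close>; since no edge joins the sides, no attachment is lost.\<close>

lemma elim_state_step:
  assumes st: "elim_state N adj F pos H" and v: "v < N" "v \<notin> F"
    and U: "U = {u. u < N \<and> u \<notin> F \<and> H u = H v}" and S: "S = H v"
    and J: "J = {x \<in> U. lab x = (2 :: nat)}"
    and lab: "\<And>x. x \<in> U \<union> S \<Longrightarrow> lab x \<le> 2"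
      "\<And>x y. x \<in> U \<Longrightarrow> y \<in> U \<union> S \<Longrightarrow> adj x y \<Longrightarrow> lab x + lab y \<noteq> 1"
    and sym: "\<And>x y. adj x y \<Longrightarrow> adj y x"
    and pos: "\<And>f. f \<in> F \<Longrightarrow> P0 + N \<le> pos f" "\<And>f. f \<in> F \<Longrightarrow> pos' f = pos f"
      "\<And>x. x \<in> J \<Longrightarrow> pos' x = P0 + (N - 1 - x)"
    and H': "\<And>u. u < N \<Longrightarrow> H' u = (if u \<in> U then {x \<in> S. lab u = 2 \<or> lab x = 2 \<or> lab x = lab u} \<union>
      {x \<in> J. lab u = 2 \<longrightarrow> x < u} else H u)"
  shows "elim_state N adj (F \<union> J) pos' H'"
proof -
  note st' = st[unfolded elim_state_def]
  note FN = st'[THEN conjunct1] and HF = st'[THEN conjunct2, THEN conjunct1, rule_format]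
  note st' = st'[THEN conjunct2, THEN conjunct2]
  note same = st'[THEN conjunct1, rule_format] and nbr = st'[THEN conjunct2, THEN conjunct1, rule_format]
  note st' = st'[THEN conjunct2, THEN conjunct2]
  note up = st'[THEN conjunct1, rule_format] and edge = st'[THEN conjunct2, THEN conjunct1, rule_format]
  note st' = st'[THEN conjunct2, THEN conjunct2]
  note fill = st'[THEN conjunct1, rule_format] and inj = st'[THEN conjunct2]
  have UN: "u < N" "u \<notin> F" if "u \<in> U" for u using that U by auto
  have JU: "x \<in> U" "lab x = 2" "x < N" "x \<notin> F" if "x \<in> J" for x using that J U by auto
  have SF: "S \<subseteq> F" using S HF v by blast
  have posJ: "pos' x < P0 + N" if "x \<in> J" for x using pos(3)[OF that] JU[OF that] by auto
  have J_lt: "pos' x < pos' y \<longleftrightarrow> y < x" if "x \<in> J" "y \<in> J" for x y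
    using pos(3) that JU[OF that(1)] JU[OF that(2)] by auto
  have lt_SJ: "pos' x < pos' f" if "x \<in> J" "f \<in> F" for x f
    using posJ[OF that(1)] pos(1,2)[OF that(2)] by linarith
  have H'U: "H' u = {x \<in> S. lab u = 2 \<or> lab x = 2 \<or> lab x = lab u} \<union> {x \<in> J. lab u = 2 \<longrightarrow> x < u}" if "u \<in> U" for u
    using H'[of u] UN[OF that] that by simp
  have H'n: "H' u = H u" if "u < N" "u \<notin> U" for u using H' that by simp
  have H'F: "H' f = H f" if "f \<in> F" for f using H'n[of f] that FN U by auto
  have c1: "H' u = H' w" if "u < N" "w < N" "u \<notin> F \<union> J" "w \<notin> F \<union> J" "adj u w" for u w
  proof -
    have eq: "H u = H w" using same that by blast
    show ?thesis
    proof (cases "u \<in> U")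
      case True
      then have w: "w \<in> U" using eq that U by auto
      \<comment> \<open>Both ends are unplaced, hence not labelled 2; as no edge joins the two
        sides, they lie on the same side.\<close>
      have "lab u \<noteq> 2" "lab w \<noteq> 2" using that True w J by auto
      moreover have "lab u \<le> 2" "lab w \<le> 2" using lab(1) True w by auto
      moreover have "lab u + lab w \<noteq> 1" using lab(2) True w that(5) by blast
      ultimately have "lab u = lab w" by linarith
      then show ?thesis using H'U True w \<open>lab u \<noteq> 2\<close> \<open>lab w \<noteq> 2\<close> by simp
    next
      case False
      then have "w \<notin> U" using eq that U by auto
      then show ?thesis using H'n False that eq by simp
    qed
  qed
  have c2: "f \<in> H' u" if "u < N" "f \<in> F \<union> J" "u \<notin> F \<union> J" "adj u f" for u f
  proof (cases "f \<in> F")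
    case True
    then have f: "f \<in> H u" using nbr that by blast
    show ?thesis
    proof (cases "u \<in> U")
      case uU: True
      then have fS: "f \<in> S" using f U S by auto
      then have "lab u + lab f \<noteq> 1" "lab u \<le> 2" "lab f \<le> 2" using lab uU that(4) by auto
      then have "lab u = 2 \<or> lab f = 2 \<or> lab f = lab u" by linarith
      then show ?thesis using H'U[OF uU] fS by auto
    next
      case False
      then show ?thesis using H'n that f by simp
    qed
  next
    case False
    then have "f \<in> J" using that by blast
    then have "H u = H f" using same that JU by blast
    then have uU: "u \<in> U" using JU[OF \<open>f \<in> J\<close>] that U by auto
    then have "lab u \<noteq> 2" using that J by auto
    then show ?thesis using H'U[OF uU] \<open>f \<in> J\<close> by auto
  qed
  have c3: "pos' f < pos' x" if "f \<in> F \<union> J" "x \<in> H' f" for f x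
  proof (cases "f \<in> F")
    case True
    then have "x \<in> H f" using H'F that by simp
    moreover from this have "x \<in> F" using HF[of f] True FN by auto
    ultimately show ?thesis using up True pos(2) by simp
  next
    case False
    then have f: "f \<in> J" using that by blast
    then have "x \<in> S \<or> x \<in> J \<and> x < f" using that(2) H'U JU by auto
    then show ?thesis using lt_SJ J_lt f SF by blast
  qed
  have c4: "w \<in> H' u" if uw: "u \<in> F \<union> J" "w \<in> F \<union> J" "adj u w" "pos' u < pos' w" for u w
  proof -
    consider "u \<in> F" "w \<in> F" | "u \<in> F" "w \<in> J" | "u \<in> J" "w \<in> F" | "u \<in> J" "w \<in> J" using uw by blast
    then show ?thesis
    proof cases
      case 1
      then show ?thesis using H'F edge uw pos(2) by simp
    next
      case 2
      then show ?thesis using lt_SJ[of w u] uw(4) by simp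
    next
      case 3
      then have "w \<in> H u" using nbr[of u w] JU uw by blast
      then have "w \<in> S" using JU(1)[OF 3(1)] U S by auto
      then show ?thesis using H'U[OF JU(1)[OF 3(1)]] JU(2)[OF 3(1)] by auto
    next
      case 4
      then have "w < u" using J_lt uw(4) by blast
      then show ?thesis using H'U[OF JU(1)[OF 4(1)]] 4 by auto
    qed
  qed
  have c5: "x \<in> H' w" if "u < N" "w \<in> H' u" "x \<in> H' u" "pos' w < pos' x" for u w x
  proof (cases "u \<in> U")
    case False
    then have "w \<in> H u" "x \<in> H u" using H'n that by auto
    then have "w \<in> F" "x \<in> F" using HF that(1) by auto
    then have "x \<in> H w" using fill[OF that(1) \<open>w \<in> H u\<close> \<open>x \<in> H u\<close>] that(4) pos(2) by simp
    then show ?thesis using H'F \<open>w \<in> F\<close> by simp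
  next
    case True
    then have wx: "w \<in> S \<or> w \<in> J" "x \<in> S \<or> x \<in> J" using that(2,3) H'U by auto
    show ?thesis
    proof (cases "w \<in> J")
      case wJ: True
      have "x \<in> S \<or> x \<in> J \<and> x < w" using wx(2) that(4) J_lt wJ by blast
      then show ?thesis using H'U[OF JU(1)[OF wJ]] JU(2)[OF wJ] by auto
    next
      case False
      then have w: "w \<in> S" using wx by blast
      then have "w \<in> F" using SF by blast
      have "x \<notin> J" using lt_SJ[of x w] \<open>w \<in> F\<close> that(4) by auto
      then have "x \<in> S" using wx by blast
      \<comment> \<open>Both vertices lie in \<open>S = H v\<close>, so the old fill-in condition at
        \<open>v\<close> applies.\<close>
      then have "x \<in> H w" using fill[of v w x] v w S pos(2) that(4) SF by (metis subsetD)
      then show ?thesis using H'F \<open>w \<in> F\<close> by simp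
    qed
  qed
  have c6: "inj_on pos' (F \<union> J)"
  proof (rule inj_onI)
    fix x y assume xy: "x \<in> F \<union> J" "y \<in> F \<union> J" "pos' x = pos' y"
    consider "x \<in> F" "y \<in> F" | "x \<in> F" "y \<in> J" | "x \<in> J" "y \<in> F" | "x \<in> J" "y \<in> J" using xy by blast
    then show "x = y"
    proof cases
      case 1
      then show ?thesis using inj xy pos(2) by (auto dest: inj_onD)
    next
      case 2
      then show ?thesis using lt_SJ[of y x] xy(3) by simp
    next
      case 3
      then show ?thesis using lt_SJ[of x y] xy(3) by simp
    next
      case 4
      then show ?thesis using J_lt[of x y] J_lt[of y x] xy(3) by auto
    qed
  qed
  have "H' u \<subseteq> F \<union> J" if "u < N" for u
    using H'U[of u] H'n[of u] HF[of u] SF that by (cases "u \<in> U") auto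
  then have c7: "\<forall>u<N. H' u \<subseteq> F \<union> J" by blast
  have c8: "F \<union> J \<subseteq> {..<N}" using FN JU by auto
  show ?thesis
    unfolding elim_state_def
    by (intro conjI c6 c7 c8 allI ballI impI; elim c1 c2 c3 c4 c5; assumption)
qed

text \<open>These counts are behind the bounds 8k for unplaced and 9k for placed vertices. An
  unplaced vertex keeps the separator and the share of \<open>S\<close> on its side; a separator
  vertex keeps \<open>S\<close> and separator vertices other than itself.\<close>

lemma elim_step_card:
  fixes S U :: "nat set"
  assumes "finite S" "finite U" and J: "J = {x \<in> U. lab x = (2 :: nat)}" and "u \<in> U" and "S \<inter> U = {}"
    and H': "H' = {x \<in> S. lab u = 2 \<or> lab x = 2 \<or> lab x = lab u} \<union> {x \<in> J. lab u = 2 \<longrightarrow> x < u}"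
  shows "lab u \<noteq> 2 \<Longrightarrow> card H' \<le> card {x \<in> U \<union> S. lab x = 2} + card {x \<in> S. lab x = lab u}"
    and "lab u = 2 \<Longrightarrow> card H' \<le> card S + (card J - 1)"
proof -
  assume "lab u \<noteq> 2"
  then have "H' \<subseteq> {x \<in> U \<union> S. lab x = 2} \<union> {x \<in> S. lab x = lab u}" using H' J by auto
  then have "card H' \<le> card ({x \<in> U \<union> S. lab x = 2} \<union> {x \<in> S. lab x = lab u})"
    using assms by (intro card_mono) auto
  also have "\<dots> \<le> card {x \<in> U \<union> S. lab x = 2} + card {x \<in> S. lab x = lab u}" by (rule card_Un_le)
  finally show "card H' \<le> card {x \<in> U \<union> S. lab x = 2} + card {x \<in> S. lab x = lab u}" .
next
  assume u: "lab u = 2"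
  have fJ: "finite J" using assms by simp
  have "u \<in> J" using u J assms by simp
  have "H' \<subseteq> S \<union> (J - {u})" unfolding H' using u by auto
  then have "card H' \<le> card (S \<union> (J - {u}))" using assms fJ by (intro card_mono) auto
  also have "\<dots> \<le> card S + card (J - {u})" by (rule card_Un_le)
  also have "card (J - {u}) = card J - 1" using \<open>u \<in> J\<close> fJ by simp
  finally show "card H' \<le> card S + (card J - 1)" .
qed

section \<open>Weakest preconditions\<close>

text \<open>The bounds on written values travel with the postcondition, so that one proof per
  program gives both its correctness and the hypotheses of the bounds on time and word
  length.\<close>

definition wp :: "(nat \<Rightarrow> nat) \<Rightarrow> (nat \<Rightarrow> nat) \<Rightarrow> cmd \<Rightarrow> env \<Rightarrow> (store \<Rightarrow> bool) \<Rightarrow> store \<Rightarrow> bool" where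
  "wp I bd c \<rho> Q st \<longleftrightarrow> writes_ok I bd c \<rho> st \<and> Q (run I c \<rho> st)"

lemma wp_Write [simp]: "wp I bd (Write a i e) \<rho> Q st \<longleftrightarrow>
    val I e \<rho> st \<le> bd a \<and> Q (st(a := (st a)(val I i \<rho> st := val I e \<rho> st)))"
  by (simp add: wp_def)

lemma wp_Seq [simp]: "wp I bd (c1 ;; c2) \<rho> Q st \<longleftrightarrow> wp I bd c1 \<rho> (wp I bd c2 \<rho> Q) st"
  by (simp add: wp_def)

lemma wp_If [simp]: "wp I bd (If e c1 c2) \<rho> Q st \<longleftrightarrow>
    (if val I e \<rho> st \<noteq> 0 then wp I bd c1 \<rho> Q st else wp I bd c2 \<rho> Q st)"
  by (simp add: wp_def)

lemma wp_Skip [simp]: "wp I bd Skip \<rho> Q st \<longleftrightarrow> Q st"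
  by (simp add: wp_def)

lemma wp_mono: "wp I bd c \<rho> Q st \<Longrightarrow> (\<And>st'. Q st' \<Longrightarrow> Q' st') \<Longrightarrow> wp I bd c \<rho> Q' st"
  by (simp add: wp_def)

lemma wp_For:
  assumes "J 0 st" "val I m \<rho> st = n"
    and step: "\<And>i st'. i < n \<Longrightarrow> J i st' \<Longrightarrow> wp I bd c (\<rho>(x := i)) (J (Suc i)) st'"
    and post: "\<And>st'. J n st' \<Longrightarrow> Q st'"
  shows "wp I bd (For x m c) \<rho> Q st"
proof -
  let ?it = "\<lambda>i. iter i (\<lambda>i. run I c (\<rho>(x := i))) st"
  have J: "J i (?it i)" if "i \<le> n" for i
    using that
  proof (induction i)
    case 0
    then show ?case using assms(1) by simp
  next
    case (Suc i)
    then have "J i (?it i)" by (meson Suc_leD)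
    then have "wp I bd c (\<rho>(x := i)) (J (Suc i)) (?it i)" by (rule step[rotated]) (use Suc.prems in simp)
    then show ?case by (simp only: wp_def iter.simps)
  qed
  moreover have "writes_ok I bd c (\<rho>(x := i)) (?it i)" if "i < n" for i
    using step[OF that J] that by (simp add: wp_def)
  ultimately show ?thesis using post[OF J[OF order_refl]] assms(2) by (simp add: wp_def)
qed

primrec cmd_writes :: "cmd \<Rightarrow> nat set" where
  "cmd_writes (Write a i e) = {a}"
| "cmd_writes (c1 ;; c2) = cmd_writes c1 \<union> cmd_writes c2"
| "cmd_writes (If e c1 c2) = cmd_writes c1 \<union> cmd_writes c2"
| "cmd_writes (For x m c) = cmd_writes c"
| "cmd_writes Skip = {}"

definition same_except :: "nat set \<Rightarrow> store \<Rightarrow> store \<Rightarrow> bool" where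
  "same_except A st st' \<longleftrightarrow> (\<forall>a. a \<notin> A \<longrightarrow> st' a = st a)"

lemma same_exceptD: "same_except A st st' \<Longrightarrow> a \<notin> A \<Longrightarrow> st' a = st a"
  by (simp add: same_except_def)

lemma same_except_refl [simp]: "same_except A st st"
  by (simp add: same_except_def)

lemma same_except_trans: "same_except A st st' \<Longrightarrow> same_except A st' st'' \<Longrightarrow> same_except A st st''"
  by (simp add: same_except_def)

lemma same_except_mono: "same_except A st st' \<Longrightarrow> A \<subseteq> B \<Longrightarrow> same_except B st st'"
  by (auto simp: same_except_def)

lemma same_except_update [simp]: "a \<in> A \<Longrightarrow> same_except A st (st'(a := f)) \<longleftrightarrow> same_except A st st'"
  by (auto simp: same_except_def)

lemma run_frame: "same_except (cmd_writes c) st (run I c \<rho> st)"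
proof (induction c arbitrary: \<rho> st)
  case (Seq c1 c2)
  then show ?case by (auto simp: same_except_def)
next
  case (For x m c)
  have "same_except (cmd_writes c) st (iter k (\<lambda>i. run I c (\<rho>(x := i))) st)" for k
    by (induction k) (auto intro: same_except_trans For)
  then show ?case by simp
qed (auto simp: same_except_def)

lemma wp_frame:
  assumes "wp I bd c \<rho> Q st" "\<And>st'. Q st' \<Longrightarrow> same_except (cmd_writes c) st st' \<Longrightarrow> Q' st'"
  shows "wp I bd c \<rho> Q' st"
  using assms run_frame by (auto simp: wp_def)

text \<open>For loops that fill distinct cells \<open>f i\<close>: by injectivity earlier results
  persist, and \<open>step\<close> may use them as well as all cells outside the range of
  \<open>f\<close>.\<close>

lemma wp_fill:
  assumes m: "val I m \<rho> st = n" and inj: "inj_on f {..<n}"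
    and step: "\<And>i st'. i < n \<Longrightarrow> same_except {a} st st' \<Longrightarrow> (\<And>j. j \<notin> f ` {..<n} \<Longrightarrow> st' a j = st a j) \<Longrightarrow>
        (\<And>j. j < i \<Longrightarrow> st' a (f j) = h j) \<Longrightarrow>
        val I ix (\<rho>(x := i)) st' = f i \<and> val I e (\<rho>(x := i)) st' = h i \<and> h i \<le> bd a"
    and post: "\<And>st'. same_except {a} st st' \<Longrightarrow> (\<And>j. j \<notin> f ` {..<n} \<Longrightarrow> st' a j = st a j) \<Longrightarrow>
        (\<And>j. j < n \<Longrightarrow> st' a (f j) = h j) \<Longrightarrow> Q st'"
  shows "wp I bd (For x m (Write a ix e)) \<rho> Q st"
proof (rule wp_For[where J = "\<lambda>i st'. same_except {a} st st' \<and> (\<forall>j. j \<notin> f ` {..<n} \<longrightarrow> st' a j = st a j) \<and>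
    (\<forall>j<i. st' a (f j) = h j)", OF _ m])
  fix i st' assume i: "i < n" and J: "same_except {a} st st' \<and> (\<forall>j. j \<notin> f ` {..<n} \<longrightarrow> st' a j = st a j) \<and>
    (\<forall>j<i. st' a (f j) = h j)"
  have s: "val I ix (\<rho>(x := i)) st' = f i" "val I e (\<rho>(x := i)) st' = h i" "h i \<le> bd a"
    using step[OF i, of st'] J by auto
  have "f j \<noteq> f i" if "j < i" for j using inj that i by (auto dest: inj_onD)
  then show "wp I bd (Write a ix e) (\<rho>(x := i)) (\<lambda>st'. same_except {a} st st' \<and>
      (\<forall>j. j \<notin> f ` {..<n} \<longrightarrow> st' a j = st a j) \<and> (\<forall>j<Suc i. st' a (f j) = h j)) st'"
    using s J i by (auto simp: less_Suc_eq)
qed (use post in auto)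

section \<open>Derived expressions\<close>

abbreviation PlusE (infixl "\<oplus>" 65) where "e1 \<oplus> e2 \<equiv> Arith Plus e1 e2"
abbreviation TimesE (infixl "\<otimes>" 70) where "e1 \<otimes> e2 \<equiv> Arith Times e1 e2"
abbreviation QuotE (infixl "\<oslash>" 70) where "e1 \<oslash> e2 \<equiv> Arith Quot e1 e2"
abbreviation RemE (infixl "\<odot>" 70) where "e1 \<odot> e2 \<equiv> Arith Rem e1 e2"
abbreviation Cell where "Cell a \<equiv> Arr a (Num 0)"

definition NotE where "NotE e = Less e (Num 1)"
definition AndE where "AndE e1 e2 = NotE (NotE (e1 \<otimes> e2))"
definition EqE where "EqE e1 e2 = NotE (Less e1 e2 \<oplus> Less e2 e1)"
text \<open>There is no short circuit: both branches are evaluated, so both count for the time and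
  both must fit into words.\<close>

definition CondE where "CondE e e1 e2 = NotE (NotE e) \<otimes> e1 \<oplus> NotE e \<otimes> e2"
definition AnyE where "AnyE x m e = NotE (NotE (Sum x m e))"
definition AllE where "AllE x m e = NotE (Sum x m (NotE e))"
definition PairE where "PairE e1 e2 = (e1 \<oplus> e2) \<otimes> (e1 \<oplus> e2 \<oplus> Num 1) \<oslash> Num 2 \<oplus> e1"

lemma val_NotE [simp]: "val I (NotE e) \<rho> st = of_bool (val I e \<rho> st = 0)"
  by (simp add: NotE_def)

lemma val_AndE [simp]: "val I (AndE e1 e2) \<rho> st = of_bool (val I e1 \<rho> st \<noteq> 0 \<and> val I e2 \<rho> st \<noteq> 0)"
  by (simp add: AndE_def)

lemma val_EqE [simp]: "val I (EqE e1 e2) \<rho> st = of_bool (val I e1 \<rho> st = val I e2 \<rho> st)"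
  by (auto simp: EqE_def)

lemma val_CondE [simp]:
  "val I (CondE e e1 e2) \<rho> st = (if val I e \<rho> st \<noteq> 0 then val I e1 \<rho> st else val I e2 \<rho> st)"
  by (simp add: CondE_def)

lemma val_AnyE [simp]:
  "val I (AnyE x m e) \<rho> st = of_bool (\<exists>i<val I m \<rho> st. val I e (\<rho>(x := i)) st \<noteq> 0)"
  by (auto simp: AnyE_def)

lemma val_AllE [simp]:
  "val I (AllE x m e) \<rho> st = of_bool (\<forall>i<val I m \<rho> st. val I e (\<rho>(x := i)) st \<noteq> 0)"
  by (auto simp: AllE_def)

lemma val_PairE [simp]: "val I (PairE e1 e2) \<rho> st = prod_encode (val I e1 \<rho> st, val I e2 \<rho> st)"
  by (simp add: PairE_def prod_encode_def triangle_def)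

lemmas derived_expr_defs = NotE_def AndE_def EqE_def CondE_def AnyE_def AllE_def PairE_def

section \<open>The elimination program\<close>

abbreviation (input) "aRes \<equiv> 0 :: nat"
abbreviation (input) "aN \<equiv> 21 :: nat"
abbreviation (input) "aK \<equiv> 2 :: nat"
abbreviation (input) "aR \<equiv> 3 :: nat"
abbreviation (input) "aH \<equiv> 4 :: nat"
abbreviation (input) "aPos \<equiv> 5 :: nat"
abbreviation (input) "aPw \<equiv> 6 :: nat"
abbreviation (input) "aP \<equiv> 7 :: nat"
abbreviation (input) "aTab \<equiv> 8 :: nat"

abbreviation (input) "rJ \<equiv> 0 :: nat"
abbreviation (input) "rV \<equiv> 15 :: nat"
abbreviation (input) "rZ \<equiv> 2 :: nat"
abbreviation (input) "rL \<equiv> 3 :: nat"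
abbreviation (input) "rS \<equiv> 4 :: nat"
abbreviation (input) "rU \<equiv> 5 :: nat"
abbreviation (input) "rX \<equiv> 6 :: nat"
abbreviation (input) "rA \<equiv> 7 :: nat"

text \<open>
  The label of vertex \<open>rX\<close> when vertex \<open>rV\<close> has label \<open>rL\<close> and the labels of its later neighbours
  are the digits of \<open>rZ\<close>.
\<close>

definition labE :: expr where
  "labE = CondE (EqE (Var rX) (Var rV)) (Var rL) ((Var rZ \<oslash> Arr aPw (PairE (Var rV) (Var rX))) \<odot> Cell aK)"

definition childE :: expr where
  "childE = AndE (Arr aH (PairE (Var rU) (Var rV)))
     (NotE (AnyE rX (Cell aN) (AndE (Arr aH (PairE (Var rU) (Var rX))) (Less (Arr aPos (Var rX)) (Arr aPos (Var rV))))))"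

text \<open>The index of the child's table that matches the current labels. It can be computed
  because the later neighbours of a child are among \<open>rV\<close> and the later neighbours of
  \<open>rV\<close>.\<close>

definition codeE :: expr where
  "codeE = Sum rX (Cell aN) (CondE (Arr aH (PairE (Var rU) (Var rX))) (labE \<otimes> Arr aPw (PairE (Var rU) (Var rX))) (Num 0))"

text \<open>\<open>ae\<close> and \<open>be\<close> are parameters because the same programme serves
  two purposes, the search for separators and the modularity. A term of \<open>be\<close> belongs to
  an edge or fill-in pair and is charged to the end that is eliminated first.\<close>

definition contribE :: "expr \<Rightarrow> expr \<Rightarrow> expr" where
  "contribE ae be = ae \<oplus> Sum rX (Cell aN) (CondE (Arr aH (PairE (Var rV) (Var rX))) be (Num 0))"

definition weightsC :: cmd where
  "weightsC = For rV (Cell aN) (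
     Write aPw (PairE (Var rV) (Num 0)) (Num 1) ;;
     For rX (Cell aN) (Write aPw (PairE (Var rV) (Var rX \<oplus> Num 1))
       (Arr aPw (PairE (Var rV) (Var rX)) \<otimes> CondE (Arr aH (PairE (Var rV) (Var rX))) (Cell aK) (Num 1))))"

text \<open>\<open>aP\<close> is indexed by label, number of scanned vertices and sum, so that no
  row is overwritten while it is still read.\<close>

definition labelC :: "expr \<Rightarrow> expr \<Rightarrow> cmd" where
  "labelC ae be =
     For rS (Cell aR) (Write aP (PairE (Var rL) (PairE (Num 0) (Var rS))) (EqE (Var rS) (contribE ae be))) ;;
     For rU (Cell aN) (For rS (Cell aR) (Write aP (PairE (Var rL) (PairE (Var rU \<oplus> Num 1) (Var rS)))
       (CondE childE
         (AnyE rA (Var rS \<oplus> Num 1) (AndE (Arr aP (PairE (Var rL) (PairE (Var rU) (Var rA))))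
            (Arr aTab (PairE (Var rU) (PairE codeE (Monus (Var rS) (Var rA)))))))
         (Arr aP (PairE (Var rL) (PairE (Var rU) (Var rS)))))))"

definition vertexC :: "expr \<Rightarrow> expr \<Rightarrow> cmd" where
  "vertexC ae be = For rZ (Arr aPw (PairE (Var rV) (Cell aN))) (
     For rL (Cell aK) (labelC ae be) ;;
     For rS (Cell aR) (Write aTab (PairE (Var rV) (PairE (Var rZ) (Var rS)))
       (AnyE rL (Cell aK) (Arr aP (PairE (Var rL) (PairE (Cell aN) (Var rS)))))))"

text \<open>The elimination order is followed by scanning all conceivable positions below
  \<open>N * N\<close>, since positions have gaps.\<close>

definition sumsC :: "expr \<Rightarrow> expr \<Rightarrow> cmd" where
  "sumsC ae be = weightsC ;;
     For rJ (Cell aN \<otimes> Cell aN) (For rV (Cell aN)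
       (If (EqE (Arr aPos (Var rV)) (Var rJ)) (vertexC ae be) Skip))"

text \<open>\<open>ae\<close> and \<open>be\<close> are evaluated while the work arrays change, so
  their values are assumed for every store that agrees with \<open>st0\<close> elsewhere. The label
  of the neighbour reaches \<open>\<beta>\<close> through \<open>labE\<close>.\<close>

locale sums_program =
  fixes I bd :: "nat \<Rightarrow> nat" and st0 :: store and N K R :: nat and adj :: "nat \<Rightarrow> nat \<Rightarrow> bool"
    and H :: "nat \<Rightarrow> nat set" and pos :: "nat \<Rightarrow> nat" and \<alpha> :: "nat \<Rightarrow> nat \<Rightarrow> nat"
    and \<beta> :: "nat \<Rightarrow> nat \<Rightarrow> nat \<Rightarrow> nat \<Rightarrow> nat" and ae be :: expr and root :: nat
  assumes cells: "st0 aN 0 = N" "st0 aK 0 = K" "st0 aR 0 = R"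
    and H_cells: "\<And>u x. u < N \<Longrightarrow> x < N \<Longrightarrow> st0 aH (prod_encode (u, x)) \<noteq> 0 \<longleftrightarrow> x \<in> H u"
    and pos_cells: "\<And>u. u < N \<Longrightarrow> st0 aPos u = pos u"
    and order: "elim_order N adj pos H" and root_less: "root < N"
    and root_in: "\<And>u. u < N \<Longrightarrow> u \<noteq> root \<Longrightarrow> root \<in> H u"
    and K_pos: "1 \<le> K"
    and val_ae: "\<And>\<rho> st. same_except {aPw, aP, aTab} st0 st \<Longrightarrow> \<rho> rV < N \<Longrightarrow> \<rho> rL < K \<Longrightarrow>
        val I ae \<rho> st = \<alpha> (\<rho> rV) (\<rho> rL)"
    and val_be: "\<And>\<rho> st. same_except {aPw, aP, aTab} st0 st \<Longrightarrow> \<rho> rV < N \<Longrightarrow> \<rho> rX < N \<Longrightarrow> \<rho> rL < K \<Longrightarrow>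
        val I be \<rho> st = \<beta> (\<rho> rV) (\<rho> rX) (\<rho> rL) (val I labE \<rho> st)"
    and weight_bound: "\<And>u. u < N \<Longrightarrow> K ^ card (H u) \<le> bd aPw"
    and bool_bound: "1 \<le> bd aP" "1 \<le> bd aTab"
begin

definition contrib :: "nat \<Rightarrow> (nat \<Rightarrow> nat) \<Rightarrow> nat" where
  "contrib y lab = \<alpha> y (lab y) + (\<Sum>x<N. if x \<in> H y then \<beta> y x (lab y) (lab x) else 0)"

sublocale bucket_elimination N K H pos contrib root
proof
  show "contrib y lab = contrib y lab'" if "y < N" "\<And>x. x \<in> insert y (H y) \<Longrightarrow> lab x = lab' x" for y lab lab'
    using that(2) by (auto simp: contrib_def intro!: sum.cong)
  show "x < N" if "u < N" "x \<in> H u" for u x using order that by (auto simp: elim_order_def)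
  show "pos u < pos x" if "u < N" "x \<in> H u" for u x using order that by (auto simp: elim_order_def)
  show "x \<in> H v" if "u < N" "v \<in> H u" "x \<in> H u" "pos v < pos x" for u v x
    using order that unfolding elim_order_def by blast
  show "inj_on pos {..<N}" using order by (simp add: elim_order_def)
qed (use root_less root_in in auto)

text \<open>The place value of \<open>x\<close> in a number with one base \<open>K\<close> digit for
  each element of \<open>H v\<close>, in the order of vertex numbers.\<close>

definition weight :: "nat \<Rightarrow> nat \<Rightarrow> nat" where
  "weight v x = K ^ card (H v \<inter> {..<x})"

definition digits :: "nat \<Rightarrow> nat \<Rightarrow> nat \<Rightarrow> nat" where
  "digits v z x = z div weight v x mod K"

definition encode :: "nat \<Rightarrow> (nat \<Rightarrow> nat) \<Rightarrow> nat" where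
  "encode u lab = (\<Sum>x<N. if x \<in> H u then lab x * weight u x else 0)"

lemma weight_0: "weight v 0 = 1"
  by (simp add: weight_def)

lemma weight_Suc: "weight v (Suc x) = weight v x * (if x \<in> H v then K else 1)"
proof -
  have "H v \<inter> {..<Suc x} = (if x \<in> H v then insert x (H v \<inter> {..<x}) else H v \<inter> {..<x})"
    by (auto simp: less_Suc_eq)
  then show ?thesis by (simp add: weight_def)
qed

lemma weight_bounded: "v < N \<Longrightarrow> weight v x \<le> bd aPw"
proof -
  assume v: "v < N"
  have "finite (H v)" using H_less[OF v] by (meson finite_lessThan finite_subset lessThan_iff subsetI)
  then have "weight v x \<le> K ^ card (H v)"
    using K_pos unfolding weight_def by (intro power_increasing card_mono) auto
  then show ?thesis using weight_bound[OF v] by linarith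
qed

lemma digits_valid: "valid (digits v z)"
  using K_pos by (simp add: valid_def digits_def)

lemma encode_eq: "encode u lab = (\<Sum>x<N. (if x \<in> H u then lab x else 0) * weight u x)"
  unfolding encode_def by (intro sum.cong) auto

lemma encode_less:
  assumes "valid lab"
  shows "encode u lab < weight u N"
  unfolding encode_eq
  by (rule mixed_radix_less[where b = "\<lambda>x. if x \<in> H u then K else 1"])
    (use assms in \<open>auto simp: weight_Suc weight_0 valid_def\<close>)

lemma digits_encode:
  assumes "valid lab" "x \<in> H u" "u < N"
  shows "digits u (encode u lab) x = lab x"
proof -
  have "encode u lab div weight u x mod (if x \<in> H u then K else 1) = (if x \<in> H u then lab x else 0)"
    unfolding encode_eq
    by (rule mixed_radix_digit[where b = "\<lambda>x. if x \<in> H u then K else 1"])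
      (use assms H_less in \<open>auto simp: weight_Suc weight_0 valid_def\<close>)
  then show ?thesis using assms(2) by (simp add: digits_def)
qed

text \<open>The encoding forgets the labels outside \<open>H u\<close>, which
  \<open>achieves\<close> does not see.\<close>

lemma achieves_digits_encode:
  assumes "valid lab" "u < N"
  shows "achieves u (digits u (encode u lab)) s \<longleftrightarrow> achieves u lab s"
  using achieves_cong[of lab u "digits u (encode u lab)" s] achieves_cong[of "digits u (encode u lab)" u lab s]
    digits_encode[OF assms(1) _ assms(2)] digits_valid assms(1) by metis

text \<open>The work arrays of the program are the weights, the partial tables and the final tables.\<close>

abbreviation "work \<equiv> {aPw, aP, aTab}"

definition weights_ok :: "store \<Rightarrow> bool" where
  "weights_ok st \<longleftrightarrow> same_except work st0 st \<and> (\<forall>v<N. \<forall>x\<le>N. st aPw (prod_encode (v, x)) = weight v x)"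

lemma work_simps:
  assumes "same_except work st0 st"
  shows "st aN 0 = N" "st aK 0 = K" "st aR 0 = R" "st aH = st0 aH" "st aPos = st0 aPos"
  using assms cells by (auto simp: same_except_def)

lemma wp_weightsC:
  assumes "same_except work st0 st"
  shows "wp I bd weightsC \<rho> weights_ok st"
  unfolding weightsC_def
proof (rule wp_For[where J = "\<lambda>i st'. same_except work st0 st' \<and>
    (\<forall>v<i. \<forall>x\<le>N. st' aPw (prod_encode (v, x)) = weight v x)"])
  fix i st1 assume i: "i < N" and J: "same_except work st0 st1 \<and>
    (\<forall>v<i. \<forall>x\<le>N. st1 aPw (prod_encode (v, x)) = weight v x)"
  define st2 where "st2 = st1(aPw := (st1 aPw)(prod_encode (i, 0) := 1))"
  have s2: "same_except work st0 st2" using J by (simp add: st2_def)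
  have one: "1 \<le> bd aPw" using weight_bounded[OF i, of 0] by (simp add: weight_def)
  have "wp I bd (For rX (Cell aN) (Write aPw (PairE (Var rV) (Var rX \<oplus> Num 1))
       (Arr aPw (PairE (Var rV) (Var rX)) \<otimes> CondE (Arr aH (PairE (Var rV) (Var rX))) (Cell aK) (Num 1))))
     (\<rho>(rV := i)) (\<lambda>st'. same_except work st0 st' \<and> (\<forall>v<Suc i. \<forall>x\<le>N. st' aPw (prod_encode (v, x)) = weight v x)) st2"
  proof (rule wp_fill[where f = "\<lambda>x. prod_encode (i, Suc x)" and h = "\<lambda>x. weight i (Suc x)" and n = N])
    show "val I (Cell aN) (\<rho>(rV := i)) st2 = N" using work_simps[OF s2] by simp
    show "inj_on (\<lambda>x. prod_encode (i, Suc x)) {..<N}" by (auto simp: inj_on_def)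
  next
    fix x st' assume x: "x < N" and s: "same_except {aPw} st2 st'"
      and out: "\<And>j. j \<notin> (\<lambda>x. prod_encode (i, Suc x)) ` {..<N} \<Longrightarrow> st' aPw j = st2 aPw j"
      and prev: "\<And>j. j < x \<Longrightarrow> st' aPw (prod_encode (i, Suc j)) = weight i (Suc j)"
    have s': "same_except work st0 st'" using s s2 by (auto simp: same_except_def)
    have "st' aPw (prod_encode (i, x)) = weight i x"
    proof (cases x)
      case 0
      have "prod_encode (i, 0) \<notin> (\<lambda>x. prod_encode (i, Suc x)) ` {..<N}" by auto
      then show ?thesis using out 0 by (simp add: st2_def weight_def)
    qed (use prev in auto)
    then show "val I (PairE (Var rV) (Var rX \<oplus> Num 1)) (\<rho>(rV := i, rX := x)) st' = prod_encode (i, Suc x) \<and>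
      val I (Arr aPw (PairE (Var rV) (Var rX)) \<otimes> CondE (Arr aH (PairE (Var rV) (Var rX))) (Cell aK) (Num 1))
        (\<rho>(rV := i, rX := x)) st' = weight i (Suc x) \<and> weight i (Suc x) \<le> bd aPw"
      using weight_bounded[OF i, of "Suc x"] work_simps[OF s'] H_cells[OF i x] by (simp add: weight_Suc)
  next
    fix st' assume s: "same_except {aPw} st2 st'"
      and out: "\<And>j. j \<notin> (\<lambda>x. prod_encode (i, Suc x)) ` {..<N} \<Longrightarrow> st' aPw j = st2 aPw j"
      and prev: "\<And>j. j < N \<Longrightarrow> st' aPw (prod_encode (i, Suc j)) = weight i (Suc j)"
    have s': "same_except work st0 st'" using s s2 by (auto simp: same_except_def)
    have "st' aPw (prod_encode (v, x)) = weight v x" if "v < i" "x \<le> N" for v x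
    proof -
      have "prod_encode (v, x) \<notin> (\<lambda>x. prod_encode (i, Suc x)) ` {..<N}" using that by auto
      then show ?thesis using out J that by (simp add: st2_def)
    qed
    moreover have "st' aPw (prod_encode (i, x)) = weight i x" if "x \<le> N" for x
    proof (cases x)
      case 0
      have "prod_encode (i, 0) \<notin> (\<lambda>x. prod_encode (i, Suc x)) ` {..<N}" by auto
      then show ?thesis using out 0 by (simp add: st2_def weight_def)
    qed (use prev that in auto)
    ultimately show "same_except work st0 st' \<and> (\<forall>v<Suc i. \<forall>x\<le>N. st' aPw (prod_encode (v, x)) = weight v x)"
      using s' by (auto simp: less_Suc_eq)
  qed
  then show "wp I bd (Write aPw (PairE (Var rV) (Num 0)) (Num 1) ;;
     For rX (Cell aN) (Write aPw (PairE (Var rV) (Var rX \<oplus> Num 1))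
       (Arr aPw (PairE (Var rV) (Var rX)) \<otimes> CondE (Arr aH (PairE (Var rV) (Var rX))) (Cell aK) (Num 1))))
     (\<rho>(rV := i)) (\<lambda>st'. same_except work st0 st' \<and> (\<forall>v<Suc i. \<forall>x\<le>N. st' aPw (prod_encode (v, x)) = weight v x)) st1"
    using one by (simp add: st2_def)
qed (use assms work_simps[OF assms] in \<open>auto simp: weights_ok_def\<close>)

definition lab_of :: "nat \<Rightarrow> nat \<Rightarrow> nat \<Rightarrow> nat \<Rightarrow> nat" where
  "lab_of v z l = (digits v z)(v := l)"

lemma lab_of_valid: "l < K \<Longrightarrow> valid (lab_of v z l)"
  using digits_valid[of v z] by (auto simp: lab_of_def valid_def)

lemma weights_okD:
  assumes "weights_ok st"
  shows "same_except work st0 st" "\<And>v x. v < N \<Longrightarrow> x \<le> N \<Longrightarrow> st aPw (prod_encode (v, x)) = weight v x"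
  using assms by (auto simp: weights_ok_def)

lemma val_labE:
  assumes "weights_ok st" "\<rho> rV < N" "\<rho> rX < N"
  shows "val I labE \<rho> st = lab_of (\<rho> rV) (\<rho> rZ) (\<rho> rL) (\<rho> rX)"
  using weights_okD[OF assms(1)] work_simps[OF weights_okD(1)[OF assms(1)]] assms(2,3)
  by (simp add: labE_def lab_of_def digits_def)

lemma val_childE:
  assumes "weights_ok st" "\<rho> rV < N" "\<rho> rU < N"
  shows "val I childE \<rho> st = of_bool (par (\<rho> rU) (\<rho> rV))"
proof -
  have "(\<exists>x<N. x \<in> H (\<rho> rU) \<and> pos x < pos (\<rho> rV)) \<longleftrightarrow> (\<exists>x\<in>H (\<rho> rU). pos x < pos (\<rho> rV))"
    using H_less assms(3) by blast
  moreover have "(\<exists>x<N. st0 aH (prod_encode (\<rho> rU, x)) \<noteq> 0 \<and> st0 aPos x < st0 aPos (\<rho> rV)) \<longleftrightarrow>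
      (\<exists>x<N. x \<in> H (\<rho> rU) \<and> pos x < pos (\<rho> rV))"
    using H_cells[OF assms(3)] pos_cells assms(2) by auto
  ultimately show ?thesis
    using work_simps[OF weights_okD(1)[OF assms(1)]] H_cells[OF assms(3,2)] assms(2,3)
    by (auto simp: childE_def par_def)
qed

lemma val_codeE:
  assumes "weights_ok st" "\<rho> rV < N" "\<rho> rU < N"
  shows "val I codeE \<rho> st = encode (\<rho> rU) (lab_of (\<rho> rV) (\<rho> rZ) (\<rho> rL))"
proof -
  have "val I labE (\<rho>(rX := x)) st = lab_of (\<rho> rV) (\<rho> rZ) (\<rho> rL) x" if "x < N" for x
    using val_labE[OF assms(1), of "\<rho>(rX := x)"] assms(2) that by simp
  then show ?thesis
    using work_simps[OF weights_okD(1)[OF assms(1)]] H_cells[OF assms(3)] weights_okD(2)[OF assms(1,3)]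
    by (auto simp: codeE_def encode_def intro!: sum.cong)
qed

lemma val_contribE:
  assumes "weights_ok st" "\<rho> rV < N" "\<rho> rL < K"
  shows "val I (contribE ae be) \<rho> st = contrib (\<rho> rV) (lab_of (\<rho> rV) (\<rho> rZ) (\<rho> rL))"
proof -
  have s: "same_except work st0 st" using weights_okD[OF assms(1)] by blast
  have "val I be (\<rho>(rX := x)) st = \<beta> (\<rho> rV) x (\<rho> rL) (lab_of (\<rho> rV) (\<rho> rZ) (\<rho> rL) x)" if "x < N" for x
    using val_labE[OF assms(1), of "\<rho>(rX := x)"] val_be[OF s, of "\<rho>(rX := x)"] assms(2,3) that by simp
  moreover have "lab_of (\<rho> rV) (\<rho> rZ) (\<rho> rL) (\<rho> rV) = \<rho> rL" by (simp add: lab_of_def)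
  ultimately show ?thesis
    using work_simps[OF s] H_cells[OF assms(2)] val_ae[OF s assms(2,3)]
    by (auto simp: contribE_def contrib_def intro!: sum.cong)
qed

text \<open>Sums from \<open>R\<close> on are not recorded. Contributions are natural numbers, so a
  total below \<open>R\<close> has only parts below \<open>R\<close>, and nothing relevant is
  lost.\<close>

definition tables_ok :: "nat \<Rightarrow> store \<Rightarrow> bool" where
  "tables_ok j st \<longleftrightarrow> (\<forall>u<N. pos u < j \<longrightarrow> (\<forall>z<weight u N. \<forall>s<R.
     st aTab (prod_encode (u, prod_encode (z, s))) = of_bool (achieves u (digits u z) s)))"

lemma weights_ok_update:
  assumes "weights_ok st" "same_except {aP, aTab} st st'"
  shows "weights_ok st'"
  using assms by (auto simp: weights_ok_def same_except_def)

text \<open>Each pass either copies a row or, at a child, convolves it with the child's table, read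
  off at the code of the current labels.\<close>

lemma wp_labelC:
  assumes ok: "weights_ok st" "tables_ok (pos v) st" and v: "v < N" and l: "l < K"
    and \<rho>: "\<rho> rV = v" "\<rho> rZ = z" "\<rho> rL = l"
  shows "wp I bd (labelC ae be) \<rho> (\<lambda>st'. same_except {aP} st st' \<and>
    (\<forall>l' j. l' \<noteq> l \<longrightarrow> st' aP (prod_encode (l', j)) = st aP (prod_encode (l', j))) \<and>
    (\<forall>u\<le>N. \<forall>s<R. st' aP (prod_encode (l, prod_encode (u, s))) = of_bool (partial v (lab_of v z l) u s))) st"
proof -
  define m where "m = lab_of v z l"
  have m: "valid m" using lab_of_valid[OF l] by (simp add: m_def)
  let ?J = "\<lambda>i st'. same_except {aP} st st' \<and>
    (\<forall>l' j. l' \<noteq> l \<longrightarrow> st' aP (prod_encode (l', j)) = st aP (prod_encode (l', j))) \<and>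
    (\<forall>u\<le>i. \<forall>s<R. st' aP (prod_encode (l, prod_encode (u, s))) = of_bool (partial v m u s))"
  have okP: "weights_ok st'" "tables_ok (pos v) st'" if "same_except {aP} st st'" for st'
  proof -
    show "weights_ok st'" using weights_ok_update[OF ok(1)] that by (auto simp: same_except_def)
    show "tables_ok (pos v) st'" using ok(2) same_exceptD[OF that, of aTab] by (simp add: tables_ok_def)
  qed
  note simps = work_simps[OF weights_okD(1)]
  have rec: "wp I bd (For rS (Cell aR) (Write aP (PairE (Var rL) (PairE (Var rU \<oplus> Num 1) (Var rS)))
       (CondE childE
         (AnyE rA (Var rS \<oplus> Num 1) (AndE (Arr aP (PairE (Var rL) (PairE (Var rU) (Var rA))))
            (Arr aTab (PairE (Var rU) (PairE codeE (Monus (Var rS) (Var rA)))))))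
         (Arr aP (PairE (Var rL) (PairE (Var rU) (Var rS))))))) (\<rho>(rU := U)) (?J (Suc U)) st1"
    if U: "U < N" and J: "?J U st1" for U st1
  proof (rule wp_fill[where f = "\<lambda>s. prod_encode (l, prod_encode (Suc U, s))" and
        h = "\<lambda>s. of_bool (partial v m (Suc U) s)" and n = R])
    show "val I (Cell aR) (\<rho>(rU := U)) st1 = R" using simps[OF okP(1)] J by simp
    show "inj_on (\<lambda>s. prod_encode (l, prod_encode (Suc U, s))) {..<R}" by (auto simp: inj_on_def)
  next
    fix s st' assume s: "s < R" and s1: "same_except {aP} st1 st'"
      and out: "\<And>j. j \<notin> (\<lambda>s. prod_encode (l, prod_encode (Suc U, s))) ` {..<R} \<Longrightarrow> st' aP j = st1 aP j"
    have same: "same_except {aP} st st'" using J s1 by (auto intro: same_except_trans)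
    note ok' = okP[OF same]
    have P: "st' aP (prod_encode (l, prod_encode (U, a))) = of_bool (partial v m U a)" if "a < R" for a
    proof -
      have "prod_encode (l, prod_encode (U, a)) \<notin> (\<lambda>s. prod_encode (l, prod_encode (Suc U, s))) ` {..<R}" by auto
      then show ?thesis using out J that by simp
    qed
    have T: "st' aTab (prod_encode (U, prod_encode (encode U m, a))) = of_bool (achieves U m a)" if "par U v" "a < R" for a
    proof -
      \<comment> \<open>A child is eliminated before its parent, so its table is already
        complete.\<close>
      have "pos U < pos v" using par_less[OF that(1)] by blast
      then show ?thesis
        using ok'(2) that(2) encode_less[OF m, of U] achieves_digits_encode[OF m U, of a] U
        unfolding tables_ok_def by simp
    qed
    let ?\<rho> = "\<rho>(rU := U, rS := s)"
    have child: "val I childE ?\<rho> st' = of_bool (par U v)"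
      using val_childE[OF ok'(1), of ?\<rho>] \<rho> v U by simp
    have code: "val I codeE (?\<rho>(rA := a)) st' = encode U m" for a
      using val_codeE[OF ok'(1), of "?\<rho>(rA := a)"] \<rho> v U by (simp add: m_def)
    have "(\<exists>a<s + 1. st' aP (prod_encode (l, prod_encode (U, a))) \<noteq> 0 \<and>
        st' aTab (prod_encode (U, prod_encode (encode U m, s - a))) \<noteq> 0) \<longleftrightarrow> partial v m (Suc U) s" if "par U v"
      unfolding partial_Suc[OF that] using P T[OF that] s by (auto simp: less_Suc_eq_le)
    then show "val I (PairE (Var rL) (PairE (Var rU \<oplus> Num 1) (Var rS))) ?\<rho> st' = prod_encode (l, prod_encode (Suc U, s)) \<and>
      val I (CondE childE
         (AnyE rA (Var rS \<oplus> Num 1) (AndE (Arr aP (PairE (Var rL) (PairE (Var rU) (Var rA))))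
            (Arr aTab (PairE (Var rU) (PairE codeE (Monus (Var rS) (Var rA)))))))
         (Arr aP (PairE (Var rL) (PairE (Var rU) (Var rS))))) ?\<rho> st' = of_bool (partial v m (Suc U) s) \<and>
      of_bool (partial v m (Suc U) s) \<le> bd aP"
      using \<rho> child code P[OF s] partial_Suc_other[of U v m s] bool_bound
      by (cases "par U v") (simp_all del: fun_upd_apply add: fun_upd_same fun_upd_other)
  next
    fix st' assume s1: "same_except {aP} st1 st'"
      and out: "\<And>j. j \<notin> (\<lambda>s. prod_encode (l, prod_encode (Suc U, s))) ` {..<R} \<Longrightarrow> st' aP j = st1 aP j"
      and res: "\<And>s. s < R \<Longrightarrow> st' aP (prod_encode (l, prod_encode (Suc U, s))) = of_bool (partial v m (Suc U) s)"
    have same: "same_except {aP} st st'" using J s1 by (auto intro: same_except_trans)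
    have "st' aP (prod_encode (l, prod_encode (u, s))) = of_bool (partial v m u s)" if "u \<le> U" "s < R" for u s
    proof -
      have "prod_encode (l, prod_encode (u, s)) \<notin> (\<lambda>s. prod_encode (l, prod_encode (Suc U, s))) ` {..<R}"
        using that by auto
      then show ?thesis using out J that by simp
    qed
    moreover have "st' aP (prod_encode (l', j)) = st aP (prod_encode (l', j))" if "l' \<noteq> l" for l' j
    proof -
      have "prod_encode (l', j) \<notin> (\<lambda>s. prod_encode (l, prod_encode (Suc U, s))) ` {..<R}" using that by auto
      then show ?thesis using out J that by simp
    qed
    ultimately show "?J (Suc U) st'" using same res by (auto simp: le_Suc_eq)
  qed
  have first: "wp I bd (For rS (Cell aR) (Write aP (PairE (Var rL) (PairE (Num 0) (Var rS)))
      (EqE (Var rS) (contribE ae be)))) \<rho> (?J 0) st"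
  proof (rule wp_fill[where f = "\<lambda>s. prod_encode (l, prod_encode (0, s))" and
        h = "\<lambda>s. of_bool (partial v m 0 s)" and n = R])
    show "val I (Cell aR) \<rho> st = R" using simps[OF ok(1)] by simp
    show "inj_on (\<lambda>s. prod_encode (l, prod_encode (0, s))) {..<R}" by (auto simp: inj_on_def)
  next
    fix s st' assume s1: "same_except {aP} st st'"
    have "val I (contribE ae be) (\<rho>(rS := s)) st' = contrib v m"
      using val_contribE[OF okP(1)[OF s1], of "\<rho>(rS := s)"] \<rho> v l by (simp add: m_def)
    then show "val I (PairE (Var rL) (PairE (Num 0) (Var rS))) (\<rho>(rS := s)) st' = prod_encode (l, prod_encode (0, s)) \<and>
      val I (EqE (Var rS) (contribE ae be)) (\<rho>(rS := s)) st' = of_bool (partial v m 0 s) \<and>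
      of_bool (partial v m 0 s) \<le> bd aP"
      using \<rho> bool_bound by (simp add: partial_0)
  next
    fix st' assume s1: "same_except {aP} st st'"
      and out: "\<And>j. j \<notin> (\<lambda>s. prod_encode (l, prod_encode (0, s))) ` {..<R} \<Longrightarrow> st' aP j = st aP j"
      and res: "\<And>s. s < R \<Longrightarrow> st' aP (prod_encode (l, prod_encode (0, s))) = of_bool (partial v m 0 s)"
    have "st' aP (prod_encode (l', j)) = st aP (prod_encode (l', j))" if "l' \<noteq> l" for l' j
    proof -
      have "prod_encode (l', j) \<notin> (\<lambda>s. prod_encode (l, prod_encode (0, s))) ` {..<R}" using that by auto
      then show ?thesis using out by simp
    qed
    then show "?J 0 st'" using s1 res by simp
  qed
  show ?thesis
    unfolding labelC_def wp_Seq m_def[symmetric]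
  proof (rule wp_mono[OF first])
    fix st1 assume J0: "?J 0 st1"
    show "wp I bd (For rU (Cell aN) (For rS (Cell aR) (Write aP (PairE (Var rL) (PairE (Var rU \<oplus> Num 1) (Var rS)))
       (CondE childE
         (AnyE rA (Var rS \<oplus> Num 1) (AndE (Arr aP (PairE (Var rL) (PairE (Var rU) (Var rA))))
            (Arr aTab (PairE (Var rU) (PairE codeE (Monus (Var rS) (Var rA)))))))
         (Arr aP (PairE (Var rL) (PairE (Var rU) (Var rS)))))))) \<rho> (?J N) st1"
    proof (rule wp_For[where J = ?J and n = N])
      show "val I (Cell aN) \<rho> st1 = N" using simps[OF okP(1)] J0 by simp
    qed (use J0 rec in auto)
  qed
qed

text \<open>The partial tables are recomputed for every labelling of the later neighbours, so only
  the rows of \<open>aTab\<close> have to be carried along.\<close>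

lemma wp_vertexC:
  assumes ok: "weights_ok st" "tables_ok (pos v) st" and v: "v < N" and \<rho>: "\<rho> rV = v"
  shows "wp I bd (vertexC ae be) \<rho> (\<lambda>st'. same_except {aP, aTab} st st' \<and>
    (\<forall>v' j. v' \<noteq> v \<longrightarrow> st' aTab (prod_encode (v', j)) = st aTab (prod_encode (v', j))) \<and>
    (\<forall>z<weight v N. \<forall>s<R. st' aTab (prod_encode (v, prod_encode (z, s))) = of_bool (achieves v (digits v z) s))) st"
proof -
  let ?J = "\<lambda>i st'. same_except {aP, aTab} st st' \<and>
    (\<forall>v' j. v' \<noteq> v \<longrightarrow> st' aTab (prod_encode (v', j)) = st aTab (prod_encode (v', j))) \<and>
    (\<forall>z<i. \<forall>s<R. st' aTab (prod_encode (v, prod_encode (z, s))) = of_bool (achieves v (digits v z) s))"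
  have okJ: "weights_ok st'" "tables_ok (pos v) st'" if "?J i st'" for i st'
  proof -
    show "weights_ok st'" using weights_ok_update[OF ok(1)] that by blast
    have "u \<noteq> v" if "pos u < pos v" for u using that by auto
    then show "tables_ok (pos v) st'" using ok(2) that unfolding tables_ok_def by metis
  qed
  note simps = work_simps[OF weights_okD(1)]
  show ?thesis
    unfolding vertexC_def
  proof (rule wp_For[where J = ?J and n = "weight v N"])
    show "val I (Arr aPw (PairE (Var rV) (Cell aN))) \<rho> st = weight v N"
      using simps[OF ok(1)] weights_okD(2)[OF ok(1) v order_refl] \<rho> by simp
  next
    fix z st1 assume z: "z < weight v N" and J: "?J z st1"
    note ok1 = okJ[OF J]
    let ?L = "\<lambda>i st'. same_except {aP} st1 st' \<and>
      (\<forall>l<i. \<forall>u\<le>N. \<forall>s<R. st' aP (prod_encode (l, prod_encode (u, s))) = of_bool (partial v (lab_of v z l) u s))"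
    have labels: "wp I bd (For rL (Cell aK) (labelC ae be)) (\<rho>(rZ := z)) (?L K) st1"
    proof (rule wp_For[where J = ?L and n = K])
      show "val I (Cell aK) (\<rho>(rZ := z)) st1 = K" using simps[OF ok1(1)] by simp
    next
      fix l st2 assume l: "l < K" and L: "?L l st2"
      have ok2: "weights_ok st2" "tables_ok (pos v) st2"
      proof -
        show "weights_ok st2" using weights_ok_update[OF ok1(1)] L by (auto simp: same_except_def)
        have "st2 aTab = st1 aTab" using L by (auto simp: same_except_def)
        then show "tables_ok (pos v) st2" using ok1(2) by (simp add: tables_ok_def)
      qed
      have "wp I bd (labelC ae be) (\<rho>(rZ := z, rL := l)) (\<lambda>st'. same_except {aP} st2 st' \<and>
        (\<forall>l' j. l' \<noteq> l \<longrightarrow> st' aP (prod_encode (l', j)) = st2 aP (prod_encode (l', j))) \<and>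
        (\<forall>u\<le>N. \<forall>s<R. st' aP (prod_encode (l, prod_encode (u, s))) = of_bool (partial v (lab_of v z l) u s))) st2"
        by (rule wp_labelC[OF ok2 v l]) (use \<rho> in auto)
      then show "wp I bd (labelC ae be) (\<rho>(rZ := z, rL := l)) (?L (Suc l)) st2"
      proof (rule wp_mono)
        fix st' assume a: "same_except {aP} st2 st' \<and>
        (\<forall>l' j. l' \<noteq> l \<longrightarrow> st' aP (prod_encode (l', j)) = st2 aP (prod_encode (l', j))) \<and>
        (\<forall>u\<le>N. \<forall>s<R. st' aP (prod_encode (l, prod_encode (u, s))) = of_bool (partial v (lab_of v z l) u s))"
        then have "same_except {aP} st1 st'" using L same_except_trans by blast
        then show "?L (Suc l) st'" using a L by (auto simp: less_Suc_eq)
      qed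
    qed auto
    have fill: "wp I bd (For rS (Cell aR) (Write aTab (PairE (Var rV) (PairE (Var rZ) (Var rS)))
       (AnyE rL (Cell aK) (Arr aP (PairE (Var rL) (PairE (Cell aN) (Var rS))))))) (\<rho>(rZ := z)) (?J (Suc z)) st2"
      if L: "?L K st2" for st2
    proof (rule wp_fill[where f = "\<lambda>s. prod_encode (v, prod_encode (z, s))" and
          h = "\<lambda>s. of_bool (achieves v (digits v z) s)" and n = R])
      have same2: "same_except {aP, aTab} st1 st2" using L by (auto simp: same_except_def)
      then have ok2: "weights_ok st2" using weights_ok_update[OF ok1(1)] by blast
      show "val I (Cell aR) (\<rho>(rZ := z)) st2 = R" using simps[OF ok2] by simp
      show "inj_on (\<lambda>s. prod_encode (v, prod_encode (z, s))) {..<R}" by (auto simp: inj_on_def)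
      fix s st' assume s: "s < R" and s2: "same_except {aTab} st2 st'"
      have ok': "weights_ok st'" using weights_ok_update[OF ok2] s2 by (auto simp: same_except_def)
      have "st' aP = st2 aP" using s2 by (auto simp: same_except_def)
      then have "(\<exists>l<K. st' aP (prod_encode (l, prod_encode (N, s))) \<noteq> 0) \<longleftrightarrow> achieves v (digits v z) s"
        unfolding achieves_iff_partial[OF v digits_valid] lab_of_def[symmetric] using L s by auto
      then show "val I (PairE (Var rV) (PairE (Var rZ) (Var rS))) (\<rho>(rZ := z, rS := s)) st' = prod_encode (v, prod_encode (z, s)) \<and>
        val I (AnyE rL (Cell aK) (Arr aP (PairE (Var rL) (PairE (Cell aN) (Var rS))))) (\<rho>(rZ := z, rS := s)) st' =
          of_bool (achieves v (digits v z) s) \<and> of_bool (achieves v (digits v z) s) \<le> bd aTab"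
        using \<rho> simps[OF ok'] bool_bound by simp
    next
      fix st' assume s2: "same_except {aTab} st2 st'"
        and out: "\<And>j. j \<notin> (\<lambda>s. prod_encode (v, prod_encode (z, s))) ` {..<R} \<Longrightarrow> st' aTab j = st2 aTab j"
        and res: "\<And>s. s < R \<Longrightarrow> st' aTab (prod_encode (v, prod_encode (z, s))) = of_bool (achieves v (digits v z) s)"
      have T: "st2 aTab = st1 aTab" using L by (auto simp: same_except_def)
      have "same_except {aP, aTab} st st'" using J L s2 by (auto simp: same_except_def)
      moreover have "st' aTab (prod_encode (v', j)) = st aTab (prod_encode (v', j))" if "v' \<noteq> v" for v' j
      proof -
        have "prod_encode (v', j) \<notin> (\<lambda>s. prod_encode (v, prod_encode (z, s))) ` {..<R}" using that by auto
        then show ?thesis using out J T that by simp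
      qed
      moreover have "st' aTab (prod_encode (v, prod_encode (z', s))) = of_bool (achieves v (digits v z') s)"
        if "z' < z" "s < R" for z' s
      proof -
        have "prod_encode (v, prod_encode (z', s)) \<notin> (\<lambda>s. prod_encode (v, prod_encode (z, s))) ` {..<R}" using that by auto
        then show ?thesis using out J T that by simp
      qed
      ultimately show "?J (Suc z) st'" using res by (auto simp: less_Suc_eq)
    qed
    show "wp I bd (For rL (Cell aK) (labelC ae be) ;;
     For rS (Cell aR) (Write aTab (PairE (Var rV) (PairE (Var rZ) (Var rS)))
       (AnyE rL (Cell aK) (Arr aP (PairE (Var rL) (PairE (Cell aN) (Var rS))))))) (\<rho>(rZ := z)) (?J (Suc z)) st1"
      unfolding wp_Seq by (rule wp_mono[OF labels fill])
  qed auto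
qed

lemma wp_sumsC:
  assumes s0: "same_except work st0 st"
  shows "wp I bd (sumsC ae be) \<rho> (\<lambda>st'. same_except work st0 st' \<and>
    (\<forall>s<R. st' aTab (prod_encode (root, prod_encode (0, s))) =
      of_bool (\<exists>lab. (\<forall>x<N. lab x < K) \<and> s = (\<Sum>y<N. contrib y lab)))) st"
proof -
  let ?J = "\<lambda>j st'. weights_ok st' \<and> tables_ok j st'"
  note simps = work_simps[OF weights_okD(1)]
  have inner: "wp I bd (For rV (Cell aN) (If (EqE (Arr aPos (Var rV)) (Var rJ)) (vertexC ae be) Skip))
      (\<rho>(rJ := j)) (?J (Suc j)) st1" if J: "?J j st1" for j st1
  proof (rule wp_For[where n = N and J = "\<lambda>i st'. weights_ok st' \<and> tables_ok j st' \<and>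
      (\<forall>u<i. pos u = j \<longrightarrow> (\<forall>z<weight u N. \<forall>s<R.
        st' aTab (prod_encode (u, prod_encode (z, s))) = of_bool (achieves u (digits u z) s)))"])
    show "val I (Cell aN) (\<rho>(rJ := j)) st1 = N" using simps J by simp
  next
    fix v st2 assume v: "v < N" and L: "weights_ok st2 \<and> tables_ok j st2 \<and>
      (\<forall>u<v. pos u = j \<longrightarrow> (\<forall>z<weight u N. \<forall>s<R.
        st2 aTab (prod_encode (u, prod_encode (z, s))) = of_bool (achieves u (digits u z) s)))"
    have cond: "val I (EqE (Arr aPos (Var rV)) (Var rJ)) (\<rho>(rJ := j, rV := v)) st2 = of_bool (pos v = j)"
      using simps L pos_cells[OF v] by simp
    show "wp I bd (If (EqE (Arr aPos (Var rV)) (Var rJ)) (vertexC ae be) Skip) (\<rho>(rJ := j, rV := v))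
      (\<lambda>st'. weights_ok st' \<and> tables_ok j st' \<and> (\<forall>u<Suc v. pos u = j \<longrightarrow> (\<forall>z<weight u N. \<forall>s<R.
        st' aTab (prod_encode (u, prod_encode (z, s))) = of_bool (achieves u (digits u z) s)))) st2"
    proof (cases "pos v = j")
      case True
      have "wp I bd (vertexC ae be) (\<rho>(rJ := j, rV := v)) (\<lambda>st'. same_except {aP, aTab} st2 st' \<and>
        (\<forall>v' j. v' \<noteq> v \<longrightarrow> st' aTab (prod_encode (v', j)) = st2 aTab (prod_encode (v', j))) \<and>
        (\<forall>z<weight v N. \<forall>s<R. st' aTab (prod_encode (v, prod_encode (z, s))) = of_bool (achieves v (digits v z) s))) st2"
        by (rule wp_vertexC[OF _ _ v]) (use L True in auto)
      then have "wp I bd (vertexC ae be) (\<rho>(rJ := j, rV := v))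
        (\<lambda>st'. weights_ok st' \<and> tables_ok j st' \<and> (\<forall>u<Suc v. pos u = j \<longrightarrow> (\<forall>z<weight u N. \<forall>s<R.
          st' aTab (prod_encode (u, prod_encode (z, s))) = of_bool (achieves u (digits u z) s)))) st2"
      proof (rule wp_mono, elim conjE, intro conjI)
        fix st' assume s: "same_except {aP, aTab} st2 st'"
          and o: "\<forall>v' j. v' \<noteq> v \<longrightarrow> st' aTab (prod_encode (v', j)) = st2 aTab (prod_encode (v', j))"
          and n: "\<forall>z<weight v N. \<forall>s<R. st' aTab (prod_encode (v, prod_encode (z, s))) = of_bool (achieves v (digits v z) s)"
        show "weights_ok st'" using weights_ok_update s L by blast
        have "u \<noteq> v" if "pos u < j" for u using that True by auto
        then show "tables_ok j st'" using L o unfolding tables_ok_def by metis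
        show "\<forall>u<Suc v. pos u = j \<longrightarrow> (\<forall>z<weight u N. \<forall>s<R.
          st' aTab (prod_encode (u, prod_encode (z, s))) = of_bool (achieves u (digits u z) s))"
          using L o n by (metis less_SucE)
      qed
      then show ?thesis using cond True by simp
    next
      case False
      then show ?thesis using cond L by (auto simp: less_Suc_eq)
    qed
  next
    fix st' assume "weights_ok st' \<and> tables_ok j st' \<and>
      (\<forall>u<N. pos u = j \<longrightarrow> (\<forall>z<weight u N. \<forall>s<R.
        st' aTab (prod_encode (u, prod_encode (z, s))) = of_bool (achieves u (digits u z) s)))"
    then show "?J (Suc j) st'" unfolding tables_ok_def by (auto simp: less_Suc_eq)
  qed (use J in auto)
  show ?thesis
    unfolding sumsC_def wp_Seq
  proof (rule wp_mono[OF wp_weightsC[OF s0]], rule wp_For[where J = ?J and n = "N * N"])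
    fix st1 assume w: "weights_ok st1"
    show "?J 0 st1" using w by (simp add: tables_ok_def)
    show "val I (Cell aN \<otimes> Cell aN) \<rho> st1 = N * N" using simps[OF w] by simp
    fix st' assume J: "?J (N * N) st'"
    \<comment> \<open>The subtree of the root consists of all vertices, so labels outside it do not
      matter, and the entry at index 0 gives the answer.\<close>
    have "pos root < N * N" using order root_less by (auto simp: elim_order_def)
    moreover have "0 < weight root N" using K_pos by (simp add: weight_def)
    ultimately have "\<forall>s<R. st' aTab (prod_encode (root, prod_encode (0, s))) = of_bool (achieves root (digits root 0) s)"
      using J root_less unfolding tables_ok_def by blast
    then show "same_except work st0 st' \<and> (\<forall>s<R. st' aTab (prod_encode (root, prod_encode (0, s))) =
      of_bool (\<exists>lab. (\<forall>x<N. lab x < K) \<and> s = (\<Sum>y<N. contrib y lab)))"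
      using J weights_okD(1) achieves_root[OF digits_valid] by auto
  qed (use inner in auto)
qed

end

section \<open>Computing an elimination order\<close>

abbreviation (input) "aN0 \<equiv> 9 :: nat"
abbreviation (input) "aKk \<equiv> 10 :: nat"
abbreviation (input) "aH2 \<equiv> 11 :: nat"
abbreviation (input) "aF \<equiv> 12 :: nat"
abbreviation (input) "aPos2 \<equiv> 13 :: nat"
abbreviation (input) "aBlk \<equiv> 14 :: nat"
abbreviation (input) "aS \<equiv> 15 :: nat"
abbreviation (input) "aFx \<equiv> 16 :: nat"

abbreviation (input) "vI \<equiv> 8 :: nat"
abbreviation (input) "vV \<equiv> 9 :: nat"
abbreviation (input) "vU \<equiv> 10 :: nat"
abbreviation (input) "vX \<equiv> 11 :: nat"
abbreviation (input) "vY \<equiv> 12 :: nat"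
abbreviation (input) "vL \<equiv> 13 :: nat"
abbreviation (input) "vS \<equiv> 14 :: nat"

definition adjE :: "expr \<Rightarrow> expr \<Rightarrow> expr" where
  "adjE u x = Input (Num 5 \<oplus> u \<otimes> Cell aN0 \<oplus> x)"

abbreviation (input) "radixE \<equiv> Cell aN0 \<oplus> Num 1"
abbreviation (input) "regionE x \<equiv> Arr aBlk x \<oplus> Arr aS x"

text \<open>
  Base \<open>n + 1\<close> digits of the sum: the size of the separator, and the numbers of vertices of \<open>aS\<close>
  on the two sides. A violated constraint adds \<open>(n + 1)\<^sup>3\<close>, which pushes the sum out of range.
\<close>

definition sepA :: expr where
  "sepA = AndE (regionE (Var rV)) (EqE (Var rL) (Num 2))
     \<oplus> radixE \<otimes> AndE (Arr aS (Var rV)) (EqE (Var rL) (Num 0))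
     \<oplus> radixE \<otimes> radixE \<otimes> AndE (Arr aS (Var rV)) (EqE (Var rL) (Num 1))
     \<oplus> Cell aR \<otimes> AndE (Less (Arr aFx (Var rV)) (Num 3)) (NotE (EqE (Arr aFx (Var rV)) (Var rL)))"

definition sepB :: expr where
  "sepB = Cell aR \<otimes> AndE (AndE (adjE (Var rV) (Var rX)) (AndE (regionE (Var rV)) (regionE (Var rX))))
     (EqE (Var rL \<oplus> labE) (Num 1))"

text \<open>The thresholds refer to a boundary of 8k vertices: a balanced separator leaves at most
  6k of them on a side, and strictly less than 7k leaves room for one further separator
  vertex.\<close>

definition feasE :: expr where
  "feasE = AnyE vS (Cell aR) (AndE (Arr aTab (PairE (Monus (Cell aN) (Num 1)) (PairE (Num 0) (Var vS))))
     (AndE (Less (Var vS \<odot> radixE) (Cell aKk \<oplus> Num 1))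
     (AndE (Less (Var vS \<oslash> radixE \<odot> radixE) (Num 7 \<otimes> Cell aKk))
       (Less (Var vS \<oslash> (radixE \<otimes> radixE)) (Num 7 \<otimes> Cell aKk)))))"

text \<open>Labels are fixed one vertex at a time, keeping the constraints satisfiable; 3 means not fixed.\<close>

definition fixC :: cmd where
  "fixC = If (EqE (Arr aFx (Var vY)) (Num 3)) (Write aFx (Var vY) (Var vL) ;; sumsC sepA sepB ;;
     If feasE Skip (Write aFx (Var vY) (Num 3))) Skip"

text \<open>If \<open>vV\<close> is still unfixed, there is no suitable labelling for the current k
  at all. Then k is raised and all labels become 0: for the larger k the boundary counts as small,
  and \<open>vV\<close> alone can serve as separator.\<close>

definition splitC :: cmd where
  "splitC =
     For vY (Cell aN) (Write aFx (Var vY) (Num 3)) ;;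
     For vY (Cell aN) (For vL (Num 3) fixC) ;;
     If (EqE (Arr aFx (Var vV)) (Num 3))
       (Write aKk (Num 0) (Cell aKk \<oplus> Num 1) ;; For vY (Cell aN) (Write aFx (Var vY) (Num 0))) Skip"

definition rowE :: expr where
  "rowE = NotE (NotE (
     AndE (Arr aS (Var vX)) (EqE (Arr aFx (Var vU)) (Num 2) \<oplus> EqE (Arr aFx (Var vX)) (Num 2) \<oplus>
       EqE (Arr aFx (Var vX)) (Arr aFx (Var vU))) \<oplus>
     AndE (AndE (Arr aBlk (Var vX)) (EqE (Arr aFx (Var vX)) (Num 2)))
       (CondE (EqE (Arr aFx (Var vU)) (Num 2)) (Less (Var vX) (Var vU)) (Num 1))))"

text \<open>Round \<open>vV\<close> owns the block of N positions from
  \<open>(N - 1 - vV) * N\<close> on. The blocks move down as the rounds advance, because the order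
  is built from its end.\<close>

definition insertC :: cmd where
  "insertC = For vU (Cell aN) (If (Arr aBlk (Var vU))
     (For vX (Cell aN) (Write aH2 (PairE (Var vU) (Var vX)) rowE) ;;
      If (EqE (Arr aFx (Var vU)) (Num 2))
        (Write aF (Var vU) (Num 1) ;;
         Write aPos2 (Var vU) (Monus (Monus (Cell aN) (Num 1)) (Var vV) \<otimes> Cell aN \<oplus>
           Monus (Monus (Cell aN) (Num 1)) (Var vU))) Skip) Skip)"

text \<open>\<open>vV\<close> is labelled 2 in any case, so its round places at least
  \<open>vV\<close>, and one round per vertex suffices.\<close>

definition placeC :: cmd where
  "placeC =
     For vU (Cell aN) (Write aBlk (Var vU) (AndE (NotE (Arr aF (Var vU)))
       (AllE vX (Cell aN) (EqE (NotE (Arr aH2 (PairE (Var vU) (Var vX)))) (NotE (Arr aH2 (PairE (Var vV) (Var vX)))))))) ;;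
     For vX (Cell aN) (Write aS (Var vX) (NotE (NotE (Arr aH2 (PairE (Var vV) (Var vX)))))) ;;
     For vY (Cell aN) (Write aFx (Var vY) (Num 0)) ;;
     If (Less (Sum vX (Cell aN) (Arr aS (Var vX))) (Num 8 \<otimes> Cell aKk)) Skip splitC ;;
     Write aFx (Var vV) (Num 2) ;;
     insertC"

text \<open>The new order is built in \<open>aH2\<close> and \<open>aPos2\<close> and copied only at
  the end, since the separator search eliminates along the old order.\<close>

definition compressC :: cmd where
  "compressC =
     For vV (Cell aN) (Write aF (Var vV) (Num 0) ;;
       For vX (Cell aN) (Write aH2 (PairE (Var vV) (Var vX)) (Num 0))) ;;
     For vV (Cell aN) (If (Arr aF (Var vV)) Skip placeC) ;;
     For vV (Cell aN) (Write aPos (Var vV) (Arr aPos2 (Var vV)) ;;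
       For vX (Cell aN) (Write aH (PairE (Var vV) (Var vX)) (NotE (NotE (Arr aH2 (PairE (Var vV) (Var vX)))))))"

definition extendC :: cmd where
  "extendC =
     Write aN (Num 0) (Var vI \<oplus> Num 1) ;;
     For vX (Var vI) (Write aH (PairE (Var vX) (Var vI)) (Num 1)) ;;
     For vX (Var vI \<oplus> Num 1) (Write aH (PairE (Var vI) (Var vX)) (Num 0)) ;;
     Write aPos (Var vI) (Var vI \<otimes> Var vI)"

text \<open>The extra round \<open>vI = n\<close> adds the dummy root for the main computation. It
  is not followed by a compression, as one more later neighbour per vertex is harmless.\<close>

definition orderC :: cmd where
  "orderC =
     Write aKk (Num 0) (Num 1) ;; Write aK (Num 0) (Num 3) ;; Write aR (Num 0) (radixE \<otimes> radixE \<otimes> radixE) ;;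
     For vI (Cell aN0 \<oplus> Num 1) (extendC ;; If (Less (Var vI) (Cell aN0)) compressC Skip)"

section \<open>Correctness of the order computation\<close>

definition rows :: "nat \<Rightarrow> store \<Rightarrow> nat \<Rightarrow> nat \<Rightarrow> nat set" where
  "rows a st N u = {x. x < N \<and> st a (prod_encode (u, x)) \<noteq> 0}"

definition flags :: "nat \<Rightarrow> store \<Rightarrow> nat \<Rightarrow> nat set" where
  "flags a st N = {u. u < N \<and> st a u \<noteq> 0}"

lemma sum_of_bool_card: "(\<Sum>y<N :: nat. of_bool (P y)) = card {y. y < N \<and> P y}"
proof -
  have "(\<Sum>y<N. of_bool (P y) :: nat) = (\<Sum>y\<in>{y. y < N \<and> P y}. 1)"
    by (rule sum.mono_neutral_cong_right) auto
  then show ?thesis by simp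
qed

text \<open>\<open>L\<close> is a common lower bound on the limits of all arrays except the result
  array. The program never reads \<open>w\<close>, which enters only through the bounds to be
  respected.\<close>

locale order_program =
  fixes I bd :: "nat \<Rightarrow> nat" and n w L :: nat and E :: "nat set set"
  assumes graph: "simple_graph {..<n} E" and tw: "treewidth {..<n} E \<le> w"
    and input: "\<And>u x. u < n \<Longrightarrow> x < n \<Longrightarrow> I (5 + u * n + x) = of_bool ({u, x} \<in> E)"
    and bd: "\<And>a. 1 \<le> a \<Longrightarrow> L \<le> bd a"
    and L: "3 ^ (9 * w + 10) \<le> L" "(n + 1) * (n + 1) * (n + 1) \<le> L" "w + 1 \<le> L"
begin

abbreviation adj :: "nat \<Rightarrow> nat \<Rightarrow> bool" where "adj u x \<equiv> {u, x} \<in> E"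

lemma adj_sym: "adj x y \<Longrightarrow> adj y x"
  by (simp add: insert_commute)

lemma adj_irrefl: "\<not> adj x x"
  using graph by (force simp: simple_graph_def)

lemma adj_less: "adj x y \<Longrightarrow> x < n \<and> y < n"
  using graph by (auto simp: simple_graph_def)

lemma small_bounds: "1 \<le> a \<Longrightarrow> 1 \<le> bd a" "1 \<le> a \<Longrightarrow> 3 \<le> bd a" "1 \<le> a \<Longrightarrow> n * n \<le> bd a" "1 \<le> a \<Longrightarrow> n + 1 \<le> bd a"
proof -
  have "(3 :: nat) ^ 1 \<le> 3 ^ (9 * w + 10)" by (intro power_increasing) auto
  then have "3 \<le> L" using L(1) by simp
  moreover have "n * n \<le> (n + 1) * (n + 1) * (n + 1)" "n + 1 \<le> (n + 1) * (n + 1) * (n + 1)" by (auto simp: algebra_simps)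
  ultimately have "1 \<le> L" "3 \<le> L" "n * n \<le> L" "n + 1 \<le> L" using L(2) by linarith+
  then show "1 \<le> a \<Longrightarrow> 1 \<le> bd a" "1 \<le> a \<Longrightarrow> 3 \<le> bd a" "1 \<le> a \<Longrightarrow> n * n \<le> bd a" "1 \<le> a \<Longrightarrow> n + 1 \<le> bd a"
    using bd[of a] by linarith+
qed

definition good :: "nat \<Rightarrow> nat set \<Rightarrow> nat set \<Rightarrow> nat \<Rightarrow> (nat \<Rightarrow> nat) \<Rightarrow> bool" where
  "good N U S k lab \<longleftrightarrow> (\<forall>x<N. lab x < 3) \<and> (\<forall>x\<in>U \<union> S. \<forall>y\<in>U \<union> S. adj x y \<longrightarrow> lab x + lab y \<noteq> 1) \<and>
     card {x \<in> U \<union> S. lab x = 2} \<le> k \<and> card {x \<in> S. lab x = 0} < 7 * k \<and> card {x \<in> S. lab x = 1} < 7 * k"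

lemma good_cong:
  assumes "U \<union> S \<subseteq> {..<N}" "\<And>x. x < N \<Longrightarrow> lab x = lab' x" "good N U S k lab"
  shows "good N U S k lab'"
proof -
  have "{x \<in> U \<union> S. lab' x = 2} = {x \<in> U \<union> S. lab x = 2}" "{x \<in> S. lab' x = 0} = {x \<in> S. lab x = 0}"
    "{x \<in> S. lab' x = 1} = {x \<in> S. lab x = 1}" using assms(1,2) by auto
  moreover have "lab' x = lab x" if "x \<in> U \<union> S" for x using that assms(1,2) by auto
  ultimately show ?thesis using assms(2,3) unfolding good_def by auto
qed

text \<open>\<open>balanced_labelling\<close> leaves at most 6k of the 8k vertices on a side, which
  is below 7k because k is positive.\<close>

lemma good_exists:
  assumes "w + 1 \<le> k" "U \<union> S \<subseteq> {..<N}" "N \<le> n" "card S = 8 * k"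
  shows "\<exists>lab. good N U S k lab"
proof -
  have "S \<subseteq> {..<n}" using assms by auto
  then obtain lab where lab: "\<forall>x. lab x \<le> (2 :: nat)" "\<forall>x y. adj x y \<longrightarrow> lab x + lab y \<noteq> 1"
    "card {x \<in> {..<n}. lab x = 2} \<le> w + 1" "4 * card {x \<in> S. lab x = 0} \<le> 3 * card S" "4 * card {x \<in> S. lab x = 1} \<le> 3 * card S"
    using balanced_labelling[OF graph tw] by blast
  have "card {x \<in> U \<union> S. lab x = 2} \<le> card {x \<in> {..<n}. lab x = 2}"
    using assms by (intro card_mono) auto
  then have "card {x \<in> U \<union> S. lab x = 2} \<le> k" using lab(3) assms(1) by linarith
  moreover have "card {x \<in> S. lab x = 0} < 7 * k" "card {x \<in> S. lab x = 1} < 7 * k" using lab(4,5) assms(1,4) by linarith+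
  moreover have "lab x < 3" for x using lab(1) by (metis le_imp_less_Suc numeral_3_eq_3 numeral_2_eq_2)
  ultimately show ?thesis using lab(2) unfolding good_def by blast
qed

text \<open>The row bound is 9(w + 1) from the last compression plus one for the newest vertex,
  which lies in every other row and serves as root.\<close>

definition order_ok :: "nat \<Rightarrow> store \<Rightarrow> bool" where
  "order_ok N st \<longleftrightarrow> st aN 0 = N \<and> st aK 0 = 3 \<and> st aR 0 = (n + 1) * (n + 1) * (n + 1) \<and> st aN0 0 = n \<and>
     1 \<le> N \<and> N \<le> n \<and> elim_order N adj (st aPos) (rows aH st N) \<and>
     (\<forall>u<N. card (rows aH st N u) \<le> 9 * w + 10 \<and> (u \<noteq> N - 1 \<longrightarrow> N - 1 \<in> rows aH st N u))"

text \<open>A single penalty already reaches \<open>R\<close>, so the recorded sums are exactly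
  those of labellings without violation, and their digits are the cardinalities to be
  compared.\<close>

lemma wp_query:
  assumes ok: "order_ok N st" and U: "U = flags aBlk st N" and S: "S = flags aS st N"
    and fx: "fx = st aFx" "\<And>y. y < N \<Longrightarrow> fx y \<le> 3" and k: "k = st aKk 0"
  shows "wp I bd (sumsC sepA sepB) \<rho> (\<lambda>st'. same_except {aPw, aP, aTab} st st' \<and>
    (\<forall>\<rho>'. val I feasE \<rho>' st' = of_bool (\<exists>lab. good N U S k lab \<and> (\<forall>y<N. fx y \<noteq> 3 \<longrightarrow> lab y = fx y)))) st"
proof -
  define b where "b = n + 1"
  define R where "R = b * b * b"
  let ?W = "U \<union> S"
  define \<alpha> where "\<alpha> y l = of_bool (y \<in> ?W \<and> l = 2) + b * of_bool (y \<in> S \<and> l = 0) + b * b * of_bool (y \<in> S \<and> l = 1) +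
    R * of_bool (fx y < 3 \<and> fx y \<noteq> l)" for y l :: nat
  define \<beta> where "\<beta> y x l l' = R * of_bool (adj y x \<and> y \<in> ?W \<and> x \<in> ?W \<and> l + l' = 1)" for y x l l' :: nat
  let ?H = "rows aH st N" and ?pos = "st aPos"
  note ok' = ok[unfolded order_ok_def]
  have N: "1 \<le> N" "N \<le> n" using ok' by auto
  have cs: "st aN 0 = N" "st aK 0 = 3" "st aR 0 = R" "st aN0 0 = n" using ok' by (auto simp: R_def b_def)
  interpret sums_program I bd st N 3 R adj ?H ?pos \<alpha> \<beta> sepA sepB "N - 1"
  proof
    show "st aH (prod_encode (u, x)) \<noteq> 0 \<longleftrightarrow> x \<in> ?H u" if "u < N" "x < N" for u x using that by (simp add: rows_def)
    show "elim_order N adj ?pos ?H" using ok' by blast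
    show "N - 1 \<in> ?H u" if "u < N" "u \<noteq> N - 1" for u using ok' that by blast
    show "3 ^ card (?H u) \<le> bd aPw" if "u < N" for u
    proof -
      have "(3 :: nat) ^ card (?H u) \<le> 3 ^ (9 * w + 10)" using ok' that by (intro power_increasing) auto
      then show ?thesis using L(1) bd[of aPw] by linarith
    qed
    fix \<rho> :: env and st' :: store assume s: "same_except {aPw, aP, aTab} st st'" and v: "\<rho> rV < N"
    have eq: "st' aBlk = st aBlk" "st' aS = st aS" "st' aFx = st aFx" "st' aR = st aR" "st' aN0 = st aN0"
      using s by (auto simp: same_except_def)
    have mem: "(st aBlk y + st aS y \<noteq> 0) = (y \<in> ?W)" "(st aS y \<noteq> 0) = (y \<in> S)" if "y < N" for y
      using that by (auto simp: U S flags_def)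
    show "val I sepA \<rho> st' = \<alpha> (\<rho> rV) (\<rho> rL)"
      unfolding sepA_def val.simps val_AndE val_EqE val_NotE arith.simps eq cs mem[OF v] \<alpha>_def
      by (simp add: fx(1) b_def)
    show "val I sepB \<rho> st' = \<beta> (\<rho> rV) (\<rho> rX) (\<rho> rL) (val I labE \<rho> st')" if "\<rho> rX < N"
      unfolding sepB_def val.simps val_AndE val_EqE val_NotE arith.simps eq cs mem[OF v] mem[OF that] \<beta>_def adjE_def
      using input[of "\<rho> rV" "\<rho> rX"] v that N by auto
  qed (use cs N small_bounds in auto)
  define X where "X lab = card {x \<in> ?W. lab x = (2 :: nat)}" for lab
  define Y where "Y l lab = card {x \<in> S. lab x = (l :: nat)}" for l lab
  define V :: "(nat \<Rightarrow> nat) \<Rightarrow> nat" where "V lab = (\<Sum>y<N. of_bool (fx y < 3 \<and> fx y \<noteq> lab y)) + (\<Sum>y<N. \<Sum>x<N. if x \<in> ?H y then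
    of_bool (adj y x \<and> y \<in> ?W \<and> x \<in> ?W \<and> lab y + lab x = 1) else 0)" for lab
  have sub: "?W \<subseteq> {..<N}" "S \<subseteq> {..<N}" by (auto simp: U S flags_def)
  have total: "(\<Sum>y<N. contrib y lab) = X lab + b * Y 0 lab + b * b * Y 1 lab + R * V lab" for lab
  proof -
    have "{y. y < N \<and> y \<in> ?W \<and> lab y = 2} = {x \<in> ?W. lab x = 2}" "{y. y < N \<and> y \<in> S \<and> lab y = l} = {x \<in> S. lab x = l}" for l
      using sub by auto
    then have c: "(\<Sum>y<N. of_bool (y \<in> ?W \<and> lab y = 2)) = X lab" "(\<Sum>y<N. of_bool (y \<in> S \<and> lab y = l)) = Y l lab" for l
      unfolding sum_of_bool_card X_def Y_def by simp_all
    have "(\<Sum>x<N. if x \<in> ?H y then \<beta> y x (lab y) (lab x) else 0) = R * (\<Sum>x<N. if x \<in> ?H y then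
      of_bool (adj y x \<and> y \<in> ?W \<and> x \<in> ?W \<and> lab y + lab x = 1) else 0)" for y
      unfolding sum_distrib_left \<beta>_def by (intro sum.cong) auto
    then have "(\<Sum>y<N. contrib y lab) = (\<Sum>y<N. of_bool (y \<in> ?W \<and> lab y = 2)) + b * (\<Sum>y<N. of_bool (y \<in> S \<and> lab y = 0)) +
      b * b * (\<Sum>y<N. of_bool (y \<in> S \<and> lab y = 1)) + R * V lab"
      unfolding contrib_def \<alpha>_def V_def
      by (simp add: sum.distrib sum_distrib_left distrib_left)
    then show ?thesis unfolding c .
  qed
  have V0: "V lab = 0 \<longleftrightarrow> (\<forall>y<N. fx y \<noteq> 3 \<longrightarrow> lab y = fx y) \<and> (\<forall>x\<in>?W. \<forall>y\<in>?W. adj x y \<longrightarrow> lab x + lab y \<noteq> 1)" for lab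
  proof -
    \<comment> \<open>Each edge lies in the row of the end eliminated first, so testing rows misses
      no edge.\<close>
    have ord: "x \<in> ?H y \<or> y \<in> ?H x" if "adj y x" "x < N" "y < N" for x y
    proof -
      have "x \<noteq> y" using that(1) adj_irrefl by metis
      then have "?pos x \<noteq> ?pos y" using pos_inj that by (auto dest: inj_onD)
      moreover have "v \<in> ?H u" if "u < N" "v < N" "adj u v" "?pos u < ?pos v" for u v
        using order that unfolding elim_order_def by blast
      ultimately show ?thesis using that adj_sym by (metis linorder_neqE_nat)
    qed
    have "V lab = 0 \<longleftrightarrow> (\<forall>y<N. \<not> (fx y < 3 \<and> fx y \<noteq> lab y)) \<and>
      (\<forall>y<N. \<forall>x<N. x \<in> ?H y \<longrightarrow> \<not> (adj y x \<and> y \<in> ?W \<and> x \<in> ?W \<and> lab y + lab x = 1))"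
      by (auto simp: V_def)
    also have "(\<forall>y<N. \<not> (fx y < 3 \<and> fx y \<noteq> lab y)) \<longleftrightarrow> (\<forall>y<N. fx y \<noteq> 3 \<longrightarrow> lab y = fx y)"
      using fx(2) by (metis le_neq_implies_less less_irrefl)
    also have "(\<forall>y<N. \<forall>x<N. x \<in> ?H y \<longrightarrow> \<not> (adj y x \<and> y \<in> ?W \<and> x \<in> ?W \<and> lab y + lab x = 1)) \<longleftrightarrow>
      (\<forall>x\<in>?W. \<forall>y\<in>?W. adj x y \<longrightarrow> lab x + lab y \<noteq> 1)"
    proof (intro iffI ballI impI notI allI)
      fix x y assume a: "\<forall>y<N. \<forall>x<N. x \<in> ?H y \<longrightarrow> \<not> (adj y x \<and> y \<in> ?W \<and> x \<in> ?W \<and> lab y + lab x = 1)"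
        and xy: "x \<in> ?W" "y \<in> ?W" "adj x y" "lab x + lab y = 1"
      have l: "x < N" "y < N" using xy sub by auto
      from ord[OF xy(3) l(2,1)] show False using a xy l adj_sym[OF xy(3)] by (metis add.commute)
    next
      fix x y assume "\<forall>x\<in>?W. \<forall>y\<in>?W. adj x y \<longrightarrow> lab x + lab y \<noteq> 1"
        "adj y x \<and> y \<in> ?W \<and> x \<in> ?W \<and> lab y + lab x = 1"
      then show False by blast
    qed
    finally show ?thesis .
  qed
  have lt: "X lab < b" "Y l lab < b" for lab l
  proof -
    have "card A < b" if "A \<subseteq> {..<N}" for A :: "nat set"
      using card_mono[OF _ that] N(2) by (simp add: b_def less_Suc_eq_le)
    moreover have "{x \<in> ?W. lab x = 2} \<subseteq> {..<N}" "{x \<in> S. lab x = l} \<subseteq> {..<N}" using sub by auto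
    ultimately show "X lab < b" "Y l lab < b" unfolding X_def Y_def by blast+
  qed
  have b0: "0 < b" by (simp add: b_def)
  \<comment> \<open>The cardinalities are at most n, so there is no carry in base n + 1.\<close>
  have small: "x + b * y + b * b * z < R" if "x < b" "y < b" "z < b" for x y z
  proof -
    have "x + b * y < b * b"
    proof -
      have "x + b * y < b * Suc y" using that by simp
      also have "\<dots> \<le> b * b" using that by (intro mult_le_mono2) simp
      finally show ?thesis .
    qed
    then have "x + b * y + b * b * z < b * b * Suc z" by simp
    also have "\<dots> \<le> R" unfolding R_def using that by (intro mult_le_mono2) simp
    finally show ?thesis .
  qed
  have dig: "(x + b * y + b * b * z) mod b = x" "(x + b * y + b * b * z) div b mod b = y"
    "(x + b * y + b * b * z) div (b * b) = z" if "x < b" "y < b" for x y z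
  proof -
    have e: "x + b * y + b * b * z = x + b * (y + b * z)" by (simp add: algebra_simps)
    have "(x + b * y + b * b * z) mod b = x" "(x + b * y + b * b * z) div b = y + b * z"
      unfolding e using that by simp_all
    then show "(x + b * y + b * b * z) mod b = x" "(x + b * y + b * b * z) div b mod b = y"
      "(x + b * y + b * b * z) div (b * b) = z" using that by (simp_all add: div_mult2_eq)
  qed
  have feas: "(\<exists>s<R. (\<exists>lab. (\<forall>x<N. lab x < 3) \<and> s = (\<Sum>y<N. contrib y lab)) \<and> s mod b < k + 1 \<and> s div b mod b < 7 * k \<and> s div (b * b) < 7 * k)
    \<longleftrightarrow> (\<exists>lab. good N U S k lab \<and> (\<forall>y<N. fx y \<noteq> 3 \<longrightarrow> lab y = fx y))" (is "?l \<longleftrightarrow> ?r")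
  proof
    assume ?l
    then obtain lab where lab: "\<forall>x<N. lab x < 3" and s: "(\<Sum>y<N. contrib y lab) < R" "(\<Sum>y<N. contrib y lab) mod b < k + 1"
      "(\<Sum>y<N. contrib y lab) div b mod b < 7 * k" "(\<Sum>y<N. contrib y lab) div (b * b) < 7 * k" by blast
    have v: "V lab = 0"
    proof (rule ccontr)
      assume "V lab \<noteq> 0"
      then have "R \<le> R * V lab" by (cases "V lab") auto
      then show False using s(1) total[of lab] by linarith
    qed
    then have "X lab < k + 1" "Y 0 lab < 7 * k" "Y 1 lab < 7 * k"
      using s(2-4) total[of lab] dig[OF lt(1) lt(2), of lab 0 lab] by simp_all
    then show ?r using V0[of lab] v lab unfolding good_def X_def Y_def by auto
  next
    assume ?r
    then obtain lab where g: "good N U S k lab" and f: "\<forall>y<N. fx y \<noteq> 3 \<longrightarrow> lab y = fx y" by blast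
    have "V lab = 0" using V0[of lab] g f unfolding good_def by blast
    then have "(\<Sum>y<N. contrib y lab) = X lab + b * Y 0 lab + b * b * Y 1 lab" using total[of lab] by simp
    then show ?l
      using small[OF lt(1) lt(2) lt(2), of lab 0 lab 1 lab] dig[OF lt(1) lt(2), of lab 0 lab "Y 1 lab"] g
      by (intro exI[of _ "X lab + b * Y 0 lab + b * b * Y 1 lab"]) (auto simp: good_def X_def Y_def)
  qed
  show ?thesis
  proof (rule wp_mono[OF wp_sumsC[OF same_except_refl]], intro conjI allI)
    fix st' \<rho>' assume a: "same_except {aPw, aP, aTab} st st' \<and> (\<forall>s<R. st' aTab (prod_encode (N - 1, prod_encode (0, s))) =
      of_bool (\<exists>lab. (\<forall>x<N. lab x < 3) \<and> s = (\<Sum>y<N. contrib y lab)))"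
    have eq: "st' aR = st aR" "st' aN0 = st aN0" "st' aN = st aN" "st' aKk = st aKk"
      using a by (auto simp: same_except_def)
    have "val I feasE \<rho>' st' = of_bool (\<exists>s<R. st' aTab (prod_encode (N - 1, prod_encode (0, s))) \<noteq> 0 \<and> s mod b < k + 1 \<and>
      s div b mod b < 7 * k \<and> s div (b * b) < 7 * k)"
      unfolding feasE_def val_AnyE val_AndE val_PairE val.simps arith.simps eq cs k[symmetric] b_def by simp
    also have "(\<exists>s<R. st' aTab (prod_encode (N - 1, prod_encode (0, s))) \<noteq> 0 \<and> s mod b < k + 1 \<and>
      s div b mod b < 7 * k \<and> s div (b * b) < 7 * k) \<longleftrightarrow> ?r"
      unfolding feas[symmetric] using a by (auto cong: conj_cong)
    finally show "val I feasE \<rho>' st' = of_bool (\<exists>lab. good N U S k lab \<and> (\<forall>y<N. fx y \<noteq> 3 \<longrightarrow> lab y = fx y))" .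
  qed blast
qed

lemma rows_cong: "st' a = st a \<Longrightarrow> rows a st' N = rows a st N"
  by (rule ext) (simp add: rows_def)

lemma flags_cong: "st' a = st a \<Longrightarrow> flags a st' N = flags a st N"
  by (simp add: flags_def)

lemma order_ok_cong:
  assumes "order_ok N st" "same_except A st st'" "A \<inter> {aN, aK, aR, aN0, aPos, aH} = {}"
  shows "order_ok N st'"
proof -
  have "st' aN = st aN" "st' aK = st aK" "st' aR = st aR" "st' aN0 = st aN0" "st' aPos = st aPos" "st' aH = st aH"
    using assms(2,3) unfolding same_except_def by auto
  then show ?thesis using assms(1) rows_cong[of st' aH st N] by (simp add: order_ok_def)
qed

lemma order_okD:
  assumes "order_ok N st"
  shows "st aN 0 = N" "1 \<le> N" "N \<le> n" "st aN (Suc 0 - Suc 0) = N"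
  using assms by (auto simp: order_ok_def)

definition agree :: "nat \<Rightarrow> (nat \<Rightarrow> nat) \<Rightarrow> (nat \<Rightarrow> nat) \<Rightarrow> bool" where
  "agree N fx lab \<longleftrightarrow> (\<forall>z<N. fx z \<noteq> 3 \<longrightarrow> lab z = fx z)"

text \<open>Invariant of the greedy search at vertex \<open>y\<close> after the labels below
  \<open>l\<close> have been tried. The fixed labels extend to a good labelling, and as long as
  \<open>y\<close> is unfixed, every such extension gives it a label of at least \<open>l\<close>.
  Without a good labelling nothing is ever fixed.\<close>

definition fixing :: "nat \<Rightarrow> nat set \<Rightarrow> nat set \<Rightarrow> nat \<Rightarrow> nat \<Rightarrow> nat \<Rightarrow> (nat \<Rightarrow> nat) \<Rightarrow> bool" where
  "fixing N U S k y l fx \<longleftrightarrow> (\<forall>z<N. fx z \<le> 3) \<and> (\<forall>z<N. y < z \<longrightarrow> fx z = 3) \<and>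
     (if \<exists>lab. good N U S k lab
      then (\<forall>z<y. fx z < 3) \<and> (\<exists>lab. good N U S k lab \<and> agree N fx lab) \<and>
        (fx y = 3 \<longrightarrow> (\<forall>lab. good N U S k lab \<longrightarrow> agree N fx lab \<longrightarrow> l \<le> lab y))
      else \<forall>z<N. fx z = 3)"

text \<open>If the tentative label \<open>l\<close> is rejected, no good extension uses it for
  \<open>y\<close>, so the lower bound on the label of \<open>y\<close> moves up by one.\<close>

lemma wp_fixC:
  assumes ok: "order_ok N st" and U: "U = flags aBlk st N" and S: "S = flags aS st N" and k: "k = st aKk 0"
    and f: "fixing N U S k y l (st aFx)" and y: "y < N" and l: "l < 3" and \<rho>: "\<rho> vY = y" "\<rho> vL = l"
  shows "wp I bd fixC \<rho> (\<lambda>st'. same_except {aPw, aP, aTab, aFx} st st' \<and> fixing N U S k y (Suc l) (st' aFx)) st"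
proof (cases "st aFx y = 3")
  case False
  then show ?thesis using f \<rho> by (simp add: fixC_def fixing_def)
next
  case True
  define fx where "fx = st aFx"
  define st1 where "st1 = st(aFx := fx(y := l))"
  have same1: "same_except {aFx} st st1" by (simp add: st1_def)
  have ok1: "order_ok N st1" by (rule order_ok_cong[OF ok same1]) simp
  let ?feas = "\<exists>lab. good N U S k lab \<and> agree N (fx(y := l)) lab"
  have q: "wp I bd (sumsC sepA sepB) \<rho> (\<lambda>st'. same_except {aPw, aP, aTab} st1 st' \<and>
    (\<forall>\<rho>'. val I feasE \<rho>' st' = of_bool ?feas)) st1"
    unfolding agree_def
    by (rule wp_query[OF ok1]) (use U S k f l in \<open>auto simp: st1_def flags_def fixing_def fx_def\<close>)
  have "wp I bd (sumsC sepA sepB) \<rho> (wp I bd (If feasE Skip (Write aFx (Var vY) (Num 3))) \<rho>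
      (\<lambda>st'. same_except {aPw, aP, aTab, aFx} st st' \<and> fixing N U S k y (Suc l) (st' aFx))) st1"
  proof (rule wp_mono[OF q])
    fix st2 assume a: "same_except {aPw, aP, aTab} st1 st2 \<and> (\<forall>\<rho>'. val I feasE \<rho>' st2 = of_bool ?feas)"
    have fx2: "st2 aFx = fx(y := l)" using a by (auto simp: same_except_def st1_def)
    have same2: "same_except {aPw, aP, aTab, aFx} st st2" using a by (auto simp: same_except_def st1_def)
    have ffx: "fixing N U S k y l fx" using f by (simp add: fx_def)
    show "wp I bd (If feasE Skip (Write aFx (Var vY) (Num 3))) \<rho>
      (\<lambda>st'. same_except {aPw, aP, aTab, aFx} st st' \<and> fixing N U S k y (Suc l) (st' aFx)) st2"
    proof (cases ?feas)
      case feas: True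
      then have ex: "\<exists>lab. good N U S k lab" by blast
      then have "fixing N U S k y (Suc l) (fx(y := l))" using ffx feas l unfolding fixing_def by auto
      then show ?thesis using a feas same2 fx2 by simp
    next
      case False
      have "fixing N U S k y (Suc l) fx"
      proof (cases "\<exists>lab. good N U S k lab")
        case ex: True
        have "Suc l \<le> lab y" if "good N U S k lab" "agree N fx lab" for lab
        proof -
          have "l \<le> lab y" using ffx ex that True unfolding fixing_def fx_def by auto
          moreover have "lab y \<noteq> l"
          proof
            assume "lab y = l"
            then have "agree N (fx(y := l)) lab" using that(2) by (auto simp: agree_def)
            then show False using False that(1) by blast
          qed
          ultimately show ?thesis by simp
        qed
        then show ?thesis using ffx ex unfolding fixing_def by auto
      next
        case False
        then show ?thesis using ffx unfolding fixing_def by auto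
      qed
      moreover have "fx(y := 3) = fx" using True by (auto simp: fx_def)
      ultimately show ?thesis using a False same2 fx2 \<rho> small_bounds(2)[of aFx] by simp
    qed
  qed
  moreover have "l \<le> bd aFx" using l small_bounds(2)[of aFx] by simp
  ultimately show ?thesis using True \<rho> by (simp add: fixC_def st1_def fx_def)
qed

text \<open>The guess grows only in the absence of a good labelling, and then
  \<open>good_exists\<close> gives \<open>k \<le> w\<close>. This keeps the guess at most
  \<open>w + 1\<close>.\<close>

lemma wp_splitC:
  assumes ok: "order_ok N st" and U: "U = flags aBlk st N" and S: "S = flags aS st N" and k: "k = st aKk 0" "1 \<le> k" "k \<le> w + 1"
    and c: "card S = 8 * k" and v: "v < N" "\<rho> vV = v"
  shows "wp I bd splitC \<rho> (\<lambda>st'. same_except {aPw, aP, aTab, aFx, aKk} st st' \<and>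
    (st' aKk 0 = k \<and> good N U S k (st' aFx) \<or> st' aKk 0 = k + 1 \<and> k \<le> w \<and> (\<forall>y<N. st' aFx y = 0))) st"
proof -
  let ?A = "{aPw, aP, aTab, aFx}"
  have sub: "U \<union> S \<subseteq> {..<N}" by (auto simp: U S flags_def)
  define start where "start y fx \<longleftrightarrow> (\<forall>z<N. fx z \<le> 3) \<and> (\<forall>z<N. y \<le> z \<longrightarrow> fx z = 3) \<and>
     (if \<exists>lab. good N U S k lab then (\<forall>z<y. fx z < 3) \<and> (\<exists>lab. good N U S k lab \<and> agree N fx lab)
      else \<forall>z<N. fx z = 3)" for y and fx :: "nat \<Rightarrow> nat"
  have init: "wp I bd (For vY (Cell aN) (Write aFx (Var vY) (Num 3))) \<rho> (\<lambda>st'. same_except ?A st st' \<and> start 0 (st' aFx)) st"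
  proof (rule wp_fill[where f = id and h = "\<lambda>_. 3" and n = N])
    show "val I (Cell aN) \<rho> st = N" using order_okD[OF ok] by simp
    show "\<And>st'. same_except {aFx} st st' \<Longrightarrow> (\<And>j. j < N \<Longrightarrow> st' aFx (id j) = 3) \<Longrightarrow> same_except ?A st st' \<and> start 0 (st' aFx)"
      by (auto simp: start_def agree_def same_except_def)
  qed (use small_bounds(2)[of aFx] in auto)
  have body: "wp I bd (For vL (Num 3) fixC) (\<rho>(vY := y)) (\<lambda>st'. same_except ?A st st' \<and> start (Suc y) (st' aFx)) st1"
    if y: "y < N" and J: "same_except ?A st st1 \<and> start y (st1 aFx)" for y st1
  proof (rule wp_For[where n = 3 and J = "\<lambda>l st'. same_except ?A st st' \<and> fixing N U S k y l (st' aFx)"])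
    show "same_except ?A st st1 \<and> fixing N U S k y 0 (st1 aFx)" using J by (auto simp: start_def fixing_def)
  next
    fix l st2 assume l: "l < 3" and F: "same_except ?A st st2 \<and> fixing N U S k y l (st2 aFx)"
    have eq: "st2 aBlk = st aBlk" "st2 aS = st aS" "st2 aKk = st aKk" using F by (auto simp: same_except_def)
    have "wp I bd fixC (\<rho>(vY := y, vL := l)) (\<lambda>st'. same_except ?A st2 st' \<and> fixing N U S k y (Suc l) (st' aFx)) st2"
    proof (rule wp_fixC)
      show "order_ok N st2" by (rule order_ok_cong[OF ok conjunct1[OF F]]) simp
    qed (use F y l eq U S k in \<open>auto simp: flags_def\<close>)
    then show "wp I bd fixC (\<rho>(vY := y, vL := l)) (\<lambda>st'. same_except ?A st st' \<and> fixing N U S k y (Suc l) (st' aFx)) st2"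
      by (rule wp_mono) (use F same_except_trans in blast)
  next
    fix st2 assume F: "same_except ?A st st2 \<and> fixing N U S k y 3 (st2 aFx)"
    have "start (Suc y) (st2 aFx)"
    proof (cases "\<exists>lab. good N U S k lab")
      case True
      then obtain lab where lab: "good N U S k lab" "agree N (st2 aFx) lab" using F unfolding fixing_def by auto
      \<comment> \<open>After all three labels have been tried, an unfixed \<open>y\<close> would
        need a label of at least 3.\<close>
      have "lab y < 3" using lab(1) y by (auto simp: good_def)
      then have "st2 aFx y \<noteq> 3" using F True lab unfolding fixing_def by (metis not_less)
      moreover have "st2 aFx y \<le> 3" using F y by (simp add: fixing_def)
      ultimately have "st2 aFx y < 3" by simp
      then show ?thesis using F True unfolding start_def fixing_def by (auto simp: less_Suc_eq)
    next
      case False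
      then show ?thesis using F unfolding start_def fixing_def by auto
    qed
    then show "same_except ?A st st2 \<and> start (Suc y) (st2 aFx)" using F by blast
  qed simp
  have loop: "wp I bd (For vY (Cell aN) (For vL (Num 3) fixC)) \<rho> (\<lambda>st'. same_except ?A st st' \<and> start N (st' aFx)) st1"
    if J: "same_except ?A st st1 \<and> start 0 (st1 aFx)" for st1
  proof (rule wp_For[where n = N and J = "\<lambda>y st'. same_except ?A st st' \<and> start y (st' aFx)"])
    have "order_ok N st1" by (rule order_ok_cong[OF ok conjunct1[OF J]]) simp
    then show "val I (Cell aN) \<rho> st1 = N" using order_okD by simp
  qed (use J body in auto)
  have final: "wp I bd (If (EqE (Arr aFx (Var vV)) (Num 3))
       (Write aKk (Num 0) (Cell aKk \<oplus> Num 1) ;; For vY (Cell aN) (Write aFx (Var vY) (Num 0))) Skip) \<rho>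
     (\<lambda>st'. same_except {aPw, aP, aTab, aFx, aKk} st st' \<and>
    (st' aKk 0 = k \<and> good N U S k (st' aFx) \<or> st' aKk 0 = k + 1 \<and> k \<le> w \<and> (\<forall>y<N. st' aFx y = 0))) st1"
    if J: "same_except ?A st st1 \<and> start N (st1 aFx)" for st1
  proof (cases "\<exists>lab. good N U S k lab")
    case True
    then obtain lab where lab: "good N U S k lab" "agree N (st1 aFx) lab" "\<forall>z<N. st1 aFx z < 3"
      using J unfolding start_def by auto
    then have "good N U S k (st1 aFx)" by (intro good_cong[OF sub _ lab(1)]) (auto simp: agree_def)
    moreover have "st1 aFx v \<noteq> 3" using lab(3) v by auto
    moreover have "st1 aKk = st aKk" using J by (auto simp: same_except_def)
    moreover have "same_except {aPw, aP, aTab, aFx, aKk} st st1" by (rule same_except_mono[OF conjunct1[OF J]]) auto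
    ultimately show ?thesis using v k by simp
  next
    case False
    have fv: "st1 aFx v = 3" using J False v unfolding start_def by auto
    have kw: "k \<le> w"
    proof (rule ccontr)
      assume "\<not> k \<le> w"
      then show False using good_exists[of k U S N] sub c order_okD(3)[OF ok] False by simp
    qed
    define st2 where "st2 = st1(aKk := (st1 aKk)(0 := k + 1))"
    have kk: "st1 aKk = st aKk" using J by (auto simp: same_except_def)
    have same2: "same_except {aPw, aP, aTab, aFx, aKk} st st2" using J by (auto simp: same_except_def st2_def)
    have "order_ok N st2" by (rule order_ok_cong[OF ok same2]) simp
    then have N2: "st2 aN 0 = N" using order_okD by simp
    have "wp I bd (For vY (Cell aN) (Write aFx (Var vY) (Num 0))) \<rho> (\<lambda>st'. same_except {aPw, aP, aTab, aFx, aKk} st st' \<and>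
      (st' aKk 0 = k \<and> good N U S k (st' aFx) \<or> st' aKk 0 = k + 1 \<and> k \<le> w \<and> (\<forall>y<N. st' aFx y = 0))) st2"
    proof (rule wp_fill[where f = id and h = "\<lambda>_. 0" and n = N])
      show "val I (Cell aN) \<rho> st2 = N" using N2 by simp
      fix st' assume a: "same_except {aFx} st2 st'" "\<And>j. j < N \<Longrightarrow> st' aFx (id j) = 0"
      have "st' aKk 0 = k + 1" using a(1) by (auto simp: same_except_def st2_def)
      moreover have "same_except {aPw, aP, aTab, aFx, aKk} st st'" using a(1) same2 by (auto simp: same_except_def)
      ultimately show "same_except {aPw, aP, aTab, aFx, aKk} st st' \<and>
      (st' aKk 0 = k \<and> good N U S k (st' aFx) \<or> st' aKk 0 = k + 1 \<and> k \<le> w \<and> (\<forall>y<N. st' aFx y = 0))" using a(2) kw by simp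
    qed auto
    moreover have "k + 1 \<le> bd aKk" using kw L(3) bd[of aKk] by simp
    ultimately show ?thesis using fv v kk k(1) by (simp add: st2_def)
  qed
  show ?thesis
    unfolding splitC_def wp_Seq by (intro wp_mono[OF init] wp_mono[OF loop] final)
qed

definition row_of :: "nat set \<Rightarrow> nat set \<Rightarrow> (nat \<Rightarrow> nat) \<Rightarrow> nat \<Rightarrow> nat set" where
  "row_of U S fx u = {x \<in> S. fx u = 2 \<or> fx x = 2 \<or> fx x = fx u} \<union> {x \<in> {x \<in> U. fx x = 2}. fx u = 2 \<longrightarrow> x < u}"

lemma wp_insertC:
  assumes N: "st aN 0 = N" "N \<le> n" and U: "U = flags aBlk st N" and S: "S = flags aS st N" and fx: "fx = st aFx"
    and J: "J = {x \<in> U. fx x = 2}" and v: "v < N" "\<rho> vV = v"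
  shows "wp I bd insertC \<rho> (\<lambda>st'. same_except {aH2, aF, aPos2} st st' \<and>
    (\<forall>u<N. rows aH2 st' N u = (if u \<in> U then row_of U S fx u else rows aH2 st N u)) \<and>
    flags aF st' N = flags aF st N \<union> J \<and>
    (\<forall>u<N. st' aPos2 u = (if u \<in> J then (N - 1 - v) * N + (N - 1 - u) else st aPos2 u))) st"
proof -
  let ?A = "{aH2, aF, aPos2}"
  let ?J = "\<lambda>i st'. same_except ?A st st' \<and>
    (\<forall>u<N. rows aH2 st' N u = (if u < i \<and> u \<in> U then row_of U S fx u else rows aH2 st N u)) \<and>
    (\<forall>u<N. st' aF u = (if u < i \<and> u \<in> J then 1 else st aF u)) \<and>
    (\<forall>u<N. st' aPos2 u = (if u < i \<and> u \<in> J then (N - 1 - v) * N + (N - 1 - u) else st aPos2 u))"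
  have US: "U \<subseteq> {..<N}" "S \<subseteq> {..<N}" by (auto simp: U S flags_def)
  show ?thesis
    unfolding insertC_def
  proof (rule wp_For[where J = ?J and n = N])
    fix u st1 assume u: "u < N" and J1: "?J u st1"
    have eq: "st1 aN = st aN" "st1 aBlk = st aBlk" "st1 aS = st aS" "st1 aFx = fx" using J1 fx by (auto simp: same_except_def)
    have blk: "st aBlk u \<noteq> 0 \<longleftrightarrow> u \<in> U" using u by (simp add: U flags_def)
    show "wp I bd (If (Arr aBlk (Var vU))
     (For vX (Cell aN) (Write aH2 (PairE (Var vU) (Var vX)) rowE) ;;
      If (EqE (Arr aFx (Var vU)) (Num 2))
        (Write aF (Var vU) (Num 1) ;;
         Write aPos2 (Var vU) (Monus (Monus (Cell aN) (Num 1)) (Var vV) \<otimes> Cell aN \<oplus>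
           Monus (Monus (Cell aN) (Num 1)) (Var vU))) Skip) Skip) (\<rho>(vU := u)) (?J (Suc u)) st1"
    proof (cases "u \<in> U")
      case False
      then have "u \<notin> J" using J by blast
      have "?J (Suc u) st1" using J1 False \<open>u \<notin> J\<close> by (auto simp: less_Suc_eq)
      then show ?thesis using blk False eq by simp
    next
      case True
      let ?Q = "\<lambda>st2. same_except {aH2} st1 st2 \<and> (\<forall>u'<N. rows aH2 st2 N u' = (if u' < Suc u \<and> u' \<in> U then row_of U S fx u' else rows aH2 st N u'))"
      have row: "wp I bd (For vX (Cell aN) (Write aH2 (PairE (Var vU) (Var vX)) rowE)) (\<rho>(vU := u)) ?Q st1"
      proof (rule wp_fill[where f = "\<lambda>x. prod_encode (u, x)" and h = "\<lambda>x. of_bool (x \<in> row_of U S fx u)" and n = N])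
        show "val I (Cell aN) (\<rho>(vU := u)) st1 = N" using eq N by simp
        show "inj_on (\<lambda>x. prod_encode (u, x)) {..<N}" by (auto simp: inj_on_def)
      next
        fix x st' assume x: "x < N" and s: "same_except {aH2} st1 st'"
        have eq': "st' aBlk = st aBlk" "st' aS = st aS" "st' aFx = fx" using s eq by (auto simp: same_except_def)
        have m: "st aBlk x = 0 \<longleftrightarrow> x \<notin> U" "st aS x = 0 \<longleftrightarrow> x \<notin> S" "0 < st aBlk x \<longleftrightarrow> x \<in> U" "0 < st aS x \<longleftrightarrow> x \<in> S"
          using x by (auto simp: U S flags_def)
        have "val I rowE (\<rho>(vU := u, vX := x)) st' = of_bool (x \<in> row_of U S fx u)"
          by (auto simp: rowE_def row_of_def eq' m)
        then show "val I (PairE (Var vU) (Var vX)) (\<rho>(vU := u, vX := x)) st' = prod_encode (u, x) \<and>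
          val I rowE (\<rho>(vU := u, vX := x)) st' = of_bool (x \<in> row_of U S fx u) \<and> of_bool (x \<in> row_of U S fx u) \<le> bd aH2"
          using small_bounds(1)[of aH2] by simp
      next
        fix st' assume s: "same_except {aH2} st1 st'"
          and out: "\<And>j. j \<notin> (\<lambda>x. prod_encode (u, x)) ` {..<N} \<Longrightarrow> st' aH2 j = st1 aH2 j"
          and res: "\<And>x. x < N \<Longrightarrow> st' aH2 (prod_encode (u, x)) = of_bool (x \<in> row_of U S fx u)"
        have "rows aH2 st' N u' = rows aH2 st1 N u'" if "u' \<noteq> u" for u'
        proof -
          have "prod_encode (u', x) \<notin> (\<lambda>x. prod_encode (u, x)) ` {..<N}" for x using that by auto
          then show ?thesis using out by (simp add: rows_def)
        qed
        moreover have "row_of U S fx u \<subseteq> {..<N}" using US unfolding row_of_def by auto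
        then have "rows aH2 st' N u = row_of U S fx u" using res by (auto simp: rows_def)
        ultimately have "rows aH2 st' N u' = (if u' < Suc u \<and> u' \<in> U then row_of U S fx u' else rows aH2 st N u')" if "u' < N" for u'
          using J1 True that by (cases "u' = u") (simp_all add: less_Suc_eq)
        then show "?Q st'" using s by simp
      qed
      have rest: "wp I bd (If (EqE (Arr aFx (Var vU)) (Num 2))
        (Write aF (Var vU) (Num 1) ;;
         Write aPos2 (Var vU) (Monus (Monus (Cell aN) (Num 1)) (Var vV) \<otimes> Cell aN \<oplus>
           Monus (Monus (Cell aN) (Num 1)) (Var vU))) Skip) (\<rho>(vU := u)) (?J (Suc u)) st2" if q: "?Q st2" for st2
      proof -
        have eq2: "st2 aFx = fx" "st2 aN = st aN" "st2 aF = st1 aF" "st2 aPos2 = st1 aPos2" using q eq by (auto simp: same_except_def)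
        have same2: "same_except ?A st st2" using q J1 by (auto simp: same_except_def)
        have uJ: "u \<in> J \<longleftrightarrow> fx u = 2" using True J by simp
        have "(N - 1 - v) * N + (N - 1 - u) \<le> (N - 1) * N + (N - 1)" by (intro add_mono mult_le_mono1) auto
        also have "\<dots> < N * N" using u by (cases N) auto
        also have "\<dots> \<le> n * n" using N(2) by (intro mult_le_mono)
        finally have pb: "(N - 1 - v) * N + (N - 1 - u) \<le> bd aPos2" using small_bounds(3)[of aPos2] by linarith
        show ?thesis
        proof (cases "fx u = 2")
          case False
          have "?J (Suc u) st2" using q J1 eq2 same2 uJ False by (auto simp: less_Suc_eq)
          then show ?thesis using False eq2 by simp
        next
          case fu: True
          define p where "p = (N - 1 - v) * N + (N - 1 - u)"
          let ?st3 = "st2(aF := (st2 aF)(u := 1), aPos2 := (st2 aPos2)(u := p))"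
          have r: "rows aH2 ?st3 N = rows aH2 st2 N" by (rule rows_cong) simp
          have "?J (Suc u) ?st3"
            unfolding r using q J1 eq2 same2 uJ fu by (auto simp: less_Suc_eq p_def)
          then show ?thesis using fu eq2 N v pb small_bounds(1)[of aF] by (simp add: p_def)
        qed
      qed
      have "wp I bd (For vX (Cell aN) (Write aH2 (PairE (Var vU) (Var vX)) rowE) ;;
        If (EqE (Arr aFx (Var vU)) (Num 2))
        (Write aF (Var vU) (Num 1) ;;
         Write aPos2 (Var vU) (Monus (Monus (Cell aN) (Num 1)) (Var vV) \<otimes> Cell aN \<oplus>
           Monus (Monus (Cell aN) (Num 1)) (Var vU))) Skip) (\<rho>(vU := u)) (?J (Suc u)) st1"
        unfolding wp_Seq by (rule wp_mono[OF row]) (rule rest)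
      then show ?thesis using blk True eq unfolding wp_If by simp
    qed
  next
    fix st' assume "?J N st'"
    moreover from this have "flags aF st' N = flags aF st N \<union> J"
      using J US unfolding flags_def by auto
    ultimately show "same_except ?A st st' \<and>
    (\<forall>u<N. rows aH2 st' N u = (if u \<in> U then row_of U S fx u else rows aH2 st N u)) \<and>
    flags aF st' N = flags aF st N \<union> J \<and>
    (\<forall>u<N. st' aPos2 u = (if u \<in> J then (N - 1 - v) * N + (N - 1 - u) else st aPos2 u))" by auto
  qed (use N in auto)
qed

end

context order_program
begin

lemma rows_eq_iff:
  "rows a st N u = rows a st N v \<longleftrightarrow>
    (\<forall>x<N. (st a (prod_encode (u, x)) = 0) = (st a (prod_encode (v, x)) = 0))"
proof -
  have "{x. x < N \<and> \<not> A x} = {x. x < N \<and> \<not> B x} \<longleftrightarrow> (\<forall>x<N. A x = B x)" for A B :: "nat \<Rightarrow> bool" by blast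
  from this[of "\<lambda>x. st a (prod_encode (u, x)) = 0" "\<lambda>x. st a (prod_encode (v, x)) = 0"]
  show ?thesis unfolding rows_def .
qed

text \<open>The positions in use before round \<open>v\<close> lie in the blocks of earlier rounds,
  at \<open>(N - v) * N\<close> or above. Unplaced vertices are held to 8k attachments so that the
  rows of the next separator stay within 9k.\<close>

definition placed :: "nat \<Rightarrow> nat \<Rightarrow> store \<Rightarrow> bool" where
  "placed N v st \<longleftrightarrow> order_ok N st \<and> 1 \<le> st aKk 0 \<and> st aKk 0 \<le> w + 1 \<and>
     elim_state N adj (flags aF st N) (st aPos2) (rows aH2 st N) \<and>
     (\<forall>u<N. card (rows aH2 st N u) \<le> (if u \<in> flags aF st N then 9 else 8) * st aKk 0) \<and>
     (\<forall>u\<in>flags aF st N. (N - v) * N \<le> st aPos2 u \<and> st aPos2 u < N * N) \<and> {..<v} \<subseteq> flags aF st N"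

text \<open>What \<open>elim_state_step\<close> and \<open>elim_step_card\<close> require, whichever
  way the labels were found. Only edges with an end in \<open>U\<close> matter, since both ends of
  an edge inside \<open>S\<close> are placed already.\<close>

definition labelled :: "nat \<Rightarrow> nat set \<Rightarrow> nat set \<Rightarrow> nat \<Rightarrow> nat \<Rightarrow> (nat \<Rightarrow> nat) \<Rightarrow> bool" where
  "labelled N U S v k fx \<longleftrightarrow> fx v = 2 \<and> (\<forall>x<N. fx x \<le> 2) \<and>
     (\<forall>x\<in>U. \<forall>y\<in>U \<union> S. adj x y \<longrightarrow> fx x + fx y \<noteq> 1) \<and>
     (\<forall>l<2. card {x \<in> U \<union> S. fx x = 2} + card {x \<in> S. fx x = l} \<le> 8 * k) \<and>
     card S + (card {x \<in> U. fx x = 2} - 1) \<le> 9 * k"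

text \<open>Moving \<open>v\<close> into the separator makes its size at most k + 1. With at most 7k
  - 1 vertices on a side this gives 8k, and the separator without one vertex adds at most k to the
  8k of \<open>S\<close>. The label 2 violates no edge condition.\<close>

lemma labelled_good:
  assumes g: "good N U S k fx" and sub: "U \<union> S \<subseteq> {..<N}" and v: "v < N" "v \<in> U" "v \<notin> S" and c: "card S \<le> 8 * k"
  shows "labelled N U S v k (fx(v := 2))"
proof -
  let ?fx = "fx(v := 2)"
  have fin: "finite U" "finite S" using sub finite_subset by auto
  have "{x \<in> U \<union> S. ?fx x = 2} \<subseteq> insert v {x \<in> U \<union> S. fx x = 2}" by auto
  then have "card {x \<in> U \<union> S. ?fx x = 2} \<le> card (insert v {x \<in> U \<union> S. fx x = 2})" using fin by (intro card_mono) auto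
  also have "\<dots> \<le> Suc (card {x \<in> U \<union> S. fx x = 2})" by (rule card_insert_le_m1) auto
  also have "\<dots> \<le> Suc k" using g by (simp add: good_def)
  finally have c2: "card {x \<in> U \<union> S. ?fx x = 2} \<le> Suc k" .
  have "{x \<in> S. ?fx x = l} = {x \<in> S. fx x = l}" for l using v(3) by auto
  then have c1: "card {x \<in> S. ?fx x = l} < 7 * k" if "l < 2" for l
    using g that unfolding good_def by (auto simp: less_2_cases_iff)
  have "card {x \<in> U. ?fx x = 2} \<le> card {x \<in> U \<union> S. ?fx x = 2}" using fin by (intro card_mono) auto
  then have c3: "card {x \<in> U. ?fx x = 2} - 1 \<le> k" using c2 by linarith
  have "card {x \<in> U \<union> S. ?fx x = 2} + card {x \<in> S. ?fx x = l} \<le> 8 * k" if "l < 2" for l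
    using c1[OF that] c2 by linarith
  moreover have "card S + (card {x \<in> U. ?fx x = 2} - 1) \<le> 9 * k" using c c3 by linarith
  moreover have "?fx x \<le> 2" if "x < N" for x
  proof -
    have "fx x < 3" using g that by (simp add: good_def)
    then show ?thesis by auto
  qed
  moreover have "?fx x + ?fx y \<noteq> 1" if "x \<in> U" "y \<in> U \<union> S" "adj x y" for x y
    using g that unfolding good_def by auto
  ultimately show ?thesis unfolding labelled_def by auto
qed

text \<open>With fewer than 8k boundary vertices there is room for one more, so \<open>v\<close>
  alone can be the separator with everything else on one side.\<close>

lemma labelled_trivial:
  assumes z: "\<And>y. y < N \<Longrightarrow> fx y = 0" and sub: "U \<union> S \<subseteq> {..<N}" and v: "v < N" "v \<in> U" "v \<notin> S" and c: "card S < 8 * k"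
  shows "labelled N U S v k (fx(v := 2))"
proof -
  let ?fx = "fx(v := 2)"
  have fin: "finite S" using sub finite_subset by auto
  have e: "{x \<in> U \<union> S. ?fx x = 2} = {v}" "{x \<in> U. ?fx x = 2} = {v}" using sub z v by (auto split: if_splits)
  have "card {x \<in> S. ?fx x = l} \<le> card S" for l using fin by (intro card_mono) auto
  then have "1 + card {x \<in> S. ?fx x = l} \<le> 8 * k" for l using c by (metis Suc_leI add.commute le_less_trans plus_1_eq_Suc)
  moreover have "?fx x + ?fx y \<noteq> 1" if "x \<in> U" "y \<in> U \<union> S" for x y
  proof -
    have "fx x = 0" "fx y = 0" using z that sub by auto
    then show ?thesis by simp
  qed
  ultimately show ?thesis unfolding labelled_def e using z c by auto
qed

lemma wp_placeC:
  assumes pl: "placed N v st" and v: "v < N" "v \<notin> flags aF st N" "\<rho> vV = v"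
  shows "wp I bd placeC \<rho> (placed N (Suc v)) st"
proof -
  let ?F = "flags aF st N" and ?H = "rows aH2 st N"
  note ok = pl[unfolded placed_def, THEN conjunct1]
  define k where "k = st aKk 0"
  have k: "1 \<le> k" "k \<le> w + 1" using pl by (auto simp: placed_def k_def)
  have st: "elim_state N adj ?F (st aPos2) ?H" using pl by (simp add: placed_def)
  define U where "U = {u. u < N \<and> u \<notin> ?F \<and> ?H u = ?H v}"
  define S where "S = ?H v"
  have SN: "S \<subseteq> {..<N}" by (auto simp: S_def rows_def)
  have SF: "S \<subseteq> ?F" using st v unfolding S_def elim_state_def by blast
  have vU: "v \<in> U" "v \<notin> S" using v SF by (auto simp: U_def)
  have sub: "U \<union> S \<subseteq> {..<N}" using SN by (auto simp: U_def)
  have disj: "S \<inter> U = {}" using SF by (auto simp: U_def)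
  have cS: "card S \<le> 8 * k" using pl v by (auto simp: placed_def S_def k_def)
  have N: "N \<le> n" using order_okD[OF ok] by blast
  let ?A0 = "{aBlk, aS, aFx}" and ?A1 = "{aBlk, aS, aFx, aPw, aP, aTab, aKk}"
  let ?Q1 = "\<lambda>st'. same_except {aBlk} st st' \<and> flags aBlk st' N = U"
  have s1: "wp I bd (For vU (Cell aN) (Write aBlk (Var vU) (AndE (NotE (Arr aF (Var vU)))
       (AllE vX (Cell aN) (EqE (NotE (Arr aH2 (PairE (Var vU) (Var vX)))) (NotE (Arr aH2 (PairE (Var vV) (Var vX))))))))) \<rho> ?Q1 st"
  proof (rule wp_fill[where f = id and h = "\<lambda>u. of_bool (u \<in> U)" and n = N])
    show "val I (Cell aN) \<rho> st = N" using order_okD[OF ok] by simp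
  next
    fix u st' assume u: "u < N" and s: "same_except {aBlk} st st'"
    have eq: "st' aN = st aN" "st' aF = st aF" "st' aH2 = st aH2" using s by (auto simp: same_except_def)
    show "val I (Var vU) (\<rho>(vU := u)) st' = id u \<and>
      val I (AndE (NotE (Arr aF (Var vU)))
       (AllE vX (Cell aN) (EqE (NotE (Arr aH2 (PairE (Var vU) (Var vX)))) (NotE (Arr aH2 (PairE (Var vV) (Var vX))))))) (\<rho>(vU := u)) st'
       = of_bool (u \<in> U) \<and> of_bool (u \<in> U) \<le> bd aBlk"
      using small_bounds(1)[of aBlk] order_okD(1)[OF ok] v(3) u
      by (simp add: eq U_def flags_def rows_eq_iff) (metis neq0_conv)
  next
    fix st' assume "same_except {aBlk} st st'" "\<And>j. j < N \<Longrightarrow> st' aBlk (id j) = of_bool (j \<in> U)"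
    then show "?Q1 st'" using sub by (auto simp: flags_def)
  qed auto
  let ?Q2 = "\<lambda>st'. same_except {aBlk, aS} st st' \<and> flags aBlk st' N = U \<and> (\<forall>x<N. st' aS x = of_bool (x \<in> S))"
  have s2: "wp I bd (For vX (Cell aN) (Write aS (Var vX) (NotE (NotE (Arr aH2 (PairE (Var vV) (Var vX))))))) \<rho> ?Q2 st1" if q: "?Q1 st1" for st1
  proof (rule wp_fill[where f = id and h = "\<lambda>x. of_bool (x \<in> S)" and n = N])
    show "val I (Cell aN) \<rho> st1 = N" using order_okD(1)[OF order_ok_cong[OF ok conjunct1[OF q]]] by simp
  next
    fix x st' assume x: "x < N" and s: "same_except {aS} st1 st'"
    have eq: "st' aH2 = st aH2" using s q by (auto simp: same_except_def)
    show "val I (Var vX) (\<rho>(vX := x)) st' = id x \<and>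
      val I (NotE (NotE (Arr aH2 (PairE (Var vV) (Var vX))))) (\<rho>(vX := x)) st' = of_bool (x \<in> S) \<and> of_bool (x \<in> S) \<le> bd aS"
      using small_bounds(1)[of aS] v(3) x by (simp add: eq S_def rows_def)
  next
    fix st' assume s: "same_except {aS} st1 st'" and r: "\<And>j. j < N \<Longrightarrow> st' aS (id j) = of_bool (j \<in> S)"
    have "st' aBlk = st1 aBlk" using s by (auto simp: same_except_def)
    then have "flags aBlk st' N = U" using q flags_cong by metis
    then show "?Q2 st'" using s q r by (auto simp: same_except_def)
  qed auto
  let ?Q3 = "\<lambda>st'. same_except ?A0 st st' \<and> flags aBlk st' N = U \<and> (\<forall>x<N. st' aS x = of_bool (x \<in> S)) \<and> (\<forall>y<N. st' aFx y = 0)"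
  have s3: "wp I bd (For vY (Cell aN) (Write aFx (Var vY) (Num 0))) \<rho> ?Q3 st1" if q: "?Q2 st1" for st1
  proof (rule wp_fill[where f = id and h = "\<lambda>_. 0" and n = N])
    show "val I (Cell aN) \<rho> st1 = N" using order_okD(1)[OF order_ok_cong[OF ok conjunct1[OF q]]] by simp
  next
    fix st' assume s: "same_except {aFx} st1 st'" and r: "\<And>j. j < N \<Longrightarrow> st' aFx (id j) = 0"
    have e: "st' aBlk = st1 aBlk" "st' aS = st1 aS" using s by (auto simp: same_except_def)
    then have "flags aBlk st' N = U" using q flags_cong by metis
    then show "?Q3 st'" using s q r e by (auto simp: same_except_def)
  qed auto
  let ?Q4 = "\<lambda>st'. same_except ?A1 st st' \<and> flags aBlk st' N = U \<and> flags aS st' N = S \<and> k \<le> st' aKk 0 \<and> st' aKk 0 \<le> w + 1 \<and>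
    labelled N U S v (st' aKk 0) ((st' aFx)(v := 2))"
  have s4: "wp I bd (If (Less (Sum vX (Cell aN) (Arr aS (Var vX))) (Num 8 \<otimes> Cell aKk)) Skip splitC) \<rho> ?Q4 st1" if q: "?Q3 st1" for st1
  proof -
    have ok1: "order_ok N st1" by (rule order_ok_cong[OF ok conjunct1[OF q]]) simp
    have fS: "flags aS st1 N = S" using q SN by (auto simp: flags_def)
    have k1: "st1 aKk 0 = k" using q by (auto simp: same_except_def k_def)
    have "(\<Sum>x<N. st1 aS x) = (\<Sum>x<N. of_bool (x \<in> S))" using q by (intro sum.cong) auto
    also have "\<dots> = card {x. x < N \<and> x \<in> S}" by (rule sum_of_bool_card)
    also have "{x. x < N \<and> x \<in> S} = S" using SN by auto
    finally have cond: "val I (Less (Sum vX (Cell aN) (Arr aS (Var vX))) (Num 8 \<otimes> Cell aKk)) \<rho> st1 = of_bool (card S < 8 * k)"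
      using order_okD(1)[OF ok1] k1 by simp
    show ?thesis
    proof (cases "card S < 8 * k")
      case True
      have "labelled N U S v k ((st1 aFx)(v := 2))"
        by (rule labelled_trivial) (use q sub v vU True in auto)
      moreover have "same_except ?A1 st st1" by (rule same_except_mono[OF conjunct1[OF q]]) auto
      ultimately have "?Q4 st1" using q fS k1 k by simp
      then show ?thesis using cond True by simp
    next
      case False
      then have c8: "card S = 8 * k" using cS by simp
      have "wp I bd splitC \<rho> (\<lambda>st'. same_except {aPw, aP, aTab, aFx, aKk} st1 st' \<and>
        (st' aKk 0 = k \<and> good N U S k (st' aFx) \<or> st' aKk 0 = k + 1 \<and> k \<le> w \<and> (\<forall>y<N. st' aFx y = 0))) st1"
        by (rule wp_splitC[OF ok1]) (use q fS k1 k c8 v in auto)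
      then have "wp I bd splitC \<rho> ?Q4 st1"
      proof (rule wp_mono)
        fix st2 assume a: "same_except {aPw, aP, aTab, aFx, aKk} st1 st2 \<and>
        (st2 aKk 0 = k \<and> good N U S k (st2 aFx) \<or> st2 aKk 0 = k + 1 \<and> k \<le> w \<and> (\<forall>y<N. st2 aFx y = 0))"
        have e: "st2 aBlk = st1 aBlk" "st2 aS = st1 aS" using a by (auto simp: same_except_def)
        have "same_except ?A1 st st2" using a q by (auto simp: same_except_def)
        moreover have "flags aBlk st2 N = U" "flags aS st2 N = S" using e q fS by (auto simp: flags_def)
        moreover have "labelled N U S v (st2 aKk 0) ((st2 aFx)(v := 2)) \<and> k \<le> st2 aKk 0 \<and> st2 aKk 0 \<le> w + 1"
        proof (cases "good N U S k (st2 aFx) \<and> st2 aKk 0 = k")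
          case True
          then show ?thesis using labelled_good[OF _ sub v(1) vU cS, of "st2 aFx"] k by simp
        next
          case False
          then have "st2 aKk 0 = k + 1" "k \<le> w" "\<forall>y<N. st2 aFx y = 0" using a by auto
          \<comment> \<open>The boundary has 8k vertices for the old k, which is less than 8(k +
            1).\<close>
          then show ?thesis using labelled_trivial[OF _ sub v(1) vU, of "st2 aFx" "k + 1"] c8 by simp
        qed
        ultimately show "?Q4 st2" by simp
      qed
      then show ?thesis using cond False by simp
    qed
  qed
  have s5: "wp I bd (Write aFx (Var vV) (Num 2) ;; insertC) \<rho> (placed N (Suc v)) st1" if q: "?Q4 st1" for st1
  proof -
    define fx where "fx = (st1 aFx)(v := 2)"
    define st2 where "st2 = st1(aFx := fx)"
    define kk where "kk = st1 aKk 0"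
    define J where "J = {x \<in> U. fx x = 2}"
    have same2: "same_except ?A1 st st2" using q by (simp add: st2_def)
    have ok2: "order_ok N st2" by (rule order_ok_cong[OF ok same2]) simp
    have fl2: "U = flags aBlk st2 N" "S = flags aS st2 N" using q by (auto simp: flags_def st2_def)
    have old2: "rows aH2 st2 N = ?H" "flags aF st2 N = ?F" "st2 aPos2 = st aPos2" "st2 aKk 0 = kk"
      using same2 by (auto simp: same_except_def rows_def flags_def kk_def st2_def fun_eq_iff)
    have lab: "labelled N U S v kk fx" and kk: "k \<le> kk" "kk \<le> w + 1" using q by (auto simp: fx_def kk_def)
    have "wp I bd insertC \<rho> (\<lambda>st'. same_except {aH2, aF, aPos2} st2 st' \<and>
      (\<forall>u<N. rows aH2 st' N u = (if u \<in> U then row_of U S fx u else rows aH2 st2 N u)) \<and>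
      flags aF st' N = flags aF st2 N \<union> J \<and>
      (\<forall>u<N. st' aPos2 u = (if u \<in> J then (N - 1 - v) * N + (N - 1 - u) else st2 aPos2 u))) st2"
      by (rule wp_insertC[OF order_okD(1,3)[OF ok2] fl2]) (use v in \<open>auto simp: J_def st2_def\<close>)
    then have "wp I bd insertC \<rho> (placed N (Suc v)) st2"
    proof (rule wp_mono, elim conjE)
      fix st' assume s: "same_except {aH2, aF, aPos2} st2 st'"
        and r: "\<forall>u<N. rows aH2 st' N u = (if u \<in> U then row_of U S fx u else rows aH2 st2 N u)"
        and F: "flags aF st' N = flags aF st2 N \<union> J"
        and p: "\<forall>u<N. st' aPos2 u = (if u \<in> J then (N - 1 - v) * N + (N - 1 - u) else st2 aPos2 u)"
      have k': "st' aKk 0 = kk" using s old2 by (auto simp: same_except_def)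
      have ok': "order_ok N st'" by (rule order_ok_cong[OF ok2 s]) simp
      have F': "flags aF st' N = ?F \<union> J" using F old2 by simp
      have JU: "J \<subseteq> U" "J \<inter> ?F = {}" by (auto simp: J_def U_def)
      \<comment> \<open>The new block of positions ends where the block of the preceding round
        starts.\<close>
      have step: "(N - v) * N = (N - 1 - v) * N + N"
      proof -
        have "N - v = Suc (N - 1 - v)" using v by simp
        then show ?thesis by simp
      qed
      have posF: "(N - v) * N \<le> st aPos2 f" "st aPos2 f < N * N" if "f \<in> ?F" for f using pl that by (auto simp: placed_def)
      have pF: "st' aPos2 f = st aPos2 f" if "f \<in> ?F" for f using p old2 that JU(2) by (auto simp: flags_def)
      have pJ: "st' aPos2 x = (N - 1 - v) * N + (N - 1 - x)" if "x \<in> J" for x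
        using p that JU(1) sub by auto
      have "elim_state N adj (?F \<union> J) (st' aPos2) (rows aH2 st' N)"
      proof (rule elim_state_step[OF st v(1,2) U_def S_def J_def, where ?P0.0 = "(N - 1 - v) * N"])
        show "fx x \<le> 2" if "x \<in> U \<union> S" for x using lab that sub by (auto simp: labelled_def)
        show "fx x + fx y \<noteq> 1" if "x \<in> U" "y \<in> U \<union> S" "adj x y" for x y using lab that unfolding labelled_def by blast
        show "adj y x" if "adj x y" for x y using adj_sym that by blast
        show "(N - 1 - v) * N + N \<le> st aPos2 f" if "f \<in> ?F" for f using posF[OF that] step by simp
        show "st' aPos2 f = st aPos2 f" if "f \<in> ?F" for f by (rule pF[OF that])
        show "st' aPos2 x = (N - 1 - v) * N + (N - 1 - x)" if "x \<in> J" for x by (rule pJ[OF that])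
        show "rows aH2 st' N u = (if u \<in> U then {x \<in> S. fx u = 2 \<or> fx x = 2 \<or> fx x = fx u} \<union>
          {x \<in> J. fx u = 2 \<longrightarrow> x < u} else ?H u)" if "u < N" for u
          using r that old2(1) by (simp add: row_of_def J_def)
      qed
      moreover have "card (rows aH2 st' N u) \<le> (if u \<in> ?F \<union> J then 9 else 8) * kk" if u: "u < N" for u
      proof (cases "u \<in> U")
        case True
        have fin: "finite S" "finite U" using sub finite_subset by auto
        have ru: "rows aH2 st' N u = {x \<in> S. fx u = 2 \<or> fx x = 2 \<or> fx x = fx u} \<union> {x \<in> J. fx u = 2 \<longrightarrow> x < u}"
          using r u True by (simp add: row_of_def J_def)
        note cd = elim_step_card[OF fin J_def True disj ru]
        show ?thesis
        proof (cases "fx u = 2")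
          case fu: True
          then have "u \<in> J" using True by (simp add: J_def)
          moreover have "card S + (card J - 1) \<le> 9 * kk" using lab by (simp add: labelled_def J_def)
          ultimately show ?thesis using cd(2)[OF fu] by simp
        next
          case False
          then have uJ: "u \<notin> ?F \<union> J" using True by (auto simp: J_def U_def)
          have "fx u \<le> 2" using lab u by (simp add: labelled_def)
          then have "fx u < 2" using False by simp
          then have "card {x \<in> U \<union> S. fx x = 2} + card {x \<in> S. fx x = fx u} \<le> 8 * kk" using lab unfolding labelled_def by blast
          then show ?thesis using cd(1)[OF False] uJ by simp
        qed
      next
        case False
        then have ru: "rows aH2 st' N u = ?H u" using r u old2 by simp
        have "u \<notin> J" using False JU by blast
        moreover have "card (?H u) \<le> (if u \<in> ?F then 9 else 8) * k" using pl u by (auto simp: placed_def k_def)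
        \<comment> \<open>Rows of earlier rounds were bounded in terms of a possibly smaller
          guess.\<close>
        moreover have "(if u \<in> ?F then 9 else 8) * k \<le> (if u \<in> ?F then 9 else 8) * kk" using kk(1) by simp
        ultimately show ?thesis using ru by auto
      qed
      moreover have "(N - Suc v) * N \<le> st' aPos2 u \<and> st' aPos2 u < N * N" if "u \<in> ?F \<union> J" for u
      proof (cases "u \<in> ?F")
        case True
        have "(N - Suc v) * N \<le> (N - v) * N" by (intro mult_le_mono1) simp
        then show ?thesis
          unfolding pF[OF True] using order_trans[OF _ posF(1)[OF True]] posF(2)[OF True] by blast
      next
        case False
        then have uJ: "u \<in> J" using that by blast
        have "(N - 1 - v) * N + (N - 1 - u) < (N - v) * N" using v step by simp
        also have "\<dots> \<le> N * N" by (intro mult_le_mono1) simp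
        finally show ?thesis using pJ[OF uJ] by simp
      qed
      moreover have "{..<Suc v} \<subseteq> ?F \<union> J"
      proof -
        have "v \<in> J" using vU lab by (simp add: J_def labelled_def)
        moreover have "{..<v} \<subseteq> ?F" using pl by (simp add: placed_def)
        ultimately show ?thesis by (auto simp: less_Suc_eq)
      qed
      ultimately show "placed N (Suc v) st'"
        using ok' k' kk k unfolding placed_def F' by auto
    qed
    moreover have "st1(aFx := (st1 aFx)(v := 2)) = st2" by (simp add: st2_def fx_def)
    ultimately show ?thesis using v small_bounds(2)[of aFx] by simp
  qed
  show ?thesis
    unfolding placeC_def wp_Seq
    by (intro wp_mono[OF s1] wp_mono[OF s2] wp_mono[OF s3] wp_mono[OF s4] s5[unfolded wp_Seq])
qed

text \<open>A vertex that was placed in the round of another one leaves its own block empty; this is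
  the origin of the gaps.\<close>

lemma placed_skip:
  assumes "placed N v st" "v \<in> flags aF st N"
  shows "placed N (Suc v) st"
proof -
  have "(N - Suc v) * N \<le> (N - v) * N" by (intro mult_le_mono1) simp
  then have "\<forall>u\<in>flags aF st N. (N - Suc v) * N \<le> st aPos2 u \<and> st aPos2 u < N * N"
    using assms(1) unfolding placed_def by (meson order_trans)
  moreover have "{..<Suc v} \<subseteq> flags aF st N" using assms unfolding placed_def by (auto simp: less_Suc_eq)
  ultimately show ?thesis using assms(1) unfolding placed_def by blast
qed

lemma elim_order_cong:
  assumes "elim_order N adj pos H" "\<And>u. u < N \<Longrightarrow> pos u = pos' u" "\<And>u. u < N \<Longrightarrow> H u = H' u"
  shows "elim_order N adj pos' H'"
proof -
  have less: "x < N" if "u < N" "x \<in> H u" for u x using assms(1) that by (auto simp: elim_order_def)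
  have "inj_on pos' {..<N}" using assms(1,2) by (auto simp: elim_order_def inj_on_def)
  moreover have "\<forall>u<N. \<forall>v\<in>H' u. \<forall>x\<in>H' u. pos' v < pos' x \<longrightarrow> x \<in> H' v"
  proof (intro allI ballI impI)
    fix u v x assume a: "u < N" "v \<in> H' u" "x \<in> H' u" "pos' v < pos' x"
    then have h: "v \<in> H u" "x \<in> H u" using assms(3) by auto
    then have l: "v < N" "x < N" using less a(1) by auto
    then have "pos v < pos x" using a(4) assms(2) by simp
    then have "x \<in> H v" using assms(1) a(1) h unfolding elim_order_def by blast
    then show "x \<in> H' v" using assms(3) l by simp
  qed
  moreover have "\<forall>u<N. \<forall>x\<in>H' u. pos' u < pos' x"
  proof (intro allI ballI impI)
    fix u x assume a: "u < N" "x \<in> H' u"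
    then have "x \<in> H u" using assms(3) by auto
    then have "pos u < pos x" "x < N" using assms(1) a(1) less unfolding elim_order_def by blast+
    then show "pos' u < pos' x" using assms(2) a(1) by simp
  qed
  moreover have "\<forall>u<N. \<forall>v<N. adj u v \<longrightarrow> pos' u < pos' v \<longrightarrow> v \<in> H' u"
  proof (intro allI impI)
    fix u v assume a: "u < N" "v < N" "adj u v" "pos' u < pos' v"
    then have "pos u < pos v" using assms(2) by simp
    then show "v \<in> H' u" using assms(1,3) a unfolding elim_order_def by blast
  qed
  moreover have "\<forall>u<N. H' u \<subseteq> {..<N} \<and> pos' u < N * N"
    using assms unfolding elim_order_def by simp
  ultimately show ?thesis unfolding elim_order_def by blast
qed

text \<open>The state between two rounds. In contrast to \<open>order_ok\<close> it covers the empty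
  order, from which the iteration starts.\<close>

definition order_done :: "nat \<Rightarrow> store \<Rightarrow> bool" where
  "order_done N st \<longleftrightarrow> st aK 0 = 3 \<and> st aR 0 = (n + 1) * (n + 1) * (n + 1) \<and> st aN0 0 = n \<and>
     1 \<le> st aKk 0 \<and> st aKk 0 \<le> w + 1 \<and> elim_order N adj (st aPos) (rows aH st N) \<and>
     (\<forall>u<N. card (rows aH st N u) \<le> 9 * w + 9)"

lemma wp_compressC:
  assumes ok: "order_ok N st" and k: "1 \<le> st aKk 0" "st aKk 0 \<le> w + 1"
  shows "wp I bd compressC \<rho> (order_done N) st"
proof -
  let ?Q1 = "\<lambda>st'. same_except {aF, aH2} st st' \<and> (\<forall>u<N. st' aF u = 0 \<and> rows aH2 st' N u = {})"
  have s1: "wp I bd (For vV (Cell aN) (Write aF (Var vV) (Num 0) ;;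
       For vX (Cell aN) (Write aH2 (PairE (Var vV) (Var vX)) (Num 0)))) \<rho> ?Q1 st"
  proof (rule wp_For[where n = N and J = "\<lambda>i st'. same_except {aF, aH2} st st' \<and>
      (\<forall>u<i. st' aF u = 0 \<and> rows aH2 st' N u = {})"])
    show "val I (Cell aN) \<rho> st = N" using order_okD[OF ok] by simp
  next
    fix i st1 assume i: "i < N" and J: "same_except {aF, aH2} st st1 \<and> (\<forall>u<i. st1 aF u = 0 \<and> rows aH2 st1 N u = {})"
    define st2 where "st2 = st1(aF := (st1 aF)(i := 0))"
    have same2: "same_except {aF, aH2} st st2" using J by (simp add: st2_def)
    have "wp I bd (For vX (Cell aN) (Write aH2 (PairE (Var vV) (Var vX)) (Num 0))) (\<rho>(vV := i))
      (\<lambda>st'. same_except {aF, aH2} st st' \<and> (\<forall>u<Suc i. st' aF u = 0 \<and> rows aH2 st' N u = {})) st2"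
    proof (rule wp_fill[where f = "\<lambda>x. prod_encode (i, x)" and h = "\<lambda>_. 0" and n = N])
      show "val I (Cell aN) (\<rho>(vV := i)) st2 = N" using order_okD(1)[OF order_ok_cong[OF ok same2]] by simp
      show "inj_on (\<lambda>x. prod_encode (i, x)) {..<N}" by (auto simp: inj_on_def)
      fix st' assume s: "same_except {aH2} st2 st'" and o: "\<And>j. j \<notin> (\<lambda>x. prod_encode (i, x)) ` {..<N} \<Longrightarrow> st' aH2 j = st2 aH2 j"
        and r: "\<And>x. x < N \<Longrightarrow> st' aH2 (prod_encode (i, x)) = 0"
      have "rows aH2 st' N u = {}" if "u < i" for u
      proof -
        have "prod_encode (u, x) \<notin> (\<lambda>x. prod_encode (i, x)) ` {..<N}" for x using that by auto
        then have "rows aH2 st' N u = rows aH2 st1 N u" using o by (simp add: rows_def st2_def)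
        then show ?thesis using J that by simp
      qed
      moreover have "rows aH2 st' N i = {}" using r by (auto simp: rows_def)
      moreover have "st' aF = (st1 aF)(i := 0)" using s by (auto simp: same_except_def st2_def)
      moreover have "same_except {aF, aH2} st st'" using s same2 by (auto simp: same_except_def)
      ultimately show "same_except {aF, aH2} st st' \<and> (\<forall>u<Suc i. st' aF u = 0 \<and> rows aH2 st' N u = {})"
        using J by (auto simp: less_Suc_eq)
    qed auto
    then show "wp I bd (Write aF (Var vV) (Num 0) ;; For vX (Cell aN) (Write aH2 (PairE (Var vV) (Var vX)) (Num 0))) (\<rho>(vV := i))
      (\<lambda>st'. same_except {aF, aH2} st st' \<and> (\<forall>u<Suc i. st' aF u = 0 \<and> rows aH2 st' N u = {})) st1"
      by (simp add: st2_def)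
  qed auto
  have s2: "wp I bd (For vV (Cell aN) (If (Arr aF (Var vV)) Skip placeC)) \<rho> (placed N N) st1" if q: "?Q1 st1" for st1
  proof (rule wp_For[where n = N and J = "placed N"])
    have ok1: "order_ok N st1" by (rule order_ok_cong[OF ok conjunct1[OF q]]) simp
    show "val I (Cell aN) \<rho> st1 = N" using order_okD(1)[OF ok1] by simp
    have F: "flags aF st1 N = {}" using q by (auto simp: flags_def)
    \<comment> \<open>While nothing is placed all rows are empty, so the first region is the whole
      vertex set; regions may be disconnected.\<close>
    have "elim_state N adj {} (st1 aPos2) (rows aH2 st1 N)" using q by (simp add: elim_state_def)
    moreover have "st1 aKk = st aKk" using q by (auto simp: same_except_def)
    ultimately show "placed N 0 st1" using ok1 k q unfolding placed_def F by simp
  next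
    fix v st2 assume v: "v < N" and pl: "placed N v st2"
    show "wp I bd (If (Arr aF (Var vV)) Skip placeC) (\<rho>(vV := v)) (placed N (Suc v)) st2"
    proof (cases "v \<in> flags aF st2 N")
      case True
      then show ?thesis using placed_skip[OF pl True] by (simp add: flags_def)
    next
      case False
      then have "st2 aF v = 0" using v by (simp add: flags_def)
      then show ?thesis using wp_placeC[OF pl v False, of "\<rho>(vV := v)"] by simp
    qed
  qed
  have s3: "wp I bd (For vV (Cell aN) (Write aPos (Var vV) (Arr aPos2 (Var vV)) ;;
       For vX (Cell aN) (Write aH (PairE (Var vV) (Var vX)) (NotE (NotE (Arr aH2 (PairE (Var vV) (Var vX)))))))) \<rho> (order_done N) st1"
    if pl: "placed N N st1" for st1
  proof -
    note ok1 = pl[unfolded placed_def, THEN conjunct1]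
    have F: "{..<N} \<subseteq> flags aF st1 N" using pl by (simp add: placed_def)
    have pb: "st1 aPos2 u < N * N" if "u < N" for u
    proof -
      have "u \<in> flags aF st1 N" using F that by blast
      then show ?thesis using pl by (auto simp: placed_def)
    qed
    have eo: "elim_order N adj (st1 aPos2) (rows aH2 st1 N)"
      by (rule elim_state_final[OF _ F pb]) (use pl in \<open>auto simp: placed_def\<close>)
    have k1: "1 \<le> st1 aKk 0" "st1 aKk 0 \<le> w + 1" using pl by (auto simp: placed_def)
    have cd: "card (rows aH2 st1 N u) \<le> 9 * w + 9" if "u < N" for u
    proof -
      have "u \<in> flags aF st1 N" using F that by blast
      then have "card (rows aH2 st1 N u) \<le> 9 * st1 aKk 0" using pl that by (auto simp: placed_def)
      then show ?thesis using k1(2) by simp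
    qed
    let ?J = "\<lambda>i st'. same_except {aPos, aH} st1 st' \<and> (\<forall>u<i. st' aPos u = st1 aPos2 u \<and> rows aH st' N u = rows aH2 st1 N u)"
    show ?thesis
    proof (rule wp_For[where n = N and J = ?J])
      show "val I (Cell aN) \<rho> st1 = N" using order_okD[OF ok1] by simp
    next
      fix i st2 assume i: "i < N" and J: "?J i st2"
      define st3 where "st3 = st2(aPos := (st2 aPos)(i := st1 aPos2 i))"
      have eq: "st2 aPos2 = st1 aPos2" "st2 aN = st1 aN" using J by (auto simp: same_except_def)
      have same3: "same_except {aPos, aH} st1 st3" using J by (simp add: st3_def)
      have "wp I bd (For vX (Cell aN) (Write aH (PairE (Var vV) (Var vX)) (NotE (NotE (Arr aH2 (PairE (Var vV) (Var vX))))))) (\<rho>(vV := i))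
        (?J (Suc i)) st3"
      proof (rule wp_fill[where f = "\<lambda>x. prod_encode (i, x)" and h = "\<lambda>x. of_bool (x \<in> rows aH2 st1 N i)" and n = N])
        show "val I (Cell aN) (\<rho>(vV := i)) st3 = N" using order_okD(1)[OF ok1] eq by (simp add: st3_def)
        show "inj_on (\<lambda>x. prod_encode (i, x)) {..<N}" by (auto simp: inj_on_def)
      next
        fix x st' assume x: "x < N" and s: "same_except {aH} st3 st'"
        have "st' aH2 = st1 aH2" using s same3 by (auto simp: same_except_def)
        then show "val I (PairE (Var vV) (Var vX)) (\<rho>(vV := i, vX := x)) st' = prod_encode (i, x) \<and>
          val I (NotE (NotE (Arr aH2 (PairE (Var vV) (Var vX))))) (\<rho>(vV := i, vX := x)) st' = of_bool (x \<in> rows aH2 st1 N i) \<and>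
          of_bool (x \<in> rows aH2 st1 N i) \<le> bd aH"
          using x small_bounds(1)[of aH] by (simp add: rows_def)
      next
        fix st' assume s: "same_except {aH} st3 st'" and o: "\<And>j. j \<notin> (\<lambda>x. prod_encode (i, x)) ` {..<N} \<Longrightarrow> st' aH j = st3 aH j"
          and r: "\<And>x. x < N \<Longrightarrow> st' aH (prod_encode (i, x)) = of_bool (x \<in> rows aH2 st1 N i)"
        have "rows aH st' N u = rows aH2 st1 N u" if "u < i" for u
        proof -
          have "prod_encode (u, x) \<notin> (\<lambda>x. prod_encode (i, x)) ` {..<N}" for x using that by auto
          then have "rows aH st' N u = rows aH st2 N u" using o by (simp add: rows_def st3_def)
          then show ?thesis using J that by simp
        qed
        moreover have "rows aH st' N i = rows aH2 st1 N i" using r by (auto simp: rows_def)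
        moreover have "st' aPos = (st2 aPos)(i := st1 aPos2 i)" using s by (auto simp: same_except_def st3_def)
        moreover have "same_except {aPos, aH} st1 st'" using s same3 by (auto simp: same_except_def)
        ultimately show "?J (Suc i) st'" using J by (auto simp: less_Suc_eq)
      qed
      moreover have "st1 aPos2 i \<le> bd aPos"
      proof -
        have "N * N \<le> n * n" using order_okD(3)[OF ok1] by (intro mult_le_mono)
        then show ?thesis using pb[OF i] small_bounds(3)[of aPos] by linarith
      qed
      ultimately show "wp I bd (Write aPos (Var vV) (Arr aPos2 (Var vV)) ;;
       For vX (Cell aN) (Write aH (PairE (Var vV) (Var vX)) (NotE (NotE (Arr aH2 (PairE (Var vV) (Var vX))))))) (\<rho>(vV := i)) (?J (Suc i)) st2"
        using eq by (simp add: st3_def)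
    next
      fix st' assume J: "?J N st'"
      have "elim_order N adj (st' aPos) (rows aH st' N)"
        by (rule elim_order_cong[OF eo]) (use J in auto)
      moreover have "st' aK = st1 aK" "st' aR = st1 aR" "st' aN0 = st1 aN0" "st' aKk = st1 aKk" using J by (auto simp: same_except_def)
      ultimately show "order_done N st'"
        using ok1 k1 cd J unfolding order_done_def order_ok_def by simp
    qed auto
  qed
  show ?thesis
    unfolding compressC_def wp_Seq by (intro wp_mono[OF s1] wp_mono[OF s2] s3[unfolded wp_Seq])
qed

lemma wp_extendC:
  assumes i: "i \<le> n" "\<rho> vI = i"
  shows "wp I bd extendC \<rho> (\<lambda>st'. same_except {aN, aH, aPos} st st' \<and> st' aN 0 = Suc i \<and>
    (\<forall>u<Suc i. rows aH st' (Suc i) u = (if u < i then insert i (rows aH st i u) else {})) \<and>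
    st' aPos = (st aPos)(i := i * i)) st"
proof -
  define st1 where "st1 = st(aN := (st aN)(0 := Suc i))"
  let ?Q = "\<lambda>st'. same_except {aN, aH} st st' \<and> st' aN 0 = Suc i \<and>
    (\<forall>u<i. \<forall>x<i. st' aH (prod_encode (u, x)) = st aH (prod_encode (u, x))) \<and> (\<forall>u<i. st' aH (prod_encode (u, i)) = 1)"
  have a: "wp I bd (For vX (Var vI) (Write aH (PairE (Var vX) (Var vI)) (Num 1))) \<rho> ?Q st1"
  proof (rule wp_fill[where f = "\<lambda>x. prod_encode (x, i)" and h = "\<lambda>_. 1" and n = i])
    fix st' assume s: "same_except {aH} st1 st'" and o: "\<And>j. j \<notin> (\<lambda>x. prod_encode (x, i)) ` {..<i} \<Longrightarrow> st' aH j = st1 aH j"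
      and r: "\<And>x. x < i \<Longrightarrow> st' aH (prod_encode (x, i)) = 1"
    have "st' aH (prod_encode (u, x)) = st aH (prod_encode (u, x))" if "x < i" for u x
    proof -
      have "prod_encode (u, x) \<notin> (\<lambda>x. prod_encode (x, i)) ` {..<i}" using that by auto
      then show ?thesis using o by (simp add: st1_def)
    qed
    moreover have "st' aN = st1 aN" using s by (auto simp: same_except_def)
    ultimately show "?Q st'" using s r by (auto simp: same_except_def st1_def)
  qed (use i small_bounds(1)[of aH] in \<open>auto simp: inj_on_def\<close>)
  let ?Q2 = "\<lambda>st'. ?Q st' \<and> (\<forall>x\<le>i. st' aH (prod_encode (i, x)) = 0)"
  have b: "wp I bd (For vX (Var vI \<oplus> Num 1) (Write aH (PairE (Var vI) (Var vX)) (Num 0))) \<rho> ?Q2 st2" if q: "?Q st2" for st2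
  proof (rule wp_fill[where f = "\<lambda>x. prod_encode (i, x)" and h = "\<lambda>_. 0" and n = "Suc i"])
    fix st' assume s: "same_except {aH} st2 st'" and o: "\<And>j. j \<notin> (\<lambda>x. prod_encode (i, x)) ` {..<Suc i} \<Longrightarrow> st' aH j = st2 aH j"
      and r: "\<And>x. x < Suc i \<Longrightarrow> st' aH (prod_encode (i, x)) = 0"
    have "st' aH (prod_encode (u, x)) = st2 aH (prod_encode (u, x))" if "u < i" for u x
    proof -
      have "prod_encode (u, x) \<notin> (\<lambda>x. prod_encode (i, x)) ` {..<Suc i}" using that by auto
      then show ?thesis using o by simp
    qed
    moreover have "st' aN = st2 aN" using s by (auto simp: same_except_def)
    ultimately show "?Q2 st'" using s r q by (auto simp: same_except_def)
  qed (use i in \<open>auto simp: inj_on_def\<close>)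
  have c: "wp I bd (Write aPos (Var vI) (Var vI \<otimes> Var vI)) \<rho> (\<lambda>st'. same_except {aN, aH, aPos} st st' \<and> st' aN 0 = Suc i \<and>
    (\<forall>u<Suc i. rows aH st' (Suc i) u = (if u < i then insert i (rows aH st i u) else {})) \<and>
    st' aPos = (st aPos)(i := i * i)) st3" if q: "?Q2 st3" for st3
  proof -
    have p: "st3 aPos = st aPos" using q by (auto simp: same_except_def)
    have "i * i \<le> n * n" using i by (intro mult_le_mono) auto
    then have "i * i \<le> bd aPos" using small_bounds(3)[of aPos] by linarith
    moreover have "rows aH (st3(aPos := f)) (Suc i) u = (if u < i then insert i (rows aH st i u) else {})" if "u < Suc i" for f u
      using q that by (auto simp: rows_def less_Suc_eq)
    moreover have "same_except {aN, aH, aPos} st st3" using q by (auto simp: same_except_def)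
    ultimately show ?thesis using i q p by simp
  qed
  have "wp I bd (For vX (Var vI) (Write aH (PairE (Var vX) (Var vI)) (Num 1)) ;;
     For vX (Var vI \<oplus> Num 1) (Write aH (PairE (Var vI) (Var vX)) (Num 0)) ;;
     Write aPos (Var vI) (Var vI \<otimes> Var vI)) \<rho> (\<lambda>st'. same_except {aN, aH, aPos} st st' \<and> st' aN 0 = Suc i \<and>
    (\<forall>u<Suc i. rows aH st' (Suc i) u = (if u < i then insert i (rows aH st i u) else {})) \<and>
    st' aPos = (st aPos)(i := i * i)) st1"
    unfolding wp_Seq by (intro wp_mono[OF a] wp_mono[OF b] c)
  moreover have "Suc i \<le> bd aN" using i small_bounds(4)[of aN] by simp
  moreover have "val I (Var vI \<oplus> Num 1) \<rho> st = Suc i" using i by simp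
  ultimately show ?thesis
    unfolding extendC_def st1_def wp_Seq[of I bd "Write aN _ _"] wp_Write[of I bd aN] val.simps(1) by simp
qed

lemma extend_order:
  assumes "elim_order i adj (st aPos) (rows aH st i)"
    "\<forall>u<Suc i. rows aH st' (Suc i) u = (if u < i then insert i (rows aH st i u) else {})" "st' aPos = (st aPos)(i := i * i)"
  shows "elim_order (Suc i) adj (st' aPos) (rows aH st' (Suc i))"
  by (rule elim_order_cong[OF elim_order_extend[OF assms(1)]]) (use assms in auto)

lemma extend_card:
  assumes "\<forall>u<i. card (rows aH st i u) \<le> h"
    "\<forall>u<Suc i. rows aH st' (Suc i) u = (if u < i then insert i (rows aH st i u) else {})" "u < Suc i"
  shows "card (rows aH st' (Suc i) u) \<le> Suc h"
proof (cases "u < i")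
  case True
  have "finite (rows aH st i u)" by (simp add: rows_def)
  then have "card (insert i (rows aH st i u)) \<le> Suc (card (rows aH st i u))" by (simp add: card_insert_if)
  then show ?thesis using assms True by (auto intro: le_trans)
qed (use assms in auto)

definition extended :: "store \<Rightarrow> bool" where
  "extended st \<longleftrightarrow> st aN 0 = Suc n \<and> st aN0 0 = n \<and> elim_order (Suc n) adj (st aPos) (rows aH st (Suc n)) \<and>
     (\<forall>u<Suc n. card (rows aH st (Suc n) u) \<le> 9 * w + 10 \<and> (u \<noteq> n \<longrightarrow> n \<in> rows aH st (Suc n) u))"

lemma wp_orderC:
  assumes n0: "st aN0 0 = n"
  shows "wp I bd orderC \<rho> extended st"
proof -
  define st1 where "st1 = st(aKk := (st aKk)(0 := 1), aK := (st aK)(0 := 3), aR := (st aR)(0 := (n + 1) * (n + 1) * (n + 1)))"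
  have init: "order_done 0 st1" using n0 by (simp add: order_done_def st1_def elim_order_def)
  have "wp I bd (For vI (Cell aN0 \<oplus> Num 1) (extendC ;; If (Less (Var vI) (Cell aN0)) compressC Skip)) \<rho> extended st1"
  proof (rule wp_For[where J = "\<lambda>i st'. if i \<le> n then order_done i st' else extended st'" and n = "Suc n"])
    show "val I (Cell aN0 \<oplus> Num 1) \<rho> st1 = Suc n" using n0 by (simp add: st1_def)
  next
    fix i st2 assume i: "i < Suc n" and "if i \<le> n then order_done i st2 else extended st2"
    then have d: "order_done i st2" and i': "i \<le> n" by simp_all
    have "wp I bd extendC (\<rho>(vI := i)) (\<lambda>st'. same_except {aN, aH, aPos} st2 st' \<and> st' aN 0 = Suc i \<and>
      (\<forall>u<Suc i. rows aH st' (Suc i) u = (if u < i then insert i (rows aH st2 i u) else {})) \<and>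
      st' aPos = (st2 aPos)(i := i * i)) st2"
      by (rule wp_extendC[OF i']) simp
    then show "wp I bd (extendC ;; If (Less (Var vI) (Cell aN0)) compressC Skip) (\<rho>(vI := i))
      (\<lambda>st'. if Suc i \<le> n then order_done (Suc i) st' else extended st') st2"
      unfolding wp_Seq
    proof (rule wp_mono, elim conjE)
      fix st3 assume s: "same_except {aN, aH, aPos} st2 st3" and N: "st3 aN 0 = Suc i"
        and r: "\<forall>u<Suc i. rows aH st3 (Suc i) u = (if u < i then insert i (rows aH st2 i u) else {})"
        and p: "st3 aPos = (st2 aPos)(i := i * i)"
      have eq: "st3 aK = st2 aK" "st3 aR = st2 aR" "st3 aN0 = st2 aN0" "st3 aKk = st2 aKk" using s by (auto simp: same_except_def)
      have n3: "st3 aN0 0 = n" using d eq by (simp add: order_done_def)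
      have eo: "elim_order (Suc i) adj (st3 aPos) (rows aH st3 (Suc i))"
        by (rule extend_order[OF _ r p]) (use d in \<open>simp add: order_done_def\<close>)
      have cd: "card (rows aH st3 (Suc i) u) \<le> 9 * w + 10" if "u < Suc i" for u
        using extend_card[OF _ r that, of "9 * w + 9"] d by (simp add: order_done_def)
      have ro: "i \<in> rows aH st3 (Suc i) u" if "u < Suc i" "u \<noteq> i" for u using r that by simp
      show "wp I bd (If (Less (Var vI) (Cell aN0)) compressC Skip) (\<rho>(vI := i))
        (\<lambda>st'. if Suc i \<le> n then order_done (Suc i) st' else extended st') st3"
      proof (cases "i < n")
        case True
        have "order_ok (Suc i) st3" using d N eq True eo cd ro unfolding order_ok_def order_done_def by simp
        then have "wp I bd compressC (\<rho>(vI := i)) (order_done (Suc i)) st3"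
          by (rule wp_compressC) (use d eq in \<open>auto simp: order_done_def\<close>)
        then show ?thesis using True n3 by simp
      next
        case False
        then have "i = n" using i by simp
        then have "extended st3" using N n3 eo cd ro unfolding extended_def by blast
        then show ?thesis using \<open>i = n\<close> n3 by simp
      qed
    qed
  qed (use init in auto)
  moreover have "(n + 1) * (n + 1) * (n + 1) \<le> bd aR" using L(2) bd[of aR] by simp
  ultimately show ?thesis
    unfolding orderC_def wp_Seq using n0 small_bounds(1)[of aKk] small_bounds(2)[of aK] by (simp add: st1_def)
qed

end

section \<open>The main program\<close>

abbreviation (input) "aT \<equiv> 17 :: nat"
abbreviation (input) "aC \<equiv> 18 :: nat"
abbreviation (input) "aCp \<equiv> 19 :: nat"
abbreviation (input) "aBp \<equiv> 20 :: nat"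
abbreviation (input) "aD \<equiv> 22 :: nat"
abbreviation (input) "aDt \<equiv> 23 :: nat"

abbreviation (input) "mT \<equiv> 16 :: nat"
abbreviation (input) "mI \<equiv> 17 :: nat"
abbreviation (input) "mJ \<equiv> 18 :: nat"
abbreviation (input) "mS \<equiv> 19 :: nat"

definition snapE :: "expr \<Rightarrow> expr \<Rightarrow> expr \<Rightarrow> expr" where
  "snapE t u x = Input (Num 5 \<oplus> Cell aN0 \<otimes> Cell aN0 \<oplus> t \<otimes> (Cell aN0 \<otimes> Cell aN0) \<oplus> u \<otimes> Cell aN0 \<oplus> x)"

definition digitE :: "expr \<Rightarrow> expr \<Rightarrow> expr" where
  "digitE t l = (l \<oslash> Arr aCp t) \<odot> Cell aC"

definition radixJE :: "expr \<Rightarrow> expr" where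
  "radixJE j = CondE (Less j (Cell aC \<otimes> Cell aT)) (Cell aN0 \<otimes> Cell aN0) (Cell aT \<otimes> (Cell aN0 \<otimes> Cell aN0))"

text \<open>
  A label is the sequence of parts of a vertex over time, written in base \<open>c\<close>. The digits of the
  sums are the volumes of the parts, the number of edges inside parts, and the loyalty. The last
  vertex \<open>n\<close> is an isolated dummy, the root of the elimination tree.
\<close>

definition mainA :: expr where
  "mainA = CondE (Less (Var rV) (Cell aN0))
     (Sum mT (Cell aT) (Sum mI (Cell aN0) (snapE (Var mT) (Var rV) (Var mI)) \<otimes>
        Arr aBp (Var mT \<otimes> Cell aC \<oplus> digitE (Var mT) (Var rL)))
      \<oplus> Sum mT (Monus (Cell aT) (Num 1)) (EqE (digitE (Var mT) (Var rL)) (digitE (Var mT \<oplus> Num 1) (Var rL))) \<otimes>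
        Arr aBp (Cell aC \<otimes> Cell aT \<oplus> Num 1)) (Num 0)"

definition mainB :: expr where
  "mainB = CondE (AndE (Less (Var rV) (Cell aN0)) (Less (Var rX) (Cell aN0)))
     (Sum mT (Cell aT) (AndE (snapE (Var mT) (Var rV) (Var rX)) (EqE (digitE (Var mT) (Var rL)) (digitE (Var mT) labE))) \<otimes>
       Arr aBp (Cell aC \<otimes> Cell aT)) (Num 0)"

definition setupC :: cmd where
  "setupC = Write aN0 (Num 0) (Input (Num 0)) ;; Write aT (Num 0) (Input (Num 1)) ;; Write aC (Num 0) (Input (Num 2))"

definition powersC :: cmd where
  "powersC =
     Write aCp (Num 0) (Num 1) ;;
     For mT (Cell aT) (Write aCp (Var mT \<oplus> Num 1) (Arr aCp (Var mT) \<otimes> Cell aC)) ;;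
     Write aBp (Num 0) (Num 1) ;;
     For mJ (Cell aC \<otimes> Cell aT \<oplus> Num 2) (Write aBp (Var mJ \<oplus> Num 1) (Arr aBp (Var mJ) \<otimes> radixJE (Var mJ))) ;;
     Write aK (Num 0) (Arr aCp (Cell aT)) ;;
     Write aR (Num 0) (Arr aBp (Cell aC \<otimes> Cell aT \<oplus> Num 2))"

text \<open>\<open>aDt\<close> holds twice the numbers of edges of the snapshots (1 for an empty one), \<open>aD\<close> their product.\<close>

definition denomC :: cmd where
  "denomC =
     For mT (Cell aT) (Write aDt (Var mT)
       (CondE (Sum mI (Cell aN0) (Sum mJ (Cell aN0) (snapE (Var mT) (Var mI) (Var mJ))))
          (Sum mI (Cell aN0) (Sum mJ (Cell aN0) (snapE (Var mT) (Var mI) (Var mJ)))) (Num 1))) ;;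
     Write aD (Num 0) (Num 1) ;;
     For mT (Cell aT) (Write aD (Num 0) (Cell aD \<otimes> Arr aDt (Var mT)))"

definition sumDigitE :: "expr \<Rightarrow> expr" where
  "sumDigitE j = (Var mS \<oslash> Arr aBp j) \<odot> radixJE j"

text \<open>The modularity multiplied by the common denominator \<open>q * D\<close>. Negative
  values are cut off at 0, which does not affect the maximum since it is never negative.\<close>

definition valueE :: expr where
  "valueE = Monus
     (Cell aD \<otimes> (Num 2 \<otimes> Input (Num 4) \<otimes> sumDigitE (Cell aC \<otimes> Cell aT) \<oplus> Input (Num 3) \<otimes> sumDigitE (Cell aC \<otimes> Cell aT \<oplus> Num 1)))
     (Input (Num 4) \<otimes> Sum mT (Cell aT) ((Cell aD \<oslash> Arr aDt (Var mT)) \<otimes>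
        Sum mI (Cell aC) (sumDigitE (Var mT \<otimes> Cell aC \<oplus> Var mI) \<otimes> sumDigitE (Var mT \<otimes> Cell aC \<oplus> Var mI))))"

definition bestC :: cmd where
  "bestC =
     For mS (Cell aR) (If (AndE (Arr aTab (PairE (Cell aN0) (PairE (Num 0) (Var mS)))) (Less (Cell aRes) valueE))
       (Write aRes (Num 0) valueE) Skip) ;;
     Write aRes (Num 1) (Input (Num 4) \<otimes> Cell aD)"

definition mainC :: cmd where
  "mainC = setupC ;; orderC ;; powersC ;; sumsC mainA mainB ;; denomC ;; bestC"

text \<open>For n = 1 or c = 1 the maximum is \<omega> n (T - 1). A separate branch is essential,
  because the time bound can then be too small for the tables: c = 1 makes the factor with the
  treewidth trivial, and n = 1 with treewidth 0 leaves T^O(c), a constant for T = 1.\<close>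

definition modularityC :: cmd where
  "modularityC = If (AndE (Less (Num 1) (Input (Num 0))) (Less (Num 1) (Input (Num 2)))) mainC
     (Write aRes (Num 0) (Input (Num 3) \<otimes> Input (Num 0) \<otimes> Monus (Input (Num 1)) (Num 1)) ;;
      Write aRes (Num 1) (Input (Num 4)))"

lemma wp_Seq_fun: "wp I bd (c1 ;; c2) \<rho> Q = wp I bd c1 \<rho> (wp I bd c2 \<rho> Q)"
  by (rule ext) simp

lemmas order_program_defs = orderC_def extendC_def compressC_def placeC_def insertC_def splitC_def fixC_def
  sumsC_def vertexC_def labelC_def weightsC_def

section \<open>The statistics of a labelling and their packing into one number\<close>

locale main_program = order_program +
  fixes T c p q :: nat and snap :: "nat \<Rightarrow> nat \<Rightarrow> nat \<Rightarrow> bool"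
  assumes header: "I 0 = n" "I 1 = T" "I 2 = c" "I 3 = p" "I 4 = q"
    and snap_input: "\<And>t u x. t < T \<Longrightarrow> u < n \<Longrightarrow> x < n \<Longrightarrow> I (5 + n * n + t * (n * n) + u * n + x) = of_bool (snap t u x)"
    and snap_adj: "\<And>t u x. snap t u x \<Longrightarrow> adj u x" and snap_sym: "\<And>t u x. snap t u x \<Longrightarrow> snap t x u"
    and n2: "2 \<le> n" and c2: "2 \<le> c" and T1: "1 \<le> T"
    and big: "bd aRes = L * L * (p + 2 * q)"
    and L2: "n ^ (2 * (c * T)) * (T * n ^ 2) ^ 2 \<le> L" "(c ^ T) ^ (9 * w + 10) \<le> L" "(n * n) ^ T \<le> L"
begin

text \<open>Strict upper bounds of the volumes, and of the number of inner edges and the loyalty,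
  respectively.\<close>

definition base :: "nat \<Rightarrow> nat" where
  "base j = (if j < c * T then n * n else T * (n * n))"

definition weightJ :: "nat \<Rightarrow> nat" where
  "weightJ j = (\<Prod>i<j. base i)"

definition K where "K = c ^ T"
definition R where "R = weightJ (c * T + 2)"

definition dig :: "nat \<Rightarrow> nat \<Rightarrow> nat" where
  "dig t l = l div c ^ t mod c"

definition degr :: "nat \<Rightarrow> nat \<Rightarrow> nat" where
  "degr t v = (\<Sum>x<n. of_bool (snap t v x))"

definition vol :: "nat \<Rightarrow> nat \<Rightarrow> (nat \<Rightarrow> nat) \<Rightarrow> nat" where
  "vol t i lab = (\<Sum>v<n. if dig t (lab v) = i then degr t v else 0)"

definition inner :: "(nat \<Rightarrow> nat) \<Rightarrow> nat" where
  "inner lab = (\<Sum>y<n. \<Sum>x<n. of_bool (y < x) * (\<Sum>t<T. of_bool (snap t y x \<and> dig t (lab y) = dig t (lab x))))"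

definition loyal :: "(nat \<Rightarrow> nat) \<Rightarrow> nat" where
  "loyal lab = (\<Sum>v<n. \<Sum>t<T - 1. of_bool (dig t (lab v) = dig (Suc t) (lab v)))"

definition twice_edges :: "nat \<Rightarrow> nat" where
  "twice_edges t = (\<Sum>u<n. degr t u)"

definition den :: "nat \<Rightarrow> nat" where
  "den t = (if twice_edges t \<noteq> 0 then twice_edges t else 1)"

definition D where "D = (\<Prod>t<T. den t)"

definition objective :: "(nat \<Rightarrow> nat) \<Rightarrow> nat" where
  "objective lab = D * (2 * q * inner lab + p * loyal lab) - q * (\<Sum>t<T. (D div den t) * (\<Sum>i<c. vol t i lab * vol t i lab))"

definition digitJ :: "(nat \<Rightarrow> nat) \<Rightarrow> nat \<Rightarrow> nat" where
  "digitJ lab j = (if j < c * T then vol (j div c) (j mod c) lab else if j = c * T then inner lab else loyal lab)"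

lemma weightJ_Suc: "weightJ (Suc j) = weightJ j * base j"
  by (simp add: weightJ_def)

lemma base_pos: "1 \<le> base j"
  using n2 T1 by (simp add: base_def)

lemma weightJ_mono: "i \<le> j \<Longrightarrow> weightJ i \<le> weightJ j"
proof (induction j)
  case (Suc j)
  have "weightJ j \<le> weightJ (Suc j)" using base_pos[of j] by (simp add: weightJ_Suc)
  then show ?case using Suc by (cases "i = Suc j") auto
qed simp

lemma weightJ_low: "j \<le> c * T \<Longrightarrow> weightJ j = (n * n) ^ j"
  by (induction j) (auto simp: weightJ_Suc base_def, simp add: weightJ_def)

lemma R_le: "R \<le> L"
proof -
  have "R = (n * n) ^ (c * T) * (T * (n * n)) * (T * (n * n))"
    unfolding R_def using weightJ_low[of "c * T"]
    by (simp add: weightJ_Suc base_def numeral_2_eq_2)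
  also have "\<dots> = n ^ (2 * (c * T)) * (T * n ^ 2) ^ 2"
    by (simp add: power_mult power2_eq_square)
  finally show ?thesis using L2(1) by simp
qed

lemma weightJ_le: "j \<le> c * T + 2 \<Longrightarrow> weightJ j \<le> L"
  using weightJ_mono[of j "c * T + 2"] R_le by (simp add: R_def)

lemma Tnn_le: "T * (n * n) \<le> L"
proof -
  have "R = weightJ (Suc (c * T)) * (T * (n * n))" unfolding R_def by (simp add: weightJ_Suc base_def)
  moreover have "1 \<le> weightJ (Suc (c * T))" using weightJ_mono[of 0 "Suc (c * T)"] by (simp add: weightJ_def)
  ultimately have "T * (n * n) \<le> R" by simp
  then show ?thesis using R_le by simp
qed

lemma T_le: "T \<le> L"
proof -
  have "T \<le> T * (n * n)" using n2 by simp
  then show ?thesis using Tnn_le by linarith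
qed

lemma cpow_le: "t \<le> T \<Longrightarrow> c ^ t \<le> L"
proof -
  assume "t \<le> T"
  then have "c ^ t \<le> c ^ T" using c2 by (intro power_increasing) auto
  also have "\<dots> \<le> (c ^ T) ^ (9 * w + 10)" using c2 by (intro self_le_power) auto
  finally show ?thesis using L2(2) by simp
qed

lemma c_le: "c \<le> L"
  using cpow_le[of 1] T1 by simp

lemma dig_less: "dig t l < c"
  using c2 by (simp add: dig_def)

text \<open>There are no loops, so the vertex itself is not counted. The strict bound is what makes
  volumes digits in base \<open>n * n\<close>.\<close>

lemma degr_less: "degr t v < n"
proof (cases "v < n")
  case True
  have "degr t v = card {x. x < n \<and> snap t v x}" unfolding degr_def by (rule sum_of_bool_card)
  also have "\<dots> \<le> card ({..<n} - {v})" using snap_adj[of t v v] adj_irrefl[of v] by (intro card_mono) auto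
  also have "\<dots> < n" using True n2 by simp
  finally show ?thesis .
next
  case False
  then have "\<not> snap t v x" for x using snap_adj adj_less by blast
  then show ?thesis using n2 by (simp add: degr_def)
qed

lemma twice_edges_le: "twice_edges t \<le> n * (n - 1)"
proof -
  have "degr t u \<le> n - 1" for u using degr_less[of t u] n2 by linarith
  then have "twice_edges t \<le> (\<Sum>u<n. n - 1)" unfolding twice_edges_def by (intro sum_mono)
  then show ?thesis by simp
qed

lemma twice_edges_less: "twice_edges t < n * n"
proof -
  have "n * (n - 1) < n * n" using n2 by simp
  then show ?thesis using twice_edges_le[of t] by linarith
qed

lemma den_pos: "1 \<le> den t"
  by (simp add: den_def)

lemma den_le: "den t \<le> n * n"
  using twice_edges_less[of t] n2 by (auto simp: den_def)

lemma vol_less: "vol t i lab < n * n"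
proof -
  have "vol t i lab \<le> twice_edges t" unfolding vol_def twice_edges_def by (intro sum_mono) auto
  then show ?thesis using twice_edges_less[of t] by linarith
qed

lemma inner_less: "inner lab < T * (n * n)"
proof -
  have "of_bool (y < x) * (\<Sum>t<T. of_bool (snap t y x \<and> dig t (lab y) = dig t (lab x))) \<le> (\<Sum>t<T. of_bool (snap t y x) :: nat)" for x y
  proof -
    have "(\<Sum>t<T. of_bool (snap t y x \<and> dig t (lab y) = dig t (lab x))) \<le> (\<Sum>t<T. of_bool (snap t y x) :: nat)"
      by (rule sum_mono) simp
    then show ?thesis by (cases "y < x") simp_all
  qed
  then have "inner lab \<le> (\<Sum>y<n. \<Sum>x<n. \<Sum>t<T. of_bool (snap t y x))"
    unfolding inner_def by (intro sum_mono)
  also have "\<dots> = (\<Sum>y<n. \<Sum>t<T. degr t y)" unfolding degr_def by (rule sum.cong[OF refl]) (rule sum.swap)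
  also have "\<dots> = (\<Sum>t<T. twice_edges t)" unfolding twice_edges_def by (rule sum.swap)
  also have "\<dots> < (\<Sum>t<T. n * n)" using twice_edges_less T1 by (intro sum_strict_mono) (auto simp: lessThan_empty_iff)
  finally show ?thesis by simp
qed

lemma loyal_less: "loyal lab < T * (n * n)"
proof -
  have "loyal lab \<le> (\<Sum>v<n. \<Sum>t<T - 1. 1)" unfolding loyal_def by (intro sum_mono) auto
  also have "\<dots> = n * (T - 1)" by simp
  also have "\<dots> < n * T" using T1 n2 by simp
  also have "\<dots> \<le> T * (n * n)" using n2 by simp
  finally show ?thesis .
qed

lemma digitJ_less: "digitJ lab j < base j"
  using vol_less inner_less loyal_less by (auto simp: digitJ_def base_def)

definition packed :: "(nat \<Rightarrow> nat) \<Rightarrow> nat" where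
  "packed lab = (\<Sum>j<c * T + 2. digitJ lab j * weightJ j)"

lemma packed_less: "packed lab < R"
  unfolding packed_def R_def
  by (rule mixed_radix_less[where b = base]) (use digitJ_less in \<open>auto simp: weightJ_Suc weightJ_def[of 0]\<close>)

lemma packed_digit: "j < c * T + 2 \<Longrightarrow> packed lab div weightJ j mod base j = digitJ lab j"
  unfolding packed_def
  by (rule mixed_radix_digit[where b = base]) (use digitJ_less in \<open>auto simp: weightJ_Suc weightJ_def[of 0]\<close>)

definition value_of :: "nat \<Rightarrow> nat" where
  "value_of s = (let d = \<lambda>j. s div weightJ j mod base j in
     D * (2 * q * d (c * T) + p * d (c * T + 1)) - q * (\<Sum>t<T. (D div den t) * (\<Sum>i<c. d (t * c + i) * d (t * c + i))))"

lemma index_less: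
  assumes "t < T" "i < c"
  shows "t * c + i < c * T" "(t * c + i) div c = t" "(t * c + i) mod c = i"
proof -
  have "t * c + i < Suc t * c" using assms by simp
  also have "\<dots> \<le> T * c" using assms by (intro mult_le_mono1) simp
  finally show "t * c + i < c * T" by (simp add: mult.commute)
qed (use assms in auto)

lemma value_packed: "value_of (packed lab) = objective lab"
proof -
  have "packed lab div weightJ (t * c + i) mod base (t * c + i) = vol t i lab" if "t < T" "i < c" for t i
    using packed_digit[of "t * c + i" lab] index_less[OF that] by (simp add: digitJ_def)
  then have "(\<Sum>i<c. (packed lab div weightJ (t * c + i) mod base (t * c + i)) * (packed lab div weightJ (t * c + i) mod base (t * c + i))) =
      (\<Sum>i<c. vol t i lab * vol t i lab)" if "t < T" for t using that by (intro sum.cong) auto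
  then have "(\<Sum>t<T. (D div den t) * (\<Sum>i<c. (packed lab div weightJ (t * c + i) mod base (t * c + i)) * (packed lab div weightJ (t * c + i) mod base (t * c + i)))) =
      (\<Sum>t<T. (D div den t) * (\<Sum>i<c. vol t i lab * vol t i lab))" by (intro sum.cong) auto
  then show ?thesis
    using packed_digit[of "c * T" lab] packed_digit[of "c * T + 1" lab]
    unfolding value_of_def objective_def Let_def by (simp add: digitJ_def)
qed

lemma D_le: "D \<le> L"
proof -
  have "D \<le> (\<Prod>t<T. n * n)" unfolding D_def using den_le by (intro prod_mono) auto
  then show ?thesis using L2(3) by simp
qed

text \<open>Every sum is covered, achievable or not: its last two digits are below
  \<open>T * (n * n)\<close>, hence at most \<open>L\<close>, and \<open>D\<close> supplies the
  second factor \<open>L\<close>.\<close>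

lemma value_le: "value_of s \<le> bd aRes"
proof -
  let ?d = "\<lambda>j. s div weightJ j mod base j"
  have b: "base (c * T) = T * (n * n)" "base (c * T + 1) = T * (n * n)" by (simp_all add: base_def)
  have "?d (c * T) \<le> L" "?d (c * T + 1) \<le> L"
    using Tnn_le b base_pos[of "c * T"] mod_less_divisor[of "T * (n * n)"] by (metis less_imp_le_nat less_le_trans zero_less_one order_trans)+
  then have "2 * q * ?d (c * T) + p * ?d (c * T + 1) \<le> 2 * q * L + p * L" by (intro add_mono mult_le_mono) auto
  then have "D * (2 * q * ?d (c * T) + p * ?d (c * T + 1)) \<le> L * (2 * q * L + p * L)" using D_le by (intro mult_le_mono) auto
  moreover have "L * (2 * q * L + p * L) = bd aRes" unfolding big by (simp add: algebra_simps)
  moreover have "value_of s \<le> D * (2 * q * ?d (c * T) + p * ?d (c * T + 1))" unfolding value_of_def Let_def by simp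
  ultimately show ?thesis by linarith
qed

text \<open>Any rule that picks one order of each pair in the support gives half of the symmetric
  sum. It serves to compare the charging of edges to their earlier ends with the order of vertex
  numbers used in \<open>inner\<close>.\<close>

lemma sum_oriented:
  fixes F :: "nat \<Rightarrow> nat \<Rightarrow> nat"
  assumes "\<And>x y. F x y = F y x" "\<And>x y. x < n \<Longrightarrow> y < n \<Longrightarrow> F y x \<noteq> 0 \<Longrightarrow> r y x = (\<not> r x y)"
  shows "2 * (\<Sum>y<n. \<Sum>x<n. of_bool (r y x) * F y x) = (\<Sum>y<n. \<Sum>x<n. F y x)"
proof -
  have "(\<Sum>y<n. \<Sum>x<n. of_bool (r y x) * F y x) = (\<Sum>x<n. \<Sum>y<n. of_bool (r y x) * F y x)" by (rule sum.swap)
  also have "\<dots> = (\<Sum>y<n. \<Sum>x<n. of_bool (r x y) * F y x)"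
    by (intro sum.cong refl) (simp add: assms(1))
  finally have "2 * (\<Sum>y<n. \<Sum>x<n. of_bool (r y x) * F y x) =
      (\<Sum>y<n. \<Sum>x<n. of_bool (r y x) * F y x) + (\<Sum>y<n. \<Sum>x<n. of_bool (r x y) * F y x)" by simp
  also have "\<dots> = (\<Sum>y<n. \<Sum>x<n. of_bool (r y x) * F y x + of_bool (r x y) * F y x)" by (simp only: sum.distrib)
  also have "\<dots> = (\<Sum>y<n. \<Sum>x<n. F y x)"
  proof (intro sum.cong refl)
    fix y x assume "y \<in> {..<n}" "x \<in> {..<n}"
    then show "of_bool (r y x) * F y x + of_bool (r x y) * F y x = F y x"
      using assms(2)[of x y] by (cases "F y x = 0"; cases "r y x") auto
  qed
  finally show ?thesis .
qed

section \<open>Correctness of the main program\<close>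

definition ready :: "store \<Rightarrow> bool" where
  "ready st \<longleftrightarrow> extended st \<and> st aT 0 = T \<and> st aC 0 = c \<and> (\<forall>t\<le>T. st aCp t = c ^ t) \<and>
     (\<forall>j\<le>c * T + 2. st aBp j = weightJ j) \<and> st aK 0 = K \<and> st aR 0 = R"

lemma readyD:
  assumes "ready st"
  shows "st aN0 0 = n" "st aN 0 = Suc n" "st aT 0 = T" "st aC 0 = c" "\<And>t. t \<le> T \<Longrightarrow> st aCp t = c ^ t"
    "\<And>j. j \<le> c * T + 2 \<Longrightarrow> st aBp j = weightJ j" "st aK 0 = K" "st aR 0 = R"
  using assms by (auto simp: ready_def extended_def)

lemma extended_cong:
  assumes "extended st" "same_except A st st'" "A \<inter> {aN, aN0, aPos, aH} = {}"
  shows "extended st'"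
proof -
  have "st' aN = st aN" "st' aN0 = st aN0" "st' aPos = st aPos" "st' aH = st aH"
    using assms(2,3) unfolding same_except_def by auto
  then show ?thesis using assms(1) rows_cong[of st' aH st "Suc n"] by (simp add: extended_def)
qed

lemma ready_cong:
  assumes "ready st" "same_except A st st'" "A \<inter> {aN, aN0, aPos, aH, aT, aC, aCp, aBp, aK, aR} = {}"
  shows "ready st'"
proof -
  have "st' aT = st aT" "st' aC = st aC" "st' aCp = st aCp" "st' aBp = st aBp" "st' aK = st aK" "st' aR = st aR"
    using assms(2,3) unfolding same_except_def by auto
  moreover have "extended st'" by (rule extended_cong[OF _ assms(2)]) (use assms(1,3) in \<open>auto simp: ready_def\<close>)
  ultimately show ?thesis using assms(1) by (simp add: ready_def)
qed

lemma val_snapE: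
  assumes "st aN0 0 = n" "val I t \<rho> st < T" "val I u \<rho> st < n" "val I x \<rho> st < n"
  shows "val I (snapE t u x) \<rho> st = of_bool (snap (val I t \<rho> st) (val I u \<rho> st) (val I x \<rho> st))"
  using snap_input[OF assms(2-4)] assms(1) by (simp add: snapE_def)

lemma val_digitE:
  assumes "ready st" "val I t \<rho> st \<le> T"
  shows "val I (digitE t l) \<rho> st = dig (val I t \<rho> st) (val I l \<rho> st)"
  using readyD[OF assms(1)] assms(2) by (simp add: digitE_def dig_def)

definition \<alpha> :: "nat \<Rightarrow> nat \<Rightarrow> nat" where
  "\<alpha> v l = (if v < n then (\<Sum>t<T. degr t v * weightJ (t * c + dig t l)) +
     (\<Sum>t<T - 1. of_bool (dig t l = dig (Suc t) l)) * weightJ (c * T + 1) else 0)"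

definition \<beta> :: "nat \<Rightarrow> nat \<Rightarrow> nat \<Rightarrow> nat \<Rightarrow> nat" where
  "\<beta> v x l l' = (if v < n \<and> x < n then (\<Sum>t<T. of_bool (snap t v x \<and> dig t l = dig t l')) * weightJ (c * T) else 0)"

lemma val_mainA:
  assumes r: "ready st"
  shows "val I mainA \<rho> st = \<alpha> (\<rho> rV) (\<rho> rL)"
proof (cases "\<rho> rV < n")
  case True
  have s: "val I (snapE (Var mT) (Var rV) (Var mI)) (\<rho>(mT := t, mI := x)) st = of_bool (snap t (\<rho> rV) x)" if "t < T" "x < n" for t x
    by (subst val_snapE) (use readyD[OF r] that True in auto)
  have d: "val I (digitE (Var mT) (Var rL)) (\<rho>(mT := t)) st = dig t (\<rho> rL)" if "t \<le> T" for t
    by (subst val_digitE[OF r]) (use that in auto)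
  have d': "val I (digitE (Var mT \<oplus> Num 1) (Var rL)) (\<rho>(mT := t)) st = dig (Suc t) (\<rho> rL)" if "Suc t \<le> T" for t
    by (subst val_digitE[OF r]) (use that in auto)
  have 1: "val I (Sum mI (Cell aN0) (snapE (Var mT) (Var rV) (Var mI)) \<otimes> Arr aBp (Var mT \<otimes> Cell aC \<oplus> digitE (Var mT) (Var rL))) (\<rho>(mT := t)) st
      = degr t (\<rho> rV) * weightJ (t * c + dig t (\<rho> rL))" if t: "t < T" for t
  proof -
    have "t * c + dig t (\<rho> rL) \<le> c * T + 2" using index_less(1)[OF t, of "dig t (\<rho> rL)"] dig_less[of t "\<rho> rL"] by simp
    then show ?thesis using readyD[OF r] s[OF t] d[of t] t by (simp add: degr_def)
  qed
  have 2: "val I (EqE (digitE (Var mT) (Var rL)) (digitE (Var mT \<oplus> Num 1) (Var rL))) (\<rho>(mT := t)) st = of_bool (dig t (\<rho> rL) = dig (Suc t) (\<rho> rL))"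
    if "t < T - 1" for t using d[of t] d'[of t] that by simp
  have "val I (Sum mT (Cell aT) (Sum mI (Cell aN0) (snapE (Var mT) (Var rV) (Var mI)) \<otimes>
        Arr aBp (Var mT \<otimes> Cell aC \<oplus> digitE (Var mT) (Var rL)))) \<rho> st = (\<Sum>t<T. degr t (\<rho> rV) * weightJ (t * c + dig t (\<rho> rL)))"
    unfolding val.simps(8)[of _ mT] by (rule sum.cong) (simp add: readyD[OF r], rule 1, simp)
  moreover have "val I (Sum mT (Monus (Cell aT) (Num 1)) (EqE (digitE (Var mT) (Var rL)) (digitE (Var mT \<oplus> Num 1) (Var rL)))) \<rho> st =
      (\<Sum>t<T - 1. of_bool (dig t (\<rho> rL) = dig (Suc t) (\<rho> rL)))"
    unfolding val.simps(8)[of _ mT] by (rule sum.cong) (simp add: readyD[OF r], rule 2, simp)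
  ultimately show ?thesis
    unfolding mainA_def using True readyD[OF r] by (simp add: \<alpha>_def)
next
  case False
  then show ?thesis unfolding mainA_def using readyD[OF r] by (simp add: \<alpha>_def)
qed

lemma val_labE_other: "val I labE (\<rho>(mT := t)) st = val I labE \<rho> st"
  by (simp add: labE_def)

lemma val_mainB:
  assumes r: "ready st"
  shows "val I mainB \<rho> st = \<beta> (\<rho> rV) (\<rho> rX) (\<rho> rL) (val I labE \<rho> st)"
proof (cases "\<rho> rV < n \<and> \<rho> rX < n")
  case True
  have "val I (AndE (snapE (Var mT) (Var rV) (Var rX)) (EqE (digitE (Var mT) (Var rL)) (digitE (Var mT) labE))) (\<rho>(mT := t)) st =
      of_bool (snap t (\<rho> rV) (\<rho> rX) \<and> dig t (\<rho> rL) = dig t (val I labE \<rho> st))" if "t < T" for t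
  proof -
    have "val I (snapE (Var mT) (Var rV) (Var rX)) (\<rho>(mT := t)) st = of_bool (snap t (\<rho> rV) (\<rho> rX))"
      by (subst val_snapE) (use readyD[OF r] that True in auto)
    moreover have "val I (digitE (Var mT) l) (\<rho>(mT := t)) st = dig t (val I l (\<rho>(mT := t)) st)" for l
      by (subst val_digitE[OF r]) (use that in auto)
    ultimately show ?thesis by (simp add: val_labE_other)
  qed
  then have "val I (Sum mT (Cell aT) (AndE (snapE (Var mT) (Var rV) (Var rX)) (EqE (digitE (Var mT) (Var rL)) (digitE (Var mT) labE)))) \<rho> st =
      (\<Sum>t<T. of_bool (snap t (\<rho> rV) (\<rho> rX) \<and> dig t (\<rho> rL) = dig t (val I labE \<rho> st)))"
    using readyD[OF r] unfolding val.simps(8)[of _ mT] by (intro sum.cong) (auto simp del: val_EqE val_AndE)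
  then show ?thesis
    unfolding mainB_def using True readyD[OF r] by (simp add: \<beta>_def)
next
  case False
  then show ?thesis unfolding mainB_def using readyD[OF r] by (auto simp: \<beta>_def)
qed

text \<open>A vertex adds its degree at time t to the digit of its own part at time t, so these
  digits collect the volumes.\<close>

lemma sum_alpha:
  "(\<Sum>v<n. \<alpha> v (lab v)) = (\<Sum>j<c * T. digitJ lab j * weightJ j) + loyal lab * weightJ (c * T + 1)"
proof -
  have "(\<Sum>v<n. \<Sum>t<T. degr t v * weightJ (t * c + dig t (lab v))) = (\<Sum>t<T. \<Sum>v<n. degr t v * weightJ (t * c + dig t (lab v)))"
    by (rule sum.swap)
  also have "\<dots> = (\<Sum>t<T. \<Sum>i<c. vol t i lab * weightJ (t * c + i))"
  proof (rule sum.cong[OF refl])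
    fix t assume "t \<in> {..<T}"
    have "(\<Sum>i<c. vol t i lab * weightJ (t * c + i)) = (\<Sum>i<c. \<Sum>v<n. if dig t (lab v) = i then degr t v * weightJ (t * c + i) else 0)"
      unfolding vol_def sum_distrib_right by (intro sum.cong refl) simp
    also have "\<dots> = (\<Sum>v<n. \<Sum>i<c. if dig t (lab v) = i then degr t v * weightJ (t * c + i) else 0)" by (rule sum.swap)
    also have "\<dots> = (\<Sum>v<n. degr t v * weightJ (t * c + dig t (lab v)))"
      using dig_less by (intro sum.cong refl) (simp add: sum.delta)
    finally show "(\<Sum>v<n. degr t v * weightJ (t * c + dig t (lab v))) = (\<Sum>i<c. vol t i lab * weightJ (t * c + i))" by simp
  qed
  \<comment> \<open>The digits of the volumes are grouped in blocks of length c, one for each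
    time.\<close>
  also have "\<dots> = (\<Sum>t<T. \<Sum>j\<in>{t * c..<t * c + c}. digitJ lab j * weightJ j)"
  proof (rule sum.cong[OF refl])
    fix t assume t: "t \<in> {..<T}"
    have "(\<Sum>j\<in>{t * c..<t * c + c}. digitJ lab j * weightJ j) = (\<Sum>i<c. digitJ lab (t * c + i) * weightJ (t * c + i))"
      using sum.shift_bounds_nat_ivl[of "\<lambda>j. digitJ lab j * weightJ j" 0 "t * c" c] by (simp add: add.commute lessThan_atLeast0)
    also have "\<dots> = (\<Sum>i<c. vol t i lab * weightJ (t * c + i))"
      using t index_less[of t] by (intro sum.cong refl) (auto simp: digitJ_def)
    finally show "(\<Sum>i<c. vol t i lab * weightJ (t * c + i)) = (\<Sum>j\<in>{t * c..<t * c + c}. digitJ lab j * weightJ j)" by simp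
  qed
  also have "\<dots> = (\<Sum>j<c * T. digitJ lab j * weightJ j)" using sum.nat_group[of _ c T] by (simp add: mult.commute)
  finally show ?thesis
    unfolding \<alpha>_def loyal_def by (simp add: sum.distrib sum_distrib_right del: sum_of_bool_eq)
qed

lemma wp_sums_main:
  assumes r: "ready st"
  shows "wp I bd (sumsC mainA mainB) \<rho> (\<lambda>st'. same_except {aPw, aP, aTab} st st' \<and>
    (\<forall>s<R. st' aTab (prod_encode (n, prod_encode (0, s))) = of_bool (\<exists>lab. (\<forall>x<n. lab x < K) \<and> s = packed lab))) st"
proof -
  let ?H = "rows aH st (Suc n)"
  have ext: "extended st" using r by (simp add: ready_def)
  have K1: "1 \<le> K" using c2 by (simp add: K_def)
  interpret S: sums_program I bd st "Suc n" K R adj ?H "st aPos" \<alpha> \<beta> mainA mainB n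
  proof
    show "st aH (prod_encode (u, x)) \<noteq> 0 \<longleftrightarrow> x \<in> ?H u" if "u < Suc n" "x < Suc n" for u x using that by (simp add: rows_def)
    show "elim_order (Suc n) adj (st aPos) ?H" using ext by (simp add: extended_def)
    show "n \<in> ?H u" if "u < Suc n" "u \<noteq> n" for u using ext that unfolding extended_def by blast
    show "K ^ card (?H u) \<le> bd aPw" if "u < Suc n" for u
    proof -
      have "card (?H u) \<le> 9 * w + 10" using ext that unfolding extended_def by blast
      then have "K ^ card (?H u) \<le> K ^ (9 * w + 10)" using K1 by (intro power_increasing)
      then show ?thesis using L2(2) bd[of aPw] by (simp add: K_def)
    qed
    fix \<rho> :: env and st' :: store assume s: "same_except {aPw, aP, aTab} st st'"
    have r': "ready st'" by (rule ready_cong[OF r s]) simp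
    show "val I mainA \<rho> st' = \<alpha> (\<rho> rV) (\<rho> rL)" by (rule val_mainA[OF r'])
    show "val I mainB \<rho> st' = \<beta> (\<rho> rV) (\<rho> rX) (\<rho> rL) (val I labE \<rho> st')" by (rule val_mainB[OF r'])
  qed (use readyD[OF r] K1 small_bounds in auto)
  have tot: "(\<Sum>y<Suc n. S.contrib y lab) = packed lab" for lab
  proof -
    define F where "F y x = (\<Sum>t<T. of_bool (snap t y x \<and> dig t (lab y) = dig t (lab x)) :: nat)" for y x
    have Fs: "F x y = F y x" for x y unfolding F_def by (intro sum.cong refl) (use snap_sym in auto)
    have Fa: "adj y x" if "F y x \<noteq> 0" for x y
    proof (rule ccontr)
      assume "\<not> adj y x"
      then have "\<not> snap t y x" for t using snap_adj by blast
      then show False using that by (simp add: F_def)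
    qed
    \<comment> \<open>Rows orient every edge from its earlier to its later end.\<close>
    have "2 * (\<Sum>y<n. \<Sum>x<n. of_bool (x \<in> ?H y) * F y x) = (\<Sum>y<n. \<Sum>x<n. F y x)"
    proof (rule sum_oriented[OF Fs])
      fix x y assume xy: "x < n" "y < n" "F y x \<noteq> 0"
      have "x \<noteq> y" using Fa[OF xy(3)] adj_irrefl by metis
      then have ne: "st aPos x \<noteq> st aPos y" using S.pos_inj xy by (auto dest: inj_onD)
      have up: "st aPos u < st aPos v" if "v \<in> ?H u" "u < n" for u v using S.H_pos[of u v] that by simp
      have dn: "v \<in> ?H u" if "u < n" "v < n" "adj u v" "st aPos u < st aPos v" for u v
        using ext that unfolding extended_def elim_order_def by (metis less_SucI)
      show "(x \<in> ?H y) = (\<not> y \<in> ?H x)"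
        using ne up[of x y] up[of y x] dn[of x y] dn[of y x] xy Fa[OF xy(3)] adj_sym by (metis linorder_neqE_nat less_asym)
    qed
    moreover have "2 * inner lab = (\<Sum>y<n. \<Sum>x<n. F y x)"
      unfolding inner_def F_def[symmetric]
    proof (rule sum_oriented[OF Fs])
      fix x y assume "F y x \<noteq> 0"
      then have "x \<noteq> y" using Fa adj_irrefl by metis
      then show "(y < x) = (\<not> x < y)" by auto
    qed
    ultimately have inn: "(\<Sum>y<n. \<Sum>x<n. of_bool (x \<in> ?H y) * F y x) = inner lab" by simp
    have row: "(\<Sum>x<Suc n. if x \<in> ?H y then \<beta> y x (lab y) (lab x) else 0) = (\<Sum>x<n. of_bool (x \<in> ?H y) * F y x) * weightJ (c * T)" if "y < n" for y
    proof -
      have "(\<Sum>x<Suc n. if x \<in> ?H y then \<beta> y x (lab y) (lab x) else 0) = (\<Sum>x<n. if x \<in> ?H y then \<beta> y x (lab y) (lab x) else 0)"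
        by (simp add: \<beta>_def)
      also have "\<dots> = (\<Sum>x<n. of_bool (x \<in> ?H y) * F y x * weightJ (c * T))"
        using that by (intro sum.cong refl) (auto simp: \<beta>_def F_def simp del: sum_of_bool_eq)
      finally show ?thesis by (simp only: sum_distrib_right)
    qed
    have "(\<Sum>y<n. \<Sum>x<Suc n. if x \<in> ?H y then \<beta> y x (lab y) (lab x) else 0) =
        (\<Sum>y<n. (\<Sum>x<n. of_bool (x \<in> ?H y) * F y x) * weightJ (c * T))"
      by (rule sum.cong[OF refl], rule row) simp
    also have "\<dots> = inner lab * weightJ (c * T)" by (simp only: sum_distrib_right[symmetric] inn)
    finally have "(\<Sum>y<n. \<Sum>x<Suc n. if x \<in> ?H y then \<beta> y x (lab y) (lab x) else 0) = inner lab * weightJ (c * T)" .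
    then have "(\<Sum>y<n. S.contrib y lab) = (\<Sum>v<n. \<alpha> v (lab v)) + inner lab * weightJ (c * T)"
      by (simp only: S.contrib_def sum.distrib)
    moreover have "S.contrib n lab = 0" by (auto simp: S.contrib_def \<alpha>_def \<beta>_def intro!: sum.neutral)
    ultimately have "(\<Sum>y<Suc n. S.contrib y lab) = (\<Sum>v<n. \<alpha> v (lab v)) + inner lab * weightJ (c * T)"
      by simp
    moreover have "packed lab = (\<Sum>j<c * T. digitJ lab j * weightJ j) + inner lab * weightJ (c * T) + loyal lab * weightJ (c * T + 1)"
      unfolding packed_def by (simp add: digitJ_def)
    ultimately show ?thesis unfolding sum_alpha by simp
  qed
  \<comment> \<open>The label of the dummy vertex does not influence the statistics, so it can be
    set to 0.\<close>
  have ex: "(\<exists>lab. (\<forall>x<Suc n. lab x < K) \<and> s = packed lab) \<longleftrightarrow> (\<exists>lab. (\<forall>x<n. lab x < K) \<and> s = packed lab)" for s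
  proof
    assume "\<exists>lab. (\<forall>x<n. lab x < K) \<and> s = packed lab"
    then obtain lab where l: "\<forall>x<n. lab x < K" "s = packed lab" by blast
    have "vol t i (lab(n := 0)) = vol t i lab" for t i unfolding vol_def by (intro sum.cong refl) simp
    moreover have "inner (lab(n := 0)) = inner lab" unfolding inner_def by (intro sum.cong refl) simp
    moreover have "loyal (lab(n := 0)) = loyal lab" unfolding loyal_def by (intro sum.cong refl) simp
    ultimately have "packed (lab(n := 0)) = packed lab" unfolding packed_def by (intro sum.cong refl) (simp add: digitJ_def)
    then show "\<exists>lab. (\<forall>x<Suc n. lab x < K) \<and> s = packed lab"
      using l K1 by (intro exI[of _ "lab(n := 0)"]) (auto simp: less_Suc_eq)
  next
    assume "\<exists>lab. (\<forall>x<Suc n. lab x < K) \<and> s = packed lab"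
    then show "\<exists>lab. (\<forall>x<n. lab x < K) \<and> s = packed lab" using less_SucI by blast
  qed
  show ?thesis by (rule wp_mono[OF S.wp_sumsC[OF same_except_refl]]) (simp only: tot ex, blast)
qed

lemma wp_powersC:
  assumes ext: "extended st" and T0: "st aT 0 = T" and C0: "st aC 0 = c"
  shows "wp I bd powersC \<rho> ready st"
proof -
  let ?A = "{aCp, aBp, aK, aR}"
  have n0: "st aN0 0 = n" using ext by (simp add: extended_def)
  have s: "st' aT 0 = T" "st' aC 0 = c" "st' aN0 0 = n" if "same_except ?A st st'" for st'
    using same_exceptD[OF that] T0 C0 n0 by auto
  define J1 where "J1 i st' \<longleftrightarrow> same_except ?A st st' \<and> (\<forall>t\<le>i. st' aCp t = c ^ t)" for i :: nat and st' :: store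
  define J2 where "J2 i st' \<longleftrightarrow> J1 T st' \<and> (\<forall>j\<le>i. st' aBp j = weightJ j)" for i :: nat and st' :: store
  have last: "wp I bd (Write aK (Num 0) (Arr aCp (Cell aT)) ;; Write aR (Num 0) (Arr aBp (Cell aC \<otimes> Cell aT \<oplus> Num 2))) \<rho> ready st'"
    if J: "J2 (c * T + 2) st'" for st'
  proof -
    have se: "same_except ?A st st'" using J by (simp add: J2_def J1_def)
    have "ready (st'(aK := (st' aK)(0 := K), aR := (st' aR)(0 := R)))"
      unfolding ready_def using J s[OF se] extended_cong[OF ext, of ?A] se by (simp add: J2_def J1_def)
    moreover have "st' aCp T = K" "st' aBp (c * T + 2) = R" "K \<le> bd aK" "R \<le> bd aR"
      using J cpow_le[of T] R_le bd[of aK] bd[of aR] by (simp_all add: J1_def J2_def K_def R_def)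
    ultimately show ?thesis using s[OF se] by simp
  qed
  have second: "wp I bd (For mJ (Cell aC \<otimes> Cell aT \<oplus> Num 2) (Write aBp (Var mJ \<oplus> Num 1) (Arr aBp (Var mJ) \<otimes> radixJE (Var mJ)))) \<rho>
      (wp I bd (Write aK (Num 0) (Arr aCp (Cell aT)) ;; Write aR (Num 0) (Arr aBp (Cell aC \<otimes> Cell aT \<oplus> Num 2))) \<rho> ready) st'"
    if J: "J2 0 st'" for st'
  proof (rule wp_For[where J = J2 and n = "c * T + 2"])
    show "val I (Cell aC \<otimes> Cell aT \<oplus> Num 2) \<rho> st' = c * T + 2" using s[of st'] J by (simp add: J2_def J1_def)
    fix i st1 assume i: "i < c * T + 2" and J: "J2 i st1"
    have se: "same_except ?A st st1" using J by (simp add: J2_def J1_def)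
    have "val I (Arr aBp (Var mJ) \<otimes> radixJE (Var mJ)) (\<rho>(mJ := i)) st1 = weightJ (Suc i)"
      using J s[OF se] by (simp add: J2_def radixJE_def weightJ_Suc base_def)
    moreover have "weightJ (Suc i) \<le> bd aBp" using weightJ_le[of "Suc i"] bd[of aBp] i by simp
    ultimately show "wp I bd (Write aBp (Var mJ \<oplus> Num 1) (Arr aBp (Var mJ) \<otimes> radixJE (Var mJ))) (\<rho>(mJ := i)) (J2 (Suc i)) st1"
      using J by (simp add: J2_def J1_def le_Suc_eq del: val.simps(5)) auto
  qed (use J last in auto)
  have "wp I bd (For mT (Cell aT) (Write aCp (Var mT \<oplus> Num 1) (Arr aCp (Var mT) \<otimes> Cell aC))) \<rho>
     (wp I bd (Write aBp (Num 0) (Num 1) ;; For mJ (Cell aC \<otimes> Cell aT \<oplus> Num 2) (Write aBp (Var mJ \<oplus> Num 1) (Arr aBp (Var mJ) \<otimes> radixJE (Var mJ))) ;;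
      Write aK (Num 0) (Arr aCp (Cell aT)) ;; Write aR (Num 0) (Arr aBp (Cell aC \<otimes> Cell aT \<oplus> Num 2))) \<rho> ready) (st(aCp := (st aCp)(0 := 1)))"
  proof (rule wp_For[where J = J1 and n = T])
    show "J1 0 (st(aCp := (st aCp)(0 := 1)))" by (simp add: J1_def)
    show "val I (Cell aT) \<rho> (st(aCp := (st aCp)(0 := 1))) = T" using T0 by simp
    fix i st1 assume i: "i < T" and J: "J1 i st1"
    have se: "same_except ?A st st1" using J by (simp add: J1_def)
    have "c ^ Suc i \<le> bd aCp" using cpow_le[of "Suc i"] bd[of aCp] i by simp
    then show "wp I bd (Write aCp (Var mT \<oplus> Num 1) (Arr aCp (Var mT) \<otimes> Cell aC)) (\<rho>(mT := i)) (J1 (Suc i)) st1"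
      using J s[OF se] by (auto simp: J1_def le_Suc_eq mult.commute)
  next
    fix st1 assume J: "J1 T st1"
    have "J2 0 (st1(aBp := (st1 aBp)(0 := 1)))" using J by (simp add: J1_def J2_def weightJ_def)
    then show "wp I bd (Write aBp (Num 0) (Num 1) ;; For mJ (Cell aC \<otimes> Cell aT \<oplus> Num 2) (Write aBp (Var mJ \<oplus> Num 1) (Arr aBp (Var mJ) \<otimes> radixJE (Var mJ))) ;;
      Write aK (Num 0) (Arr aCp (Cell aT)) ;; Write aR (Num 0) (Arr aBp (Cell aC \<otimes> Cell aT \<oplus> Num 2))) \<rho> ready st1"
      using second small_bounds(1)[of aBp] by (simp del: val.simps(2-8))
  qed
  then show ?thesis unfolding powersC_def using small_bounds(1)[of aCp] by (simp del: wp_If)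
qed

definition weighed :: "store \<Rightarrow> bool" where
  "weighed st \<longleftrightarrow> (\<forall>t<T. st aDt t = den t) \<and> st aD 0 = D"

lemma wp_denomC:
  assumes r: "ready st"
  shows "wp I bd denomC \<rho> weighed st"
proof -
  let ?S = "Sum mI (Cell aN0) (Sum mJ (Cell aN0) (snapE (Var mT) (Var mI) (Var mJ)))"
  have S: "val I ?S (\<rho>(mT := t)) st' = twice_edges t" if "same_except {aDt} st st'" "t < T" for t st'
  proof -
    have n0: "st' aN0 0 = n" using same_exceptD[OF that(1), of aN0] readyD[OF r] by simp
    have "val I (snapE (Var mT) (Var mI) (Var mJ)) (\<rho>(mT := t, mI := u, mJ := x)) st' = of_bool (snap t u x)" if "u < n" "x < n" for u x
      by (subst val_snapE) (use n0 that \<open>t < T\<close> in auto)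
    then show ?thesis using n0 by (simp add: twice_edges_def degr_def del: sum_of_bool_eq)
  qed
  have part: "(\<Prod>t<i. den t) \<le> bd aD" if "i \<le> T" for i
  proof -
    have "(\<Prod>t<i. den t) \<le> (\<Prod>t<i. n * n)" using den_le by (intro prod_mono) auto
    also have "\<dots> = (n * n) ^ i" by simp
    also have "\<dots> \<le> (n * n) ^ T" using that n2 by (intro power_increasing) auto
    finally show ?thesis using L2(3) bd[of aD] by simp
  qed
  have second: "wp I bd (For mT (Cell aT) (Write aD (Num 0) (Cell aD \<otimes> Arr aDt (Var mT)))) \<rho> weighed st'"
    if "st' aD 0 = 1" "st' aT 0 = T" "\<forall>t<T. st' aDt t = den t" for st'
  proof (rule wp_For[where n = T and J = "\<lambda>i st1. same_except {aD} st' st1 \<and> st1 aD 0 = (\<Prod>t<i. den t)"])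
    fix i st1 assume i: "i < T" and J: "same_except {aD} st' st1 \<and> st1 aD 0 = (\<Prod>t<i. den t)"
    have "st1 aDt = st' aDt" using J same_exceptD[of "{aD}" st' st1 aDt] by simp
    then show "wp I bd (Write aD (Num 0) (Cell aD \<otimes> Arr aDt (Var mT))) (\<rho>(mT := i))
        (\<lambda>st1. same_except {aD} st' st1 \<and> st1 aD 0 = (\<Prod>t<Suc i. den t)) st1"
      using J i that(3) part[of "Suc i"] by simp
  next
    fix st1 assume "same_except {aD} st' st1 \<and> st1 aD 0 = (\<Prod>t<T. den t)"
    then show "weighed st1" using that(3) same_exceptD[of "{aD}" st' st1 aDt] by (simp add: weighed_def D_def)
  qed (use that in auto)
  have "wp I bd (For mT (Cell aT) (Write aDt (Var mT) (CondE ?S ?S (Num 1)))) \<rho>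
      (wp I bd (Write aD (Num 0) (Num 1) ;; For mT (Cell aT) (Write aD (Num 0) (Cell aD \<otimes> Arr aDt (Var mT)))) \<rho> weighed) st"
  proof (rule wp_fill[where n = T and f = "\<lambda>t. t" and h = den])
    show "val I (Cell aT) \<rho> st = T" using readyD[OF r] by simp
    fix i st' assume "i < T" "same_except {aDt} st st'"
    then show "val I (Var mT) (\<rho>(mT := i)) st' = i \<and> val I (CondE ?S ?S (Num 1)) (\<rho>(mT := i)) st' = den i \<and> den i \<le> bd aDt"
      using S[of st' i] den_le[of i] Tnn_le bd[of aDt] T1 n2 le_trans[of "n * n" "T * (n * n)" L]
      by (simp add: den_def del: val.simps(8)) 
  next
    fix st' assume se: "same_except {aDt} st st'" and h: "\<And>j. j < T \<Longrightarrow> st' aDt j = den j"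
    have "st' aT 0 = T" using same_exceptD[OF se, of aT] readyD[OF r] by simp
    then show "wp I bd (Write aD (Num 0) (Num 1) ;; For mT (Cell aT) (Write aD (Num 0) (Cell aD \<otimes> Arr aDt (Var mT)))) \<rho> weighed st'"
      using second h small_bounds(1)[of aD] by (simp del: val.simps(2-8))
  qed simp
  then show ?thesis unfolding denomC_def by (simp only: wp_Seq)
qed

lemma val_valueE:
  assumes r: "ready st" and d: "weighed st"
  shows "val I valueE (\<rho>(mS := s)) st = value_of s"
proof -
  let ?d = "\<lambda>j. s div weightJ j mod base j"
  have sd: "val I (sumDigitE j) \<rho>' st = ?d (val I j \<rho>' st)" if "\<rho>' mS = s" "val I j \<rho>' st \<le> c * T + 2" for j \<rho>'
    using readyD[OF r] that by (simp add: sumDigitE_def radixJE_def base_def)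
  have i: "val I (Sum mI (Cell aC) (sumDigitE (Var mT \<otimes> Cell aC \<oplus> Var mI) \<otimes> sumDigitE (Var mT \<otimes> Cell aC \<oplus> Var mI))) (\<rho>(mS := s, mT := t)) st =
      (\<Sum>i<c. ?d (t * c + i) * ?d (t * c + i))" if "t < T" for t
  proof -
    have "val I (sumDigitE (Var mT \<otimes> Cell aC \<oplus> Var mI)) (\<rho>(mS := s, mT := t, mI := i)) st = ?d (t * c + i)" if "i < c" for i
      using sd[of "\<rho>(mS := s, mT := t, mI := i)" "Var mT \<otimes> Cell aC \<oplus> Var mI"] readyD[OF r] index_less(1)[OF \<open>t < T\<close> that] by simp
    then show ?thesis using readyD[OF r] by simp
  qed
  have "val I (Sum mT (Cell aT) ((Cell aD \<oslash> Arr aDt (Var mT)) \<otimes>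
        Sum mI (Cell aC) (sumDigitE (Var mT \<otimes> Cell aC \<oplus> Var mI) \<otimes> sumDigitE (Var mT \<otimes> Cell aC \<oplus> Var mI)))) (\<rho>(mS := s)) st =
      (\<Sum>t<T. (D div den t) * (\<Sum>i<c. ?d (t * c + i) * ?d (t * c + i)))"
    unfolding val.simps(8)[of _ mT]
  proof (rule sum.cong)
    show "{..<val I (Cell aT) (\<rho>(mS := s)) st} = {..<T}" using readyD[OF r] by simp
    fix t assume "t \<in> {..<T}"
    then have t: "t < T" by simp
    have "val I (Cell aD \<oslash> Arr aDt (Var mT)) (\<rho>(mS := s, mT := t)) st = D div den t" using d t by (simp add: weighed_def)
    then show "val I ((Cell aD \<oslash> Arr aDt (Var mT)) \<otimes>
        Sum mI (Cell aC) (sumDigitE (Var mT \<otimes> Cell aC \<oplus> Var mI) \<otimes> sumDigitE (Var mT \<otimes> Cell aC \<oplus> Var mI))) (\<rho>(mS := s, mT := t)) st =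
      (D div den t) * (\<Sum>i<c. ?d (t * c + i) * ?d (t * c + i))" using i[OF t] by (simp del: val.simps(8))
  qed
  moreover have "val I (sumDigitE (Cell aC \<otimes> Cell aT)) (\<rho>(mS := s)) st = ?d (c * T)"
    "val I (sumDigitE (Cell aC \<otimes> Cell aT \<oplus> Num 1)) (\<rho>(mS := s)) st = ?d (c * T + 1)"
    using sd[of "\<rho>(mS := s)" "Cell aC \<otimes> Cell aT"] sd[of "\<rho>(mS := s)" "Cell aC \<otimes> Cell aT \<oplus> Num 1"] readyD[OF r] by simp_all
  moreover have "st aD 0 = D" using d by (simp add: weighed_def)
  ultimately show ?thesis
    unfolding valueE_def value_of_def Let_def using header by (simp del: val.simps(8))
qed

text \<open>The alternative \<open>r = 0\<close> reflects the initial content of the result cell,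
  which only a larger value overwrites.\<close>

definition best :: "nat \<Rightarrow> bool" where
  "best r \<longleftrightarrow> (\<forall>lab. (\<forall>x<n. lab x < K) \<longrightarrow> objective lab \<le> r) \<and> (r = 0 \<or> (\<exists>lab. (\<forall>x<n. lab x < K) \<and> objective lab = r))"

lemma wp_bestC:
  assumes r: "ready st" and d: "weighed st" and z: "st aRes 0 = 0"
    and tab: "\<And>s. s < R \<Longrightarrow> st aTab (prod_encode (n, prod_encode (0, s))) = of_bool (\<exists>lab. (\<forall>x<n. lab x < K) \<and> s = packed lab)"
  shows "wp I bd bestC \<rho> (\<lambda>st'. best (st' aRes 0) \<and> st' aRes 1 = q * D) st"
proof -
  let ?ok = "\<lambda>lab. \<forall>x<n. lab x < K"
  define J where "J i st' \<longleftrightarrow> same_except {aRes} st st' \<and> (\<forall>lab. ?ok lab \<longrightarrow> packed lab < i \<longrightarrow> objective lab \<le> st' aRes 0) \<and>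
    (st' aRes 0 = 0 \<or> (\<exists>lab. ?ok lab \<and> objective lab = st' aRes 0))" for i and st' :: store
  have "wp I bd (For mS (Cell aR) (If (AndE (Arr aTab (PairE (Cell aN0) (PairE (Num 0) (Var mS)))) (Less (Cell aRes) valueE))
       (Write aRes (Num 0) valueE) Skip)) \<rho> (wp I bd (Write aRes (Num 1) (Input (Num 4) \<otimes> Cell aD)) \<rho>
         (\<lambda>st'. best (st' aRes 0) \<and> st' aRes 1 = q * D)) st"
  proof (rule wp_For[where J = J and n = R])
    show "J 0 st" using z by (simp add: J_def)
    show "val I (Cell aR) \<rho> st = R" using readyD[OF r] by simp
    fix i st' assume i: "i < R" and J: "J i st'"
    have se: "same_except {aRes} st st'" using J by (simp add: J_def)
    have r': "ready st'" by (rule ready_cong[OF r se]) simp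
    have d': "weighed st'" using d same_exceptD[OF se, of aD] same_exceptD[OF se, of aDt] by (simp add: weighed_def)
    have v: "val I valueE (\<rho>(mS := i)) st' = value_of i" by (rule val_valueE[OF r' d'])
    have t: "val I (Arr aTab (PairE (Cell aN0) (PairE (Num 0) (Var mS)))) (\<rho>(mS := i)) st' = of_bool (\<exists>lab. ?ok lab \<and> i = packed lab)"
      using tab[OF i] same_exceptD[OF se, of aTab] readyD[OF r'] by simp
    have obj: "objective lab = value_of i" if "packed lab = i" for lab using value_packed[of lab] that by simp
    let ?st = "st'(aRes := (st' aRes)(0 := value_of i))"
    show "wp I bd (If (AndE (Arr aTab (PairE (Cell aN0) (PairE (Num 0) (Var mS)))) (Less (Cell aRes) valueE))
       (Write aRes (Num 0) valueE) Skip) (\<rho>(mS := i)) (J (Suc i)) st'"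
    proof (cases "(\<exists>lab. ?ok lab \<and> i = packed lab) \<and> st' aRes 0 < value_of i")
      case True
      have "J (Suc i) ?st" unfolding J_def
      proof (intro conjI allI impI)
        show "same_except {aRes} st ?st" using se by simp
        show "objective lab \<le> ?st aRes 0" if "?ok lab" "packed lab < Suc i" for lab
        proof (cases "packed lab = i")
          case False
          then have "objective lab \<le> st' aRes 0" using that J by (simp add: J_def)
          then show ?thesis using True by simp
        qed (use obj in simp)
        show "?st aRes 0 = 0 \<or> (\<exists>lab. ?ok lab \<and> objective lab = ?st aRes 0)" using True obj by auto
      qed
      then show ?thesis using True v t value_le[of i] by simp
    next
      case False
      have "J (Suc i) st'" unfolding J_def
      proof (intro conjI allI impI)
        show "objective lab \<le> st' aRes 0" if "?ok lab" "packed lab < Suc i" for lab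
        proof (cases "packed lab = i")
          case True
          then show ?thesis using False that obj by fastforce
        next
          case ne: False
          then show ?thesis using that J by (simp add: J_def)
        qed
      qed (use J in \<open>auto simp: J_def\<close>)
      then show ?thesis using False v t by auto
    qed
  next
    fix st' assume J: "J R st'"
    have "st' aD 0 = D" using J d same_exceptD[of "{aRes}" st st' aD] by (simp add: J_def weighed_def)
    moreover have "q * D \<le> bd aRes"
    proof -
      have "1 \<le> L" using T1 T_le by linarith
      then have "q * D \<le> (p + 2 * q) * (L * L)" using D_le by (intro mult_le_mono) (auto intro: order_trans[OF D_le])
      then show ?thesis unfolding big by (simp add: mult.commute)
    qed
    moreover have "best (st' aRes 0)" using J packed_less by (auto simp: J_def best_def)
    ultimately show "wp I bd (Write aRes (Num 1) (Input (Num 4) \<otimes> Cell aD)) \<rho> (\<lambda>st'. best (st' aRes 0) \<and> st' aRes 1 = q * D) st'"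
      using header by simp
  qed
  then show ?thesis unfolding bestC_def by (simp only: wp_Seq)
qed

lemma wp_mainC:
  assumes z: "st aRes 0 = 0"
  shows "wp I bd mainC \<rho> (\<lambda>st'. best (st' aRes 0) \<and> st' aRes 1 = q * D) st"
proof -
  let ?Q = "\<lambda>st'. best (st' aRes 0) \<and> st' aRes 1 = q * D"
  let ?st = "st(aN0 := (st aN0)(0 := n), aT := (st aT)(0 := T), aC := (st aC)(0 := c))"
  have "n \<le> L" using L(2) by (simp add: algebra_simps)
  then have b: "n \<le> bd aN0" "T \<le> bd aT" "c \<le> bd aC" using T_le c_le bd[of aN0] bd[of aT] bd[of aC] by simp_all
  have 5: "wp I bd bestC \<rho> ?Q st'"
    if "ready st'" "weighed st'" "st' aRes 0 = 0"
      "\<forall>s<R. st' aTab (prod_encode (n, prod_encode (0, s))) = of_bool (\<exists>lab. (\<forall>x<n. lab x < K) \<and> s = packed lab)" for st'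
    by (rule wp_bestC) (use that in auto)
  have 4: "wp I bd denomC \<rho> (wp I bd bestC \<rho> ?Q) st'"
    if r: "ready st'" and z: "st' aRes 0 = 0"
      and t: "\<forall>s<R. st' aTab (prod_encode (n, prod_encode (0, s))) = of_bool (\<exists>lab. (\<forall>x<n. lab x < K) \<and> s = packed lab)" for st'
  proof (rule wp_frame[OF wp_denomC[OF r]])
    fix st1 assume w: "weighed st1" and se: "same_except (cmd_writes denomC) st' st1"
    have "cmd_writes denomC = {aD, aDt}" by (auto simp: denomC_def)
    then have se: "same_except {aD, aDt} st' st1" using se by simp
    have "ready st1" by (rule ready_cong[OF r se]) simp
    then show "wp I bd bestC \<rho> ?Q st1" using w z t same_exceptD[OF se, of aRes] same_exceptD[OF se, of aTab] by (intro 5) auto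
  qed
  have 3: "wp I bd (sumsC mainA mainB) \<rho> (wp I bd denomC \<rho> (wp I bd bestC \<rho> ?Q)) st'" if r: "ready st'" and z: "st' aRes 0 = 0" for st'
  proof (rule wp_mono[OF wp_sums_main[OF r]], elim conjE)
    fix st1 assume se: "same_except {aPw, aP, aTab} st' st1"
      and t: "\<forall>s<R. st1 aTab (prod_encode (n, prod_encode (0, s))) = of_bool (\<exists>lab. (\<forall>x<n. lab x < K) \<and> s = packed lab)"
    have "ready st1" by (rule ready_cong[OF r se]) simp
    then show "wp I bd denomC \<rho> (wp I bd bestC \<rho> ?Q) st1" using z t same_exceptD[OF se, of aRes] by (intro 4) auto
  qed
  have 2: "wp I bd powersC \<rho> (wp I bd (sumsC mainA mainB) \<rho> (wp I bd denomC \<rho> (wp I bd bestC \<rho> ?Q))) st'"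
    if "extended st'" "st' aT 0 = T" "st' aC 0 = c" "st' aRes 0 = 0" for st'
  proof (rule wp_frame[OF wp_powersC[OF that(1-3)]])
    fix st1 assume "ready st1" "same_except (cmd_writes powersC) st' st1"
    moreover have "aRes \<notin> cmd_writes powersC" by (simp add: powersC_def)
    ultimately show "wp I bd (sumsC mainA mainB) \<rho> (wp I bd denomC \<rho> (wp I bd bestC \<rho> ?Q)) st1"
      using that(4) by (intro 3) (auto dest: same_exceptD)
  qed
  have "wp I bd orderC \<rho> (wp I bd powersC \<rho> (wp I bd (sumsC mainA mainB) \<rho> (wp I bd denomC \<rho> (wp I bd bestC \<rho> ?Q)))) ?st"
  proof (rule wp_frame[OF wp_orderC])
    fix st1 assume e: "extended st1" and se: "same_except (cmd_writes orderC) ?st st1"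
    have nw: "{aRes, aT, aC} \<inter> cmd_writes orderC = {}" by (simp add: order_program_defs)
    have "st1 a = ?st a" if "a \<in> {aRes, aT, aC}" for a using same_exceptD[OF se] nw that by blast
    from this[of aRes] this[of aT] this[of aC] show "wp I bd powersC \<rho> (wp I bd (sumsC mainA mainB) \<rho> (wp I bd denomC \<rho> (wp I bd bestC \<rho> ?Q))) st1"
      using e z by (intro 2) auto
  qed simp
  then show ?thesis unfolding mainC_def setupC_def using b header by (simp add: wp_Seq_fun)
qed

end

section \<open>Temporal modularity in terms of labels\<close>

lemma handshake:
  assumes "simple_graph V S"
  shows "(\<Sum>v\<in>V. card {e \<in> S. v \<in> e}) = 2 * card S"
proof -
  have fV: "finite V" and S: "\<And>e. e \<in> S \<Longrightarrow> e \<subseteq> V \<and> card e = 2" using assms by (auto simp: simple_graph_def)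
  have fS: "finite S" using S by (intro finite_subset[of S "Pow V"]) (auto simp: fV)
  have "(\<Sum>v\<in>V. card {e \<in> S. v \<in> e}) = (\<Sum>v\<in>V. \<Sum>e\<in>S. of_bool (v \<in> e))"
    using fS by (intro sum.cong) (simp_all add: Int_def)
  also have "\<dots> = (\<Sum>e\<in>S. \<Sum>v\<in>V. of_bool (v \<in> e))" by (rule sum.swap)
  also have "\<dots> = (\<Sum>e\<in>S. 2)"
  proof (rule sum.cong[OF refl])
    fix e assume "e \<in> S"
    then have "V \<inter> e = e" "card e = 2" using S by auto
    then show "(\<Sum>v\<in>V. of_bool (v \<in> e)) = (2 :: nat)" using fV by simp
  qed
  finally show ?thesis by simp
qed

lemma simple_graph_snapshot: "wf_temporal_graph G \<Longrightarrow> simple_graph (verts G) (snapshot G t)"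
  by (auto simp: wf_temporal_graph_def simple_graph_def snapshot_def)

lemma edges_inside_empty: "wf_temporal_graph G \<Longrightarrow> edges_inside G t {} = 0"
proof -
  assume "wf_temporal_graph G"
  then have "{e \<in> snapshot G t. e \<subseteq> {}} = {}" using simple_graph_snapshot[of G t] by (auto simp: simple_graph_def)
  then show ?thesis by (simp add: edges_inside_def)
qed

text \<open>With everything in one part, 2m - (2m)^2 / (2m) = 0 at each time, also for m = 0, and
  only the loyalty remains. This settles c = 1 and shows that the maximum is not negative.\<close>

lemma modularity_single_part:
  assumes wf: "wf_temporal_graph G" and k: "1 \<le> k"
    and \<pi>: "\<And>v t. v \<in> verts G \<Longrightarrow> t \<in> {1..lifetime G} \<Longrightarrow> \<pi> (v, t) = 1"
  shows "temporal_modularity G \<omega> k \<pi> = \<omega> * real (card (verts G) * (lifetime G - 1))"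
proof -
  define f where "f t i = 2 * real (edges_inside G t (part G \<pi> t i))
        - (real (volume G t (part G \<pi> t i)))\<^sup>2 / (2 * real (card (snapshot G t)))" for t i
  have "(\<Sum>i=1..k. f t i) = 0" if t: "t \<in> {1..lifetime G}" for t
  proof (rule sum.neutral, rule ballI)
    fix i
    have sg: "simple_graph (verts G) (snapshot G t)" by (rule simple_graph_snapshot[OF wf])
    show "f t i = 0"
    proof (cases "i = 1")
      case True
      then have p: "part G \<pi> t i = verts G" using \<pi> t by (auto simp: part_def)
      have "volume G t (verts G) = 2 * card (snapshot G t)"
        unfolding volume_def degree_at_def by (rule handshake[OF sg])
      moreover have "edges_inside G t (verts G) = card (snapshot G t)"
        unfolding edges_inside_def using sg by (intro arg_cong[of _ _ card]) (auto simp: simple_graph_def)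
      ultimately show ?thesis by (simp add: f_def p power2_eq_square)
    next
      case False
      then have "part G \<pi> t i = {}" using \<pi> t by (auto simp: part_def)
      then show ?thesis using edges_inside_empty[OF wf] by (simp add: f_def volume_def)
    qed
  qed
  then have "(\<Sum>t=1..lifetime G. \<Sum>i=1..k. f t i) = 0" by (intro sum.neutral) blast
  moreover have "loyalty G \<pi> = card (verts G) * (lifetime G - 1)"
  proof -
    have "loyalty G \<pi> = (\<Sum>v\<in>verts G. \<Sum>t=1..lifetime G - 1. 1)"
      unfolding loyalty_def using \<pi> by (intro sum.cong refl) auto
    then show ?thesis by simp
  qed
  ultimately show ?thesis by (simp add: temporal_modularity_def f_def)
qed

lemma finite_modularities:
  assumes "wf_temporal_graph G"
  shows "finite {temporal_modularity G \<omega> k \<pi> | k \<pi>. k \<le> c \<and> \<pi> \<in> temporal_partitions G k}"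
proof -
  have "finite (temporal_partitions G k)" for k
    unfolding temporal_partitions_def using assms by (intro finite_PiE) (auto simp: wf_temporal_graph_def simple_graph_def)
  moreover have "{temporal_modularity G \<omega> k \<pi> | k \<pi>. k \<le> c \<and> \<pi> \<in> temporal_partitions G k} =
      (\<Union>k\<le>c. temporal_modularity G \<omega> k ` temporal_partitions G k)" by auto
  ultimately show ?thesis by simp
qed

lemma temporal_partitions_0:
  assumes "wf_temporal_graph G"
  shows "temporal_partitions G 0 = {}"
  using assms by (auto simp: temporal_partitions_def wf_temporal_graph_def PiE_eq_empty_iff)

text \<open>For c = 1 all vertices are always in the same part. A single vertex has no edges, so
  only the loyalty counts, and it is largest if the vertex never moves. For k = 0 there is no
  partition, as there are vertices and times.\<close>

lemma max_modularity_trivial: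
  assumes wf: "wf_temporal_graph G" and c: "1 \<le> c" and triv: "c = 1 \<or> card (verts G) = 1" and \<omega>: "0 \<le> \<omega>"
  shows "max_temporal_modularity G c \<omega> = \<omega> * real (card (verts G) * (lifetime G - 1))"
  unfolding max_temporal_modularity_def
proof (rule Max_eqI[OF finite_modularities[OF wf]])
  define \<pi> where "\<pi> = restrict (\<lambda>_. 1 :: nat) (verts G \<times> {1..lifetime G})"
  have "\<pi> \<in> temporal_partitions G 1" by (auto simp: \<pi>_def temporal_partitions_def)
  moreover have "temporal_modularity G \<omega> 1 \<pi> = \<omega> * real (card (verts G) * (lifetime G - 1))"
    by (rule modularity_single_part[OF wf]) (auto simp: \<pi>_def)
  ultimately show "\<omega> * real (card (verts G) * (lifetime G - 1)) \<in>
      {temporal_modularity G \<omega> k \<pi> | k \<pi>. k \<le> c \<and> \<pi> \<in> temporal_partitions G k}"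
    using c by (auto intro!: exI[of _ 1] exI[of _ \<pi>])
next
  fix y assume "y \<in> {temporal_modularity G \<omega> k \<pi> | k \<pi>. k \<le> c \<and> \<pi> \<in> temporal_partitions G k}"
  then obtain k \<pi> where y: "y = temporal_modularity G \<omega> k \<pi>" and k: "k \<le> c" and \<pi>: "\<pi> \<in> temporal_partitions G k" by blast
  have k1: "1 \<le> k" using \<pi> temporal_partitions_0[OF wf] by (cases k) auto
  show "y \<le> \<omega> * real (card (verts G) * (lifetime G - 1))"
  proof (cases "c = 1")
    case True
    then have "\<pi> (v, t) = 1" if "v \<in> verts G" "t \<in> {1..lifetime G}" for v t
      using \<pi> that k k1 by (auto simp: temporal_partitions_def)
    then show ?thesis using modularity_single_part[OF wf k1] y by simp
  next
    case False
    then have 1: "card (verts G) = 1" using triv by simp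
    have "snapshot G t = {}" for t
    proof (rule ccontr)
      assume "snapshot G t \<noteq> {}"
      then obtain e where "e \<subseteq> verts G" "card e = 2" "finite (verts G)"
        using simple_graph_snapshot[OF wf, of t] by (auto simp: simple_graph_def)
      then show False using 1 card_mono[of "verts G" e] by simp
    qed
    then have "y = \<omega> * real (loyalty G \<pi>)"
      by (simp add: y temporal_modularity_def edges_inside_def)
    moreover have "loyalty G \<pi> \<le> (\<Sum>v\<in>verts G. \<Sum>t=1..lifetime G - 1. 1)"
      unfolding loyalty_def by (intro sum_mono) auto
    ultimately show ?thesis using \<omega> by (simp add: mult_left_mono del: of_nat_mult)
  qed
qed

text \<open>Sorting the two ends turns an edge into a unique ordered pair.\<close>

lemma card_oriented_pairs:
  fixes n :: nat
  assumes "simple_graph {..<n} S"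
  shows "card {e \<in> S. e \<subseteq> A} = (\<Sum>y<n. \<Sum>x<n. of_bool (y < x) * of_bool ({y, x} \<in> S \<and> y \<in> A \<and> x \<in> A))"
proof -
  let ?P = "{(y, x). y < x \<and> x < n \<and> {y, x} \<in> S \<and> y \<in> A \<and> x \<in> A}"
  have "bij_betw (\<lambda>(y, x). {y, x}) ?P {e \<in> S. e \<subseteq> A}"
  proof (rule bij_betw_imageI)
    show "inj_on (\<lambda>(y, x). {y, x}) ?P" by (auto simp: inj_on_def doubleton_eq_iff dest: less_asym)
    show "(\<lambda>(y, x). {y, x}) ` ?P = {e \<in> S. e \<subseteq> A}"
    proof (intro set_eqI iffI)
      fix e assume e: "e \<in> {e \<in> S. e \<subseteq> A}"
      then obtain a b where ab: "e = {a, b}" "a \<noteq> b" using assms by (auto simp: simple_graph_def card_2_iff)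
      have "e \<subseteq> {..<n}" using e assms by (auto simp: simple_graph_def)
      then have "(min a b, max a b) \<in> ?P" using e ab by (auto simp: min_def max_def insert_commute)
      moreover have "e = {min a b, max a b}" using ab by (auto simp: min_def max_def)
      ultimately show "e \<in> (\<lambda>(y, x). {y, x}) ` ?P" by (intro image_eqI[of _ _ "(min a b, max a b)"]) auto
    qed auto
  qed
  then have "card {e \<in> S. e \<subseteq> A} = card ?P" by (simp add: bij_betw_same_card)
  also have "?P = (SIGMA y:{..<n}. {x. x < n \<and> y < x \<and> {y, x} \<in> S \<and> y \<in> A \<and> x \<in> A})" by auto
  also have "card \<dots> = (\<Sum>y<n. card {x. x < n \<and> y < x \<and> {y, x} \<in> S \<and> y \<in> A \<and> x \<in> A})" by simp
  also have "\<dots> = (\<Sum>y<n. \<Sum>x<n. of_bool (y < x) * of_bool ({y, x} \<in> S \<and> y \<in> A \<and> x \<in> A))"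
    unfolding sum_of_bool_card[symmetric] by (intro sum.cong refl) auto
  finally show ?thesis .
qed

locale modularity_program = main_program +
  fixes G :: "nat temporal_graph"
  assumes wf: "wf_temporal_graph G" and verts_G: "verts G = {..<n}" and lifetime_G: "lifetime G = T"
    and snap_G: "\<And>t u x. snap t u x \<longleftrightarrow> {u, x} \<in> snapshot G (Suc t)" and q1: "1 \<le> q"
begin

lemma snapshot_G: "simple_graph {..<n} (snapshot G t)"
  using simple_graph_snapshot[OF wf] verts_G by metis

lemma degree_at_G: "degree_at G (Suc t) v = degr t v"
proof -
  let ?X = "{x. x < n \<and> snap t v x}"
  have "bij_betw (\<lambda>x. {v, x}) ?X {e \<in> snapshot G (Suc t). v \<in> e}"
  proof (rule bij_betw_imageI)
    show "inj_on (\<lambda>x. {v, x}) ?X" by (auto simp: inj_on_def doubleton_eq_iff)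
    show "(\<lambda>x. {v, x}) ` ?X = {e \<in> snapshot G (Suc t). v \<in> e}"
    proof (intro set_eqI iffI)
      fix e assume e: "e \<in> {e \<in> snapshot G (Suc t). v \<in> e}"
      then have "card e = 2" "e \<subseteq> {..<n}" using snapshot_G[of "Suc t"] by (auto simp: simple_graph_def)
      then obtain x where "e = {v, x}" using e by (auto simp: card_2_iff)
      then show "e \<in> (\<lambda>x. {v, x}) ` ?X" using e \<open>e \<subseteq> {..<n}\<close> by (auto simp: snap_G)
    qed (auto simp: snap_G)
  qed
  then show ?thesis
    unfolding degree_at_def degr_def sum_of_bool_card by (simp add: bij_betw_same_card)
qed

lemma twice_edges_G: "twice_edges t = 2 * card (snapshot G (Suc t))"
  unfolding twice_edges_def using handshake[OF snapshot_G[of "Suc t"]] by (simp add: degree_at_G[symmetric] degree_at_def)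

definition coded :: "(nat \<times> nat \<Rightarrow> nat) \<Rightarrow> (nat \<Rightarrow> nat) \<Rightarrow> bool" where
  "coded \<pi> lab \<longleftrightarrow> (\<forall>v<n. \<forall>t<T. \<pi> (v, Suc t) = Suc (dig t (lab v)))"

lemma part_coded: "coded \<pi> lab \<Longrightarrow> t < T \<Longrightarrow> part G \<pi> (Suc t) (Suc i) = {v. v < n \<and> dig t (lab v) = i}"
  by (auto simp: part_def coded_def verts_G)

lemma volume_coded:
  assumes "coded \<pi> lab" "t < T"
  shows "volume G (Suc t) (part G \<pi> (Suc t) (Suc i)) = vol t i lab"
proof -
  have "vol t i lab = (\<Sum>v\<in>{v. v < n \<and> dig t (lab v) = i}. degr t v)"
    unfolding vol_def by (subst sum.inter_filter[symmetric]) (auto simp: lessThan_def)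
  then show ?thesis by (simp add: part_coded[OF assms] volume_def degree_at_G)
qed

lemma edges_inside_coded:
  assumes "coded \<pi> lab"
  shows "(\<Sum>t<T. \<Sum>i<c. edges_inside G (Suc t) (part G \<pi> (Suc t) (Suc i))) = inner lab"
proof -
  define g where "g t y x = (of_bool (y < x) * of_bool (snap t y x \<and> dig t (lab y) = dig t (lab x)) :: nat)" for t y x
  have "(\<Sum>i<c. edges_inside G (Suc t) (part G \<pi> (Suc t) (Suc i))) = (\<Sum>y<n. \<Sum>x<n. g t y x)" if t: "t < T" for t
  proof -
    let ?g = "\<lambda>i y x. if dig t (lab y) = i then g t y x else 0"
    have "edges_inside G (Suc t) (part G \<pi> (Suc t) (Suc i)) = (\<Sum>y<n. \<Sum>x<n. ?g i y x)" for i
      unfolding edges_inside_def card_oriented_pairs[OF snapshot_G] part_coded[OF assms t]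
      by (intro sum.cong refl) (auto simp: g_def snap_G)
    then have "(\<Sum>i<c. edges_inside G (Suc t) (part G \<pi> (Suc t) (Suc i))) = (\<Sum>y<n. \<Sum>i<c. \<Sum>x<n. ?g i y x)"
      by (simp only: sum.swap[of _ "{..<n}" "{..<c}"])
    also have "\<dots> = (\<Sum>y<n. \<Sum>x<n. \<Sum>i<c. ?g i y x)" by (rule sum.cong[OF refl], rule sum.swap)
    also have "\<dots> = (\<Sum>y<n. \<Sum>x<n. g t y x)" using dig_less by (intro sum.cong refl) simp
    finally show ?thesis .
  qed
  then have "(\<Sum>t<T. \<Sum>i<c. edges_inside G (Suc t) (part G \<pi> (Suc t) (Suc i))) = (\<Sum>t<T. \<Sum>y<n. \<Sum>x<n. g t y x)" by simp
  also have "\<dots> = (\<Sum>y<n. \<Sum>t<T. \<Sum>x<n. g t y x)" by (rule sum.swap)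
  also have "\<dots> = (\<Sum>y<n. \<Sum>x<n. \<Sum>t<T. g t y x)" by (rule sum.cong[OF refl], rule sum.swap)
  also have "\<dots> = inner lab" unfolding inner_def g_def sum_distrib_left ..
  finally show ?thesis .
qed

lemma loyalty_coded:
  assumes "coded \<pi> lab"
  shows "loyalty G \<pi> = loyal lab"
  unfolding loyalty_def loyal_def verts_G lifetime_G One_nat_def sum.atLeast1_atMost_eq
  using assms by (intro sum.cong refl) (auto simp: coded_def)

definition modul :: "(nat \<Rightarrow> nat) \<Rightarrow> real" where
  "modul lab = 2 * real (inner lab) - (\<Sum>t<T. \<Sum>i<c. (real (vol t i lab))\<^sup>2 / real (den t)) + real p / real q * real (loyal lab)"

lemma modularity_coded:
  assumes "coded \<pi> lab"
  shows "temporal_modularity G (real p / real q) c \<pi> = modul lab"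
proof -
  have "(real (vol t i lab))\<^sup>2 / (2 * real (card (snapshot G (Suc t)))) = (real (vol t i lab))\<^sup>2 / real (den t)" for t i
  proof (cases "twice_edges t = 0")
    case True
    \<comment> \<open>All volumes of an empty snapshot vanish, so the denominator 1 chosen in
      \<open>den\<close> agrees with the convention x / 0 = 0.\<close>
    have "vol t i lab \<le> twice_edges t" unfolding vol_def twice_edges_def by (intro sum_mono) auto
    then show ?thesis using True by simp
  next
    case False
    then have "real (den t) = 2 * real (card (snapshot G (Suc t)))" using twice_edges_G[of t] by (simp add: den_def)
    then show ?thesis by simp
  qed
  then have "(\<Sum>t=1..lifetime G. \<Sum>i=1..c. 2 * real (edges_inside G t (part G \<pi> t i))
        - (real (volume G t (part G \<pi> t i)))\<^sup>2 / (2 * real (card (snapshot G t)))) =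
     (\<Sum>t<T. \<Sum>i<c. 2 * real (edges_inside G (Suc t) (part G \<pi> (Suc t) (Suc i))) - (real (vol t i lab))\<^sup>2 / real (den t))"
    unfolding lifetime_G One_nat_def sum.atLeast1_atMost_eq using volume_coded[OF assms] by (intro sum.cong refl) auto
  also have "\<dots> = 2 * real (\<Sum>t<T. \<Sum>i<c. edges_inside G (Suc t) (part G \<pi> (Suc t) (Suc i))) -
      (\<Sum>t<T. \<Sum>i<c. (real (vol t i lab))\<^sup>2 / real (den t))"
    by (simp add: sum_subtractf sum_distrib_left)
  finally show ?thesis
    unfolding temporal_modularity_def modul_def edges_inside_coded[OF assms] loyalty_coded[OF assms] by simp
qed

lemma D_pos: "1 \<le> D"
  unfolding D_def using den_pos by (intro prod_ge_1) auto

text \<open>Each \<open>den t\<close> divides \<open>D\<close>, so the integer divisions in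
  \<open>objective\<close> are exact, and the truncated subtraction is the maximum with 0.\<close>

lemma objective_modul: "real (objective lab) = max 0 (real (q * D) * modul lab)"
proof -
  let ?X = "D * (2 * q * inner lab + p * loyal lab)"
  let ?Y = "q * (\<Sum>t<T. (D div den t) * (\<Sum>i<c. vol t i lab * vol t i lab))"
  have "real (D div den t) = real D / real (den t)" if "t < T" for t
  proof -
    have "den t dvd D" unfolding D_def using that by (intro dvd_prodI) auto
    then show ?thesis by (rule real_of_nat_div)
  qed
  then have "real ?Y = real q * (\<Sum>t<T. real D / real (den t) * (\<Sum>i<c. (real (vol t i lab))\<^sup>2))"
    by (simp add: power2_eq_square)
  also have "\<dots> = real (q * D) * (\<Sum>t<T. \<Sum>i<c. (real (vol t i lab))\<^sup>2 / real (den t))"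
    by (simp add: sum_distrib_left sum_divide_distrib mult.assoc)
  finally have Y: "real ?Y = real (q * D) * (\<Sum>t<T. \<Sum>i<c. (real (vol t i lab))\<^sup>2 / real (den t))" .
  have X: "real ?X = real (q * D) * (2 * real (inner lab) + real p / real q * real (loyal lab))"
    using q1 by (simp add: field_simps)
  have "real (q * D) * modul lab = real ?X - real ?Y"
    unfolding X Y modul_def by (simp add: algebra_simps)
  moreover have "real (objective lab) = max 0 (real ?X - real ?Y)"
    unfolding objective_def by (cases "?Y \<le> ?X") (auto simp: of_nat_diff simp del: of_nat_mult of_nat_add of_nat_sum)
  ultimately show ?thesis by simp
qed

text \<open>The parts of a vertex over time, shifted to start at 0, are the base c digits of its
  label.\<close>

lemma coded_exists:
  assumes "\<pi> \<in> temporal_partitions G k" "k \<le> c"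
  shows "\<exists>lab. coded \<pi> lab \<and> (\<forall>v<n. lab v < K)"
proof -
  define lab where "lab v = (\<Sum>t<T. (\<pi> (v, Suc t) - 1) * c ^ t)" for v
  have r: "1 \<le> \<pi> (v, Suc t) \<and> \<pi> (v, Suc t) \<le> c" if "v < n" "t < T" for v t
  proof -
    have "(v, Suc t) \<in> verts G \<times> {1..lifetime G}" using that by (simp add: verts_G lifetime_G)
    then have "\<pi> (v, Suc t) \<in> {1..k}" using assms(1) unfolding temporal_partitions_def by (rule PiE_mem[rotated])
    then show ?thesis using assms(2) by simp
  qed
  have "lab v < K" if "v < n" for v
    unfolding lab_def K_def using r[OF that] by (intro mixed_radix_less[where b = "\<lambda>_. c"]) fastforce+
  moreover have "\<pi> (v, Suc t) = Suc (dig t (lab v))" if "v < n" "t < T" for v t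
  proof -
    have "lab v div c ^ t mod c = \<pi> (v, Suc t) - 1"
      unfolding lab_def using r[OF that(1)] that(2) by (intro mixed_radix_digit[where b = "\<lambda>_. c"]) fastforce+
    then show ?thesis using r[OF that] by (simp add: dig_def)
  qed
  ultimately show ?thesis by (intro exI[of _ lab]) (auto simp: coded_def)
qed

lemma decoded_exists: "\<exists>\<pi>. coded \<pi> lab \<and> \<pi> \<in> temporal_partitions G c"
proof -
  define \<pi> where "\<pi> = restrict (\<lambda>(v, t). Suc (dig (t - 1) (lab v))) (verts G \<times> {1..lifetime G})"
  have "coded \<pi> lab" by (auto simp: coded_def \<pi>_def verts_G lifetime_G)
  moreover have "\<pi> \<in> temporal_partitions G c"
    using dig_less by (auto simp: \<pi>_def temporal_partitions_def Suc_le_eq)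
  ultimately show ?thesis by blast
qed

text \<open>The additional parts are empty and contribute 0, so exactly \<open>c\<close> parts may
  be assumed.\<close>

lemma modularity_more_parts:
  assumes "\<pi> \<in> temporal_partitions G k" "k \<le> c"
  shows "temporal_modularity G \<omega> k \<pi> = temporal_modularity G \<omega> c \<pi>"
proof -
  have "part G \<pi> t i = {}" if "t \<in> {1..lifetime G}" "i \<in> {1..c} - {1..k}" for t i
    using assms(1) that by (fastforce simp: part_def temporal_partitions_def PiE_iff)
  then show ?thesis
    unfolding temporal_modularity_def using assms(2) edges_inside_empty[OF wf]
    by (intro arg_cong2[of _ _ _ _ "(+)"] sum.cong sum.mono_neutral_left refl) (auto simp: volume_def)
qed

lemma max_modularity_best:
  assumes "best r"
  shows "max_temporal_modularity G c (real p / real q) = real r / real (q * D)"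
  unfolding max_temporal_modularity_def
proof (rule Max_eqI[OF finite_modularities[OF wf]])
  have qD: "0 < real (q * D)" using q1 D_pos by simp
  fix y assume "y \<in> {temporal_modularity G (real p / real q) k \<pi> | k \<pi>. k \<le> c \<and> \<pi> \<in> temporal_partitions G k}"
  then obtain k \<pi> where y: "y = temporal_modularity G (real p / real q) k \<pi>" and k: "k \<le> c" and \<pi>: "\<pi> \<in> temporal_partitions G k" by blast
  obtain lab where lab: "coded \<pi> lab" "\<forall>v<n. lab v < K" using coded_exists[OF \<pi> k] by blast
  have "y = modul lab" using y modularity_more_parts[OF \<pi> k] modularity_coded[OF lab(1)] by simp
  moreover have "objective lab \<le> r" using assms lab(2) by (simp add: best_def)
  ultimately have "real (q * D) * y \<le> real r" using objective_modul[of lab] by simp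
  then show "y \<le> real r / real (q * D)" using qD by (simp add: pos_le_divide_eq mult.commute)
next
  have qD: "0 < real (q * D)" using q1 D_pos by simp
  have "\<exists>lab. modul lab = real r / real (q * D)"
  proof (cases "r = 0")
    case True
    \<comment> \<open>If the result stayed 0, the labelling that uses a single part attains it: its
      modularity is not negative, and its objective is 0.\<close>
    define lab where "lab = (\<lambda>_ :: nat. 0 :: nat)"
    obtain \<pi> where \<pi>: "coded \<pi> lab" using decoded_exists by blast
    have "\<pi> (v, t) = 1" if "v \<in> verts G" "t \<in> {1..lifetime G}" for v t
      using \<pi> that unfolding coded_def verts_G lifetime_G by (cases t) (auto simp: lab_def dig_def)
    then have "0 \<le> modul lab"
      using modularity_single_part[OF wf, of c \<pi> "real p / real q"] c2 modularity_coded[OF \<pi>] by simp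
    moreover have "objective lab = 0" using assms True c2 by (simp add: best_def lab_def K_def)
    then have "real (q * D) * modul lab \<le> 0" using objective_modul[of lab] max.cobounded2[of "real (q * D) * modul lab" 0] by linarith
    then have "modul lab \<le> 0" using qD by (auto simp only: mult_le_0_iff)
    ultimately have "modul lab = 0" by simp
    then show ?thesis using True by auto
  next
    case False
    then obtain lab where "objective lab = r" using assms by (auto simp: best_def)
    then have "real r = real (q * D) * modul lab" using objective_modul[of lab] False by (auto simp: max_def split: if_splits)
    moreover have "real (q * D) \<noteq> 0" using qD by linarith
    ultimately show ?thesis by (metis nonzero_mult_div_cancel_left)
  qed
  then obtain lab where lab: "modul lab = real r / real (q * D)" by blast
  obtain \<pi> where "coded \<pi> lab" "\<pi> \<in> temporal_partitions G c" using decoded_exists by blast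
  then show "real r / real (q * D) \<in> {temporal_modularity G (real p / real q) k \<pi> | k \<pi>. k \<le> c \<and> \<pi> \<in> temporal_partitions G k}"
    using modularity_coded lab by (intro CollectI exI[of _ c] exI[of _ \<pi>]) auto
qed

end

section \<open>The encoding of instances\<close>

lemma concat_equal_lengths:
  assumes "\<And>ys. ys \<in> set yss \<Longrightarrow> length ys = m"
  shows "length (concat yss) = length yss * m"
    and "i < length yss \<Longrightarrow> j < m \<Longrightarrow> concat yss ! (i * m + j) = yss ! i ! j"
proof -
  show "length (concat yss) = length yss * m" using assms by (induction yss) auto
  show "concat yss ! (i * m + j) = yss ! i ! j" if "i < length yss" "j < m"
    using assms that
  proof (induction yss arbitrary: i)
    case (Cons ys yss)
    then show ?case by (cases i) (auto simp: nth_append add.assoc)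
  qed simp
qed

lemma length_adjacency_matrix: "length (adjacency_matrix n S) = n * n"
  unfolding adjacency_matrix_def by (subst concat_equal_lengths(1)[where m = n]) auto

lemma nth_adjacency_matrix:
  "u < n \<Longrightarrow> x < n \<Longrightarrow> adjacency_matrix n S ! (u * n + x) = of_bool ({u, x} \<in> S)"
  unfolding adjacency_matrix_def by (subst concat_equal_lengths(2)[where m = n]) auto

lemma matrix_index_less: "u < n \<Longrightarrow> x < n \<Longrightarrow> u * n + x < n * (n :: nat)"
proof -
  assume "u < n" "x < n"
  then have "u * n + x < Suc u * n" by simp
  also have "\<dots> \<le> n * n" using \<open>u < n\<close> by (intro mult_le_mono1) simp
  finally show ?thesis .
qed

lemma encode_instance_facts:
  fixes G :: "nat temporal_graph" and c p q :: nat
  assumes "verts G = {..<n}" "lifetime G = T"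
  defines "xs \<equiv> encode_instance G c p q"
  shows "length xs = 5 + n * n * (T + 1)" "xs ! 0 = n" "xs ! 1 = T" "xs ! 2 = c" "xs ! 3 = p" "xs ! 4 = q"
    and "u < n \<Longrightarrow> x < n \<Longrightarrow> xs ! (5 + u * n + x) = of_bool ({u, x} \<in> edges G)"
    and "t < T \<Longrightarrow> u < n \<Longrightarrow> x < n \<Longrightarrow> xs ! (5 + n * n + t * (n * n) + u * n + x) = of_bool ({u, x} \<in> snapshot G (Suc t))"
proof -
  let ?yss = "map (\<lambda>t. adjacency_matrix n (snapshot G t)) [1..<T + 1]"
  have xs: "xs = [n, T, c, p, q] @ adjacency_matrix n (edges G) @ concat ?yss"
    unfolding xs_def encode_instance_def using assms(1,2) by (simp add: Let_def)
  have eq: "length ys = n * n" if "ys \<in> set ?yss" for ys using that length_adjacency_matrix by auto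
  show "length xs = 5 + n * n * (T + 1)"
    unfolding xs using concat_equal_lengths(1)[of ?yss "n * n"] eq by (simp add: length_adjacency_matrix algebra_simps)
  show "xs ! 0 = n" "xs ! 1 = T" "xs ! 2 = c" "xs ! 3 = p" "xs ! 4 = q" by (simp_all add: xs)
  have 5: "xs ! (5 + k) = (adjacency_matrix n (edges G) @ concat ?yss) ! k" for k
    unfolding xs by (subst nth_append) simp
  show "xs ! (5 + u * n + x) = of_bool ({u, x} \<in> edges G)" if "u < n" "x < n"
    using 5[of "u * n + x"] matrix_index_less[OF that] nth_adjacency_matrix[OF that]
    by (simp add: nth_append length_adjacency_matrix add.assoc)
  show "xs ! (5 + n * n + t * (n * n) + u * n + x) = of_bool ({u, x} \<in> snapshot G (Suc t))" if "t < T" "u < n" "x < n"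
  proof -
    have "xs ! (5 + n * n + t * (n * n) + u * n + x) = concat ?yss ! (t * (n * n) + (u * n + x))"
      using 5[of "n * n + (t * (n * n) + (u * n + x))"] by (simp add: nth_append length_adjacency_matrix add.assoc)
    also have "\<dots> = ?yss ! t ! (u * n + x)"
      by (rule concat_equal_lengths(2)[of ?yss "n * n"]) (use eq that matrix_index_less in auto)
    also have "\<dots> = of_bool ({u, x} \<in> snapshot G (Suc t))" using that nth_adjacency_matrix by (simp add: nth_append del: upt_Suc)
    finally show ?thesis .
  qed
qed

section \<open>The time bound\<close>

lemma modularityC_vars: "cmd_vars modularityC \<subseteq> {..<20}"
  by (simp add: modularityC_def mainC_def setupC_def powersC_def denomC_def bestC_def order_program_defs
      mainA_def mainB_def valueE_def sumDigitE_def radixJE_def digitE_def snapE_def sepA_def sepB_def feasE_def rowE_def adjE_def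
      contribE_def codeE_def childE_def labE_def derived_expr_defs)

lemma modularityC_ranges: "cmd_ranges_over {a. a \<noteq> 0} modularityC"
  by (simp add: modularityC_def mainC_def setupC_def powersC_def denomC_def bestC_def order_program_defs
      mainA_def mainB_def valueE_def sumDigitE_def radixJE_def digitE_def snapE_def sepA_def sepB_def feasE_def rowE_def adjE_def
      contribE_def codeE_def childE_def labE_def derived_expr_defs)

text \<open>Every quantity is bounded by a power of \<open>Z\<close>, by means of 2^w \<le> c^(w T),
  c \<le> 2^c and T \<le> 2^T. The exponent 28 is 18 + 10 and comes from 3^(9 w + 10) \<le> (2^w)^18
  4^10, where 2^w and 4 are at most \<open>Z\<close>.\<close>

lemma bounds_by_basic_quantity:
  fixes n c T w :: nat
  assumes n: "2 \<le> n" and c: "2 \<le> c" and T: "1 \<le> T"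
  defines "Z \<equiv> n ^ (c * T) * c ^ (w * T)"
  defines "L \<equiv> Z ^ 28"
  shows "4 \<le> Z" "3 ^ (9 * w + 10) \<le> L" "(n + 1) * (n + 1) * (n + 1) \<le> L" "w + 1 \<le> L"
    "n ^ (2 * (c * T)) * (T * n ^ 2) ^ 2 \<le> L" "(c ^ T) ^ (9 * w + 10) \<le> L" "(n * n) ^ T \<le> L"
proof -
  have c1: "1 \<le> c ^ (w * T)" using c by simp
  have n1: "1 \<le> n ^ (c * T)" using n by simp
  have ZN: "n ^ (c * T) \<le> Z" unfolding Z_def using c1 by simp
  have ZC: "c ^ (w * T) \<le> Z" unfolding Z_def using n1 by simp
  have cT: "2 \<le> c * T" using mult_le_mono[OF c T] by simp
  have two: "2 ^ (c * T) \<le> Z" using power_mono[OF n, of "c * T"] ZN by simp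
  show Z4: "4 \<le> Z" using power_increasing[OF cT, of "2 :: nat"] two by simp
  have wZ: "2 ^ w \<le> Z"
  proof -
    have "(2 :: nat) ^ w \<le> 2 ^ (w * T)" using T by (intro power_increasing) auto
    also have "\<dots> \<le> c ^ (w * T)" using c by (intro power_mono) auto
    finally show ?thesis using ZC by simp
  qed
  have nZ: "n \<le> Z" using self_le_power[of n "c * T"] n c T ZN by simp
  have TZ: "T \<le> Z"
  proof -
    have "T \<le> 2 ^ T" by (simp add: less_imp_le)
    also have "\<dots> \<le> 2 ^ (c * T)" using c by (intro power_increasing) auto
    finally show ?thesis using two by simp
  qed
  have nTZ: "n ^ T \<le> Z"
  proof -
    have "n ^ T \<le> n ^ (c * T)" using n c by (intro power_increasing) auto
    then show ?thesis using ZN by simp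
  qed
  have cTZ: "c ^ T \<le> Z"
  proof -
    have "c ^ T \<le> (2 ^ c) ^ T" by (intro power_mono) (auto simp: less_imp_le)
    then show ?thesis using two by (simp add: power_mult)
  qed
  have ZL: "x \<le> L" if "x \<le> Z ^ k" "k \<le> 28" for x k
    unfolding L_def by (rule order_trans[OF that(1) power_increasing[OF that(2)]]) (use Z4 in simp)
  have "(3 :: nat) ^ (9 * w + 10) \<le> 4 ^ (9 * w + 10)" by (intro power_mono) auto
  also have "\<dots> = (2 ^ w) ^ 18 * 4 ^ 10"
  proof -
    have "(4 :: nat) ^ (9 * w) = (2 ^ 2) ^ (9 * w)" by simp
    also have "\<dots> = 2 ^ (w * 18)" by (simp only: power_mult[symmetric]) (simp add: mult.commute)
    also have "\<dots> = (2 ^ w) ^ 18" by (rule power_mult)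
    finally show ?thesis by (simp only: power_add)
  qed
  also have "\<dots> \<le> Z ^ 18 * Z ^ 10" using wZ Z4 by (intro mult_le_mono power_mono) auto
  also have "\<dots> = Z ^ 28" by (simp add: power_add[symmetric])
  finally show "3 ^ (9 * w + 10) \<le> L" by (simp add: L_def)
  have "n + 1 \<le> n * n" using mult_le_mono1[OF n, of n] n by linarith
  also have "\<dots> \<le> Z * Z" using nZ by (intro mult_le_mono)
  finally have "(n + 1) * (n + 1) * (n + 1) \<le> (Z * Z) * (Z * Z) * (Z * Z)" by (intro mult_le_mono)
  then show "(n + 1) * (n + 1) * (n + 1) \<le> L" by (intro ZL[of _ 6]) (simp_all add: eval_nat_numeral)
  have "w + 1 \<le> 2 ^ w" using less_exp[of w] by (simp add: Suc_le_eq)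
  then show "w + 1 \<le> L" using wZ by (intro ZL[of _ 1]) simp_all
  have "n ^ (2 * (c * T)) * (T * n ^ 2) ^ 2 = (n ^ (c * T)) ^ 2 * (T * n ^ 2) ^ 2" by (simp add: power_mult[symmetric] mult.commute)
  also have "\<dots> \<le> Z ^ 2 * (Z * Z ^ 2) ^ 2" using ZN TZ nZ by (intro mult_le_mono power_mono) auto
  also have "\<dots> = Z ^ 8" by (simp add: eval_nat_numeral)
  finally show "n ^ (2 * (c * T)) * (T * n ^ 2) ^ 2 \<le> L" by (intro ZL[of _ 8]) simp_all
  have "(c ^ T) ^ (9 * w + 10) = (c ^ (w * T)) ^ 9 * (c ^ T) ^ 10" by (simp add: power_add power_mult[symmetric] algebra_simps)
  also have "\<dots> \<le> Z ^ 9 * Z ^ 10" using ZC cTZ by (intro mult_le_mono power_mono) auto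
  also have "\<dots> = Z ^ 19" by (simp add: power_add[symmetric])
  finally show "(c ^ T) ^ (9 * w + 10) \<le> L" by (intro ZL[of _ 19]) simp_all
  have "(n * n) ^ T \<le> Z ^ 2" using nTZ by (simp add: power_mult_distrib power2_eq_square mult_le_mono)
  then show "(n * n) ^ T \<le> L" by (intro ZL[of _ 2]) simp_all
qed

text \<open>\<open>\<Lambda>\<close> bounds all loop ranges and array entries except the result.\<close>

lemma modularityC_correct:
  fixes G :: "nat temporal_graph" and p :: nat
  assumes wf: "wf_temporal_graph G" and V: "verts G = {..<n}" and T: "lifetime G = T"
    and w: "treewidth (verts G) (edges G) \<le> w" and c: "1 \<le> c" and q: "1 \<le> q"
  defines "xs \<equiv> encode_instance G c p q"
  defines "I \<equiv> \<lambda>j. if j < length xs then xs ! j else 0"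
  defines "\<Lambda> \<equiv> max 2 ((n ^ (c * T) * c ^ (w * T)) ^ 28)"
  shows "\<exists>bd. (\<forall>a. a \<noteq> 0 \<longrightarrow> bd a \<le> (if 2 \<le> n \<and> 2 \<le> c then \<Lambda> else 2)) \<and>
    bd 0 \<le> \<Lambda> * \<Lambda> * (p + 2 * q) + p * n * T + q \<and>
    wp I bd modularityC (\<lambda>_. 0) (\<lambda>st. st 0 1 \<noteq> 0 \<and>
      max_temporal_modularity G c (real p / real q) = real (st 0 0) / real (st 0 1)) (\<lambda>_ _. 0)"
proof -
  note enc = encode_instance_facts[where c = c and p = p and q = q, OF V T, folded xs_def]
  have n1: "1 \<le> n" using wf V by (auto simp: wf_temporal_graph_def)
  have T1: "1 \<le> T" using wf T by (simp add: wf_temporal_graph_def)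
  have header: "I 0 = n" "I 1 = T" "I 2 = c" "I 3 = p" "I 4 = q" using enc(1-6) by (auto simp: I_def)
  show ?thesis
  proof (cases "2 \<le> n \<and> 2 \<le> c")
    case True
    define L where "L = (n ^ (c * T) * c ^ (w * T)) ^ 28"
    have n2: "2 \<le> n" and c2: "2 \<le> c" using True by auto
    note Lb = bounds_by_basic_quantity[OF n2 c2 T1, of w, folded L_def]
    have \<Lambda>: "\<Lambda> = L"
    proof -
      have "n ^ (c * T) * c ^ (w * T) \<le> L" unfolding L_def by (rule self_le_power) (use Lb(1) in linarith, simp)
      then show ?thesis using Lb(1) by (simp add: \<Lambda>_def L_def[symmetric])
    qed
    \<comment> \<open>Only the result cells depend on p and q. The two factors \<open>L\<close>
      bound \<open>D\<close> and one of the last two digits.\<close>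
    define bd where "bd a = (if a = 0 then L * L * (p + 2 * q) else L)" for a :: nat
    have i1: "I (5 + u * n + x) = of_bool ({u, x} \<in> edges G)" if "u < n" "x < n" for u x
      using enc(7)[OF that] enc(1) matrix_index_less[OF that] by (auto simp: I_def add_mult_distrib2)
    have i2: "I (5 + n * n + t * (n * n) + u * n + x) = of_bool ({u, x} \<in> snapshot G (Suc t))" if "t < T" "u < n" "x < n" for t u x
    proof -
      have "t * (n * n) + (u * n + x) < Suc t * (n * n)" using matrix_index_less[OF that(2,3)] by simp
      also have "\<dots> \<le> T * (n * n)" using that(1) by (intro mult_le_mono1) simp
      finally have "5 + n * n + t * (n * n) + u * n + x < length xs" unfolding enc(1) by (simp add: algebra_simps)
      then show ?thesis using enc(8)[OF that] by (simp add: I_def)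
    qed
    interpret O: order_program I bd n w L "edges G"
    proof
      show "simple_graph {..<n} (edges G)" using wf V by (simp add: wf_temporal_graph_def)
      show "treewidth {..<n} (edges G) \<le> w" using w V by simp
    qed (use i1 Lb in \<open>auto simp: bd_def\<close>)
    interpret M: modularity_program I bd n w L "edges G" T c p q "\<lambda>t u x. {u, x} \<in> snapshot G (Suc t)" G
      by unfold_locales (use header i2 n2 c2 T1 Lb wf V T q in \<open>auto simp: bd_def snapshot_def insert_commute\<close>)
    have "wp I bd mainC (\<lambda>_. 0) (\<lambda>st. M.best (st aRes 0) \<and> st aRes 1 = q * M.D) (\<lambda>_ _. 0)" by (rule M.wp_mainC) simp
    then have "wp I bd mainC (\<lambda>_. 0) (\<lambda>st. st 0 1 \<noteq> 0 \<and>
        max_temporal_modularity G c (real p / real q) = real (st 0 0) / real (st 0 1)) (\<lambda>_ _. 0)"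
    proof (rule wp_mono, elim conjE)
      fix st assume b: "M.best (st aRes 0)" and D: "st aRes 1 = q * M.D"
      show "st 0 1 \<noteq> 0 \<and> max_temporal_modularity G c (real p / real q) = real (st 0 0) / real (st 0 1)"
        unfolding D M.max_modularity_best[OF b] using q M.D_pos by simp
    qed
    then have "wp I bd modularityC (\<lambda>_. 0) (\<lambda>st. st 0 1 \<noteq> 0 \<and>
        max_temporal_modularity G c (real p / real q) = real (st 0 0) / real (st 0 1)) (\<lambda>_ _. 0)"
      using header n2 c2 by (simp add: modularityC_def)
    then show ?thesis using True \<Lambda> by (intro exI[of _ bd]) (auto simp: bd_def)
  next
    case False
    define bd where "bd a = (if a = 0 then p * n * T + q else 0)" for a :: nat
    have "n = 1 \<or> c = 1" using False n1 c by linarith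
    then have "max_temporal_modularity G c (real p / real q) = real p / real q * real (n * (T - 1))"
      using max_modularity_trivial[OF wf c, of "real p / real q"] V T by auto
    moreover have "p * n * (T - 1) \<le> p * n * T + q" by (intro trans_le_add1 mult_le_mono2) simp
    ultimately have "wp I bd modularityC (\<lambda>_. 0) (\<lambda>st. st 0 1 \<noteq> 0 \<and>
        max_temporal_modularity G c (real p / real q) = real (st 0 0) / real (st 0 1)) (\<lambda>_ _. 0)"
      using header False q unfolding modularityC_def by (auto simp: bd_def)
    then show ?thesis using False by (intro exI[of _ bd]) (auto simp: bd_def)
  qed
qed

theorem theorem2:
  shows "\<exists>(P :: program) (C :: nat).
    \<forall>(G :: nat temporal_graph) (n :: nat) (T :: nat) (w :: nat) (c :: nat)
      (\<omega> :: real) (p :: nat) (q :: nat).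
      wf_temporal_graph G \<and> verts G = {..<n} \<and> lifetime G = T \<and>
      treewidth (verts G) (edges G) \<le> w \<and>
      c \<ge> 1 \<and> q \<ge> 1 \<and> \<omega> = real p / real q \<longrightarrow>
      (let xs = encode_instance G c p q;
           \<tau> = C * n ^ (C * c * T) * c ^ (C * w * T) * T ^ (C * c)
       in \<forall>W. adequate_word_length W C xs \<tau> \<longrightarrow>
            ram_computes_within W P xs (max_temporal_modularity G c \<omega>) \<tau>)"
proof -
  obtain d1 where d1: "\<forall>(B :: nat) I M base bd \<rho> st. 2 \<le> B \<longrightarrow> (\<forall>x. \<rho> x \<le> B) \<longrightarrow> (\<forall>j. I j \<le> B) \<longrightarrow> (\<forall>a. bd a \<le> B) \<longrightarrow>
     (\<forall>a i. st a i \<le> bd a) \<longrightarrow> writes_ok I bd modularityC \<rho> st \<longrightarrow> base \<le> B \<longrightarrow> B ^ d1 < M \<longrightarrow> cmd_fits I M base modularityC \<rho> st"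
    using cmd_fits_poly[of modularityC] by (rule exE)
  have small: "{a :: nat. a \<noteq> 0} \<noteq> UNIV" by blast
  obtain d2 where d2: "\<forall>(B :: nat) I bd \<rho> st. 2 \<le> B \<longrightarrow> (\<forall>x. \<rho> x \<le> B) \<longrightarrow> (\<forall>a\<in>{a. a \<noteq> 0}. bd a \<le> B) \<longrightarrow>
     (\<forall>a i. st a i \<le> bd a) \<longrightarrow> writes_ok I bd modularityC \<rho> st \<longrightarrow> cost I modularityC \<rho> st \<le> B ^ d2"
    using cost_poly[OF modularityC_ranges small] by (rule exE)
  \<comment> \<open>\<open>2 ^ d2\<close> pays for the trivial cases, \<open>28 * d2\<close> is the
    exponent of \<open>Z\<close> in the running time, \<open>5 * d1\<close> covers the exponent
    \<open>4 * d1\<close> of the word bound, and 100 absorbs the constants.\<close>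
  define C where "C = 2 ^ d2 + 28 * d2 + 5 * d1 + 100"
  show ?thesis
  proof (rule exI[of _ "compile 20 modularityC"], rule exI[of _ C], intro allI impI, elim conjE)
    fix G :: "nat temporal_graph" and n T w c :: nat and \<omega> :: real and p q :: nat
    assume wf: "wf_temporal_graph G" and V: "verts G = {..<n}" and T: "lifetime G = T"
      and w: "treewidth (verts G) (edges G) \<le> w" and c: "1 \<le> c" and q: "1 \<le> q" and \<omega>: "\<omega> = real p / real q"
    define xs where "xs = encode_instance G c p q"
    define \<tau> where "\<tau> = C * n ^ (C * c * T) * c ^ (C * w * T) * T ^ (C * c)"
    define I where "I = (\<lambda>j. if j < length xs then xs ! j else 0)"
    define Z where "Z = n ^ (c * T) * c ^ (w * T)"
    define \<Lambda> where "\<Lambda> = max 2 (Z ^ 28)"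
    note enc = encode_instance_facts[where c = c and p = p and q = q, OF V T, folded xs_def]
    have n1: "1 \<le> n" using wf V by (auto simp: wf_temporal_graph_def)
    have T1: "1 \<le> T" using wf T by (simp add: wf_temporal_graph_def)
    have Z1: "1 \<le> Z" using n1 c by (simp add: Z_def)
    have \<tau>Z: "C * Z ^ C \<le> \<tau>"
    proof -
      have "Z ^ C = n ^ (C * c * T) * c ^ (C * w * T)" by (simp add: Z_def power_mult_distrib power_mult[symmetric] mult_ac)
      moreover have "1 \<le> T ^ (C * c)" using T1 by simp
      ultimately show ?thesis by (simp add: \<tau>_def mult.assoc)
    qed
    obtain bd where bd: "\<forall>a. a \<noteq> 0 \<longrightarrow> bd a \<le> (if 2 \<le> n \<and> 2 \<le> c then \<Lambda> else 2)" "bd 0 \<le> \<Lambda> * \<Lambda> * (p + 2 * q) + p * n * T + q"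
      and wp: "wp I bd modularityC (\<lambda>_. 0) (\<lambda>st. st 0 1 \<noteq> 0 \<and>
        max_temporal_modularity G c (real p / real q) = real (st 0 0) / real (st 0 1)) (\<lambda>_ _. 0)"
      using modularityC_correct[OF wf V T w c q, of p, folded xs_def Z_def, folded I_def \<Lambda>_def] by (elim exE conjE)
    have ok: "writes_ok I bd modularityC (\<lambda>_. 0) (\<lambda>_ _. 0)" using wp by (simp add: wp_def)
    have cost: "cost I modularityC (\<lambda>_. 0) (\<lambda>_ _. 0) + 42 \<le> \<tau>"
    proof -
      \<comment> \<open>Loop ranges are governed by \<open>\<Lambda>\<close> in general, but the
        constant 2 is needed in the trivial cases, where the time bound itself may be
        constant.\<close>
      have "\<exists>B. 2 \<le> B \<and> (\<forall>a\<in>{a. a \<noteq> 0}. bd a \<le> B) \<and> B ^ d2 + 42 \<le> C * Z ^ C"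
      proof (cases "2 \<le> n \<and> 2 \<le> c")
        case True
        have "4 \<le> Z" unfolding Z_def using True T1 by (intro bounds_by_basic_quantity) auto
        have "Z \<le> Z ^ 28" using Z1 by (intro self_le_power) auto
        then have \<Lambda>: "\<Lambda> = Z ^ 28" using \<open>4 \<le> Z\<close> by (simp add: \<Lambda>_def)
        have "\<Lambda> ^ d2 = Z ^ (28 * d2)" by (simp add: \<Lambda> power_mult)
        also have "\<dots> \<le> Z ^ C" using Z1 by (intro power_increasing) (auto simp: C_def)
        finally have "\<Lambda> ^ d2 + 42 \<le> Z ^ C + 42 * Z ^ C" using Z1 by (intro add_mono) auto
        also have "\<dots> \<le> C * Z ^ C"
        proof -
          have "43 * Z ^ C \<le> C * Z ^ C" by (intro mult_le_mono1) (simp add: C_def)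
          then show ?thesis by simp
        qed
        finally show ?thesis using True bd(1) by (intro exI[of _ \<Lambda>]) (auto simp: \<Lambda>_def)
      next
        case False
        have "2 ^ d2 + 42 \<le> C * 1" by (simp add: C_def)
        also have "\<dots> \<le> C * Z ^ C" using Z1 by (intro mult_le_mono2) simp
        finally show ?thesis using False bd(1) by (intro exI[of _ 2]) auto
      qed
      then obtain B where "2 \<le> B" "\<forall>a\<in>{a. a \<noteq> 0}. bd a \<le> B" "B ^ d2 + 42 \<le> C * Z ^ C" by blast
      moreover from this have "cost I modularityC (\<lambda>_. 0) (\<lambda>_ _. 0) \<le> B ^ d2"
        using ok by (intro d2[rule_format]) auto
      ultimately show ?thesis using \<tau>Z by linarith
    qed
    have "ram_computes_within W (compile 20 modularityC) xs (max_temporal_modularity G c \<omega>) \<tau>"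
      if W: "adequate_word_length W C xs \<tau>" for W
    proof -
      \<comment> \<open>The largest number whose power with exponent \<open>C\<close> is known to
        fit into a word; all word bounds are expressed as powers of it.\<close>
      define m where "m = Max (insert \<tau> (insert (length xs) (set xs)))"
      have "m \<in> insert \<tau> (insert (length xs) (set xs))" unfolding m_def by (intro Max_in) auto
      then have m: "m ^ C < 2 ^ W" using W by (simp only: adequate_word_length_def)
      have ge: "x \<le> m" if "x \<in> insert \<tau> (insert (length xs) (set xs))" for x using that unfolding m_def by (intro Max_ge) auto
      have lenm: "length xs \<le> m" and \<tau>m: "\<tau> \<le> m" by (auto intro: ge)
      have m5: "5 \<le> m" using lenm enc(1) by simp
      have mC: "m ^ k < 2 ^ W" if "k \<le> C" for k
        by (rule le_less_trans[OF power_increasing[OF that] m]) (use m5 in simp)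
      have Im: "I j \<le> m" for j using ge[of "xs ! j"] by (auto simp: I_def)
      have "n \<le> m" "T \<le> m" "p \<le> m" "q \<le> m" using Im[of 0] Im[of 1] Im[of 3] Im[of 4] enc by (auto simp: I_def)
      moreover have "\<Lambda> \<le> m"
      proof -
        have "28 \<le> C" by (simp add: C_def)
        then have "Z ^ 28 \<le> 1 * Z ^ C" using power_increasing[of 28 C Z] Z1 by simp
        also have "\<dots> \<le> C * Z ^ C" by (intro mult_le_mono1) (simp add: C_def)
        finally show ?thesis using \<tau>Z \<tau>m m5 by (simp add: \<Lambda>_def)
      qed
      \<comment> \<open>The result is at most 3m^3 + m^3 + m \<le> 5m^3, and m \<ge> 5 because the
        header of the input has five words; this gives the exponent 4.\<close>
      ultimately have "\<Lambda> * \<Lambda> * (p + 2 * q) + p * n * T + q \<le> m * m * (m + 2 * m) + m * m * m + m"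
        by (intro add_mono mult_le_mono) auto
      also have "\<dots> \<le> m * m * m * 5" using m5 mult_le_mono[of 1 "m * m" m m] by (simp add: algebra_simps)
      also have "\<dots> \<le> m * m * m * m" using m5 by (intro mult_le_mono2)
      finally have bd0: "bd 0 \<le> m ^ 4" using bd(2) by (simp add: eval_nat_numeral)
      have m4: "m \<le> m ^ 4" using m5 by (intro self_le_power) auto
      have "cmd_fits I (2 ^ W) (length xs) modularityC (\<lambda>_. 0) (\<lambda>_ _. 0)"
      proof (rule d1[rule_format, where B = "m ^ 4", OF _ _ _ _ _ ok])
        have "bd a \<le> m ^ 4" if "a \<noteq> 0" for a
        proof -
          have "2 \<le> \<Lambda>" by (simp add: \<Lambda>_def)
          then have "bd a \<le> \<Lambda>" using bd(1)[rule_format, OF that] by (auto split: if_splits)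
          then show ?thesis using \<open>\<Lambda> \<le> m\<close> m4 by simp
        qed
        then show "bd a \<le> m ^ 4" for a using bd0 by metis
        show "(m ^ 4) ^ d1 < 2 ^ W" using mC[of "4 * d1"] by (simp add: power_mult C_def)
        show "I j \<le> m ^ 4" for j using Im m4 by (meson order_trans)
      qed (use m4 m5 lenm in auto)
      moreover have "length xs + 9 < 2 ^ W"
      proof -
        have "length xs + 9 \<le> m * m" using lenm m5 mult_le_mono1[OF m5, of m] by linarith
        then show ?thesis using mC[of 2] by (simp add: C_def power2_eq_square)
      qed
      moreover have "length xs = 5 + xs ! 0 * xs ! 0 * (xs ! 1 + 1)" using enc(1-3) by simp
      ultimately show ?thesis
        using wp cost modularityC_vars \<omega> unfolding I_def wp_def by (intro compile_correct) auto
    qed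
    then show "let xs = encode_instance G c p q;
           \<tau> = C * n ^ (C * c * T) * c ^ (C * w * T) * T ^ (C * c)
       in \<forall>W. adequate_word_length W C xs \<tau> \<longrightarrow>
            ram_computes_within W (compile 20 modularityC) xs (max_temporal_modularity G c \<omega>) \<tau>"
      unfolding Let_def xs_def \<tau>_def by blast
  qed
qed

end
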